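(* Let $\Omega\subset\mathbb{R}^N$ ($N\ge 2$) be a smooth bounded domain, $1<p<N$, $p^*=\frac{Np}{N-p}$, $\delta>0$, $0<\beta<p-1$, and let $a,b:\Omega\to[0,\infty)$ be measurable. Suppose that $b\in L^{(\frac{p^*}{\beta+1})'}(\Omega)$ and $a+b>0$ in $\Omega$. Assume that one of the following holds: (1) $0<\delta<1$ and $a\in L^{(\frac{p^*}{1-\delta})'}(\Omega)$; (2) $\delta>1$ and $a\in L^1(\Omega)$; (3) $\delta=1$ and $a\in L^s(\Omega)$ for some $s>1$. If $\underline v,\overline v\in W^{1,p}_{loc}(\Omega)$ are respectively a subsolution and a supersolution of $$-\Delta_p u=a(x)u^{-\delta}+b(x)u^{\beta}\ \text{in }\Omega,\qquad u>0\ \text{in }\Omega,\qquad u=0\ \text{on }\partial\Omega,$$ with $\underline v\le 0$ on $\partial\Omega$, then $\underline v\le\overline v$ a.e. in $\Omega$. Besides this, if in addition $\underline v,\overline v\in W^{1,p}_0(\Omega)$ and the integral inequalities defining the subsolution $\underline v$ and the supersolution $\overline v$ hold for all $0\le\varphi\in W^{1,p}_0(\Omega)$, then the same conclusion holds even when in (3) one only assumes $a\in L^1(\Omega)$ (with $\delta=1$).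
   Context: $\Delta_p u=\mathrm{div}(|\nabla u|^{p-2}\nabla u)$; $s'=\frac{s}{s-1}$ denotes the conjugate exponent. $\underline v\le 0$ on $\partial\Omega$ means $(\underline v-\epsilon)^+\in W^{1,p}_0(\Omega)$ for every $\epsilon>0$. A function $\underline v\in W^{1,p}_{loc}(\Omega)$ is a subsolution if (i) for each $K\subset\subset\Omega$ there is a constant $c_K>0$ with $\underline v\ge c_K$ in $K$; and (ii) $$\int_\Omega|\nabla\underline v|^{p-2}\nabla\underline v\nabla\varphi\,dx\le\int_\Omega\Big(\frac{a(x)}{\underline v^{\delta}}+b(x)\underline v^{\beta}\Big)\varphi\,dx\quad\text{for all }0\le\varphi\in C_c^\infty(\Omega).$$ A function $\overline v\in W^{1,p}_{loc}(\Omega)$ is a supersolution if it satisfies (i) and the reversed inequality in (ii) for all $0\le\varphi\in C_c^\infty(\Omega)$. *)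

theory Defs
  imports "HOL-Analysis.Analysis"
begin

section \<open>Smooth functions and smooth domains\<close>

definition grad :: "('a::euclidean_space \<Rightarrow> real) \<Rightarrow> 'a \<Rightarrow> 'a" where
  "grad f x = (\<Sum>i\<in>Basis. frechet_derivative f (at x) i *\<^sub>R i)"

text \<open>Intended for open \<open>S\<close> only: derivatives are taken with respect to \<open>at x\<close>.\<close>

primrec Ck_on :: "nat \<Rightarrow> ('a::euclidean_space \<Rightarrow> real) \<Rightarrow> 'a set \<Rightarrow> bool" where
  "Ck_on 0 f S \<longleftrightarrow> continuous_on S f"
| "Ck_on (Suc k) f S \<longleftrightarrow>
     (\<forall>x\<in>S. f differentiable (at x)) \<and>
     (\<forall>i\<in>Basis. Ck_on k (\<lambda>x. frechet_derivative f (at x) i) S)"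

definition smooth_on :: "('a::euclidean_space \<Rightarrow> real) \<Rightarrow> 'a set \<Rightarrow> bool" where
  "smooth_on f S \<longleftrightarrow> (\<forall>k. Ck_on k f S)"

text \<open>The boundary is locally the graph of a smooth function over the hyperplane orthogonal to
  some direction \<open>e\<close>, with the domain lying on one side of it. The function of
  \<open>N - 1\<close> variables is represented by a function on the whole space that is evaluated only at the
  projection \<open>x - (x \<bullet> e) *\<^sub>R e\<close>.\<close>

definition smooth_boundary :: "'a::euclidean_space set \<Rightarrow> bool" where
  "smooth_boundary \<Omega> \<longleftrightarrow>
     (\<forall>z\<in>frontier \<Omega>. \<exists>r>0. \<exists>e \<gamma>. norm e = 1 \<and> smooth_on \<gamma> UNIV \<and>
        \<Omega> \<inter> ball z r = {x \<in> ball z r. \<gamma> (x - (x \<bullet> e) *\<^sub>R e) < x \<bullet> e})"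

definition smooth_bounded_domain :: "'a::euclidean_space set \<Rightarrow> bool" where
  "smooth_bounded_domain \<Omega> \<longleftrightarrow>
     open \<Omega> \<and> connected \<Omega> \<and> \<Omega> \<noteq> {} \<and> bounded \<Omega> \<and> smooth_boundary \<Omega>"

definition compactly_contained :: "'a::euclidean_space set \<Rightarrow> 'a set \<Rightarrow> bool"
    (infix \<open>\<subset>\<subset>\<close> 50) where
  "K \<subset>\<subset> \<Omega> \<longleftrightarrow> compact (closure K) \<and> closure K \<subseteq> \<Omega>"

definition Cc_inf :: "'a::euclidean_space set \<Rightarrow> ('a \<Rightarrow> real) set" where
  "Cc_inf \<Omega> = {\<phi>. smooth_on \<phi> UNIV \<and> {x. \<phi> x \<noteq> 0} \<subset>\<subset> \<Omega>}"


section \<open>Lebesgue and Sobolev spaces\<close>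

text \<open>Elements of the function spaces are represented by functions on the whole space; their
  values outside \<open>\<Omega>\<close> are irrelevant, and functions that agree almost everywhere on \<open>\<Omega>\<close> are
  not identified.\<close>

definition Lp :: "'a::euclidean_space set \<Rightarrow> real \<Rightarrow> ('a \<Rightarrow> 'b::euclidean_space) set" where
  "Lp \<Omega> q = {f. f \<in> borel_measurable (lebesgue_on \<Omega>) \<and>
                integrable (lebesgue_on \<Omega>) (\<lambda>x. norm (f x) powr q)}"

definition Lp_loc :: "'a::euclidean_space set \<Rightarrow> real \<Rightarrow> ('a \<Rightarrow> 'b::euclidean_space) set" where
  "Lp_loc \<Omega> q = {f. \<forall>K. compact K \<and> K \<subseteq> \<Omega> \<longrightarrow> f \<in> Lp K q}"

definition has_weak_grad ::
    "'a::euclidean_space set \<Rightarrow> ('a \<Rightarrow> real) \<Rightarrow> ('a \<Rightarrow> 'a) \<Rightarrow> bool" where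
  "has_weak_grad \<Omega> u g \<longleftrightarrow>
     u \<in> Lp_loc \<Omega> 1 \<and> g \<in> Lp_loc \<Omega> 1 \<and>
     (\<forall>\<phi>\<in>Cc_inf \<Omega>. (\<integral>x. u x *\<^sub>R grad \<phi> x \<partial>lebesgue_on \<Omega>)
                   = - (\<integral>x. \<phi> x *\<^sub>R g x \<partial>lebesgue_on \<Omega>))"

text \<open>A representative of the weak gradient, which is unique up to null sets; meaningful only if
  a weak gradient exists.\<close>

definition weak_grad :: "'a::euclidean_space set \<Rightarrow> ('a \<Rightarrow> real) \<Rightarrow> 'a \<Rightarrow> 'a" where
  "weak_grad \<Omega> u = (SOME g. has_weak_grad \<Omega> u g)"

definition W1p :: "'a::euclidean_space set \<Rightarrow> real \<Rightarrow> ('a \<Rightarrow> real) set" where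
  "W1p \<Omega> p = {u. u \<in> Lp \<Omega> p \<and> (\<exists>g. has_weak_grad \<Omega> u g \<and> g \<in> Lp \<Omega> p)}"

definition W1p_loc :: "'a::euclidean_space set \<Rightarrow> real \<Rightarrow> ('a \<Rightarrow> real) set" where
  "W1p_loc \<Omega> p = {u. u \<in> Lp_loc \<Omega> p \<and> (\<exists>g. has_weak_grad \<Omega> u g \<and> g \<in> Lp_loc \<Omega> p)}"

definition W1p_norm :: "'a::euclidean_space set \<Rightarrow> real \<Rightarrow> ('a \<Rightarrow> real) \<Rightarrow> real" where
  "W1p_norm \<Omega> p u =
     ((\<integral>x. norm (u x) powr p \<partial>lebesgue_on \<Omega>)
      + (\<integral>x. norm (weak_grad \<Omega> u x) powr p \<partial>lebesgue_on \<Omega>)) powr (1 / p)"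

text \<open>The closure of \<open>Cc_inf \<Omega>\<close> in \<open>W1p \<Omega> p\<close>.\<close>

definition W1p_0 :: "'a::euclidean_space set \<Rightarrow> real \<Rightarrow> ('a \<Rightarrow> real) set" where
  "W1p_0 \<Omega> p = {u \<in> W1p \<Omega> p. \<forall>\<epsilon>>0. \<exists>\<phi>\<in>Cc_inf \<Omega>. W1p_norm \<Omega> p (\<lambda>x. u x - \<phi> x) < \<epsilon>}"

definition nonpos_on_boundary :: "'a::euclidean_space set \<Rightarrow> real \<Rightarrow> ('a \<Rightarrow> real) \<Rightarrow> bool" where
  "nonpos_on_boundary \<Omega> p v \<longleftrightarrow> (\<forall>\<epsilon>>0. (\<lambda>x. max (v x - \<epsilon>) 0) \<in> W1p_0 \<Omega> p)"

definition conj_exp :: "real \<Rightarrow> real" where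
  "conj_exp s = s / (s - 1)"

definition sobolev_exp :: "nat \<Rightarrow> real \<Rightarrow> real" where
  "sobolev_exp N p = real N * p / (real N - p)"


section \<open>Subsolutions and supersolutions\<close>

definition locally_positive :: "'a::euclidean_space set \<Rightarrow> ('a \<Rightarrow> real) \<Rightarrow> bool" where
  "locally_positive \<Omega> v \<longleftrightarrow>
     (\<forall>K. K \<subset>\<subset> \<Omega> \<longrightarrow> (\<exists>c>0. AE x in lebesgue. x \<in> K \<longrightarrow> c \<le> v x))"

text \<open>Where the gradient vanishes and \<open>p < 2\<close>, the field \<open>|\<nabla>v|^(p-2) \<nabla>v\<close> is zero, as it should be.\<close>

definition p_laplace_form ::
    "'a::euclidean_space set \<Rightarrow> real \<Rightarrow> ('a \<Rightarrow> real) \<Rightarrow> ('a \<Rightarrow> real) \<Rightarrow> real" where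
  "p_laplace_form \<Omega> p v \<phi> =
     (\<integral>x. (norm (weak_grad \<Omega> v x) powr (p - 2) *\<^sub>R weak_grad \<Omega> v x) \<bullet> weak_grad \<Omega> \<phi> x
        \<partial>lebesgue_on \<Omega>)"

text \<open>For nonnegative \<open>\<phi>\<close> the integrand is nonnegative, so the integral is taken in
  \<open>[0, \<infinity>]\<close>. It is finite for smooth compactly supported \<open>\<phi>\<close>, but for general \<open>\<phi>\<close> in
  \<open>W1p_0 \<Omega> p\<close> the singular term need not be integrable; a Bochner integral would then be zero.\<close>

definition source_form ::
    "'a::euclidean_space set \<Rightarrow> ('a \<Rightarrow> real) \<Rightarrow> ('a \<Rightarrow> real) \<Rightarrow> real \<Rightarrow> real \<Rightarrow>
     ('a \<Rightarrow> real) \<Rightarrow> ('a \<Rightarrow> real) \<Rightarrow> ennreal" where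
  "source_form \<Omega> a b \<delta> \<beta> v \<phi> =
     (\<integral>\<^sup>+x. ennreal ((a x / v x powr \<delta> + b x * v x powr \<beta>) * \<phi> x) \<partial>lebesgue_on \<Omega>)"

text \<open>The integral inequalities, for all nonnegative test functions from a class \<open>T\<close>.\<close>

definition sub_inequality ::
    "'a::euclidean_space set \<Rightarrow> real \<Rightarrow> ('a \<Rightarrow> real) \<Rightarrow> ('a \<Rightarrow> real) \<Rightarrow> real \<Rightarrow> real \<Rightarrow>
     ('a \<Rightarrow> real) set \<Rightarrow> ('a \<Rightarrow> real) \<Rightarrow> bool" where
  "sub_inequality \<Omega> p a b \<delta> \<beta> T v \<longleftrightarrow>
     (\<forall>\<phi>\<in>T. (AE x in lebesgue_on \<Omega>. 0 \<le> \<phi> x) \<longrightarrow>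
        ereal (p_laplace_form \<Omega> p v \<phi>) \<le> enn2ereal (source_form \<Omega> a b \<delta> \<beta> v \<phi>))"

definition super_inequality ::
    "'a::euclidean_space set \<Rightarrow> real \<Rightarrow> ('a \<Rightarrow> real) \<Rightarrow> ('a \<Rightarrow> real) \<Rightarrow> real \<Rightarrow> real \<Rightarrow>
     ('a \<Rightarrow> real) set \<Rightarrow> ('a \<Rightarrow> real) \<Rightarrow> bool" where
  "super_inequality \<Omega> p a b \<delta> \<beta> T v \<longleftrightarrow>
     (\<forall>\<phi>\<in>T. (AE x in lebesgue_on \<Omega>. 0 \<le> \<phi> x) \<longrightarrow>
        enn2ereal (source_form \<Omega> a b \<delta> \<beta> v \<phi>) \<le> ereal (p_laplace_form \<Omega> p v \<phi>))"

definition subsolution ::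
    "'a::euclidean_space set \<Rightarrow> real \<Rightarrow> ('a \<Rightarrow> real) \<Rightarrow> ('a \<Rightarrow> real) \<Rightarrow> real \<Rightarrow> real \<Rightarrow>
     ('a \<Rightarrow> real) \<Rightarrow> bool" where
  "subsolution \<Omega> p a b \<delta> \<beta> v \<longleftrightarrow>
     v \<in> W1p_loc \<Omega> p \<and> locally_positive \<Omega> v \<and> sub_inequality \<Omega> p a b \<delta> \<beta> (Cc_inf \<Omega>) v"

definition supersolution ::
    "'a::euclidean_space set \<Rightarrow> real \<Rightarrow> ('a \<Rightarrow> real) \<Rightarrow> ('a \<Rightarrow> real) \<Rightarrow> real \<Rightarrow> real \<Rightarrow>
     ('a \<Rightarrow> real) \<Rightarrow> bool" where
  "supersolution \<Omega> p a b \<delta> \<beta> v \<longleftrightarrow>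
     v \<in> W1p_loc \<Omega> p \<and> locally_positive \<Omega> v \<and> super_inequality \<Omega> p a b \<delta> \<beta> (Cc_inf \<Omega>) v"

end

theory Submission
  imports Defs
begin

text \<open>Write \<open>f(x,t) = a(x) t^(-\<delta>) + b(x) t^\<beta>\<close>. Since \<open>\<beta> < p - 1\<close> and \<open>a + b > 0\<close>, the quotient
\<open>f(x,t) / t^(p-1)\<close> is strictly decreasing in \<open>t\<close>. For two positive functions \<open>z\<close>, \<open>w\<close> one tests the
inequality of \<open>v\<close> with \<open>(z^p - w^p)^+ / z^(p-1)\<close> and that of \<open>w\<close> with \<open>(z^p - w^p)^+ / w^(p-1)\<close>. By
Picone's inequality (in the pointwise form \<open>picone_super\<close>, \<open>picone_sub\<close>) the gradient terms have the
good sign when \<open>z = v\<close>, so the difference of the two source terms is nonnegative, whereas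
monotonicity of the quotient makes it strictly negative on \<open>{v > w}\<close>. Hence that set is null.

The boundary condition only says that \<open>z = (v - \<epsilon>)^+\<close> belongs to \<open>W_0^(1,p)\<close>, and \<open>w\<close> is Sobolev
only locally, so three points need care.

Admissibility. The function \<open>z\<close> is replaced by compactly supported truncations
\<open>zn = min z (\<phi>n^+)\<close>, where \<open>\<phi>n\<close> are smooth functions converging to \<open>z\<close> (\<open>truncations_exist\<close>). The
test function \<open>(zn^p - k^p w^p)^+ / w^(p-1)\<close> has compact support, and Picone's inequality turns the
inequality of \<open>w\<close> into
\<open>\<integral> f(x,w) (zn^p - k^p w^p)^+ / w^(p-1) + k^p \<integral>_{zn > k w} |\<nabla>w|^p \<le> \<integral>_{zn > k w} |\<nabla>zn|^p\<close>,
which survives the limit (\<open>super_estimate\<close>). Thus \<open>\<nabla>w\<close> is \<open>p\<close>-integrable on \<open>{z > w}\<close>, which is what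
dominated convergence needs for the other test function (\<open>sub_estimate\<close>).

The shift. Replacing \<open>v\<close> by \<open>v - \<epsilon>\<close> is harmless in the decreasing term of \<open>f\<close>, and in the increasing
one it produces the error \<open>b (v^\<beta> - z^\<beta>) z\<close>, dominated by \<open>b v^(\<beta>+1)\<close> on \<open>{w < v}\<close>. The estimate above
with \<open>\<epsilon> = 1\<close> and \<open>k = 1/4\<close> shows that this bound is integrable (\<open>large_b_term\<close>), because
\<open>w^(\<beta>+1-p) \<ge> v^(\<beta>+1-p)\<close> there.

Finiteness. The inequality of \<open>v\<close> carries information only if \<open>f(x,v)\<close> is locally integrable. Where
\<open>v \<le> w\<close> its increasing term is bounded by that of \<open>f(x,w)\<close>, whose local integrability is part of the
inequality of \<open>w\<close>; where \<open>w < v\<close> one uses the previous point (\<open>source_v_local\<close>).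

The first half of the file develops weak gradients from mollification: their uniqueness, the chain
rule for functions of two variables, positive parts, and the passage from smooth test functions to
bounded compactly supported ones that are only weakly differentiable.\<close>

section \<open>Smooth functions\<close>

lemma inner_grad:
  fixes f :: "'a::euclidean_space \<Rightarrow> real"
  assumes "(f has_derivative D) (at x)"
  shows "grad f x \<bullet> h = D h"
proof -
  have D: "frechet_derivative f (at x) = D"
    using assms frechet_derivative_at by metis
  interpret D: linear D using assms by (rule has_derivative_linear)
  have "grad f x \<bullet> h = (\<Sum>i\<in>Basis. (h \<bullet> i) *\<^sub>R D i)"
    unfolding grad_def D inner_sum_left by (simp add: inner_commute[of _ h] mult.commute)
  also have "\<dots> = D (\<Sum>i\<in>Basis. (h \<bullet> i) *\<^sub>R i)"
    by (simp add: D.sum D.scale)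
  finally show ?thesis by (simp add: euclidean_representation)
qed

lemma has_derivative_grad:
  fixes f :: "'a::euclidean_space \<Rightarrow> real"
  assumes "f differentiable (at x)"
  shows "(f has_derivative (\<lambda>h. grad f x \<bullet> h)) (at x)"
proof -
  obtain D where "(f has_derivative D) (at x)" using assms differentiable_def by blast
  moreover have "(\<lambda>h. grad f x \<bullet> h) = D" using inner_grad[OF calculation] by auto
  ultimately show ?thesis by simp
qed

lemma gradI:
  fixes f :: "'a::euclidean_space \<Rightarrow> real"
  assumes "(f has_derivative (\<lambda>h. g \<bullet> h)) (at x)"
  shows "grad f x = g"
  using inner_grad[OF assms] by (metis vector_eq_rdot)

lemma frechet_derivative_eq_grad:
  fixes f :: "'a::euclidean_space \<Rightarrow> real"
  assumes "f differentiable (at x)"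
  shows "frechet_derivative f (at x) i = grad f x \<bullet> i"
  using has_derivative_grad[OF assms] frechet_derivative_at by metis

text \<open>Differentiability gives continuity at the bottom of the recursion; above it the claim is the same for the partial derivatives.\<close>

lemma Ck_on_Suc_imp: "Ck_on (Suc k) f S \<Longrightarrow> Ck_on k f S"
proof (induction k arbitrary: f)
  case 0
  then show ?case
    by (metis Ck_on.simps continuous_on_eq_continuous_within differentiable_at_withinI
        differentiable_imp_continuous_within)
next
  case (Suc k)
  then show ?case by (metis Ck_on.simps(2))
qed

lemma Ck_on_const: "Ck_on k (\<lambda>x. c) S"
proof (induction k arbitrary: c)
  case (Suc k)
  have "frechet_derivative (\<lambda>x::'a. c) (at x) i = 0" for x i
    by (metis frechet_derivative_at has_derivative_const)
  with Suc show ?case by simp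
qed simp

lemma Ck_on_add: "Ck_on k f UNIV \<Longrightarrow> Ck_on k g UNIV \<Longrightarrow> Ck_on k (\<lambda>x. f x + g x) UNIV"
proof (induction k arbitrary: f g)
  case 0 then show ?case by (auto intro: continuous_intros)
next
  case (Suc k)
  have "frechet_derivative (\<lambda>x. f x + g x) (at x) i
       = frechet_derivative f (at x) i + frechet_derivative g (at x) i" for x i
  proof -
    have "(f has_derivative frechet_derivative f (at x)) (at x)"
      "(g has_derivative frechet_derivative g (at x)) (at x)"
      using Suc.prems frechet_derivative_works by (metis Ck_on.simps(2) UNIV_I)+
    then have h: "((\<lambda>x. f x + g x) has_derivative
       (\<lambda>i. frechet_derivative f (at x) i + frechet_derivative g (at x) i)) (at x)"
      by (rule has_derivative_add)
    show ?thesis using frechet_derivative_at[OF h] by metis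
  qed
  with Suc show ?case by (auto intro: differentiable_add)
qed

lemma Ck_on_mult: "Ck_on k f UNIV \<Longrightarrow> Ck_on k g UNIV \<Longrightarrow> Ck_on k (\<lambda>x. f x * g x) UNIV"
proof (induction k arbitrary: f g)
  case 0 then show ?case by (auto intro: continuous_intros)
next
  case (Suc k)
  have "frechet_derivative (\<lambda>x. f x * g x) (at x) i
       = f x * frechet_derivative g (at x) i + frechet_derivative f (at x) i * g x" for x i
  proof -
    have "(f has_derivative frechet_derivative f (at x)) (at x)"
      "(g has_derivative frechet_derivative g (at x)) (at x)"
      using Suc.prems frechet_derivative_works by (metis Ck_on.simps(2) UNIV_I)+
    then have h: "((\<lambda>x. f x * g x) has_derivative
       (\<lambda>i. f x * frechet_derivative g (at x) i + frechet_derivative f (at x) i * g x)) (at x)"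
      by (rule has_derivative_mult)
    show ?thesis using frechet_derivative_at[OF h] by metis
  qed
  moreover have "Ck_on k (\<lambda>x. f x * frechet_derivative g (at x) i + frechet_derivative f (at x) i * g x) UNIV"
    if "i \<in> Basis" for i
    using Suc that Ck_on_Suc_imp[OF Suc.prems(1)] Ck_on_Suc_imp[OF Suc.prems(2)]
    by (intro Ck_on_add Suc.IH) auto
  ultimately show ?case using Suc.prems by (auto intro: differentiable_mult)
qed

lemma Ck_on_inner: "Ck_on k (\<lambda>x. x \<bullet> i) UNIV"
proof (cases k)
  case (Suc k')
  have "((\<lambda>x. x \<bullet> i) has_derivative (\<lambda>x. x \<bullet> i)) (at y)" for y
    by (intro derivative_eq_intros) auto
  then have "frechet_derivative (\<lambda>x. x \<bullet> i) (at y) = (\<lambda>x. x \<bullet> i)" "(\<lambda>x. x \<bullet> i) differentiable (at y)" for y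
    using frechet_derivative_at differentiable_def by metis+
  then show ?thesis by (simp add: Suc Ck_on_const)
qed (auto intro: continuous_intros)

text \<open>The derivatives of \<open>exp (-1/t)\<close>, extended by zero to \<open>t \<le> 0\<close>, are linear combinations of these
functions, so the family is closed under differentiation up to linear combinations.\<close>

definition flat_exp :: "nat \<Rightarrow> real \<Rightarrow> real" where
  "flat_exp m t = (if t > 0 then inverse t ^ m * exp (- inverse t) else 0)"

text \<open>Substituting \<open>s = 1/t\<close> turns this into the decay of \<open>s^m exp (-s)\<close>. Applied to \<open>Suc m\<close> it also computes the
difference quotient of \<open>flat_exp m\<close> at zero.\<close>

lemma flat_exp_tendsto_0: "((\<lambda>t. flat_exp m t) \<longlongrightarrow> 0) (at 0)"
proof -
  have "((\<lambda>s::real. s ^ m / exp s) \<longlongrightarrow> 0) at_top" by (rule tendsto_power_div_exp_0)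
  then have "((\<lambda>t::real. inverse t ^ m / exp (inverse t)) \<longlongrightarrow> 0) (at_right 0)"
    using filterlim_compose filterlim_inverse_at_top_right by blast
  then have "(flat_exp m \<longlongrightarrow> 0) (at_right 0)"
    by (rule Lim_transform_eventually)
      (auto simp: eventually_at_filter flat_exp_def exp_minus divide_inverse)
  moreover have "(flat_exp m \<longlongrightarrow> 0) (at_left 0)"
    by (rule Lim_transform_eventually[of "\<lambda>_. 0"]) (auto simp: eventually_at_filter flat_exp_def)
  ultimately show ?thesis by (simp add: filterlim_split_at)
qed

lemma flat_exp_has_derivative:
  "(flat_exp m has_real_derivative (flat_exp (m+2) t - real m * flat_exp (m+1) t)) (at t)"
proof -
  consider "t > 0" | "t < 0" | "t = 0" by linarith
  then show ?thesis
  proof cases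
    case 1
    have "((\<lambda>t. inverse t ^ m * exp (- inverse t)) has_real_derivative
        (flat_exp (m+2) t - real m * flat_exp (m+1) t)) (at t)"
    proof (cases m)
      case 0
      then show ?thesis using 1
        by (auto intro!: derivative_eq_intros simp: flat_exp_def power2_eq_square)
    next
      case (Suc n)
      show ?thesis using 1 unfolding Suc
        by (auto intro!: derivative_eq_intros simp: flat_exp_def field_simps) (cases n; simp)
    qed
    then show ?thesis
      by (rule DERIV_cong_ev[THEN iffD1, rotated -1])
        (use 1 in \<open>auto simp: flat_exp_def eventually_nhds intro!: exI[of _ "{0<..}"]\<close>)
  next
    case 2
    have "((\<lambda>t. 0) has_real_derivative 0) (at t)" by simp
    then have "(flat_exp m has_real_derivative 0) (at t)"
      by (rule DERIV_cong_ev[THEN iffD1, rotated -1])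
        (use 2 in \<open>auto simp: flat_exp_def eventually_nhds intro!: exI[of _ "{..<0}"]\<close>)
    then show ?thesis using 2 by (simp add: flat_exp_def)
  next
    case 3
    have "((\<lambda>h. (flat_exp m (0 + h) - flat_exp m 0) / h) \<longlongrightarrow> 0) (at 0)"
      by (rule Lim_transform_eventually[OF flat_exp_tendsto_0[of "Suc m"]])
        (auto simp: eventually_at_filter flat_exp_def divide_simps)
    then have "(flat_exp m has_real_derivative 0) (at 0)" by (simp add: DERIV_def)
    then show ?thesis using 3 by (simp add: flat_exp_def)
  qed
qed

lemma Ck_on_flat_exp: "Ck_on k (\<lambda>x. flat_exp m (r - x \<bullet> x)) (UNIV :: 'a::euclidean_space set)"
proof (induction k arbitrary: m)
  case 0
  have "continuous_on UNIV (flat_exp m)"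
    using flat_exp_has_derivative DERIV_isCont by (metis continuous_at_imp_continuous_on)
  then show ?case by (auto intro!: continuous_on_compose2[of UNIV "flat_exp m"] continuous_intros)
next
  case (Suc k)
  let ?d = "\<lambda>x i::'a. (flat_exp (m+2) (r - x \<bullet> x) + (- real m) * flat_exp (m+1) (r - x \<bullet> x)) * ((-2) * (x \<bullet> i))"
  have der: "((\<lambda>x. flat_exp m (r - x \<bullet> x)) has_derivative (?d x)) (at x)" for x :: 'a
  proof -
    have "((\<lambda>x. r - x \<bullet> x) has_derivative (\<lambda>i. (-2) * (x \<bullet> i))) (at x)"
      by (auto intro!: derivative_eq_intros simp: inner_commute)
    from has_derivative_compose[OF this, of "flat_exp m"] 
    show ?thesis using flat_exp_has_derivative[of m "r - x \<bullet> x"]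
      unfolding has_field_derivative_def by fastforce
  qed
  have "Ck_on k (\<lambda>x. ?d x i) UNIV" for i
    by (intro Ck_on_mult Ck_on_add Suc Ck_on_const Ck_on_inner)
  moreover have "(\<lambda>x. flat_exp m (r - x \<bullet> x)) differentiable (at x)" for x :: 'a
    using der differentiable_def by blast
  ultimately show ?case unfolding Ck_on.simps frechet_derivative_at[OF der, symmetric] by blast
qed

lemma smooth_onD:
  assumes "smooth_on f (UNIV::'a::euclidean_space set)"
  shows "f differentiable (at x)" "continuous_on UNIV (grad f)" "continuous_on UNIV f"
    "i \<in> Basis \<Longrightarrow> smooth_on (\<lambda>x. grad f x \<bullet> i) UNIV"
proof -
  have C: "Ck_on k f UNIV" for k using assms by (auto simp: smooth_on_def)
  show d: "f differentiable (at x)" for x using C[of "Suc 0"] by auto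
  show "continuous_on UNIV f" using C[of 0] by auto
  have "continuous_on UNIV (\<lambda>x. frechet_derivative f (at x) i)" if "i \<in> Basis" for i
    using C[of "Suc 0"] that by auto
  then show "continuous_on UNIV (grad f)"
    unfolding grad_def[abs_def] by (auto intro!: continuous_intros)
  show "smooth_on (\<lambda>x. grad f x \<bullet> i) UNIV" if "i \<in> Basis"
    unfolding smooth_on_def
  proof
    fix k show "Ck_on k (\<lambda>x. grad f x \<bullet> i) UNIV"
      using C[of "Suc k"] that d by (simp add: frechet_derivative_eq_grad)
  qed
qed

lemma grad_eq_0_outside:
  assumes "closed K" "\<And>x. x \<notin> K \<Longrightarrow> f x = 0" "x \<notin> K"
  shows "grad f x = 0"
proof -
  have "(f has_derivative (\<lambda>h. 0)) (at x)"
    using assms by (intro has_derivative_transform_within_open[OF has_derivative_const, of "- K" x 0]) auto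
  then show ?thesis using gradI[of f 0 x] by simp
qed

text \<open>Two points closer than 1, one of which lies in the support, both lie in a slightly larger ball, which is compact.\<close>

lemma uniformly_continuous_compact_support:
  fixes f :: "'a::euclidean_space \<Rightarrow> 'b::metric_space"
  assumes "continuous_on UNIV f" "\<And>x. r \<le> norm x \<Longrightarrow> f x = c"
  shows "uniformly_continuous_on UNIV f"
proof -
  have u: "uniformly_continuous_on (cball 0 (r+1)) f"
    using assms by (intro compact_uniformly_continuous continuous_on_subset[OF assms(1)]) auto
  show ?thesis unfolding uniformly_continuous_on_def
  proof (intro allI impI)
    fix e :: real assume "e > 0"
    then obtain d where d: "d>0" "\<And>x y. norm x \<le> r + 1 \<Longrightarrow> norm y \<le> r + 1 \<Longrightarrow> dist y x < d \<Longrightarrow> dist (f y) (f x) < e"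
      using u unfolding uniformly_continuous_on_def by (force simp: dist_norm)
    have "dist (f y) (f x) < e" if "dist y x < min d 1" for x y
    proof (cases "norm x \<le> r \<or> norm y \<le> r")
      case True
      have "\<bar>norm y - norm x\<bar> \<le> dist y x" by (simp add: dist_norm norm_triangle_ineq3)
      with True that have "norm x \<le> r + 1" "norm y \<le> r + 1" by auto
      with d that show ?thesis by auto
    next
      case False then show ?thesis using assms \<open>e > 0\<close> by auto
    qed
    then show "\<exists>d>0. \<forall>x\<in>UNIV. \<forall>x'\<in>UNIV. dist x' x < d \<longrightarrow> dist (f x') (f x) < e"
      using d(1) by (metis min_less_iff_conj zero_less_one)
  qed
qed

lemma bounded_compact_support:
  fixes f :: "'a::euclidean_space \<Rightarrow> 'b::real_normed_vector"
  assumes "continuous_on UNIV f" "compact K" "\<And>x. x \<notin> K \<Longrightarrow> f x = 0"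
  obtains B where "B > 0" "\<And>x. norm (f x) \<le> B"
proof -
  have "bounded (f ` K)" 
    using assms by (meson compact_continuous_image compact_imp_bounded continuous_on_subset subset_UNIV)
  then obtain B where "B > 0" "\<And>x. x \<in> K \<Longrightarrow> norm (f x) \<le> B" by (auto simp: bounded_pos)
  then show ?thesis using assms that[of B] by (metis less_imp_le norm_zero)
qed

section \<open>Powers, dominated sequences and density in \<open>L^p\<close>\<close>

text \<open>Young's inequality with the weights arranged so that both sides agree at \<open>s = t\<close>; it says that
the graph of \<open>t^p\<close> lies above its tangent at \<open>s\<close>. Jensen's and Picone's inequalities below are
integrated and pointwise uses of it.\<close>

lemma young_powr:
  fixes s t p :: real
  assumes "s \<ge> 0" "t \<ge> 0" "p \<ge> 1"
  shows "p * s powr (p - 1) * t \<le> (p - 1) * s powr p + t powr p"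
proof (cases "p = 1")
  case True
  then show ?thesis using assms by (cases "s = 0") auto
next
  case False
  then have p: "p > 1" using assms by simp
  define q where "q = p / (p - 1)"
  have q: "q > 1" "1 / p + 1 / q = 1" "(p - 1) * q = p" "p / q = p - 1"
    using p by (auto simp: q_def field_simps)
  have "t * s powr (p - 1) \<le> t powr p / p + (s powr (p - 1)) powr q / q"
    using p q assms by (intro Youngs_inequality) auto
  then have "p * (t * s powr (p - 1)) \<le> p * (t powr p / p + s powr p / q)"
    using p q by (intro mult_left_mono) (auto simp: powr_powr)
  also have "\<dots> = t powr p + (p / q) * s powr p"
    using p by (simp add: field_simps)
  finally show ?thesis using q by (simp add: algebra_simps)
qed

lemma powr_add_le:
  fixes s t p :: real
  assumes "s \<ge> 0" "t \<ge> 0" "p > 0"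
  shows "(s + t) powr p \<le> 2 powr p * (s powr p + t powr p)"
proof -
  have "(s + t) powr p \<le> (2 * max s t) powr p"
    using assms by (intro powr_mono2) auto
  also have "\<dots> = 2 powr p * max s t powr p" using assms by (simp add: powr_mult)
  also have "\<dots> \<le> 2 powr p * (s powr p + t powr p)"
    by (intro mult_left_mono) (auto simp: max_def)
  finally show ?thesis .
qed

lemma norm_diff_powr_le:
  fixes x y :: "'a::real_normed_vector"
  assumes "p > 0"
  shows "norm (x - y) powr p \<le> 2 powr p * (norm x powr p + norm y powr p)"
proof -
  have "norm (x - y) powr p \<le> (norm x + norm y) powr p"
    using assms by (intro powr_mono2) (auto simp: norm_triangle_ineq4)
  also have "\<dots> \<le> 2 powr p * (norm x powr p + norm y powr p)"
    using assms by (intro powr_add_le) auto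
  finally show ?thesis .
qed

text \<open>Integrate the tangent inequality \<open>young_powr\<close> at the mean value against the weight.\<close>

lemma jensen_powr:
  fixes w g :: "'a \<Rightarrow> real"
  assumes w: "integrable M w" "(\<integral>x. w x \<partial>M) = 1" "\<And>x. w x \<ge> 0"
    and g: "integrable M (\<lambda>x. w x * g x)" "\<And>x. g x \<ge> 0" "g \<in> borel_measurable M" and "p \<ge> 1"
  shows "ennreal ((\<integral>x. w x * g x \<partial>M) powr p) \<le> (\<integral>\<^sup>+x. ennreal (w x * g x powr p) \<partial>M)"
proof (cases "integrable M (\<lambda>x. w x * g x powr p)")
  case True
  define s where "s = (\<integral>x. w x * g x \<partial>M)"
  have s: "s \<ge> 0" unfolding s_def using w g by (intro integral_nonneg_AE) auto
  have "(\<integral>x. p * s powr (p - 1) * (w x * g x) - (p - 1) * s powr p * w x \<partial>M) \<le> (\<integral>x. w x * g x powr p \<partial>M)"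
  proof (rule integral_mono)
    fix x
    have "w x * (p * s powr (p - 1) * g x) \<le> w x * ((p - 1) * s powr p + g x powr p)"
      using s w g assms by (intro mult_left_mono young_powr) auto
    then show "p * s powr (p - 1) * (w x * g x) - (p - 1) * s powr p * w x \<le> w x * g x powr p"
      by (simp add: algebra_simps)
  qed (use w g True in auto)
  also have "(\<integral>x. p * s powr (p - 1) * (w x * g x) - (p - 1) * s powr p * w x \<partial>M)
      = p * s powr (p - 1) * s - (p - 1) * s powr p"
    using w g by (simp add: s_def)
  also have "\<dots> = s powr p"
    using s by (cases "s = 0") (auto simp: powr_diff algebra_simps)
  finally have "ennreal (s powr p) \<le> ennreal (\<integral>x. w x * g x powr p \<partial>M)"
    by (rule ennreal_leI)
  also have "\<dots> = (\<integral>\<^sup>+x. ennreal (w x * g x powr p) \<partial>M)"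
    using True w by (intro nn_integral_eq_integral[symmetric]) auto
  finally show ?thesis by (simp add: s_def)
next
  case False
  have "(\<integral>\<^sup>+x. ennreal (w x * g x powr p) \<partial>M) = \<infinity>"
    using False w g by (simp add: integrable_iff_bounded less_top[symmetric])
  then show ?thesis by simp
qed

text \<open>The sum over \<open>n\<close> of \<open>|f n|^p\<close> is integrable, hence finite almost everywhere. It dominates each term,
and its terms tend to zero. So summable \<open>L^p\<close> distances give at once the almost everywhere convergence
and the majorant that dominated convergence asks for.\<close>

lemma summable_powr_imp_dominated:
  fixes f :: "nat \<Rightarrow> 'a \<Rightarrow> 'b::euclidean_space"
  assumes [measurable]: "\<And>n. f n \<in> borel_measurable M"
    and fin: "(\<Sum>n. \<integral>\<^sup>+x. ennreal (norm (f n x) powr p) \<partial>M) < \<infinity>" and "p > 0"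
  obtains S where "integrable M S" "\<And>x. S x \<ge> 0" "AE x in M. \<forall>n. norm (f n x) powr p \<le> S x"
    "AE x in M. (\<lambda>n. f n x) \<longlonglongrightarrow> 0"
proof -
  define g where "g x = (\<Sum>n. ennreal (norm (f n x) powr p))" for x
  have [measurable]: "g \<in> borel_measurable M" unfolding g_def by measurable
  have int: "(\<integral>\<^sup>+x. g x \<partial>M) < \<infinity>"
    unfolding g_def using fin by (subst nn_integral_suminf) auto
  then have AE: "AE x in M. g x \<noteq> \<infinity>"
    by (intro nn_integral_PInf_AE) auto
  define S where "S x = enn2real (g x)" for x
  have [measurable]: "S \<in> borel_measurable M" unfolding S_def by measurable
  have "AE x in M. ennreal (S x) = g x"
    using AE by eventually_elim (auto simp: S_def less_top[symmetric])
  then have "(\<integral>\<^sup>+x. ennreal (S x) \<partial>M) = (\<integral>\<^sup>+x. g x \<partial>M)"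
    by (intro nn_integral_cong_AE) auto
  then have 1: "integrable M S"
    using int by (intro integrableI_nonneg) (auto simp: S_def)
  have 2: "AE x in M. \<forall>n. norm (f n x) powr p \<le> S x"
    using AE
  proof eventually_elim
    case (elim x)
    show ?case
    proof
      fix n
      have "(\<Sum>m\<in>{n}. ennreal (norm (f m x) powr p)) \<le> g x"
        unfolding g_def by (intro sum_le_suminf) auto
      then have "enn2real (ennreal (norm (f n x) powr p)) \<le> enn2real (g x)"
        using elim by (intro enn2real_mono) (auto simp: less_top[symmetric])
      then show "norm (f n x) powr p \<le> S x" by (simp add: S_def)
    qed
  qed
  have 3: "AE x in M. (\<lambda>n. f n x) \<longlonglongrightarrow> 0"
    using AE
  proof eventually_elim
    case (elim x)
    have "summable (\<lambda>n. norm (f n x) powr p)"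
      using elim unfolding g_def by (intro summable_suminf_not_top) auto
    then have "(\<lambda>n. norm (f n x) powr p) \<longlonglongrightarrow> 0" by (rule summable_LIMSEQ_zero)
    then have "(\<lambda>n. (norm (f n x) powr p) powr (1 / p)) \<longlonglongrightarrow> 0 powr (1 / p)"
      using assms by (intro tendsto_powr') auto
    then have "(\<lambda>n. norm (f n x)) \<longlonglongrightarrow> 0"
      using assms by (simp add: powr_powr)
    then show ?case by (rule tendsto_norm_zero_cancel)
  qed
  show ?thesis using that[OF 1 _ 2 3] by (simp add: S_def)
qed

lemma lborel_reflect: "lborel = distr lborel borel (\<lambda>y. x - y :: 'a::euclidean_space)"
  using lborel_affine[of "-1" x] by (simp add: density_1)

lemma lborel_nn_integral_reflect:
  fixes f :: "'a::euclidean_space \<Rightarrow> ennreal"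
  assumes [measurable]: "f \<in> borel_measurable borel"
  shows "(\<integral>\<^sup>+y. f (x - y) \<partial>lborel) = (\<integral>\<^sup>+y. f y \<partial>lborel)"
  by (subst (2) lborel_reflect[of x]) (simp add: nn_integral_distr)

lemma lborel_nn_integral_shift:
  fixes f :: "'a::euclidean_space \<Rightarrow> ennreal"
  assumes [measurable]: "f \<in> borel_measurable borel"
  shows "(\<integral>\<^sup>+y. f (y + x) \<partial>lborel) = (\<integral>\<^sup>+y. f y \<partial>lborel)"
  by (subst (2) lborel_distr_plus[of x, symmetric]) (simp add: nn_integral_distr add.commute)

lemma lborel_integral_reflect:
  fixes f :: "'a::euclidean_space \<Rightarrow> 'b::euclidean_space"
  assumes [measurable]: "f \<in> borel_measurable borel"
  shows "(\<integral>y. f (x - y) \<partial>lborel) = (\<integral>y. f y \<partial>lborel)"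
  by (subst (2) lborel_reflect[of x]) (simp add: integral_distr)

lemma lborel_integral_shift:
  fixes f :: "'a::euclidean_space \<Rightarrow> 'b::euclidean_space"
  assumes [measurable]: "f \<in> borel_measurable borel"
  shows "(\<integral>y. f (y + x) \<partial>lborel) = (\<integral>y. f y \<partial>lborel)"
  by (subst (2) lborel_distr_plus[of x, symmetric]) (simp add: integral_distr add.commute)

lemma lborel_integrable_reflect:
  fixes f :: "'a::euclidean_space \<Rightarrow> 'b::euclidean_space"
  assumes [measurable]: "integrable lborel f"
  shows "integrable lborel (\<lambda>y. f (x - y))"
proof -
  have "integrable (distr lborel borel (\<lambda>y. x - y)) f"
    using assms lborel_reflect[of x] by simp
  then show ?thesis by (simp add: integrable_distr_eq)
qed

lemma lborel_integrable_shift: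
  fixes f :: "'a::euclidean_space \<Rightarrow> 'b::euclidean_space"
  assumes [measurable]: "integrable lborel f"
  shows "integrable lborel (\<lambda>y. f (y + x))"
proof -
  have "integrable (distr lborel borel ((+) x)) f"
    using assms by (simp add: lborel_distr_plus)
  then show ?thesis by (simp add: integrable_distr_eq add.commute)
qed

lemma integrable_compact_support:
  fixes f :: "'a::euclidean_space \<Rightarrow> 'b::euclidean_space"
  assumes "continuous_on UNIV f" "compact K" "\<And>x. x \<notin> K \<Longrightarrow> f x = 0"
  shows "integrable lborel f"
proof -
  have "integrable lborel (\<lambda>x. indicator K x *\<^sub>R f x)"
    using assms by (intro borel_integrable_compact) (auto intro: continuous_on_subset)
  moreover have "(\<lambda>x. indicator K x *\<^sub>R f x) = f" using assms by (auto simp: indicator_def)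
  ultimately show ?thesis by simp
qed

text \<open>A measurable function is an almost everywhere limit of continuous functions. Cutting these off in
space and in range makes the convergence dominated, and the cut-offs of \<open>f\<close> itself converge to \<open>f\<close>
because they are dominated by \<open>f\<close>.\<close>

lemma continuous_dense_Lp:
  fixes f :: "'a::euclidean_space \<Rightarrow> 'b::euclidean_space"
  assumes f[measurable]: "f \<in> borel_measurable borel"
    and int: "integrable lborel (\<lambda>x. norm (f x) powr p)" and p: "p > 0" and e: "e > 0"
  obtains g R where "continuous_on UNIV g" "\<And>x. R \<le> norm x \<Longrightarrow> g x = 0" "R > 0"
    "integrable lborel (\<lambda>x. norm (f x - g x) powr p)" "(\<integral>x. norm (f x - g x) powr p \<partial>lborel) < e"
proof -
  (* ch cuts off in space and cl in range; the cut-off of f is f itself once M exceeds |x| and |f x|. *)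
  define ch where "ch M x = max 0 (min 1 (M + 1 - norm x))" for M :: real and x :: 'a
  define cl where "cl M v = (M / max M (norm v)) *\<^sub>R v" for M :: real and v :: 'b
  define h where "h M g x = ch M x *\<^sub>R cl M (g x)" for M :: real and g :: "'a \<Rightarrow> 'b" and x
  have ch: "0 \<le> ch M x" "ch M x \<le> 1" for M x by (auto simp: ch_def)
  have cl: "norm (cl M v) \<le> norm v" "norm (cl M v) \<le> M" if "M > 0" for M v
    using that by (auto simp: cl_def max_def divide_simps)
  have hM: "norm (h M g x) \<le> M" if "M > 0" for M g x
    using ch[of M x] cl[OF that, of "g x"] mult_mono[of "ch M x" 1 "norm (cl M (g x))" M]
    by (auto simp: h_def)
  have h0: "h M g x = 0" if "norm x \<ge> M + 1" for M g x
    using that by (simp add: h_def ch_def)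
  have hdiff: "norm (f x - h M f x) \<le> norm (f x)" if "M > 0" for M x
  proof -
    have "f x - h M f x = (1 - ch M x * (M / max M (norm (f x)))) *\<^sub>R f x"
      by (simp add: h_def cl_def algebra_simps)
    moreover have "0 \<le> ch M x * (M / max M (norm (f x)))" using ch that by auto
    moreover have "ch M x * (M / max M (norm (f x))) \<le> 1"
      using ch[of M x] that by (intro mult_le_one) (auto simp: max_def divide_le_eq)
    ultimately show ?thesis by (auto intro!: mult_left_le_one_le simp: )
  qed
  have [measurable]: "h M f \<in> borel_measurable borel" for M
    unfolding h_def ch_def cl_def by measurable
  have lim1: "(\<lambda>M. \<integral>x. norm (f x - h (real (Suc M)) f x) powr p \<partial>lborel) \<longlonglongrightarrow> integral\<^sup>L (lborel :: 'a measure) (\<lambda>_. 0)"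
  proof (rule integral_dominated_convergence[where w = "\<lambda>x. norm (f x) powr p"])
    show "AE x in lborel. (\<lambda>M. norm (f x - h (real (Suc M)) f x) powr p) \<longlonglongrightarrow> 0"
    proof (rule AE_I2, rule tendsto_eventually)
      fix x
      obtain N :: nat where N: "norm x + norm (f x) \<le> real N" using real_arch_simple by blast
      show "\<forall>\<^sub>F M in sequentially. norm (f x - h (real (Suc M)) f x) powr p = 0"
        using eventually_ge_at_top[of N]
      proof eventually_elim
        case (elim M)
        then have "real (Suc M) \<ge> norm x" "real (Suc M) \<ge> norm (f x)"
          using N norm_ge_zero[of x] norm_ge_zero[of "f x"] by linarith+
        then have "h (real (Suc M)) f x = f x" by (simp add: h_def ch_def cl_def max_def)
        then show ?case by simp
      qed
    qed
    show "AE x in lborel. norm (norm (f x - h (real (Suc M)) f x) powr p) \<le> norm (f x) powr p" for M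
      using hdiff p by (intro AE_I2) (auto intro!: powr_mono2)
  qed (use int in auto)
  define e' where "e' = e / (2 powr p * 2)"
  have e': "e' > 0" using e by (simp add: e'_def)
  have "\<forall>\<^sub>F M in sequentially. (\<integral>x. norm (f x - h (real (Suc M)) f x) powr p \<partial>lborel) < e'"
    using order_tendstoD(2)[OF lim1] e' by simp
  then obtain m where m: "(\<integral>x. norm (f x - h (real (Suc m)) f x) powr p \<partial>lborel) < e'"
    by (auto simp: eventually_sequentially)
  define M where "M = real (Suc m)"
  have M: "M > 0" by (simp add: M_def)
  have i1: "integrable lborel (\<lambda>x. norm (f x - h M f x) powr p)"
    by (rule Bochner_Integration.integrable_bound[OF int]) (use hdiff M p in \<open>auto intro!: powr_mono2\<close>)
  have "f measurable_on UNIV"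
    using f by (intro lebesgue_measurable_imp_measurable_on) (auto simp: measurable_completion)
  then obtain N g where N: "negligible N" and cont: "\<And>n::nat. continuous_on UNIV (g n)"
    and conv: "\<And>x. x \<notin> N \<Longrightarrow> (\<lambda>n. g n x) \<longlonglongrightarrow> f x"
    unfolding measurable_on_def by auto
  have cl_cont: "continuous_on UNIV (cl M)"
    unfolding cl_def using M by (intro continuous_intros) (auto simp: max_def)
  have hcont: "continuous_on UNIV (h M (g n))" for n
    unfolding h_def ch_def
    by (intro continuous_intros continuous_on_compose2[OF cl_cont] cont) auto
  then have [measurable]: "h M (g n) \<in> borel_measurable borel" for n
    by (rule borel_measurable_continuous_onI)
  let ?w = "\<lambda>x::'a. (2 * M) powr p * indicator (cball 0 (M + 1)) x"
  have wint: "integrable lborel ?w"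
    by (intro integrable_mult_right integrable_real_indicator)
      (use emeasure_compact_finite[OF compact_cball, of "0::'a" "M + 1"] in auto)
  have dom: "norm (norm (h M f x - h M (g n) x) powr p) \<le> ?w x" for n x
  proof (cases "norm x \<le> M + 1")
    case True
    have "norm (h M f x - h M (g n) x) \<le> 2 * M"
      using norm_triangle_ineq4[of "h M f x" "h M (g n) x"] hM[OF M, of f x] hM[OF M, of "g n" x] by linarith
    then show ?thesis using True p by (auto intro!: powr_mono2)
  next
    case False then show ?thesis by (simp add: h0)
  qed
  have N': "AE x in lborel. x \<notin> N"
    using N by (metis AE_completion_iff AE_not_in negligible_iff_null_sets)
  have lim2: "(\<lambda>n. \<integral>x. norm (h M f x - h M (g n) x) powr p \<partial>lborel) \<longlonglongrightarrow> integral\<^sup>L (lborel :: 'a measure) (\<lambda>_. 0)"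
  proof (rule integral_dominated_convergence[where w = ?w])
    show "AE x in lborel. (\<lambda>n. norm (h M f x - h M (g n) x) powr p) \<longlonglongrightarrow> 0"
      using N'
    proof eventually_elim
      case (elim x)
      have "(\<lambda>n. cl M (g n x)) \<longlonglongrightarrow> cl M (f x)"
        using cl_cont conv[OF elim] by (metis UNIV_I continuous_on_tendsto_compose eventuallyI)
      then have "(\<lambda>n. h M f x - h M (g n) x) \<longlonglongrightarrow> h M f x - h M f x"
        unfolding h_def by (intro tendsto_intros)
      then have "(\<lambda>n. norm (h M f x - h M (g n) x) powr p) \<longlonglongrightarrow> norm (h M f x - h M f x) powr p"
        using p by (intro tendsto_powr' tendsto_norm) auto
      then show ?case by simp
    qed
  qed (use wint dom in auto)
  have "\<forall>\<^sub>F n in sequentially. (\<integral>x. norm (h M f x - h M (g n) x) powr p \<partial>lborel) < e'"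
    using order_tendstoD(2)[OF lim2] e' by simp
  then obtain n where n: "(\<integral>x. norm (h M f x - h M (g n) x) powr p \<partial>lborel) < e'"
    by (auto simp: eventually_sequentially)
  have i2: "integrable lborel (\<lambda>x. norm (h M f x - h M (g n) x) powr p)"
    by (rule Bochner_Integration.integrable_bound[OF wint]) (use dom in auto)
  have bd: "norm (f x - h M (g n) x) powr p
     \<le> 2 powr p * (norm (f x - h M f x) powr p + norm (h M f x - h M (g n) x) powr p)" for x
    using norm_diff_powr_le[OF p, of "f x - h M f x" "h M (g n) x - h M f x"]
    by (simp add: norm_minus_commute)
  have i3: "integrable lborel (\<lambda>x. 2 powr p * (norm (f x - h M f x) powr p + norm (h M f x - h M (g n) x) powr p))"
    using i1 i2 by auto
  have i4: "integrable lborel (\<lambda>x. norm (f x - h M (g n) x) powr p)"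
    by (rule Bochner_Integration.integrable_bound[OF i3]) (use bd in \<open>auto intro!: AE_I2\<close>)
  have "(\<integral>x. norm (f x - h M (g n) x) powr p \<partial>lborel)
     \<le> (\<integral>x. 2 powr p * (norm (f x - h M f x) powr p + norm (h M f x - h M (g n) x) powr p) \<partial>lborel)"
    using i3 i4 bd by (intro integral_mono) auto
  also have "\<dots> = 2 powr p * ((\<integral>x. norm (f x - h M f x) powr p \<partial>lborel)
       + (\<integral>x. norm (h M f x - h M (g n) x) powr p \<partial>lborel))"
    using i1 i2 by simp
  also have "\<dots> < 2 powr p * (e' + e')"
    using n m by (intro mult_strict_left_mono) (auto simp: M_def)
  also have "\<dots> = e" by (simp add: e'_def)
  finally show ?thesis
    using hcont[of n] h0 i4 that[of "h M (g n)" "M + 1"] M by auto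
qed

section \<open>Mollification\<close>

lemma compact_support_modulus:
  fixes f :: "'a::euclidean_space \<Rightarrow> 'b::metric_space"
  assumes "continuous_on UNIV f" "\<And>x. r \<le> norm x \<Longrightarrow> f x = c" "e > 0"
  obtains d where "d > 0" "\<And>x y. dist y x < d \<Longrightarrow> dist (f y) (f x) < e"
proof -
  have u: "uniformly_continuous_on UNIV f"
    using assms(1,2) by (rule uniformly_continuous_compact_support)
  show ?thesis
    using u[unfolded uniformly_continuous_on_def, rule_format, OF assms(3)] that by auto
qed

text \<open>Compare \<open>f\<close> with a continuous compactly supported \<open>g\<close>: translation preserves the distance between them, and for \<open>g\<close> the claim is uniform continuity.\<close>

lemma translation_continuous_Lp:
  fixes f :: "'a::euclidean_space \<Rightarrow> 'b::euclidean_space"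
  assumes f[measurable]: "f \<in> borel_measurable borel"
    and int: "integrable lborel (\<lambda>x. norm (f x) powr p)" and p: "p > 0" and e: "e > 0"
  obtains d where "d > 0"
    "\<And>h. norm h < d \<Longrightarrow> (\<integral>\<^sup>+x. ennreal (norm (f (x - h) - f x) powr p) \<partial>lborel) \<le> ennreal e"
proof -
  (* C is the constant for splitting the p-th power of a sum of three terms. *)
  define C where "C = (2 powr p * (2 powr p + 1) :: real)"
  have C: "C > 0" by (simp add: C_def add_pos_pos)
  define e1 where "e1 = e / (4 * C)"
  have e1: "e1 > 0" using e C by (simp add: e1_def)
  obtain g R where g: "continuous_on UNIV g" "\<And>x. R \<le> norm x \<Longrightarrow> g x = 0" "R > 0"
    and gi: "integrable lborel (\<lambda>x. norm (f x - g x) powr p)" "(\<integral>x. norm (f x - g x) powr p \<partial>lborel) < e1"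
    using continuous_dense_Lp[OF f int p e1] by blast
  have [measurable]: "g \<in> borel_measurable borel" using g(1) by (rule borel_measurable_continuous_onI)
  define m where "m = measure lborel (cball (0::'a) (R + 1))"
  define \<eta> where "\<eta> = (e / (2 * C * (m + 1))) powr (1 / p)"
  have m: "m \<ge> 0" by (simp add: m_def)
  have \<eta>: "\<eta> > 0" "\<eta> powr p = e / (2 * C * (m + 1))" using e C p m by (auto simp: \<eta>_def powr_powr)
  obtain d where d: "d > 0" "\<And>x y. dist y x < d \<Longrightarrow> dist (g y) (g x) < \<eta>"
    using compact_support_modulus[OF g(1,2) \<eta>(1)] by blast
  define a where "a x = norm (f x - g x) powr p" for x
  have [measurable]: "a \<in> borel_measurable borel" unfolding a_def by measurable
  have a: "(\<integral>\<^sup>+x. ennreal (a x) \<partial>lborel) \<le> ennreal e1"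
    unfolding a_def using gi by (subst nn_integral_eq_integral) (auto intro!: ennreal_leI)
  show ?thesis
  proof (rule that[of "min d 1"])
    fix h :: 'a assume h: "norm h < min d 1"
    define b where "b x = norm (g (x - h) - g x) powr p" for x
    have [measurable]: "b \<in> borel_measurable borel" unfolding b_def by measurable
    have b: "ennreal (b x) \<le> ennreal (\<eta> powr p) * indicator (cball 0 (R+1)) x" for x
    proof (cases "norm x \<le> R + 1")
      case True
      have "norm (g (x - h) - g x) < \<eta>" using d(2)[of "x - h" x] h by (simp add: dist_norm)
      then show ?thesis using True p by (auto simp: b_def intro!: ennreal_leI powr_mono2)
    next
      case False
      have "norm (x - h) \<ge> norm x - norm h" by (rule norm_triangle_ineq2)
      then show ?thesis using False g(2) h by (simp add: b_def)
    qed
    have "(\<integral>\<^sup>+x. ennreal (b x) \<partial>lborel) \<le> (\<integral>\<^sup>+x. ennreal (\<eta> powr p) * indicator (cball (0::'a) (R+1)) x \<partial>lborel)"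
      using b by (intro nn_integral_mono) auto
    also have "\<dots> = ennreal (\<eta> powr p) * emeasure lborel (cball (0::'a) (R+1))"
      by (simp add: nn_integral_cmult_indicator)
    also have "\<dots> = ennreal (\<eta> powr p * m)"
      using emeasure_compact_finite[OF compact_cball, of "0::'a" "R+1"]
      by (simp add: m_def ennreal_mult emeasure_eq_ennreal_measure)
    also have "\<dots> \<le> ennreal (e / (2 * C))"
      unfolding \<eta> using e C m by (intro ennreal_leI) (auto simp: divide_simps)
    finally have b2: "(\<integral>\<^sup>+x. ennreal (b x) \<partial>lborel) \<le> ennreal (e / (2 * C))" .
    have pw: "norm (f (x - h) - f x) powr p \<le> C * (a (x - h) + a x + b x)" for x
    proof -
      have "norm (f (x - h) - f x) powr p
        = norm ((f (x - h) - g (x - h)) - ((f x - g x) - (g (x - h) - g x))) powr p" by simp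
      also have "\<dots> \<le> 2 powr p * (a (x - h) + norm ((f x - g x) - (g (x - h) - g x)) powr p)"
        unfolding a_def by (rule norm_diff_powr_le[OF p])
      also have "\<dots> \<le> 2 powr p * (a (x - h) + 2 powr p * (a x + b x))"
        unfolding a_def b_def by (intro mult_left_mono add_left_mono norm_diff_powr_le p) auto
      also have "\<dots> \<le> 2 powr p * ((2 powr p + 1) * (a (x - h) + a x + b x))"
      proof (rule mult_left_mono)
        have "0 \<le> a (x - h)" "0 \<le> a x" "0 \<le> b x" by (auto simp: a_def b_def)
        then show "a (x - h) + 2 powr p * (a x + b x) \<le> (2 powr p + 1) * (a (x - h) + a x + b x)"
          by (simp add: algebra_simps)
      qed simp
      finally show ?thesis by (simp add: C_def mult.assoc)
    qed
    have pos: "0 \<le> a x" "0 \<le> b x" for x by (auto simp: a_def b_def)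
    have "(\<integral>\<^sup>+x. ennreal (norm (f (x - h) - f x) powr p) \<partial>lborel)
        \<le> (\<integral>\<^sup>+x. ennreal C * (ennreal (a (x - h)) + ennreal (a x) + ennreal (b x)) \<partial>lborel)"
      using pw C pos by (intro nn_integral_mono) (auto simp: ennreal_mult'[symmetric] ennreal_plus[symmetric] simp del: ennreal_plus)
    also have "\<dots> = ennreal C * ((\<integral>\<^sup>+x. ennreal (a (x - h)) \<partial>lborel) + (\<integral>\<^sup>+x. ennreal (a x) \<partial>lborel)
        + (\<integral>\<^sup>+x. ennreal (b x) \<partial>lborel))"
      by (simp add: nn_integral_cmult nn_integral_add)
    also have "(\<integral>\<^sup>+x. ennreal (a (x - h)) \<partial>lborel) = (\<integral>\<^sup>+x. ennreal (a x) \<partial>lborel)"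
      using lborel_nn_integral_shift[of "\<lambda>x. ennreal (a x)" "- h"] by simp
    also have "ennreal C * ((\<integral>\<^sup>+x. ennreal (a x) \<partial>lborel) + (\<integral>\<^sup>+x. ennreal (a x) \<partial>lborel)
        + (\<integral>\<^sup>+x. ennreal (b x) \<partial>lborel)) \<le> ennreal C * (ennreal e1 + ennreal e1 + ennreal (e / (2 * C)))"
      using a b2 by (intro mult_left_mono add_mono) auto
    also have "\<dots> = ennreal e"
      using C e e1 by (simp add: ennreal_mult'[symmetric] ennreal_plus[symmetric] del: ennreal_plus)
        (simp add: e1_def field_simps)
    finally show "(\<integral>\<^sup>+x. ennreal (norm (f (x - h) - f x) powr p) \<partial>lborel) \<le> ennreal e" .
  qed (use d in auto)
qed

lemma compact_support_bounded:
  fixes f :: "'a::euclidean_space \<Rightarrow> 'b::real_normed_vector"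
  assumes "continuous_on UNIV f" "\<And>x. R \<le> norm x \<Longrightarrow> f x = 0"
  obtains B where "\<And>x. norm (f x) \<le> B"
proof -
  have out: "f x = 0" if "x \<notin> cball 0 R" for x using that assms(2)[of x] by auto
  show ?thesis by (rule bounded_compact_support[OF assms(1) compact_cball[of 0 R] out]) (use that in auto)
qed

lemma norm_integral_le:
  fixes f :: "'a \<Rightarrow> 'b::euclidean_space"
  assumes "integrable M f" "integrable M g" "\<And>x. norm (f x) \<le> g x"
  shows "norm (\<integral>x. f x \<partial>M) \<le> (\<integral>x. g x \<partial>M)"
  by (rule order.trans[OF integral_norm_bound integral_mono]) (use assms in auto)

text \<open>Positivity of the normalising integral holds since the integrand is positive on a ball.\<close>

definition mollifier :: "real \<Rightarrow> 'a::euclidean_space \<Rightarrow> real" where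
  "mollifier r x = flat_exp 0 (r\<^sup>2 - x \<bullet> x) / (\<integral>y. flat_exp 0 (r\<^sup>2 - y \<bullet> y) \<partial>(lborel :: 'a measure))"

lemma mollifier:
  assumes r: "r > 0"
  shows mollifier_smooth: "smooth_on (mollifier r :: 'a::euclidean_space \<Rightarrow> real) UNIV"
    and mollifier_nonneg: "mollifier r (x :: 'a) \<ge> 0"
    and mollifier_eq_0: "r \<le> norm (x :: 'a) \<Longrightarrow> mollifier r x = 0"
    and mollifier_integrable: "integrable lborel (mollifier r :: 'a \<Rightarrow> real)"
    and mollifier_integral: "(\<integral>x. mollifier r (x :: 'a) \<partial>lborel) = 1"
    and mollifier_continuous: "continuous_on UNIV (mollifier r :: 'a \<Rightarrow> real)"
proof -
  let ?F = "\<lambda>y::'a. flat_exp 0 (r\<^sup>2 - y \<bullet> y)"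
  define I where "I = (\<integral>y. ?F y \<partial>lborel)"
  have C: "Ck_on k ?F UNIV" for k by (rule Ck_on_flat_exp)
  then have cont: "continuous_on UNIV ?F" using Ck_on.simps(1) by blast
  have nn: "?F y \<ge> 0" for y by (simp add: flat_exp_def)
  have pos: "?F y > 0 \<longleftrightarrow> norm y < r" for y
    using r by (simp add: flat_exp_def norm_lt_square)
  have out: "?F y = 0" if "r \<le> norm y" for y using pos[of y] nn[of y] that by linarith
  have int: "integrable lborel ?F"
    by (rule integrable_compact_support[OF cont, of "cball 0 r"]) (auto intro: out)
  have "I \<noteq> 0"
  proof
    assume "I = 0"
    then have "AE y in lborel. ?F y = 0"
      using integral_nonneg_eq_0_iff_AE[OF int] nn by (auto simp: I_def)
    then have "AE y in lborel. y \<notin> ball (0::'a) r"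
      by (rule eventually_mono) (use pos in force)
    then have "AE y in lebesgue. y \<notin> ball (0::'a) r" by (rule AE_completion)
    then have "negligible (ball (0::'a) r)"
      by (simp add: AE_iff_null_sets negligible_iff_null_sets)
    then show False using open_not_negligible[of "ball (0::'a) r"] r by auto
  qed
  moreover have "I \<ge> 0" unfolding I_def using nn by (intro integral_nonneg_AE) auto
  ultimately have I: "I > 0" by simp
  have def: "mollifier r = (\<lambda>x. (1 / I) * ?F x)"
    by (auto simp: mollifier_def I_def)
  show "smooth_on (mollifier r :: 'a \<Rightarrow> real) UNIV"
    unfolding smooth_on_def def by (intro allI Ck_on_mult Ck_on_const C)
  then show "continuous_on UNIV (mollifier r :: 'a \<Rightarrow> real)" by (rule smooth_onD)
  show "mollifier r (x :: 'a) \<ge> 0" using nn I by (simp add: def)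
  show "r \<le> norm (x :: 'a) \<Longrightarrow> mollifier r x = 0" using out by (simp add: def)
  show "integrable lborel (mollifier r :: 'a \<Rightarrow> real)" unfolding def using int by simp
  show "(\<integral>x. mollifier r (x :: 'a) \<partial>lborel) = 1"
    unfolding def using I by (simp add: I_def[symmetric])
qed

definition conv :: "('a::euclidean_space \<Rightarrow> real) \<Rightarrow> ('a \<Rightarrow> 'b::euclidean_space) \<Rightarrow> 'a \<Rightarrow> 'b" where
  "conv k f x = (\<integral>y. k (x - y) *\<^sub>R f y \<partial>lborel)"

lemma integrable_bounded_continuous_scaleR:
  fixes f :: "'a::euclidean_space \<Rightarrow> 'b::euclidean_space" and k :: "'a \<Rightarrow> real"
  assumes k: "k \<in> borel_measurable borel" "\<And>x. \<bar>k x\<bar> \<le> B" and f: "integrable lborel f"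
  shows "integrable lborel (\<lambda>y. k y *\<^sub>R f y)"
proof (rule Bochner_Integration.integrable_bound)
  show "integrable lborel (\<lambda>y. B * norm (f y))" using f by simp
  show "AE y in lborel. norm (k y *\<^sub>R f y) \<le> norm (B * norm (f y))"
  proof (rule AE_I2)
    fix y
    have "\<bar>k y\<bar> * norm (f y) \<le> \<bar>B\<bar> * norm (f y)"
      using k(2)[of y] by (intro mult_right_mono) auto
    then show "norm (k y *\<^sub>R f y) \<le> norm (B * norm (f y))" by (simp add: abs_mult)
  qed
qed (use k f in auto)

lemma conv_integrable:
  fixes f :: "'a::euclidean_space \<Rightarrow> 'b::euclidean_space"
  assumes k: "continuous_on UNIV k" "\<And>x. R \<le> norm x \<Longrightarrow> k x = 0" and f: "integrable lborel f"
  shows "integrable lborel (\<lambda>y. k (x - y) *\<^sub>R f y)"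
proof -
  obtain B where B: "\<And>x. norm (k x) \<le> B"
    using compact_support_bounded[where f = k and R = R, OF k(1,2)] by metis
  have "continuous_on UNIV (\<lambda>y. k (x - y))"
    by (intro continuous_on_compose2[OF k(1)] continuous_intros) auto
  then have "(\<lambda>y. k (x - y)) \<in> borel_measurable borel" by (rule borel_measurable_continuous_onI)
  then show ?thesis using B f by (intro integrable_bounded_continuous_scaleR[where B = B]) auto
qed

lemma conv_continuous:
  fixes f :: "'a::euclidean_space \<Rightarrow> 'b::euclidean_space"
  assumes k: "continuous_on UNIV k" "\<And>x. R \<le> norm x \<Longrightarrow> k x = 0" and f: "integrable lborel f"
  shows "continuous_on UNIV (conv k f)"
  unfolding continuous_on_iff
proof (intro ballI allI impI)
  fix x :: 'a and e :: real assume e: "e > 0"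
  define N where "N = (\<integral>y. norm (f y) \<partial>lborel)"
  have N: "N \<ge> 0" by (simp add: N_def)
  define e' where "e' = e / (N + 1)"
  have e': "e' > 0" using e N by (simp add: e'_def)
  obtain d where d: "d > 0" "\<And>x y. dist y x < d \<Longrightarrow> dist (k y) (k x) < e'"
    using compact_support_modulus[OF k e'] by blast
  show "\<exists>d>0. \<forall>x'\<in>UNIV. dist x' x < d \<longrightarrow> dist (conv k f x') (conv k f x) < e"
  proof (intro exI[of _ d] conjI ballI impI)
    fix x' assume x': "dist x' x < d"
    note ci = conv_integrable[where k = k and R = R, OF k f]
    have "conv k f x' - conv k f x = (\<integral>y. (k (x' - y) - k (x - y)) *\<^sub>R f y \<partial>lborel)"
      unfolding conv_def using ci by (subst Bochner_Integration.integral_diff[symmetric]) (auto simp: algebra_simps)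
    also have "norm \<dots> \<le> (\<integral>y. e' * norm (f y) \<partial>lborel)"
    proof (rule norm_integral_le)
      show "integrable lborel (\<lambda>y. (k (x' - y) - k (x - y)) *\<^sub>R f y)"
        using Bochner_Integration.integrable_diff[OF ci[of x'] ci[of x]] by (simp add: algebra_simps)
      fix y
      have "\<bar>k (x' - y) - k (x - y)\<bar> \<le> e'" using d(2)[of "x' - y" "x - y"] x' by (simp add: dist_norm)
      then show "norm ((k (x' - y) - k (x - y)) *\<^sub>R f y) \<le> e' * norm (f y)" by (simp add: mult_right_mono)
    qed (use f in auto)
    also have "\<dots> = e' * N" by (simp add: N_def)
    also have "\<dots> < e" using e N by (simp add: e'_def divide_simps)
    finally show "dist (conv k f x') (conv k f x) < e" by (simp add: dist_norm)
  qed (rule d)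
qed

text \<open>Mean value theorem together with the uniform continuity of the gradient; uniformity in \<open>x\<close> allows the estimate to be integrated.\<close>

lemma uniform_linearization:
  fixes k :: "'a::euclidean_space \<Rightarrow> real"
  assumes k: "\<And>x. k differentiable (at x)" "continuous_on UNIV (grad k)" "\<And>x. R \<le> norm x \<Longrightarrow> grad k x = 0"
    and e: "e > 0"
  obtains d where "d > 0" "\<And>x h. norm h < d \<Longrightarrow> \<bar>k (x + h) - k x - grad k x \<bullet> h\<bar> \<le> e * norm h"
proof -
  obtain d where d: "d > 0" "\<And>x y. dist y x < d \<Longrightarrow> dist (grad k y) (grad k x) < e"
    using compact_support_modulus[OF k(2,3) e] by blast
  show ?thesis
  proof (rule that[OF d(1)])
    fix x h :: 'a assume h: "norm h < d"
    have "norm (k (x + h) - k x - (\<lambda>h. grad k x \<bullet> h) ((x + h) - x)) \<le> norm ((x + h) - x) * e"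
    proof (rule differentiable_bound_linearization[where S = "ball x d" and f' = "\<lambda>z h. grad k z \<bullet> h"])
      show "x + t *\<^sub>R (x + h - x) \<in> ball x d" if "t \<in> {0..1}" for t
      proof -
        have "\<bar>t\<bar> * norm h \<le> 1 * norm h" using that by (intro mult_right_mono) auto
        then show ?thesis using h by (simp add: dist_norm)
      qed
      show "(k has_derivative (\<lambda>h. grad k z \<bullet> h)) (at z within ball x d)" for z
        using has_derivative_grad[OF k(1)] has_derivative_at_withinI by blast
      show "onorm ((\<lambda>h. grad k z \<bullet> h) - (\<lambda>h. grad k x \<bullet> h)) \<le> e" if "z \<in> ball x d" for z
      proof (rule onorm_le)
        fix h'
        have "\<bar>(grad k z - grad k x) \<bullet> h'\<bar> \<le> norm (grad k z - grad k x) * norm h'"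
          by (rule Cauchy_Schwarz_ineq2)
        also have "\<dots> \<le> e * norm h'"
          using d(2)[of z x] that by (intro mult_right_mono) (auto simp: dist_norm norm_minus_commute)
        finally show "norm (((\<lambda>h. grad k z \<bullet> h) - (\<lambda>h. grad k x \<bullet> h)) h') \<le> e * norm h'" by (simp add: inner_diff_left)
      qed
    qed (use d in auto)
    then show "\<bar>k (x + h) - k x - grad k x \<bullet> h\<bar> \<le> e * norm h" by (simp add: mult.commute)
  qed
qed

text \<open>The linearization error of the kernel is uniformly \<open>o(h)\<close>, so it can be integrated against \<open>f\<close>.\<close>

lemma conv_has_derivative:
  fixes f :: "'a::euclidean_space \<Rightarrow> real"
  assumes k: "\<And>x. k differentiable (at x)" "continuous_on UNIV (grad k)" "\<And>x. R \<le> norm x \<Longrightarrow> k x = 0"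
    "\<And>x. R \<le> norm x \<Longrightarrow> grad k x = 0"
    and f: "integrable lborel f"
  shows "(conv k f has_derivative (\<lambda>h. (\<integral>y. f y *\<^sub>R grad k (x - y) \<partial>lborel) \<bullet> h)) (at x)"
    and "integrable lborel (\<lambda>y. f y *\<^sub>R grad k (x - y))"
proof -
  have kc: "continuous_on UNIV k"
    using k(1) by (simp add: continuous_at_imp_continuous_on differentiable_imp_continuous_within)
  obtain B where B: "\<And>x. norm (grad k x) \<le> B"
    using compact_support_bounded[where f = "grad k" and R = R, OF k(2,4)] by metis
  have B0: "B \<ge> 0" using B[of 0] norm_ge_zero order_trans by blast
  have "continuous_on UNIV (\<lambda>y. grad k (x - y))"
    by (intro continuous_on_compose2[OF k(2)] continuous_intros) auto
  then have [measurable]: "(\<lambda>y. grad k (x - y)) \<in> borel_measurable borel" by (rule borel_measurable_continuous_onI)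
  show gi: "integrable lborel (\<lambda>y. f y *\<^sub>R grad k (x - y))"
  proof (rule Bochner_Integration.integrable_bound)
    show "integrable lborel (\<lambda>y. B * norm (f y))" using f by simp
    show "AE y in lborel. norm (f y *\<^sub>R grad k (x - y)) \<le> norm (B * norm (f y))"
      using B B0 by (auto simp: abs_mult mult.commute[of B] intro!: AE_I2 mult_left_mono)
  qed (use f in auto)
  define G where "G = (\<integral>y. f y *\<^sub>R grad k (x - y) \<partial>lborel)"
  define N where "N = (\<integral>y. norm (f y) \<partial>lborel)"
  have N: "N \<ge> 0" by (simp add: N_def)
  note ci = conv_integrable[where k = k and R = R, OF kc k(3) f]
  show "(conv k f has_derivative (\<lambda>h. (\<integral>y. f y *\<^sub>R grad k (x - y) \<partial>lborel) \<bullet> h)) (at x)"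
    unfolding has_derivative_at_alt G_def[symmetric]
  proof (intro conjI allI impI)
    show "bounded_linear (\<lambda>h. G \<bullet> h)" by (rule bounded_linear_inner_right)
    fix e :: real assume e: "e > 0"
    define e' where "e' = e / (N + 1)"
    have e': "e' > 0" using e N by (simp add: e'_def)
    obtain d where d: "d > 0" "\<And>x h. norm h < d \<Longrightarrow> \<bar>k (x + h) - k x - grad k x \<bullet> h\<bar> \<le> e' * norm h"
      using uniform_linearization[OF k(1,2,4) e'] by blast
    show "\<exists>d>0. \<forall>y. norm (y - x) < d \<longrightarrow> norm (conv k f y - conv k f x - G \<bullet> (y - x)) \<le> e * norm (y - x)"
    proof (intro exI[of _ d] conjI allI impI)
      fix z assume z: "norm (z - x) < d"
      let ?q = "\<lambda>y. k (z - y) *\<^sub>R f y - k (x - y) *\<^sub>R f y - (f y *\<^sub>R grad k (x - y)) \<bullet> (z - x)"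
      have "conv k f z - conv k f x - G \<bullet> (z - x) = (\<integral>y. ?q y \<partial>lborel)"
        unfolding conv_def G_def using ci gi by (simp del: inner_scaleR_left)
      also have "norm \<dots> \<le> (\<integral>y. e' * norm (z - x) * norm (f y) \<partial>lborel)"
      proof (rule norm_integral_le)
        show "integrable lborel ?q" using ci gi by (simp del: inner_scaleR_left)
        fix y
        have "\<bar>k ((x - y) + (z - x)) - k (x - y) - grad k (x - y) \<bullet> (z - x)\<bar> \<le> e' * norm (z - x)"
          using d(2)[OF z] .
        then have "\<bar>k (z - y) - k (x - y) - grad k (x - y) \<bullet> (z - x)\<bar> * \<bar>f y\<bar> \<le> e' * norm (z - x) * \<bar>f y\<bar>"
          by (intro mult_right_mono) (auto simp: algebra_simps)
        also have "\<bar>k (z - y) - k (x - y) - grad k (x - y) \<bullet> (z - x)\<bar> * \<bar>f y\<bar> = norm (?q y)"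
          by (simp add: abs_mult[symmetric] algebra_simps)
        finally show "norm (?q y) \<le> e' * norm (z - x) * norm (f y)" by simp
      qed (use f in auto)
      also have "\<dots> = e' * N * norm (z - x)" by (simp add: N_def)
      also have "\<dots> \<le> e * norm (z - x)"
        using e N by (intro mult_right_mono) (auto simp: e'_def divide_simps)
      finally show "norm (conv k f z - conv k f x - G \<bullet> (z - x)) \<le> e * norm (z - x)" .
    qed (rule d)
  qed
qed

lemma grad_eq_0_beyond:
  assumes "\<And>x. R \<le> norm x \<Longrightarrow> k x = (0::real)" "R + 1 \<le> norm (x :: 'a::euclidean_space)"
  shows "grad k x = 0"
  using assms by (intro grad_eq_0_outside[of "cball 0 R" k]) auto

text \<open>Each partial derivative of a convolution is the convolution with a partial derivative of the kernel.\<close>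

lemma Ck_on_conv:
  fixes f :: "'a::euclidean_space \<Rightarrow> real"
  assumes "smooth_on k UNIV" "\<And>x. R \<le> norm x \<Longrightarrow> k x = 0" and f: "integrable lborel f"
  shows "Ck_on n (conv k f) UNIV"
  using assms(1,2)
proof (induction n arbitrary: k R)
  case 0
  then show ?case using conv_continuous[OF smooth_onD(3) _ f] by (metis Ck_on.simps(1))
next
  case (Suc n)
  have g0: "grad k x = 0" if "R + 1 \<le> norm x" for x using grad_eq_0_beyond[where k = k and R = R, OF Suc.prems(2) that] by blast
  have k0: "k x = 0" if "R + 1 \<le> norm x" for x using Suc.prems(2)[of x] that by simp
  note d = conv_has_derivative[where k = k and R = "R + 1", OF smooth_onD(1)[OF Suc.prems(1)] smooth_onD(2)[OF Suc.prems(1)] k0 g0 f]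
  have "(\<lambda>x. frechet_derivative (conv k f) (at x) i) = conv (\<lambda>x. grad k x \<bullet> i) f" for i
  proof
    fix x
    have "frechet_derivative (conv k f) (at x) i = (\<integral>y. f y *\<^sub>R grad k (x - y) \<partial>lborel) \<bullet> i"
      using frechet_derivative_at[OF d(1)] by metis
    also have "\<dots> = (\<integral>y. (f y *\<^sub>R grad k (x - y)) \<bullet> i \<partial>lborel)"
      using d(2) by (simp del: inner_scaleR_left)
    also have "\<dots> = conv (\<lambda>x. grad k x \<bullet> i) f x" by (simp add: conv_def mult.commute)
    finally show "frechet_derivative (conv k f) (at x) i = conv (\<lambda>x. grad k x \<bullet> i) f x" .
  qed
  moreover have "Ck_on n (conv (\<lambda>x. grad k x \<bullet> i) f) UNIV" if "i \<in> Basis" for i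
    by (rule Suc.IH[of _ "R + 1"]) (use smooth_onD(4)[OF Suc.prems(1) that] g0 in auto)
  moreover have "conv k f differentiable (at x)" for x using d(1) differentiable_def by blast
  ultimately show ?case by simp
qed

text \<open>A closed convex set is an intersection of half-spaces, and each of these contains the mean by monotonicity of the integral.\<close>

lemma integral_mem_closed_convex:
  fixes f :: "'a \<Rightarrow> 'b::euclidean_space"
  assumes w: "integrable M w" "(\<integral>x. w x \<partial>M) = 1" "\<And>x. w x \<ge> 0"
    and f: "integrable M (\<lambda>x. w x *\<^sub>R f x)" "AE x in M. w x \<noteq> 0 \<longrightarrow> f x \<in> C"
    and C: "closed C" "convex C"
  shows "(\<integral>x. w x *\<^sub>R f x \<partial>M) \<in> C"
proof (rule ccontr)
  define z where "z = (\<integral>x. w x *\<^sub>R f x \<partial>M)"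
  assume "(\<integral>x. w x *\<^sub>R f x \<partial>M) \<notin> C"
  then obtain a b where ab: "a \<bullet> z < b" "\<And>x. x \<in> C \<Longrightarrow> a \<bullet> x > b"
    using separating_hyperplane_closed_point[OF C(2,1)] by (metis z_def)
  have i: "integrable M (\<lambda>x. a \<bullet> (w x *\<^sub>R f x))" using f(1) by (intro integrable_inner_right)
  have "b = (\<integral>x. w x * b \<partial>M)" using w by simp
  also have "\<dots> \<le> (\<integral>x. a \<bullet> (w x *\<^sub>R f x) \<partial>M)"
  proof (rule integral_mono_AE)
    show "AE x in M. w x * b \<le> a \<bullet> (w x *\<^sub>R f x)"
      using f(2)
    proof eventually_elim
      case (elim x)
      show ?case
      proof (cases "w x = 0")
        case False
        then show ?thesis using elim ab(2)[of "f x"] w(3)[of x] by (auto intro!: mult_left_mono)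
      qed simp
    qed
  qed (use w i in \<open>auto simp del: inner_scaleR_right\<close>)
  also have "\<dots> = a \<bullet> z" unfolding z_def using f by (simp del: inner_scaleR_right)
  finally show False using ab by simp
qed

text \<open>By Jensen's inequality \<open>|f * \<rho> - f|^p\<close> is at most the \<open>\<rho>\<close>-average of \<open>|f(x-h) - f(x)|^p\<close> over small \<open>h\<close>;
Tonelli's theorem and the continuity of translations finish the proof.\<close>

lemma conv_mollifier_Lp:
  fixes f :: "'a::euclidean_space \<Rightarrow> 'b::euclidean_space"
  assumes f: "integrable lborel f" and fp: "integrable lborel (\<lambda>x. norm (f x) powr p)" and p: "p \<ge> 1" and e: "e > 0"
  obtains d where "d > 0"
    "\<And>r. 0 < r \<Longrightarrow> r < d \<Longrightarrow> (\<integral>\<^sup>+x. ennreal (norm (conv (mollifier r) f x - f x) powr p) \<partial>lborel) \<le> ennreal e"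
proof -
  have [measurable]: "f \<in> borel_measurable borel" using f by auto
  have p0: "p > 0" using p by simp
  obtain d where d: "d > 0"
    "\<And>h. norm h < d \<Longrightarrow> (\<integral>\<^sup>+x. ennreal (norm (f (x - h) - f x) powr p) \<partial>lborel) \<le> ennreal e"
    using translation_continuous_Lp[of f p e] fp e p0 by auto
  show ?thesis
  proof (rule that[OF d(1)])
    fix r :: real assume r: "0 < r" "r < d"
    let ?k = "mollifier r :: 'a \<Rightarrow> real"
    note m = mollifier[OF r(1), where 'a = 'a]
    have [measurable]: "?k \<in> borel_measurable borel" using m(4) by auto
    have pt: "ennreal (norm (conv ?k f x - f x) powr p)
        \<le> (\<integral>\<^sup>+h. ennreal (?k h * norm (f (x - h) - f x) powr p) \<partial>lborel)" for x
    proof -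
      let ?w = "\<lambda>y. ?k (x - y)"
      have w: "integrable lborel ?w" "(\<integral>y. ?w y \<partial>lborel) = 1"
        using lborel_integrable_reflect[OF m(4), of x] lborel_integral_reflect[of ?k x] m(5) by auto
      have wf: "integrable lborel (\<lambda>y. ?w y *\<^sub>R f y)" by (rule conv_integrable[where k = ?k and R = r, OF m(6) m(3) f])
      have i: "integrable lborel (\<lambda>y. ?w y *\<^sub>R (f y - f x))"
      proof -
        have "integrable lborel (\<lambda>y. ?w y *\<^sub>R f x)" using w by simp
        from Bochner_Integration.integrable_diff[OF wf this] show ?thesis by (simp add: algebra_simps)
      qed
      have i2: "integrable lborel (\<lambda>y. ?w y * norm (f y - f x))"
        using integrable_norm[OF i] m(2) by simp
      have "conv ?k f x - f x = (\<integral>y. ?w y *\<^sub>R f y \<partial>lborel) - (\<integral>y. ?w y *\<^sub>R f x \<partial>lborel)"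
        using w by (simp add: conv_def)
      also have "\<dots> = (\<integral>y. ?w y *\<^sub>R (f y - f x) \<partial>lborel)"
        using wf w by (subst Bochner_Integration.integral_diff[symmetric]) (auto simp: algebra_simps)
      finally have "norm (conv ?k f x - f x) \<le> (\<integral>y. norm (?w y *\<^sub>R (f y - f x)) \<partial>lborel)"
        by (metis integral_norm_bound)
      also have "\<dots> = (\<integral>y. ?w y * norm (f y - f x) \<partial>lborel)" using m(2) by simp
      finally have "ennreal (norm (conv ?k f x - f x) powr p) \<le> ennreal ((\<integral>y. ?w y * norm (f y - f x) \<partial>lborel) powr p)"
        using p by (intro ennreal_leI powr_mono2) auto
      also have "\<dots> \<le> (\<integral>\<^sup>+y. ennreal (?w y * norm (f y - f x) powr p) \<partial>lborel)"
        using w i2 m(2) p by (intro jensen_powr) auto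
      also have "\<dots> = (\<integral>\<^sup>+h. ennreal (?k h * norm (f (x - h) - f x) powr p) \<partial>lborel)"
        using lborel_nn_integral_reflect[of "\<lambda>h. ennreal (?k h * norm (f (x - h) - f x) powr p)" x] by simp
      finally show ?thesis .
    qed
    have "(\<integral>\<^sup>+x. ennreal (norm (conv ?k f x - f x) powr p) \<partial>lborel)
      \<le> (\<integral>\<^sup>+x. (\<integral>\<^sup>+h. ennreal (?k h * norm (f (x - h) - f x) powr p) \<partial>lborel) \<partial>lborel)"
      by (intro nn_integral_mono pt)
    also have "\<dots> = (\<integral>\<^sup>+h. (\<integral>\<^sup>+x. ennreal (?k h * norm (f (x - h) - f x) powr p) \<partial>lborel) \<partial>lborel)"
      by (rule lborel_pair.Fubini'[symmetric]) measurable
    also have "\<dots> \<le> (\<integral>\<^sup>+h. ennreal (?k h) * ennreal e \<partial>lborel)"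
    proof (rule nn_integral_mono)
      fix h :: 'a
      show "(\<integral>\<^sup>+x. ennreal (?k h * norm (f (x - h) - f x) powr p) \<partial>lborel) \<le> ennreal (?k h) * ennreal e"
      proof (cases "norm h < r")
        case True
        have "(\<integral>\<^sup>+x. ennreal (?k h * norm (f (x - h) - f x) powr p) \<partial>lborel)
          = ennreal (?k h) * (\<integral>\<^sup>+x. ennreal (norm (f (x - h) - f x) powr p) \<partial>lborel)"
          using m(2) by (simp add: ennreal_mult nn_integral_cmult)
        also have "\<dots> \<le> ennreal (?k h) * ennreal e" using d(2)[of h] True r by (intro mult_left_mono) auto
        finally show ?thesis .
      next
        case False then show ?thesis using m(3)[of h] by simp
      qed
    qed
    also have "\<dots> = (\<integral>\<^sup>+h. ennreal (?k h) \<partial>lborel) * ennreal e" by (simp add: nn_integral_multc)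
    also have "(\<integral>\<^sup>+h. ennreal (?k h) \<partial>lborel) = 1"
      using m(2,4,5) by (simp add: nn_integral_eq_integral)
    finally show "(\<integral>\<^sup>+x. ennreal (norm (conv ?k f x - f x) powr p) \<partial>lborel) \<le> ennreal e" by simp
  qed
qed

section \<open>Local integrability and mollified weak gradients\<close>

text \<open>Used to leave room for mollification inside an open set.\<close>

lemma compact_neighbourhood:
  fixes \<Omega> :: "'a::euclidean_space set"
  assumes "open \<Omega>" "compact K" "K \<subseteq> \<Omega>"
  obtains d K1 where "d > 0" "compact K1" "K1 \<subseteq> \<Omega>" "\<And>x. x \<in> K \<Longrightarrow> cball x d \<subseteq> K1"
proof -
  obtain d where d: "d > 0" "(\<Union>x\<in>K. cball x d) \<subseteq> \<Omega>"
    using compact_subset_open_imp_cball_epsilon_subset[OF assms(2,1,3)] by blast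
  have "(\<Union>x\<in>K. cball x d) = {x + y | x y. x \<in> K \<and> y \<in> cball 0 d}"
  proof (intro set_eqI iffI)
    fix z assume "z \<in> (\<Union>x\<in>K. cball x d)"
    then obtain x where "x \<in> K" "dist x z \<le> d" by auto
    then show "z \<in> {x + y | x y. x \<in> K \<and> y \<in> cball 0 d}"
      by (intro CollectI exI[of _ x] exI[of _ "z - x"]) (auto simp: dist_norm norm_minus_commute)
  next
    fix z assume "z \<in> {x + y | x y. x \<in> K \<and> y \<in> cball 0 d}"
    then obtain x y where "x \<in> K" "norm y \<le> d" "z = x + y" by auto
    then show "z \<in> (\<Union>x\<in>K. cball x d)" by (intro UN_I[of x]) (auto simp: dist_norm)
  qed
  moreover have "compact {x + y | x y. x \<in> K \<and> y \<in> cball (0::'a) d}"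
    using assms by (intro compact_sums) auto
  ultimately have c: "compact (\<Union>x\<in>K. cball x d)" by simp
  show ?thesis by (rule that[OF d(1) c d(2)]) blast
qed

lemma Cc_infI:
  assumes "smooth_on \<phi> UNIV" "compact K" "K \<subseteq> \<Omega>" "\<And>x. x \<notin> K \<Longrightarrow> \<phi> x = 0"
  shows "\<phi> \<in> Cc_inf \<Omega>"
proof -
  have s: "closure {x. \<phi> x \<noteq> 0} \<subseteq> K"
    using assms by (intro closure_minimal compact_imp_closed) auto
  then have "compact (K \<inter> closure {x. \<phi> x \<noteq> 0})"
    using assms(2) by (intro compact_Int_closed) auto
  then have "compact (closure {x. \<phi> x \<noteq> 0})" using s by (simp add: Int_absorb1)
  then show ?thesis using assms s unfolding Cc_inf_def compactly_contained_def by auto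
qed

lemma Cc_infE:
  assumes "\<phi> \<in> Cc_inf \<Omega>"
  obtains K where "compact K" "K \<subseteq> \<Omega>" "\<And>x. x \<notin> K \<Longrightarrow> \<phi> x = 0" "\<And>x. x \<notin> K \<Longrightarrow> grad \<phi> x = 0" "smooth_on \<phi> UNIV"
proof -
  define K where "K = closure {x. \<phi> x \<noteq> 0}"
  have K: "compact K" "K \<subseteq> \<Omega>" "smooth_on \<phi> UNIV"
    using assms by (auto simp: Cc_inf_def compactly_contained_def K_def)
  have out: "\<phi> x = 0" if "x \<notin> K" for x
    using that closure_subset[of "{x. \<phi> x \<noteq> 0}"] by (auto simp: K_def)
  have "grad \<phi> x = 0" if "x \<notin> K" for x
    using grad_eq_0_outside[of K \<phi> x] K out that by (auto intro: compact_imp_closed)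
  then show ?thesis using that K out by blast
qed

lemma compact_sets_lebesgue [simp]: "compact K \<Longrightarrow> K \<in> sets lebesgue"
  by (simp add: borel_compact)

lemma open_sets_lebesgue: "open S \<Longrightarrow> S \<in> sets lebesgue"
  by simp

lemma integrable_lebesgue_on:
  fixes f :: "'a::euclidean_space \<Rightarrow> 'b::euclidean_space"
  assumes "S \<in> sets lebesgue"
  shows "integrable (lebesgue_on S) f \<longleftrightarrow> integrable lebesgue (\<lambda>x. indicator S x *\<^sub>R f x)"
  using assms by (intro integrable_restrict_space) simp

lemma measurable_lebesgue_on:
  fixes f :: "'a::euclidean_space \<Rightarrow> 'b::euclidean_space"
  assumes "S \<in> sets lebesgue"
  shows "f \<in> borel_measurable (lebesgue_on S) \<longleftrightarrow> (\<lambda>x. indicator S x *\<^sub>R f x) \<in> borel_measurable lebesgue"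
  using assms by (intro borel_measurable_restrict_space_iff) simp

lemma integral_lebesgue_on:
  fixes f :: "'a::euclidean_space \<Rightarrow> 'b::euclidean_space"
  assumes "S \<in> sets lebesgue" "\<And>x. x \<notin> S \<Longrightarrow> f x = 0"
  shows "(\<integral>x. f x \<partial>lebesgue_on S) = (\<integral>x. f x \<partial>lebesgue)"
proof -
  have "(\<lambda>x. indicator S x *\<^sub>R f x) = f" using assms by (auto simp: indicator_def)
  then show ?thesis using assms by (subst integral_restrict_space) auto
qed

lemma AE_lebesgue_on:
  assumes "S \<in> sets lebesgue"
  shows "(AE x in lebesgue_on S. P x) \<longleftrightarrow> (AE x in lebesgue. x \<in> S \<longrightarrow> P x)"
  using assms by (intro AE_restrict_space_iff) simp

lemma Lp_1_iff:
  fixes f :: "'a::euclidean_space \<Rightarrow> 'b::euclidean_space"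
  shows "f \<in> Lp S 1 \<longleftrightarrow> integrable (lebesgue_on S) f"
  by (auto simp: Lp_def integrable_norm_iff)

lemma Lp_loc_1_iff:
  fixes f :: "'a::euclidean_space \<Rightarrow> 'b::euclidean_space"
  shows "f \<in> Lp_loc \<Omega> 1 \<longleftrightarrow> (\<forall>K. compact K \<longrightarrow> K \<subseteq> \<Omega> \<longrightarrow> integrable lebesgue (\<lambda>x. indicator K x *\<^sub>R f x))"
  unfolding Lp_loc_def Lp_1_iff by (auto simp: integrable_lebesgue_on)

lemma open_exhaustion:
  fixes \<Omega> :: "'a::euclidean_space set"
  assumes "open \<Omega>"
  obtains C :: "nat \<Rightarrow> 'a set" where "\<And>n. compact (C n)" "\<And>n. C n \<subseteq> \<Omega>" "\<And>n. C n \<subseteq> interior (C (Suc n))"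
    "(\<Union>n. C n) = \<Omega>" "\<And>x. x \<in> \<Omega> \<Longrightarrow> \<forall>\<^sub>F n in sequentially. x \<in> C n"
proof -
  obtain C :: "nat \<Rightarrow> 'a set" where C: "\<And>n. compact (C n)" "\<And>n. C n \<subseteq> \<Omega>" "\<And>n. C n \<subseteq> interior (C (Suc n))"
    "(\<Union>n. C n) = \<Omega>"
    using open_Union_compact_subsets[OF assms] by metis
  have "C n \<subseteq> C (Suc n)" for n using C(3) interior_subset by blast
  then have mono: "C m \<subseteq> C n" if "m \<le> n" for m n using that by (metis lift_Suc_mono_le)
  have ev: "\<forall>\<^sub>F n in sequentially. x \<in> C n" if "x \<in> \<Omega>" for x
  proof -
    have "x \<in> (\<Union>n. C n)" using that C(4) by simp
    then obtain m where "x \<in> C m" by (rule UN_E)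
    then show ?thesis unfolding eventually_sequentially using mono by (intro exI[of _ m]) (meson subsetD)
  qed
  show ?thesis using that[of C] C ev by presburger
qed

lemma AE_open_from_compact:
  fixes \<Omega> :: "'a::euclidean_space set"
  assumes "open \<Omega>" "\<And>K. compact K \<Longrightarrow> K \<subseteq> \<Omega> \<Longrightarrow> AE x in lebesgue. x \<in> K \<longrightarrow> P x"
  shows "AE x in lebesgue. x \<in> \<Omega> \<longrightarrow> P x"
proof -
  obtain C :: "nat \<Rightarrow> 'a set" where C: "\<And>n. compact (C n)" "\<And>n. C n \<subseteq> \<Omega>" "(\<Union>n. C n) = \<Omega>"
    using open_exhaustion[OF assms(1)] by metis
  have "AE x in lebesgue. \<forall>n. x \<in> C n \<longrightarrow> P x"
    unfolding AE_all_countable using assms(2) C by blast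
  then show ?thesis by eventually_elim (use C(3) in blast)
qed

text \<open>Local integrability contains measurability on every compact subset; exhaust the open set by compact ones.\<close>

lemma measurable_Lp_loc:
  fixes f :: "'a::euclidean_space \<Rightarrow> 'b::euclidean_space"
  assumes "open \<Omega>" "f \<in> Lp_loc \<Omega> q"
  shows "f \<in> borel_measurable (lebesgue_on \<Omega>)"
proof -
  obtain C :: "nat \<Rightarrow> 'a set" where C: "\<And>n. compact (C n)" "\<And>n. C n \<subseteq> \<Omega>"
    "\<And>x. x \<in> \<Omega> \<Longrightarrow> \<forall>\<^sub>F n in sequentially. x \<in> C n"
    using open_exhaustion[OF assms(1)] by metis
  have "(\<lambda>x. indicator \<Omega> x *\<^sub>R f x) \<in> borel_measurable lebesgue"
  proof (rule borel_measurable_LIMSEQ_metric)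
    fix n
    have "f \<in> Lp (C n) q" using assms C unfolding Lp_loc_def by blast
    then show "(\<lambda>x. indicator (C n) x *\<^sub>R f x) \<in> borel_measurable lebesgue"
      using C(1)[of n] by (simp add: Lp_def measurable_lebesgue_on)
  next
    fix x
    show "(\<lambda>n. indicator (C n) x *\<^sub>R f x) \<longlonglongrightarrow> indicator \<Omega> x *\<^sub>R f x"
    proof (cases "x \<in> \<Omega>")
      case True
      show ?thesis
        by (rule tendsto_eventually, rule eventually_mono[OF C(3)[OF True]]) (use True in auto)
    next
      case False
      then have "x \<notin> C n" for n using C(2) by blast
      then show ?thesis using False by simp
    qed
  qed
  then show ?thesis using assms(1) by (simp add: measurable_lebesgue_on)
qed

lemma borel_representative:
  fixes f :: "'a::euclidean_space \<Rightarrow> 'b::euclidean_space"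
  assumes "f \<in> borel_measurable lebesgue"
  obtains f' where "f' \<in> borel_measurable borel" "AE x in lebesgue. f' x = f x"
proof -
  have "\<exists>g. g \<in> borel_measurable lborel \<and> (AE x in lborel. f x \<bullet> i = g x)" for i
    using completion_ex_borel_measurable_real[of "\<lambda>x. f x \<bullet> i" lborel] assms by auto
  then obtain g where g: "\<And>i. g i \<in> borel_measurable lborel" "\<And>i. AE x in lborel. f x \<bullet> i = g i x"
    by metis
  define f' where "f' x = (\<Sum>i\<in>Basis. g i x *\<^sub>R i)" for x
  have "f' \<in> borel_measurable borel" unfolding f'_def using g(1) by auto
  moreover have "AE x in lborel. \<forall>i\<in>Basis. f x \<bullet> i = g i x"
    using g(2) by (simp add: AE_ball_countable countable_finite)
  then have "AE x in lborel. f' x = f x"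
  proof (rule eventually_mono)
    fix x assume "\<forall>i\<in>Basis. f x \<bullet> i = g i x"
    then have "f' x = (\<Sum>i\<in>Basis. (f x \<bullet> i) *\<^sub>R i)" by (simp add: f'_def)
    then show "f' x = f x" by (simp add: euclidean_representation)
  qed
  ultimately show ?thesis using that AE_completion by blast
qed

lemma integrable_cong_AE_lebesgue:
  fixes f g :: "'a::euclidean_space \<Rightarrow> 'b::euclidean_space"
  assumes "g \<in> borel_measurable borel" "AE x in lebesgue. g x = f x"
  shows "integrable lebesgue f \<Longrightarrow> integrable lborel g"
    "f \<in> borel_measurable lebesgue \<Longrightarrow> (\<integral>x. f x \<partial>lebesgue) = (\<integral>x. g x \<partial>lborel)"
proof -
  have gl: "g \<in> borel_measurable lebesgue" using assms(1) by (simp add: measurable_completion)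
  show "integrable lborel g" if "integrable lebesgue f"
  proof -
    have "integrable lebesgue g"
      using assms(2) that gl by (subst integrable_cong_AE[of _ _ f]) auto
    then show ?thesis using assms(1) by (simp add: integrable_completion)
  qed
  show "(\<integral>x. f x \<partial>lebesgue) = (\<integral>x. g x \<partial>lborel)" if "f \<in> borel_measurable lebesgue"
  proof -
    have "(\<integral>x. f x \<partial>lebesgue) = (\<integral>x. g x \<partial>lebesgue)"
      using assms(2) that gl by (intro integral_cong_AE) (auto elim: eventually_mono)
    then show ?thesis using assms(1) by (simp add: integral_completion)
  qed
qed

text \<open>Convolutions are taken with respect to the Borel measure, whereas Sobolev functions are only Lebesgue
measurable and only locally integrable. So \<open>u\<close> is replaced near the region of interest by a Borel
function that equals \<open>u\<close> on \<open>K\<close> and zero outside, up to a null set.\<close>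

definition borel_restriction ::
    "'a::euclidean_space set \<Rightarrow> ('a \<Rightarrow> 'b::euclidean_space) \<Rightarrow> ('a \<Rightarrow> 'b) \<Rightarrow> bool" where
  "borel_restriction K u U \<longleftrightarrow> U \<in> borel_measurable borel \<and> integrable lborel U \<and>
     (AE x in lebesgue. U x = indicator K x *\<^sub>R u x)"

lemma borel_restriction_exists:
  fixes u :: "'a::euclidean_space \<Rightarrow> 'b::euclidean_space"
  assumes "u \<in> Lp_loc \<Omega> 1" "compact K" "K \<subseteq> \<Omega>"
  obtains U where "borel_restriction K u U"
proof -
  have i: "integrable lebesgue (\<lambda>x. indicator K x *\<^sub>R u x)" using assms by (simp add: Lp_loc_1_iff)
  obtain U where U: "U \<in> borel_measurable borel" "AE x in lebesgue. U x = indicator K x *\<^sub>R u x"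
    using borel_representative[OF borel_measurable_integrable[OF i]] .
  show ?thesis
    using that[of U] U integrable_cong_AE_lebesgue(1)[OF U i] unfolding borel_restriction_def by blast
qed

lemma borel_restriction_powr:
  fixes u :: "'a::euclidean_space \<Rightarrow> 'b::euclidean_space"
  assumes "u \<in> Lp_loc \<Omega> p" "compact K" "K \<subseteq> \<Omega>" "borel_restriction K u U" "p > 0"
  shows "integrable lborel (\<lambda>x. norm (U x) powr p)"
proof -
  have "integrable (lebesgue_on K) (\<lambda>x. norm (u x) powr p)" using assms by (simp add: Lp_loc_def Lp_def)
  then have i: "integrable lebesgue (\<lambda>x. indicator K x *\<^sub>R (norm (u x) powr p))"
    using assms by (simp add: integrable_lebesgue_on)
  have "AE x in lebesgue. U x = indicator K x *\<^sub>R u x"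
    using assms(4) by (simp add: borel_restriction_def)
  then have "AE x in lebesgue. norm (U x) powr p = indicator K x *\<^sub>R (norm (u x) powr p)"
    by (rule eventually_mono) (auto simp: indicator_def)
  then show ?thesis
    using assms(4) by (intro integrable_cong_AE_lebesgue(1)[OF _ _ i]) (auto simp: borel_restriction_def)
qed

lemma Ck_on_reflect: "Ck_on k f UNIV \<Longrightarrow> Ck_on k (\<lambda>y. f (x - y)) UNIV"
proof (induction k arbitrary: f)
  case 0
  then show ?case by (auto intro!: continuous_on_compose2[of UNIV f] continuous_intros)
next
  case (Suc k)
  have d: "((\<lambda>y. f (x - y)) has_derivative (\<lambda>i. - frechet_derivative f (at (x - y)) i)) (at y)" for y
  proof -
    have f: "(f has_derivative frechet_derivative f (at (x - y))) (at (x - y))"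
      using Suc.prems frechet_derivative_works by (metis Ck_on.simps(2) UNIV_I)
    have "((\<lambda>y. x - y) has_derivative (\<lambda>i. - i)) (at y)" by (auto intro!: derivative_eq_intros)
    from has_derivative_compose[OF this f] show ?thesis
      using linear_neg[OF has_derivative_linear[OF f]] by simp
  qed
  have "frechet_derivative (\<lambda>y. f (x - y)) (at y) i = (-1) * frechet_derivative f (at (x - y)) i" for y i
    using frechet_derivative_at[OF d] by (metis mult_minus1)
  moreover have "(\<lambda>y. f (x - y)) differentiable (at y)" for y using d differentiable_def by blast
  moreover have "Ck_on k (\<lambda>y. (-1) * frechet_derivative f (at (x - y)) i) UNIV" if "i \<in> Basis" for i
    using Suc.prems that by (intro Ck_on_mult Ck_on_const Suc.IH) auto
  ultimately show ?case by simp
qed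

lemma smooth_on_reflect: "smooth_on f UNIV \<Longrightarrow> smooth_on (\<lambda>y. f (x - y)) UNIV"
  using Ck_on_reflect by (auto simp: smooth_on_def)

lemma grad_reflect:
  assumes "f differentiable (at (x - y))"
  shows "grad (\<lambda>y. f (x - y)) y = - grad f (x - y)"
proof (rule gradI)
  have "((\<lambda>y. x - y) has_derivative (\<lambda>i. - i)) (at y)" by (auto intro!: derivative_eq_intros)
  from has_derivative_compose[OF this has_derivative_grad[OF assms]]
  show "((\<lambda>y. f (x - y)) has_derivative (\<lambda>i. (- grad f (x - y)) \<bullet> i)) (at y)" by simp
qed

lemma integrable_compact_bound:
  fixes f :: "'a::euclidean_space \<Rightarrow> 'b::euclidean_space" and h :: "'a \<Rightarrow> 'c::euclidean_space"
  assumes "integrable lebesgue (\<lambda>x. indicator K x *\<^sub>R f x)" "h \<in> borel_measurable lebesgue"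
    "\<And>x. x \<in> K \<Longrightarrow> norm (h x) \<le> B * norm (f x)" "\<And>x. x \<notin> K \<Longrightarrow> h x = 0"
  shows "integrable lebesgue h"
proof (rule Bochner_Integration.integrable_bound)
  show "integrable lebesgue (\<lambda>x. B *\<^sub>R (indicator K x *\<^sub>R f x))" using assms(1) by (intro integrable_scaleR_right)
  show "AE x in lebesgue. norm (h x) \<le> norm (B *\<^sub>R indicator K x *\<^sub>R f x)"
  proof (rule AE_I2)
    fix x
    show "norm (h x) \<le> norm (B *\<^sub>R indicator K x *\<^sub>R f x)"
    proof (cases "x \<in> K")
      case True
      have "B * norm (f x) \<le> \<bar>B\<bar> * norm (f x)" by (intro mult_right_mono) auto
      then show ?thesis using assms(3)[OF True] True by simp
    qed (simp add: assms(4))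
  qed
qed (rule assms(2))

lemma continuous_measurable_lebesgue:
  fixes f :: "'a::euclidean_space \<Rightarrow> 'b::euclidean_space"
  assumes "continuous_on UNIV f"
  shows "f \<in> borel_measurable lebesgue"
  using borel_measurable_continuous_onI[OF assms] by (simp add: measurable_completion)

lemma integrable_test_times:
  fixes u :: "'a::euclidean_space \<Rightarrow> 'b::euclidean_space" and \<psi> :: "'a \<Rightarrow> real"
  assumes "u \<in> Lp_loc \<Omega> 1" "compact K" "K \<subseteq> \<Omega>" "continuous_on UNIV \<psi>" "\<And>x. x \<notin> K \<Longrightarrow> \<psi> x = 0"
  shows "integrable lebesgue (\<lambda>x. \<psi> x *\<^sub>R u x)"
proof -
  obtain B where B: "\<And>x. norm (\<psi> x) \<le> B" using bounded_compact_support[OF assms(4,2,5)] by metis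
  have i: "integrable lebesgue (\<lambda>x. indicator K x *\<^sub>R u x)" using assms by (simp add: Lp_loc_1_iff)
  have "(\<lambda>x. \<psi> x *\<^sub>R (indicator K x *\<^sub>R u x)) \<in> borel_measurable lebesgue"
    by (rule borel_measurable_scaleR[OF continuous_measurable_lebesgue[OF assms(4)] borel_measurable_integrable[OF i]])
  also have "(\<lambda>x. \<psi> x *\<^sub>R (indicator K x *\<^sub>R u x)) = (\<lambda>x. \<psi> x *\<^sub>R u x)"
    by (rule ext, rename_tac x, case_tac "x \<in> K") (simp_all add: assms(5))
  finally show ?thesis
    by (rule integrable_compact_bound[OF i, where B = B]) (use B assms(5) in \<open>auto intro!: mult_right_mono\<close>)
qed

lemma integrable_times_test:
  fixes u :: "'a::euclidean_space \<Rightarrow> real" and \<psi> :: "'a \<Rightarrow> 'b::euclidean_space"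
  assumes "u \<in> Lp_loc \<Omega> 1" "compact K" "K \<subseteq> \<Omega>" "continuous_on UNIV \<psi>" "\<And>x. x \<notin> K \<Longrightarrow> \<psi> x = 0"
  shows "integrable lebesgue (\<lambda>x. u x *\<^sub>R \<psi> x)"
proof -
  obtain B where B: "\<And>x. norm (\<psi> x) \<le> B" using bounded_compact_support[OF assms(4,2,5)] by metis
  have i: "integrable lebesgue (\<lambda>x. indicator K x *\<^sub>R u x)" using assms by (simp add: Lp_loc_1_iff)
  have "(\<lambda>x. (indicator K x *\<^sub>R u x) *\<^sub>R \<psi> x) \<in> borel_measurable lebesgue"
    using borel_measurable_integrable[OF i] continuous_measurable_lebesgue[OF assms(4)] by simp
  also have "(\<lambda>x. (indicator K x *\<^sub>R u x) *\<^sub>R \<psi> x) = (\<lambda>x. u x *\<^sub>R \<psi> x)"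
    using assms(5) by (intro ext) (auto simp: indicator_def)
  finally show ?thesis
    by (rule integrable_compact_bound[OF i, where B = B])
      (use B assms(5) in \<open>auto simp: mult.commute[of B] intro!: mult_left_mono\<close>)
qed

text \<open>Test functions vanish outside the domain, so the integrals may be taken over the whole space.\<close>

lemma has_weak_grad_iff:
  assumes "open \<Omega>"
  shows "has_weak_grad \<Omega> u g \<longleftrightarrow> u \<in> Lp_loc \<Omega> 1 \<and> g \<in> Lp_loc \<Omega> 1 \<and>
     (\<forall>\<phi>\<in>Cc_inf \<Omega>. (\<integral>x. u x *\<^sub>R grad \<phi> x \<partial>lebesgue) = - (\<integral>x. \<phi> x *\<^sub>R g x \<partial>lebesgue))"
proof -
  have "(\<integral>x. u x *\<^sub>R grad \<phi> x \<partial>lebesgue_on \<Omega>) = (\<integral>x. u x *\<^sub>R grad \<phi> x \<partial>lebesgue)"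
    "(\<integral>x. \<phi> x *\<^sub>R g x \<partial>lebesgue_on \<Omega>) = (\<integral>x. \<phi> x *\<^sub>R g x \<partial>lebesgue)" if \<phi>: "\<phi> \<in> Cc_inf \<Omega>" for \<phi>
  proof -
    obtain K where K: "K \<subseteq> \<Omega>" "\<And>x. x \<notin> K \<Longrightarrow> \<phi> x = 0" "\<And>x. x \<notin> K \<Longrightarrow> grad \<phi> x = 0"
      using Cc_infE[OF \<phi>] by metis
    show "(\<integral>x. u x *\<^sub>R grad \<phi> x \<partial>lebesgue_on \<Omega>) = (\<integral>x. u x *\<^sub>R grad \<phi> x \<partial>lebesgue)"
      using assms K by (intro integral_lebesgue_on open_sets_lebesgue) (auto simp: subset_iff)
    show "(\<integral>x. \<phi> x *\<^sub>R g x \<partial>lebesgue_on \<Omega>) = (\<integral>x. \<phi> x *\<^sub>R g x \<partial>lebesgue)"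
      using assms K by (intro integral_lebesgue_on open_sets_lebesgue) (auto simp: subset_iff)
  qed
  then show ?thesis unfolding has_weak_grad_def by simp
qed

text \<open>The reflected kernel \<open>y \<mapsto> \<rho>(x - y)\<close> is an admissible test function as soon as the ball of radius \<open>r\<close>
about \<open>x\<close> lies in the domain, and the definition of the weak gradient moves the derivative from it to \<open>u\<close>.\<close>

lemma mollified_has_derivative:
  fixes \<Omega> :: "'a::euclidean_space set"
  assumes \<Omega>: "open \<Omega>" and wg: "has_weak_grad \<Omega> u g" and K: "compact K" "K \<subseteq> \<Omega>"
    and r: "r > 0" "cball x r \<subseteq> K" and U: "borel_restriction K u U" and G: "borel_restriction K g G"
  shows "(conv (mollifier r) U has_derivative (\<lambda>h. conv (mollifier r) G x \<bullet> h)) (at x)"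
proof -
  let ?k = "mollifier r :: 'a \<Rightarrow> real"
  note m = mollifier[OF r(1), where 'a = 'a]
  note s = smooth_onD[OF m(1)]
  define \<psi> where "\<psi> y = ?k (x - y)" for y
  have out: "\<psi> y = 0" if "y \<notin> cball x r" for y using that m(3)[of "x - y"] by (auto simp: \<psi>_def dist_norm)
  have sm: "smooth_on \<psi> UNIV" unfolding \<psi>_def by (rule smooth_on_reflect[OF m(1)])
  have \<psi>: "\<psi> \<in> Cc_inf \<Omega>"
    by (rule Cc_infI[OF sm, of "cball x r"]) (use out r K in auto)
  have g\<psi>: "grad \<psi> y = - grad ?k (x - y)" for y
    unfolding \<psi>_def by (rule grad_reflect) (rule s(1))
  have gout: "grad \<psi> y = 0" if "y \<notin> cball x r" for y
    using grad_eq_0_outside[of "cball x r" \<psi> y] out that by auto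
  have kout: "mollifier r z = 0" if "r + 1 \<le> norm z" for z :: 'a using m(3)[of z] that by simp
  have gkout: "grad ?k z = 0" if "r + 1 \<le> norm z" for z :: 'a
    using grad_eq_0_beyond[where k = ?k and R = r, OF m(3) that] by blast
  have iU: "integrable lborel U" and bU: "U \<in> borel_measurable borel" and aU: "AE x in lebesgue. U x = indicator K x *\<^sub>R u x"
    and bG: "G \<in> borel_measurable borel" and aG: "AE x in lebesgue. G x = indicator K x *\<^sub>R g x"
    using U G by (auto simp: borel_restriction_def)
  note d = conv_has_derivative[where k = ?k and R = "r + 1", OF s(1,2) kout gkout iU]
  have u1: "u \<in> Lp_loc \<Omega> 1" "g \<in> Lp_loc \<Omega> 1" using wg by (auto simp: has_weak_grad_def)
  have eq: "(\<integral>y. u y *\<^sub>R grad \<psi> y \<partial>lebesgue) = - (\<integral>y. \<psi> y *\<^sub>R g y \<partial>lebesgue)"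
    using wg \<psi> by (simp add: has_weak_grad_iff[OF \<Omega>])
  have [measurable]: "grad \<psi> \<in> borel_measurable borel" "\<psi> \<in> borel_measurable borel"
    using smooth_onD[OF sm] by (auto intro: borel_measurable_continuous_onI)
  note [measurable] = bU bG
  have "(\<integral>y. u y *\<^sub>R grad \<psi> y \<partial>lebesgue) = (\<integral>y. U y *\<^sub>R grad \<psi> y \<partial>lborel)"
  proof (rule integrable_cong_AE_lebesgue(2))
    show "AE y in lebesgue. U y *\<^sub>R grad \<psi> y = u y *\<^sub>R grad \<psi> y"
      using aU by eventually_elim (use gout r in \<open>fastforce simp: indicator_def\<close>)
    show "(\<lambda>y. u y *\<^sub>R grad \<psi> y) \<in> borel_measurable lebesgue"
      by (rule borel_measurable_integrable, rule integrable_times_test[OF u1(1), of "cball x r"])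
        (use gout r K smooth_onD[OF sm] in auto)
  qed simp
  moreover have "(\<integral>y. \<psi> y *\<^sub>R g y \<partial>lebesgue) = (\<integral>y. \<psi> y *\<^sub>R G y \<partial>lborel)"
  proof (rule integrable_cong_AE_lebesgue(2))
    show "AE y in lebesgue. \<psi> y *\<^sub>R G y = \<psi> y *\<^sub>R g y"
      using aG by eventually_elim (use out r in \<open>fastforce simp: indicator_def\<close>)
    show "(\<lambda>y. \<psi> y *\<^sub>R g y) \<in> borel_measurable lebesgue"
      by (rule borel_measurable_integrable, rule integrable_test_times[OF u1(2), of "cball x r"])
        (use out r K smooth_onD[OF sm] in auto)
  qed simp
  ultimately have "(\<integral>y. U y *\<^sub>R grad ?k (x - y) \<partial>lborel) = conv ?k G x"
    using eq by (simp add: g\<psi> conv_def \<psi>_def)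
  then show ?thesis using d(1)[of x] by (simp only:)
qed

text \<open>The difference quotients have integral zero by translation invariance and are bounded with bounded support.\<close>

lemma integral_grad_eq_0:
  fixes f :: "'a::euclidean_space \<Rightarrow> real"
  assumes d: "\<And>x. f differentiable (at x)" and B: "\<And>x. norm (grad f x) \<le> B"
    and K: "compact K" "\<And>x. x \<notin> K \<Longrightarrow> f x = 0"
  shows "integrable lborel (grad f)" "(\<integral>x. grad f x \<partial>lborel) = 0"
proof -
  have cont: "continuous_on UNIV f"
    using d by (simp add: continuous_at_imp_continuous_on differentiable_imp_continuous_within)
  have fi: "integrable lborel f" by (rule integrable_compact_support[OF cont K])
  have lip: "\<bar>f y - f x\<bar> \<le> B * norm (y - x)" for x y
  proof -
    have "norm (f y - f x) \<le> B * norm (y - x)"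
    proof (rule differentiable_bound[where S = UNIV and f' = "\<lambda>x h. grad f x \<bullet> h"])
      show "(f has_derivative (\<lambda>h. grad f x \<bullet> h)) (at x within UNIV)" for x using has_derivative_grad[OF d] by simp
      show "onorm (\<lambda>h. grad f x \<bullet> h) \<le> B" for x
      proof (rule onorm_le)
        fix h
        have "\<bar>grad f x \<bullet> h\<bar> \<le> norm (grad f x) * norm h" by (rule Cauchy_Schwarz_ineq2)
        also have "\<dots> \<le> B * norm h" using B by (intro mult_right_mono) auto
        finally show "norm (grad f x \<bullet> h) \<le> B * norm h" by simp
      qed
    qed auto
    then show ?thesis by simp
  qed
  obtain R where R: "R > 0" "K \<subseteq> cball 0 R"
    using compact_imp_bounded[OF K(1)] unfolding bounded_pos by (auto simp: subset_iff)
  have out: "f x = 0" if "norm x > R" for x proof -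
    have "x \<notin> K" using R(2) that by auto
    then show ?thesis by (rule K(2))
  qed
  define q where "q i n x = real (Suc n) * (f (x + inverse (real (Suc n)) *\<^sub>R i) - f x)" for i :: 'a and n x
  have [measurable]: "f \<in> borel_measurable borel" using cont by (rule borel_measurable_continuous_onI)
  have qi: "integrable lborel (q i n)" for i n
    unfolding q_def using lborel_integrable_shift[OF fi] fi by (intro integrable_mult_right Bochner_Integration.integrable_diff) auto
  have q0: "(\<integral>x. q i n x \<partial>lborel) = 0" for i n
    unfolding q_def using lborel_integrable_shift[OF fi] fi by (simp add: lborel_integral_shift)
  have lim: "(\<lambda>n. q i n x) \<longlonglongrightarrow> grad f x \<bullet> i" for i x
  proof -
    have "((\<lambda>t. f (x + t *\<^sub>R i)) has_derivative (\<lambda>t. grad f x \<bullet> (t *\<^sub>R i))) (at 0)"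
    proof -
      have "((\<lambda>t. x + t *\<^sub>R i) has_derivative (\<lambda>t. t *\<^sub>R i)) (at 0)" by (auto intro!: derivative_eq_intros)
      moreover have "(f has_derivative (\<lambda>h. grad f x \<bullet> h)) (at (x + 0 *\<^sub>R i))" using has_derivative_grad[OF d] by simp
      ultimately show ?thesis by (rule has_derivative_compose)
    qed
    then have "((\<lambda>t. f (x + t *\<^sub>R i)) has_real_derivative (grad f x \<bullet> i)) (at 0)"
      by (simp add: has_field_derivative_def mult.commute[of _ "grad f x \<bullet> i"] fun_eq_iff[symmetric])
    then have "((\<lambda>t. (f (x + t *\<^sub>R i) - f x) / t) \<longlongrightarrow> grad f x \<bullet> i) (at 0)"
      by (simp add: DERIV_def)
    moreover have "filterlim (\<lambda>n. inverse (real (Suc n))) (at 0) sequentially"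
      using LIMSEQ_inverse_real_of_nat by (auto simp: filterlim_at intro!: always_eventually)
    ultimately have "(\<lambda>n. (f (x + inverse (real (Suc n)) *\<^sub>R i) - f x) / inverse (real (Suc n))) \<longlonglongrightarrow> grad f x \<bullet> i"
      by (rule filterlim_compose)
    then show ?thesis by (simp add: q_def field_simps)
  qed
  define w where "w i x = (B * norm i) * indicator (cball (0::'a) (R + norm i)) x" for i x :: 'a
  have wi: "integrable lborel (w i)" for i
    unfolding w_def by (intro integrable_mult_right integrable_real_indicator)
      (use emeasure_compact_finite[OF compact_cball, of "0::'a"] in auto)
  have qb: "norm (q i n x) \<le> w i x" for i n x
  proof (cases "x \<in> cball 0 (R + norm i)")
    case True
    have "norm (q i n x) = real (Suc n) * \<bar>f (x + inverse (real (Suc n)) *\<^sub>R i) - f x\<bar>" by (simp add: q_def abs_mult)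
    also have "\<dots> \<le> real (Suc n) * (B * norm (inverse (real (Suc n)) *\<^sub>R i))"
      using lip[of "x + inverse (real (Suc n)) *\<^sub>R i" x] by (intro mult_left_mono) auto
    also have "\<dots> = B * norm i" by (simp add: field_simps)
    finally show ?thesis using True by (simp add: w_def)
  next
    case False
    have "norm (inverse (real (Suc n)) *\<^sub>R i) \<le> norm i"
      by (simp add: divide_simps distrib_left)
    moreover have "norm x \<le> norm (x + inverse (real (Suc n)) *\<^sub>R i) + norm (inverse (real (Suc n)) *\<^sub>R i)"
      using norm_triangle_ineq4[of "x + inverse (real (Suc n)) *\<^sub>R i" "inverse (real (Suc n)) *\<^sub>R i"] by simp
    ultimately have "norm (x + inverse (real (Suc n)) *\<^sub>R i) > R" using False by auto
    moreover have "norm x > R" using False norm_ge_zero[of i] by (simp del: norm_ge_zero)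
    ultimately have "q i n x = 0" using out by (simp add: q_def)
    then show ?thesis using False by (simp add: w_def)
  qed
  have meas: "(\<lambda>x. grad f x \<bullet> i) \<in> borel_measurable borel" for i
    using lim by (rule borel_measurable_LIMSEQ_metric[rotated]) (use qi in auto)
  have dom: "(\<lambda>x. grad f x \<bullet> i) \<in> borel_measurable lborel" "q i n \<in> borel_measurable lborel"
    "AE x in lborel. (\<lambda>n. q i n x) \<longlonglongrightarrow> grad f x \<bullet> i" "AE x in lborel. norm (q i n x) \<le> w i x" for i n
    using lim qb qi meas by auto
  have ci: "integrable lborel (\<lambda>x. grad f x \<bullet> i)" for i
    by (rule integrable_dominated_convergence[where s = "q i" and w = "w i"]) (rule dom wi)+
  have conv: "(\<lambda>n. \<integral>x. q i n x \<partial>lborel) \<longlonglongrightarrow> (\<integral>x. grad f x \<bullet> i \<partial>lborel)" for i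
    by (rule integral_dominated_convergence[where w = "w i"]) (rule dom wi)+
  have "integrable lborel (\<lambda>x. \<Sum>i\<in>Basis. (grad f x \<bullet> i) *\<^sub>R i)"
    using ci by (intro Bochner_Integration.integrable_sum integrable_scaleR_left)
  then show gi: "integrable lborel (grad f)" by (simp add: euclidean_representation)
  have "(\<integral>x. grad f x \<bullet> i \<partial>lborel) = 0" for i
    using conv[of i] by (simp add: q0 LIMSEQ_const_iff)
  then have "(\<integral>x. grad f x \<partial>lborel) \<bullet> i = 0" for i
    using integral_inner_left[of i lborel "grad f"] gi by simp
  then show "(\<integral>x. grad f x \<partial>lborel) = 0" by (metis inner_eq_zero_iff)
qed

section \<open>Uniqueness of weak gradients and the chain rule\<close>

lemma AE_lborel_lebesgue: "(AE x in lebesgue. P x) \<longleftrightarrow> (AE x in lborel. P x)"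
  by (rule AE_completion_iff)

text \<open>Two weak gradients of one function have the same mollifications, and these converge to either of them.\<close>

lemma weak_grad_unique:
  fixes \<Omega> :: "'a::euclidean_space set"
  assumes \<Omega>: "open \<Omega>" and g1: "has_weak_grad \<Omega> u g1" and g2: "has_weak_grad \<Omega> u g2"
  shows "AE x in lebesgue. x \<in> \<Omega> \<longrightarrow> g1 x = g2 x"
proof (rule AE_open_from_compact[OF \<Omega>])
  fix K assume K: "compact K" "K \<subseteq> \<Omega>"
  obtain d K1 where d: "d > 0" "compact K1" "K1 \<subseteq> \<Omega>" "\<And>x. x \<in> K \<Longrightarrow> cball x d \<subseteq> K1"
    using compact_neighbourhood[OF \<Omega> K] by metis
  have l: "u \<in> Lp_loc \<Omega> 1" "g1 \<in> Lp_loc \<Omega> 1" "g2 \<in> Lp_loc \<Omega> 1"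
    using g1 g2 by (auto simp: has_weak_grad_def)
  obtain U G1 G2 where r: "borel_restriction K1 u U" "borel_restriction K1 g1 G1" "borel_restriction K1 g2 G2"
    using borel_restriction_exists[OF l(1) d(2,3)] borel_restriction_exists[OF l(2) d(2,3)]
      borel_restriction_exists[OF l(3) d(2,3)] by metis
  have [measurable]: "G1 \<in> borel_measurable borel" "G2 \<in> borel_measurable borel"
    and i: "integrable lborel G1" "integrable lborel G2" using r by (auto simp: borel_restriction_def)
  have [measurable]: "K \<in> sets borel" using K by (simp add: borel_compact)
  define I where "I = (\<integral>\<^sup>+x. indicator K x * ennreal (norm (G1 x - G2 x)) \<partial>lborel)"
  have small: "I \<le> 0 + ennreal e" if e: "e > 0" for e
  proof -
    have ip: "integrable lborel (\<lambda>x. norm (G1 x) powr 1)" "integrable lborel (\<lambda>x. norm (G2 x) powr 1)"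
      using i by auto
    have e2: "e / 2 > 0" using e by simp
    obtain d1 where d1: "d1 > 0" "\<And>r. 0 < r \<Longrightarrow> r < d1 \<Longrightarrow>
        (\<integral>\<^sup>+x. ennreal (norm (conv (mollifier r) G1 x - G1 x) powr 1) \<partial>lborel) \<le> ennreal (e / 2)"
      by (rule conv_mollifier_Lp[OF i(1) ip(1) order_refl e2]) blast
    obtain d2 where d2: "d2 > 0" "\<And>r. 0 < r \<Longrightarrow> r < d2 \<Longrightarrow>
        (\<integral>\<^sup>+x. ennreal (norm (conv (mollifier r) G2 x - G2 x) powr 1) \<partial>lborel) \<le> ennreal (e / 2)"
      by (rule conv_mollifier_Lp[OF i(2) ip(2) order_refl e2]) blast
    define r' where "r' = min d (min d1 d2) / 2"
    have r': "0 < r'" "r' < d1" "r' < d2" "r' < d" using d d1 d2 by (auto simp: r'_def)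
    let ?k = "mollifier r' :: 'a \<Rightarrow> real"
    note mo = mollifier[OF r'(1), where 'a = 'a]
    have [measurable]: "conv ?k G1 \<in> borel_measurable borel" "conv ?k G2 \<in> borel_measurable borel"
      using conv_continuous[where k = ?k and R = r', OF mo(6,3)] i
      by (auto intro!: borel_measurable_continuous_onI)
    have eq: "conv ?k G1 x = conv ?k G2 x" if "x \<in> K" for x
    proof -
      have c: "cball x r' \<subseteq> K1" using d(4)[OF that] r' by auto
      show ?thesis
        using gradI[OF mollified_has_derivative[OF \<Omega> g1 d(2,3) r'(1) c r(1,2)]]
          gradI[OF mollified_has_derivative[OF \<Omega> g2 d(2,3) r'(1) c r(1,3)]] by simp
    qed
    have "I \<le> (\<integral>\<^sup>+x. ennreal (norm (conv ?k G1 x - G1 x) powr 1) + ennreal (norm (conv ?k G2 x - G2 x) powr 1) \<partial>lborel)"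
      unfolding I_def
    proof (rule nn_integral_mono)
      fix x
      show "indicator K x * ennreal (norm (G1 x - G2 x))
        \<le> ennreal (norm (conv ?k G1 x - G1 x) powr 1) + ennreal (norm (conv ?k G2 x - G2 x) powr 1)"
      proof (cases "x \<in> K")
        case True
        have "norm (G1 x - G2 x) \<le> norm (conv ?k G1 x - G1 x) + norm (conv ?k G2 x - G2 x)"
          using norm_triangle_ineq4[of "conv ?k G2 x - G2 x" "conv ?k G1 x - G1 x"] eq[OF True] by simp
        then show ?thesis using True by (simp add: ennreal_plus[symmetric] del: ennreal_plus)
      qed simp
    qed
    also have "\<dots> = (\<integral>\<^sup>+x. ennreal (norm (conv ?k G1 x - G1 x) powr 1) \<partial>lborel)
       + (\<integral>\<^sup>+x. ennreal (norm (conv ?k G2 x - G2 x) powr 1) \<partial>lborel)"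
      by (rule nn_integral_add) auto
    also have "\<dots> \<le> ennreal (e / 2) + ennreal (e / 2)"
      by (intro add_mono d1(2) d2(2) r'(1,2,3))
    also have "\<dots> = ennreal e" using e by (simp add: ennreal_plus[symmetric] del: ennreal_plus)
    finally show ?thesis by simp
  qed
  have "I \<le> 0" by (rule ennreal_le_epsilon) (rule small)
  then have "I = 0" by simp
  then have "AE x in lborel. indicator K x * ennreal (norm (G1 x - G2 x)) = 0"
    unfolding I_def by (subst (asm) nn_integral_0_iff_AE) auto
  then have "AE x in lebesgue. indicator K x * ennreal (norm (G1 x - G2 x)) = 0" by (rule AE_completion)
  moreover have "AE x in lebesgue. G1 x = indicator K1 x *\<^sub>R g1 x" "AE x in lebesgue. G2 x = indicator K1 x *\<^sub>R g2 x"
    using r by (auto simp: borel_restriction_def)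
  ultimately show "AE x in lebesgue. x \<in> K \<longrightarrow> g1 x = g2 x"
  proof eventually_elim
    case (elim x)
    show ?case
    proof
      assume "x \<in> K"
      then have "x \<in> K1" using d(4)[of x] d(1) by auto
      then show "g1 x = g2 x" using elim \<open>x \<in> K\<close> by simp
    qed
  qed
qed

text \<open>The form in which the convergence of mollifications is used: almost everywhere, with an integrable bound
for the \<open>p\<close>-th power of the distance.\<close>

definition converges_along ::
    "real \<Rightarrow> ('a::euclidean_space \<Rightarrow> 'b::euclidean_space) \<Rightarrow> (nat \<Rightarrow> real) \<Rightarrow> bool" where
  "converges_along p f r \<longleftrightarrow> (\<exists>S. integrable lborel S \<and> (\<forall>x. 0 \<le> S x) \<and>
       (AE x in lebesgue. \<forall>n. norm (conv (mollifier (r n)) f x - f x) powr p \<le> S x) \<and>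
       (AE x in lebesgue. (\<lambda>n. conv (mollifier (r n)) f x) \<longlonglongrightarrow> f x))"

text \<open>Choose the radii so small that the \<open>n\<close>-th distance is at most \<open>2^(-n)\<close>. Giving only upper bounds for the radii
allows several functions to be mollified along the same radii.\<close>

lemma converges_along_small_radii:
  fixes f :: "'a::euclidean_space \<Rightarrow> 'b::euclidean_space"
  assumes f: "integrable lborel f" and fp: "integrable lborel (\<lambda>x. norm (f x) powr p)" and p: "p \<ge> 1"
  shows "\<exists>T :: nat \<Rightarrow> real. (\<forall>n. T n > 0) \<and> (\<forall>r. (\<forall>n. 0 < r n \<and> r n < T n) \<longrightarrow> converges_along p f r)"
proof -
  have "\<exists>d>0. \<forall>r. 0 < r \<longrightarrow> r < d \<longrightarrow>
    (\<integral>\<^sup>+x. ennreal (norm (conv (mollifier r) f x - f x) powr p) \<partial>lborel) \<le> ennreal ((1/2)^n)" for n :: nat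
  proof -
    have pos: "(1/2)^n > (0::real)" by simp
    show ?thesis by (rule conv_mollifier_Lp[OF f fp p pos]) blast
  qed
  then obtain T where T: "\<And>n. T n > 0" "\<And>n r. 0 < r \<Longrightarrow> r < T n \<Longrightarrow>
    (\<integral>\<^sup>+x. ennreal (norm (conv (mollifier r) f x - f x) powr p) \<partial>lborel) \<le> ennreal ((1/2)^n)"
    by metis
  have "converges_along p f r" if r: "\<forall>n. 0 < r n \<and> r n < T n" for r :: "nat \<Rightarrow> real"
  proof -
    have r0: "0 < r n" for n using r by blast
    have cont: "continuous_on UNIV (conv (mollifier (r n)) f)" for n
      using mollifier[OF r0[of n], where 'a = 'a] f
      by (intro conv_continuous[where R = "r n"]) auto
    have [measurable]: "f \<in> borel_measurable borel" using f by auto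
    have m: "(\<lambda>x. conv (mollifier (r n)) f x - f x) \<in> borel_measurable lborel" for n
      using borel_measurable_continuous_onI[OF cont[of n]] by auto
    have "(\<Sum>n. \<integral>\<^sup>+x. ennreal (norm (conv (mollifier (r n)) f x - f x) powr p) \<partial>lborel) \<le> (\<Sum>n. ennreal ((1/2)^n))"
      using T(2) r by (intro suminf_le) auto
    also have "\<dots> = ennreal (\<Sum>n. (1/2)^n)" by (intro suminf_ennreal2) (auto intro: summable_geometric)
    also have "\<dots> < \<infinity>" by simp
    finally have fin: "(\<Sum>n. \<integral>\<^sup>+x. ennreal (norm (conv (mollifier (r n)) f x - f x) powr p) \<partial>lborel) < \<infinity>" .
    have p0: "p > 0" using p by simp
    obtain S where S: "integrable lborel S" "\<And>x. S x \<ge> 0"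
      "AE x in lborel. \<forall>n. norm (conv (mollifier (r n)) f x - f x) powr p \<le> S x"
      "AE x in lborel. (\<lambda>n. conv (mollifier (r n)) f x - f x) \<longlonglongrightarrow> 0"
      by (rule summable_powr_imp_dominated[OF m fin p0]) blast
    have "AE x in lborel. (\<lambda>n. conv (mollifier (r n)) f x) \<longlonglongrightarrow> f x"
      using S(4) by eventually_elim (simp add: LIM_zero_iff)
    then show ?thesis
      using S unfolding converges_along_def AE_lborel_lebesgue by blast
  qed
  then show ?thesis using T(1) by blast
qed

lemma measurable_indicator_compact:
  fixes f :: "'a::euclidean_space \<Rightarrow> 'b::euclidean_space"
  assumes "open \<Omega>" "f \<in> borel_measurable (lebesgue_on \<Omega>)" "compact K" "K \<subseteq> \<Omega>"
  shows "(\<lambda>x. indicator K x *\<^sub>R f x) \<in> borel_measurable lebesgue"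
proof -
  have "(\<lambda>x. indicator \<Omega> x *\<^sub>R f x) \<in> borel_measurable lebesgue"
    using assms by (simp add: measurable_lebesgue_on)
  then have "(\<lambda>x. indicator K x *\<^sub>R (indicator \<Omega> x *\<^sub>R f x)) \<in> borel_measurable lebesgue"
    by (rule borel_measurable_scaleR[rotated]) (use assms in \<open>simp add: borel_measurable_indicator\<close>)
  also have "(\<lambda>x. indicator K x *\<^sub>R (indicator \<Omega> x *\<^sub>R f x)) = (\<lambda>x. indicator K x *\<^sub>R f x)"
    using assms(4) by (intro ext) (auto simp: indicator_def)
  finally show ?thesis .
qed

lemma measurable_outside_compact:
  fixes f :: "'a::euclidean_space \<Rightarrow> 'b::euclidean_space"
  assumes "open \<Omega>" "f \<in> borel_measurable (lebesgue_on \<Omega>)" "K \<subseteq> \<Omega>" "\<And>x. x \<notin> K \<Longrightarrow> f x = 0"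
  shows "f \<in> borel_measurable lebesgue"
proof -
  have "(\<lambda>x. indicator \<Omega> x *\<^sub>R f x) \<in> borel_measurable lebesgue"
    using assms by (simp add: measurable_lebesgue_on)
  also have "(\<lambda>x. indicator \<Omega> x *\<^sub>R f x) = f"
    using assms(3,4) by (intro ext) (auto simp: indicator_def)
  finally show ?thesis .
qed

lemma Lp_loc_1_bound:
  fixes f :: "'a::euclidean_space \<Rightarrow> 'b::euclidean_space" and H :: "'a \<Rightarrow> real"
  assumes "open \<Omega>" "f \<in> borel_measurable (lebesgue_on \<Omega>)" "H \<in> Lp_loc \<Omega> 1"
    "AE x in lebesgue. x \<in> \<Omega> \<longrightarrow> norm (f x) \<le> H x"
  shows "f \<in> Lp_loc \<Omega> 1"
  unfolding Lp_loc_1_iff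
proof (intro allI impI)
  fix K assume K: "compact K" "K \<subseteq> \<Omega>"
  show "integrable lebesgue (\<lambda>x. indicator K x *\<^sub>R f x)"
  proof (rule Bochner_Integration.integrable_bound)
    show "integrable lebesgue (\<lambda>x. indicator K x *\<^sub>R H x)" using assms(3) K unfolding Lp_loc_1_iff by blast
    show "AE x in lebesgue. norm (indicator K x *\<^sub>R f x) \<le> norm (indicator K x *\<^sub>R H x)"
      using assms(4) by eventually_elim (use K(2) in \<open>auto simp: indicator_def\<close>)
  qed (rule measurable_indicator_compact[OF assms(1,2) K])
qed

text \<open>Mollify \<open>m\<close> and \<open>w\<close> and apply the classical chain rule. Mollification takes averages, so the mollified pair
stays in any closed convex set \<open>C\<close> that contains the values of \<open>(m, w)\<close> near the support of the test
function. Hence \<open>F\<close> need be differentiable only near \<open>C\<close>, and it suffices that its partial derivatives are bounded on \<open>C\<close>,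
where \<open>C\<close> may depend on the compact set; this is what admits quotients of functions that are locally
bounded away from zero.\<close>

lemma has_weak_grad_chain_rule:
  fixes \<Omega> :: "'a::euclidean_space set" and F Fs Ft :: "real \<Rightarrow> real \<Rightarrow> real"
  assumes \<Omega>: "open \<Omega>" and m: "has_weak_grad \<Omega> m g" and w: "has_weak_grad \<Omega> w h"
    and der: "\<And>s t. (s, t) \<in> S \<Longrightarrow>
      ((\<lambda>z. F (fst z) (snd z)) has_derivative (\<lambda>z. Fs s t * fst z + Ft s t * snd z)) (at (s, t))"
    and cont: "continuous_on S (\<lambda>z. Fs (fst z) (snd z))" "continuous_on S (\<lambda>z. Ft (fst z) (snd z))"
    and loc: "\<And>K. compact K \<Longrightarrow> K \<subseteq> \<Omega> \<Longrightarrow> \<exists>C L. closed C \<and> convex C \<and> C \<noteq> {} \<and> C \<subseteq> S \<and>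
       (\<forall>s t. (s, t) \<in> C \<longrightarrow> \<bar>Fs s t\<bar> \<le> L \<and> \<bar>Ft s t\<bar> \<le> L) \<and>
       (AE x in lebesgue. x \<in> K \<longrightarrow> (m x, w x) \<in> C)"
    and meas: "(\<lambda>x. F (m x) (w x)) \<in> borel_measurable (lebesgue_on \<Omega>)"
      "(\<lambda>x. Fs (m x) (w x)) \<in> borel_measurable (lebesgue_on \<Omega>)"
      "(\<lambda>x. Ft (m x) (w x)) \<in> borel_measurable (lebesgue_on \<Omega>)"
  shows "has_weak_grad \<Omega> (\<lambda>x. F (m x) (w x)) (\<lambda>x. Fs (m x) (w x) *\<^sub>R g x + Ft (m x) (w x) *\<^sub>R h x)"
proof -
  have l: "m \<in> Lp_loc \<Omega> 1" "g \<in> Lp_loc \<Omega> 1" "w \<in> Lp_loc \<Omega> 1" "h \<in> Lp_loc \<Omega> 1"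
    using m w by (auto simp: has_weak_grad_def)
  note ml = l[THEN measurable_Lp_loc[OF \<Omega>]]
  let ?q = "\<lambda>x. Fs (m x) (w x) *\<^sub>R g x + Ft (m x) (w x) *\<^sub>R h x"
  have mq: "?q \<in> borel_measurable (lebesgue_on \<Omega>)"
    using meas ml by (intro borel_measurable_add borel_measurable_scaleR)
  have lip: "\<bar>F s t - F s' t'\<bar> \<le> 2 * L * (\<bar>s - s'\<bar> + \<bar>t - t'\<bar>)"
    if C: "convex C" "C \<subseteq> S" "\<And>s t. (s, t) \<in> C \<Longrightarrow> \<bar>Fs s t\<bar> \<le> L \<and> \<bar>Ft s t\<bar> \<le> L"
      and pts: "(s, t) \<in> C" "(s', t') \<in> C" for C L s t s' t'
  proof -
    have L: "L \<ge> 0" using C(3)[OF pts(1)] by auto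
    have "norm (F (fst (s,t)) (snd (s,t)) - F (fst (s',t')) (snd (s',t'))) \<le> (2 * L) * norm ((s, t) - (s', t'))"
    proof (rule differentiable_bound[OF C(1) _ _ pts])
      fix z assume z: "z \<in> C"
      show "((\<lambda>z. F (fst z) (snd z)) has_derivative (\<lambda>y. Fs (fst z) (snd z) * fst y + Ft (fst z) (snd z) * snd y)) (at z within C)"
        using der[of "fst z" "snd z"] C(2) z by (auto intro: has_derivative_at_withinI)
      show "onorm (\<lambda>y. Fs (fst z) (snd z) * fst y + Ft (fst z) (snd z) * snd y) \<le> 2 * L"
      proof (rule onorm_le)
        fix y :: "real \<times> real"
        have "\<bar>fst y\<bar> \<le> norm y" "\<bar>snd y\<bar> \<le> norm y"
          using norm_fst_le[of "fst y" "snd y"] norm_snd_le[of "snd y" "fst y"] by auto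
        then have "\<bar>Fs (fst z) (snd z)\<bar> * \<bar>fst y\<bar> \<le> L * norm y" "\<bar>Ft (fst z) (snd z)\<bar> * \<bar>snd y\<bar> \<le> L * norm y"
          using C(3)[of "fst z" "snd z"] z L by (auto intro!: mult_mono)
        then show "norm (Fs (fst z) (snd z) * fst y + Ft (fst z) (snd z) * snd y) \<le> 2 * L * norm y"
          using abs_triangle_ineq[of "Fs (fst z) (snd z) * fst y" "Ft (fst z) (snd z) * snd y"]
          by (simp add: abs_mult)
      qed
    qed
    also have "\<dots> \<le> (2 * L) * (\<bar>s - s'\<bar> + \<bar>t - t'\<bar>)"
    proof (rule mult_left_mono)
      show "norm ((s, t) - (s', t')) \<le> \<bar>s - s'\<bar> + \<bar>t - t'\<bar>"
        by (simp add: norm_Pair sqrt_sum_squares_le_sum_abs)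
    qed (use L in simp)
    finally show ?thesis by simp
  qed
  have li: "integrable lebesgue (\<lambda>x. indicator K x *\<^sub>R F (m x) (w x)) \<and> integrable lebesgue (\<lambda>x. indicator K x *\<^sub>R ?q x)"
    if K: "compact K" "K \<subseteq> \<Omega>" for K
  proof -
    obtain C L where CL: "closed C \<and> convex C \<and> C \<noteq> {} \<and> C \<subseteq> S \<and>
       (\<forall>s t. (s, t) \<in> C \<longrightarrow> \<bar>Fs s t\<bar> \<le> L \<and> \<bar>Ft s t\<bar> \<le> L) \<and>
       (AE x in lebesgue. x \<in> K \<longrightarrow> (m x, w x) \<in> C)"
      using loc[OF K] by (elim exE) (rule that)
    have C: "convex C" "C \<noteq> {}" "C \<subseteq> S"
       "\<And>s t. (s, t) \<in> C \<Longrightarrow> \<bar>Fs s t\<bar> \<le> L \<and> \<bar>Ft s t\<bar> \<le> L"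
      and ae: "AE x in lebesgue. x \<in> K \<longrightarrow> (m x, w x) \<in> C" using CL by blast+
    obtain a b where ab: "(a, b) \<in> C" using C(2) by auto
    have L: "L \<ge> 0" using C(4)[OF ab] by auto
    have iK: "integrable lebesgue (\<lambda>x. indicator K x *\<^sub>R m x)" "integrable lebesgue (\<lambda>x. indicator K x *\<^sub>R w x)"
      "integrable lebesgue (\<lambda>x. indicator K x *\<^sub>R g x)" "integrable lebesgue (\<lambda>x. indicator K x *\<^sub>R h x)"
      using l K by (auto simp: Lp_loc_1_iff)
    have iKc: "integrable lebesgue (indicator K :: 'a \<Rightarrow> real)"
      using K emeasure_compact_finite[OF K(1)] by (intro integrable_real_indicator) (auto simp: borel_compact emeasure_completion)
    have 1: "integrable lebesgue (\<lambda>x. indicator K x *\<^sub>R F (m x) (w x))"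
    proof (rule Bochner_Integration.integrable_bound)
      show "integrable lebesgue (\<lambda>x. indicator K x * (\<bar>F a b\<bar> + 2 * L * (\<bar>a\<bar> + \<bar>b\<bar>))
        + 2 * L * norm (indicator K x *\<^sub>R m x) + 2 * L * norm (indicator K x *\<^sub>R w x))"
        using iK(1,2) iKc by (intro Bochner_Integration.integrable_add integrable_mult_right integrable_norm integrable_mult_left)
      show "AE x in lebesgue. norm (indicator K x *\<^sub>R F (m x) (w x)) \<le> norm (indicator K x * (\<bar>F a b\<bar> + 2 * L * (\<bar>a\<bar> + \<bar>b\<bar>))
        + 2 * L * norm (indicator K x *\<^sub>R m x) + 2 * L * norm (indicator K x *\<^sub>R w x))"
        using ae
      proof eventually_elim
        case (elim x)
        show ?case
        proof (cases "x \<in> K")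
          case True
          then have mC: "(m x, w x) \<in> C" using elim by blast
          have "\<bar>F (m x) (w x) - F a b\<bar> \<le> 2 * L * (\<bar>m x - a\<bar> + \<bar>w x - b\<bar>)"
            using lip[where C = C and L = L, OF C(1,3,4) mC ab] by simp
          also have "\<dots> \<le> 2 * L * ((\<bar>m x\<bar> + \<bar>a\<bar>) + (\<bar>w x\<bar> + \<bar>b\<bar>))"
            using L by (intro mult_left_mono add_mono) auto
          finally have "\<bar>F (m x) (w x)\<bar> \<le> (\<bar>F a b\<bar> + 2 * L * (\<bar>a\<bar> + \<bar>b\<bar>)) + 2 * L * \<bar>m x\<bar> + 2 * L * \<bar>w x\<bar>"
            using abs_triangle_ineq2[of "F (m x) (w x)" "F a b"] by (simp add: algebra_simps)
          also note abs_ge_self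
          finally show ?thesis using True by simp
        qed simp
      qed
    qed (rule measurable_indicator_compact[OF \<Omega> meas(1) K])
    have 2: "integrable lebesgue (\<lambda>x. indicator K x *\<^sub>R ?q x)"
    proof (rule Bochner_Integration.integrable_bound)
      show "integrable lebesgue (\<lambda>x. L * norm (indicator K x *\<^sub>R g x) + L * norm (indicator K x *\<^sub>R h x))"
        using iK by (intro Bochner_Integration.integrable_add integrable_mult_right integrable_norm)
      show "AE x in lebesgue. norm (indicator K x *\<^sub>R ?q x) \<le> norm (L * norm (indicator K x *\<^sub>R g x) + L * norm (indicator K x *\<^sub>R h x))"
        using ae
      proof eventually_elim
        case (elim x)
        show ?case
        proof (cases "x \<in> K")
          case True
          have "norm (?q x) \<le> \<bar>Fs (m x) (w x)\<bar> * norm (g x) + \<bar>Ft (m x) (w x)\<bar> * norm (h x)"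
            using norm_triangle_ineq[of "Fs (m x) (w x) *\<^sub>R g x" "Ft (m x) (w x) *\<^sub>R h x"] by simp
          also have "\<dots> \<le> L * norm (g x) + L * norm (h x)"
            using C(4) elim True by (intro add_mono mult_right_mono) auto
          finally show ?thesis using True by simp
        qed simp
      qed
    qed (rule measurable_indicator_compact[OF \<Omega> mq K])
    show ?thesis using 1 2 by blast
  qed
  have F_loc: "(\<lambda>x. F (m x) (w x)) \<in> Lp_loc \<Omega> 1" "?q \<in> Lp_loc \<Omega> 1"
    using li by (auto simp: Lp_loc_1_iff)
  have main: "(\<integral>x. F (m x) (w x) *\<^sub>R grad \<phi> x \<partial>lebesgue) = - (\<integral>x. \<phi> x *\<^sub>R ?q x \<partial>lebesgue)"
    if \<phi>: "\<phi> \<in> Cc_inf \<Omega>" for \<phi>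
  proof -
    obtain K where K: "compact K" "K \<subseteq> \<Omega>" and \<phi>0: "\<And>x. x \<notin> K \<Longrightarrow> \<phi> x = 0" "\<And>x. x \<notin> K \<Longrightarrow> grad \<phi> x = 0"
      and sm: "smooth_on \<phi> UNIV" using Cc_infE[OF \<phi>] by metis
    note s\<phi> = smooth_onD[OF sm]
    obtain d K1 where d: "d > 0" "compact K1" "K1 \<subseteq> \<Omega>" "\<And>x. x \<in> K \<Longrightarrow> cball x d \<subseteq> K1"
      using compact_neighbourhood[OF \<Omega> K] by metis
    obtain C L where CL: "closed C \<and> convex C \<and> C \<noteq> {} \<and> C \<subseteq> S \<and>
       (\<forall>s t. (s, t) \<in> C \<longrightarrow> \<bar>Fs s t\<bar> \<le> L \<and> \<bar>Ft s t\<bar> \<le> L) \<and>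
       (AE x in lebesgue. x \<in> K1 \<longrightarrow> (m x, w x) \<in> C)"
      using loc[OF d(2,3)] by (elim exE) (rule that)
    have C: "closed C" "convex C" "C \<noteq> {}" "C \<subseteq> S"
       "\<And>s t. (s, t) \<in> C \<Longrightarrow> \<bar>Fs s t\<bar> \<le> L \<and> \<bar>Ft s t\<bar> \<le> L"
       and ae: "AE x in lebesgue. x \<in> K1 \<longrightarrow> (m x, w x) \<in> C" using CL by blast+
    obtain a b where ab: "(a, b) \<in> C" using C(3) by auto
    have L: "L \<ge> 0" using C(5)[OF ab] by auto
    obtain M where M: "borel_restriction K1 m M" using borel_restriction_exists[OF l(1) d(2,3)] by blast
    obtain G where G: "borel_restriction K1 g G" using borel_restriction_exists[OF l(2) d(2,3)] by blast
    obtain W where W: "borel_restriction K1 w W" using borel_restriction_exists[OF l(3) d(2,3)] by blast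
    obtain H where H: "borel_restriction K1 h H" using borel_restriction_exists[OF l(4) d(2,3)] by blast
    have im: "integrable lborel M" "integrable lborel G" "integrable lborel W" "integrable lborel H"
      and am: "AE x in lebesgue. M x = indicator K1 x *\<^sub>R m x" "AE x in lebesgue. G x = indicator K1 x *\<^sub>R g x"
       "AE x in lebesgue. W x = indicator K1 x *\<^sub>R w x" "AE x in lebesgue. H x = indicator K1 x *\<^sub>R h x"
      using M G W H by (auto simp: borel_restriction_def)
    have ip: "integrable lborel (\<lambda>x. norm (M x) powr 1)" "integrable lborel (\<lambda>x. norm (G x) powr 1)"
      "integrable lborel (\<lambda>x. norm (W x) powr 1)" "integrable lborel (\<lambda>x. norm (H x) powr 1)"
      using im by auto
    obtain TM :: "nat \<Rightarrow> real" where TM: "\<forall>n. TM n > 0" "\<forall>r. (\<forall>n. 0 < r n \<and> r n < TM n) \<longrightarrow> converges_along 1 M r"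
      using converges_along_small_radii[OF im(1) ip(1) order_refl] by blast
    obtain TG :: "nat \<Rightarrow> real" where TG: "\<forall>n. TG n > 0" "\<forall>r. (\<forall>n. 0 < r n \<and> r n < TG n) \<longrightarrow> converges_along 1 G r"
      using converges_along_small_radii[OF im(2) ip(2) order_refl] by blast
    obtain TW :: "nat \<Rightarrow> real" where TW: "\<forall>n. TW n > 0" "\<forall>r. (\<forall>n. 0 < r n \<and> r n < TW n) \<longrightarrow> converges_along 1 W r"
      using converges_along_small_radii[OF im(3) ip(3) order_refl] by blast
    obtain TH :: "nat \<Rightarrow> real" where TH: "\<forall>n. TH n > 0" "\<forall>r. (\<forall>n. 0 < r n \<and> r n < TH n) \<longrightarrow> converges_along 1 H r"
      using converges_along_small_radii[OF im(4) ip(4) order_refl] by blast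
    (* One sequence of radii along which both functions and both gradients converge, and which
       keeps the mollification inside K1. *)
    define r where "r n = min d (min (min (TM n) (TG n)) (min (TW n) (TH n))) / 2" for n
    have r: "0 < r n" "r n < d" "0 < r n \<and> r n < TM n" "0 < r n \<and> r n < TG n" "0 < r n \<and> r n < TW n" "0 < r n \<and> r n < TH n" for n
      using d(1) TM(1)[rule_format, of n] TG(1)[rule_format, of n] TW(1)[rule_format, of n] TH(1)[rule_format, of n]
      by (auto simp: r_def)
    have conv_r: "converges_along 1 M r" "converges_along 1 G r" "converges_along 1 W r" "converges_along 1 H r"
      using TM(2) TG(2) TW(2) TH(2) r by blast+
    obtain SM where SM: "integrable lborel SM" "AE x in lebesgue. \<forall>n. norm (conv (mollifier (r n)) M x - M x) powr 1 \<le> SM x"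
       "AE x in lebesgue. (\<lambda>n. conv (mollifier (r n)) M x) \<longlonglongrightarrow> M x" using conv_r(1) unfolding converges_along_def by blast
    obtain SG where SG: "integrable lborel SG" "AE x in lebesgue. \<forall>n. norm (conv (mollifier (r n)) G x - G x) powr 1 \<le> SG x"
       "AE x in lebesgue. (\<lambda>n. conv (mollifier (r n)) G x) \<longlonglongrightarrow> G x" using conv_r(2) unfolding converges_along_def by blast
    obtain SW where SW: "integrable lborel SW" "AE x in lebesgue. \<forall>n. norm (conv (mollifier (r n)) W x - W x) powr 1 \<le> SW x"
       "AE x in lebesgue. (\<lambda>n. conv (mollifier (r n)) W x) \<longlonglongrightarrow> W x" using conv_r(3) unfolding converges_along_def by blast
    obtain SH where SH: "integrable lborel SH" "AE x in lebesgue. \<forall>n. norm (conv (mollifier (r n)) H x - H x) powr 1 \<le> SH x"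
       "AE x in lebesgue. (\<lambda>n. conv (mollifier (r n)) H x) \<longlonglongrightarrow> H x" using conv_r(4) unfolding converges_along_def by blast
    define mn where "mn n = conv (mollifier (r n)) M" for n
    define wn where "wn n = conv (mollifier (r n)) W" for n
    define Gn where "Gn n = conv (mollifier (r n)) G" for n
    define Hn where "Hn n = conv (mollifier (r n)) H" for n
    note mo = mollifier[OF r(1), where 'a = 'a]
    have cn: "continuous_on UNIV (mn n)" "continuous_on UNIV (wn n)" "continuous_on UNIV (Gn n)" "continuous_on UNIV (Hn n)" for n
      unfolding mn_def wn_def Gn_def Hn_def
      using im by (auto intro!: conv_continuous[where k = "mollifier (r n)" and R = "r n", OF mo(6)[of n] mo(3)[of n]])
    have dn: "(mn n has_derivative (\<lambda>h. Gn n x \<bullet> h)) (at x)" "(wn n has_derivative (\<lambda>h. Hn n x \<bullet> h)) (at x)" if x: "x \<in> K" for n x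
    proof -
      have c: "cball x (r n) \<subseteq> K1" using d(4)[OF x] r(2)[of n] by auto
      show "(mn n has_derivative (\<lambda>h. Gn n x \<bullet> h)) (at x)" "(wn n has_derivative (\<lambda>h. Hn n x \<bullet> h)) (at x)"
        unfolding mn_def wn_def Gn_def Hn_def
        using mollified_has_derivative[OF \<Omega> m d(2,3) r(1) c M G] mollified_has_derivative[OF \<Omega> w d(2,3) r(1) c W H] by auto
    qed
    have aeC: "AE y in lborel. y \<in> K1 \<longrightarrow> (M y, W y) \<in> C"
      using ae am(1,3) unfolding AE_lborel_lebesgue by eventually_elim auto
    have inC: "(mn n x, wn n x) \<in> C" if x: "x \<in> K" for n x
    proof -
      let ?k = "\<lambda>y. mollifier (r n) (x - y) :: real"
      have k: "integrable lborel ?k" "(\<integral>y. ?k y \<partial>lborel) = 1"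
        using lborel_integrable_reflect[OF mo(4)[of n], of x] lborel_integral_reflect[of "mollifier (r n)" x] mo(4,5)[of n] by auto
      have iM: "integrable lborel (\<lambda>y. ?k y *\<^sub>R M y)" and iW: "integrable lborel (\<lambda>y. ?k y *\<^sub>R W y)"
        using im by (auto intro!: conv_integrable[where k = "mollifier (r n)" and R = "r n", OF mo(6)[of n] mo(3)[of n]] simp del: real_scaleR_def)
      have sp: "?k y *\<^sub>R (M y, W y) = (?k y *\<^sub>R M y) *\<^sub>R (1, 0) + (?k y *\<^sub>R W y) *\<^sub>R (0, 1)" for y by simp
      have iP: "integrable lborel (\<lambda>y. ?k y *\<^sub>R (M y, W y))"
        unfolding sp using iM iW by (intro Bochner_Integration.integrable_add integrable_scaleR_left)
      have "(\<integral>y. ?k y *\<^sub>R (M y, W y) \<partial>lborel) \<in> C"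
      proof (rule integral_mem_closed_convex[OF k _ iP _ C(1,2)])
        show "AE y in lborel. ?k y \<noteq> 0 \<longrightarrow> (M y, W y) \<in> C"
          using aeC
        proof eventually_elim
          case (elim y)
          show ?case
          proof
            assume "?k y \<noteq> 0"
            then have "norm (x - y) < r n" using mo(3)[of n "x - y"] by force
            then have "y \<in> cball x d" using r(2)[of n] by (simp add: dist_norm)
            then show "(M y, W y) \<in> C" using d(4)[OF x] elim by blast
          qed
        qed
      qed (rule mo(2))
      also have "(\<integral>y. ?k y *\<^sub>R (M y, W y) \<partial>lborel) = (mn n x, wn n x)"
      proof -
        have "(\<integral>y. ?k y *\<^sub>R (M y, W y) \<partial>lborel) = (\<integral>y. ?k y *\<^sub>R M y \<partial>lborel) *\<^sub>R (1, 0) + (\<integral>y. ?k y *\<^sub>R W y \<partial>lborel) *\<^sub>R (0, 1)"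
          unfolding sp using iM iW by (subst Bochner_Integration.integral_add) (auto simp del: real_scaleR_def scaleR_Pair)
        then show ?thesis by (simp add: mn_def wn_def conv_def)
      qed
      finally show ?thesis .
    qed
    (* The gradient of the product of the test function and F applied to the mollified pair. *)
    define q where "q n x = F (mn n x) (wn n x) *\<^sub>R grad \<phi> x
       + \<phi> x *\<^sub>R (Fs (mn n x) (wn n x) *\<^sub>R Gn n x + Ft (mn n x) (wn n x) *\<^sub>R Hn n x)" for n x
    have derf: "((\<lambda>x. \<phi> x * F (mn n x) (wn n x)) has_derivative (\<lambda>h. q n x \<bullet> h)) (at x)" for n x
    proof (cases "x \<in> K")
      case True
      have "((\<lambda>x. (mn n x, wn n x)) has_derivative (\<lambda>h. (Gn n x \<bullet> h, Hn n x \<bullet> h))) (at x)"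
        using dn[OF True] by (intro has_derivative_Pair)
      from has_derivative_compose[OF this der] inC[OF True, of n] C(4)
      have "((\<lambda>x. F (mn n x) (wn n x)) has_derivative (\<lambda>h. Fs (mn n x) (wn n x) * (Gn n x \<bullet> h) + Ft (mn n x) (wn n x) * (Hn n x \<bullet> h))) (at x)"
        by auto
      from has_derivative_mult[OF has_derivative_grad[OF s\<phi>(1)] this] show ?thesis
        by (rule has_derivative_eq_rhs) (auto simp: q_def inner_add_left algebra_simps)
    next
      case False
      have "((\<lambda>x. \<phi> x * F (mn n x) (wn n x)) has_derivative (\<lambda>h. 0)) (at x)"
        by (rule has_derivative_transform_within_open[OF has_derivative_const, of "- K" x 0])
          (use False \<phi>0 K in \<open>auto intro: compact_imp_closed\<close>)
      then show ?thesis using False \<phi>0 by (simp add: q_def)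
    qed
    have cF: "continuous_on C (\<lambda>z. F (fst z) (snd z))"
    proof (rule continuous_at_imp_continuous_on, rule ballI)
      fix z assume "z \<in> C"
      then show "isCont (\<lambda>z. F (fst z) (snd z)) z"
        using has_derivative_continuous[OF der[of "fst z" "snd z"]] C(4) by auto
    qed
    have cF12: "continuous_on C (\<lambda>z. Fs (fst z) (snd z))" "continuous_on C (\<lambda>z. Ft (fst z) (snd z))"
      using cont C(4) continuous_on_subset by blast+
    have comp: "continuous_on K (\<lambda>x. \<Phi> (mn n x) (wn n x))" if c: "continuous_on C (\<lambda>z. \<Phi> (fst z) (snd z))" for \<Phi> :: "real \<Rightarrow> real \<Rightarrow> real" and n
    proof -
      have "continuous_on K (\<lambda>x. (mn n x, wn n x))"
        using cn(1,2)[of n] by (intro continuous_on_Pair) (auto intro: continuous_on_subset)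
      from continuous_on_compose2[OF c this] show ?thesis using inC by auto
    qed
    have contq: "continuous_on K (q n)" for n
      unfolding q_def
      by (intro continuous_intros comp cF cF12 continuous_on_subset[OF cn(3)] continuous_on_subset[OF cn(4)]
            continuous_on_subset[OF s\<phi>(2)] continuous_on_subset[OF s\<phi>(3)]) auto
    have qout: "q n x = 0" if "x \<notin> K" for n x using \<phi>0 that by (simp add: q_def)
    have q0: "integrable lborel (q n) \<and> (\<integral>x. q n x \<partial>lborel) = 0" for n
    proof -
      have "bounded (q n ` K)" using contq K by (intro compact_imp_bounded compact_continuous_image)
      then obtain B where B: "B > 0" "\<And>x. x \<in> K \<Longrightarrow> norm (q n x) \<le> B" by (auto simp: bounded_pos)
      have gq: "grad (\<lambda>x. \<phi> x * F (mn n x) (wn n x)) x = q n x" for x using gradI[OF derf] .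
      have "norm (grad (\<lambda>x. \<phi> x * F (mn n x) (wn n x)) x) \<le> B" for x
        unfolding gq using B qout[of x n] by (cases "x \<in> K") auto
      moreover have "(\<lambda>x. \<phi> x * F (mn n x) (wn n x)) differentiable (at x)" for x using derf differentiable_def by blast
      ultimately show ?thesis
        using integral_grad_eq_0[of "\<lambda>x. \<phi> x * F (mn n x) (wn n x)" B K] K \<phi>0 unfolding gq by auto
    qed
    let ?Q = "\<lambda>x. F (m x) (w x) *\<^sub>R grad \<phi> x + \<phi> x *\<^sub>R ?q x"
    have i1: "integrable lebesgue (\<lambda>x. F (m x) (w x) *\<^sub>R grad \<phi> x)"
      by (rule integrable_times_test[OF F_loc(1) K s\<phi>(2) \<phi>0(2)])
    have i2: "integrable lebesgue (\<lambda>x. \<phi> x *\<^sub>R ?q x)"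
      by (rule integrable_test_times[OF F_loc(2) K s\<phi>(3) \<phi>0(1)])
    have mQ: "?Q \<in> borel_measurable lebesgue"
      using i1 i2 by (intro borel_measurable_add) (auto intro: borel_measurable_integrable)
    obtain B1 where B1: "\<And>x. norm (\<phi> x) \<le> B1" using bounded_compact_support[OF s\<phi>(3) K(1) \<phi>0(1)] by metis
    obtain B2 where B2: "\<And>x. norm (grad \<phi> x) \<le> B2" using bounded_compact_support[OF s\<phi>(2) K(1) \<phi>0(2)] by metis
    have B12: "B1 \<ge> 0" "B2 \<ge> 0" using B1[of 0] B2[of 0] norm_ge_zero order_trans by blast+
    define dom where "dom x = (\<bar>F a b\<bar> + 2 * L * (\<bar>a\<bar> + \<bar>b\<bar>)) * B2 * indicator K x + 2 * L * B2 * (norm (M x) + SM x + norm (W x) + SW x)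
       + B1 * L * (norm (G x) + SG x + norm (H x) + SH x)" for x
    have iKc: "integrable lborel (indicator K :: 'a \<Rightarrow> real)"
      using K emeasure_compact_finite[OF K(1)] by (intro integrable_real_indicator) (auto simp: borel_compact)
    have "integrable lborel dom"
      unfolding dom_def using im SM(1) SG(1) SW(1) SH(1) iKc
      by (intro Bochner_Integration.integrable_add integrable_mult_right integrable_norm)
    then have idom: "integrable lebesgue dom" by (subst integrable_completion) auto
    have lim: "(\<lambda>n. \<integral>x. q n x \<partial>lebesgue) \<longlonglongrightarrow> (\<integral>x. ?Q x \<partial>lebesgue)"
    proof (rule integral_dominated_convergence[OF mQ _ idom])
      show "q n \<in> borel_measurable lebesgue" for n
        using q0[of n] by (auto simp: measurable_completion)
      show "AE x in lebesgue. (\<lambda>n. q n x) \<longlonglongrightarrow> ?Q x"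
        using SM(3) SG(3) SW(3) SH(3) am ae
      proof eventually_elim
        case (elim x)
        show ?case
        proof (cases "x \<in> K")
          case True
          then have x1: "x \<in> K1" using d(4)[of x] d(1) by auto
          have t: "(\<lambda>n. mn n x) \<longlonglongrightarrow> m x" "(\<lambda>n. wn n x) \<longlonglongrightarrow> w x" "(\<lambda>n. Gn n x) \<longlonglongrightarrow> g x" "(\<lambda>n. Hn n x) \<longlonglongrightarrow> h x"
            using elim x1 by (auto simp: mn_def wn_def Gn_def Hn_def)
          have tp: "(\<lambda>n. (mn n x, wn n x)) \<longlonglongrightarrow> (m x, w x)" using t by (intro tendsto_Pair)
          have mC: "(m x, w x) \<in> C" using elim x1 by blast
          have tc: "(\<lambda>n. \<Phi> (mn n x) (wn n x)) \<longlonglongrightarrow> \<Phi> (m x) (w x)" if c: "continuous_on C (\<lambda>z. \<Phi> (fst z) (snd z))" for \<Phi> :: "real \<Rightarrow> real \<Rightarrow> real"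
            using continuous_on_tendsto_compose[OF c tp mC] inC[OF True] by simp
          show ?thesis unfolding q_def by (intro tendsto_intros tc cF cF12 t)
        next
          case False then show ?thesis using \<phi>0 by (simp add: q_def)
        qed
      qed
      show "AE x in lebesgue. norm (q n x) \<le> dom x" for n
        using SM(2) SG(2) SW(2) SH(2)
      proof eventually_elim
        case (elim x)
        have e: "norm (mn n x - M x) \<le> SM x" "norm (Gn n x - G x) \<le> SG x" "norm (wn n x - W x) \<le> SW x" "norm (Hn n x - H x) \<le> SH x"
          using elim unfolding mn_def Gn_def wn_def Hn_def by auto
        have e2: "\<bar>mn n x\<bar> \<le> norm (M x) + SM x" "\<bar>wn n x\<bar> \<le> norm (W x) + SW x"
          "norm (Gn n x) \<le> norm (G x) + SG x" "norm (Hn n x) \<le> norm (H x) + SH x"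
          using e norm_triangle_ineq2[of "Gn n x" "G x"] norm_triangle_ineq2[of "Hn n x" "H x"] by auto
        show ?case
        proof (cases "x \<in> K")
          case True
          have "\<bar>F (mn n x) (wn n x) - F a b\<bar> \<le> 2 * L * (\<bar>mn n x - a\<bar> + \<bar>wn n x - b\<bar>)"
            using lip[where C = C and L = L, OF C(2,4,5) inC[OF True] ab] .
          also have "\<dots> \<le> 2 * L * ((norm (M x) + SM x + \<bar>a\<bar>) + (norm (W x) + SW x + \<bar>b\<bar>))"
            using L e2 by (intro mult_left_mono add_mono) auto
          finally have FR: "\<bar>F (mn n x) (wn n x)\<bar> \<le> \<bar>F a b\<bar> + 2 * L * (\<bar>a\<bar> + \<bar>b\<bar>) + 2 * L * (norm (M x) + SM x + norm (W x) + SW x)" (is "_ \<le> ?R")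
            using abs_triangle_ineq2[of "F (mn n x) (wn n x)" "F a b"] by (simp add: algebra_simps)
          have R0: "0 \<le> ?R" using FR abs_ge_zero[of "F (mn n x) (wn n x)"] by linarith
          have 1: "norm (F (mn n x) (wn n x) *\<^sub>R grad \<phi> x) \<le> ?R * B2"
            unfolding norm_scaleR by (rule mult_mono[OF _ B2 R0]) (use FR in auto)
          have "norm (Fs (mn n x) (wn n x) *\<^sub>R Gn n x + Ft (mn n x) (wn n x) *\<^sub>R Hn n x)
             \<le> \<bar>Fs (mn n x) (wn n x)\<bar> * norm (Gn n x) + \<bar>Ft (mn n x) (wn n x)\<bar> * norm (Hn n x)"
            using norm_triangle_ineq[of "Fs (mn n x) (wn n x) *\<^sub>R Gn n x" "Ft (mn n x) (wn n x) *\<^sub>R Hn n x"] by simp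
          also have "\<dots> \<le> L * (norm (G x) + SG x) + L * (norm (H x) + SH x)"
            using C(5)[OF inC[OF True, of n]] L e2 by (intro add_mono mult_mono) auto
          finally have 2: "norm (\<phi> x *\<^sub>R (Fs (mn n x) (wn n x) *\<^sub>R Gn n x + Ft (mn n x) (wn n x) *\<^sub>R Hn n x))
              \<le> B1 * (L * (norm (G x) + SG x) + L * (norm (H x) + SH x))"
            using B1[of x] B12 unfolding norm_scaleR by (intro mult_mono) auto
          show ?thesis
            using norm_triangle_ineq[of "F (mn n x) (wn n x) *\<^sub>R grad \<phi> x" "\<phi> x *\<^sub>R (Fs (mn n x) (wn n x) *\<^sub>R Gn n x + Ft (mn n x) (wn n x) *\<^sub>R Hn n x)"] 1 2 True
            by (simp add: q_def dom_def algebra_simps)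
        next
          case False
          have "0 \<le> norm (M x) + SM x + norm (W x) + SW x" "0 \<le> norm (G x) + SG x + norm (H x) + SH x"
            using e2 abs_ge_zero[of "mn n x"] abs_ge_zero[of "wn n x"] norm_ge_zero[of "Gn n x"] norm_ge_zero[of "Hn n x"] by linarith+
          then show ?thesis using qout[OF False] L B12 False by (simp add: dom_def)
        qed
      qed
    qed
    have "(\<integral>x. q n x \<partial>lebesgue) = 0" for n using q0[of n] by (subst integral_completion) auto
    then have "(\<integral>x. ?Q x \<partial>lebesgue) = 0" using lim by (simp add: LIMSEQ_const_iff)
    then show ?thesis using i1 i2 by (simp add: Bochner_Integration.integral_add eq_neg_iff_add_eq_0)
  qed
  show ?thesis unfolding has_weak_grad_iff[OF \<Omega>] using F_loc main by blast
qed

section \<open>Calculus of weak gradients\<close>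

lemma has_weak_grad_Lp_loc:
  "has_weak_grad \<Omega> u g \<Longrightarrow> u \<in> Lp_loc \<Omega> 1" "has_weak_grad \<Omega> u g \<Longrightarrow> g \<in> Lp_loc \<Omega> 1"
  by (auto simp: has_weak_grad_def)

lemma has_weak_grad_measurable:
  assumes "open \<Omega>" "has_weak_grad \<Omega> u g"
  shows "u \<in> borel_measurable (lebesgue_on \<Omega>)" "g \<in> borel_measurable (lebesgue_on \<Omega>)"
  by (rule measurable_Lp_loc[OF assms(1) has_weak_grad_Lp_loc(1)[OF assms(2)]],
      rule measurable_Lp_loc[OF assms(1) has_weak_grad_Lp_loc(2)[OF assms(2)]])

lemma Lp_loc_1D:
  fixes f :: "'a::euclidean_space \<Rightarrow> 'b::euclidean_space"
  assumes "f \<in> Lp_loc \<Omega> 1" "compact K" "K \<subseteq> \<Omega>"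
  shows "integrable lebesgue (\<lambda>x. indicator K x *\<^sub>R f x)"
  using assms unfolding Lp_loc_1_iff by blast

lemma Lp_loc_1_add:
  fixes f g :: "'a::euclidean_space \<Rightarrow> 'b::euclidean_space"
  assumes "f \<in> Lp_loc \<Omega> 1" "g \<in> Lp_loc \<Omega> 1"
  shows "(\<lambda>x. f x + g x) \<in> Lp_loc \<Omega> 1"
  unfolding Lp_loc_1_iff scaleR_add_right
proof (intro allI impI)
  fix K assume K: "compact K" "K \<subseteq> \<Omega>"
  show "integrable lebesgue (\<lambda>x. indicator K x *\<^sub>R f x + indicator K x *\<^sub>R g x)"
    by (rule Bochner_Integration.integrable_add[OF Lp_loc_1D[OF assms(1) K] Lp_loc_1D[OF assms(2) K]])
qed

lemma Lp_loc_1_scaleR: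
  fixes f :: "'a::euclidean_space \<Rightarrow> 'b::euclidean_space"
  assumes "f \<in> Lp_loc \<Omega> 1"
  shows "(\<lambda>x. c *\<^sub>R f x) \<in> Lp_loc \<Omega> 1"
  unfolding Lp_loc_1_iff scaleR_left_commute[of _ c]
proof (intro allI impI)
  fix K assume K: "compact K" "K \<subseteq> \<Omega>"
  show "integrable lebesgue (\<lambda>x. c *\<^sub>R (indicator K x *\<^sub>R f x))"
    by (rule integrable_scaleR_right[OF Lp_loc_1D[OF assms K]])
qed

lemma Lp_loc_1_norm:
  fixes f :: "'a::euclidean_space \<Rightarrow> 'b::euclidean_space"
  assumes "f \<in> Lp_loc \<Omega> 1"
  shows "(\<lambda>x. norm (f x)) \<in> Lp_loc \<Omega> 1"
  unfolding Lp_loc_1_iff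
proof (intro allI impI)
  fix K assume K: "compact K" "K \<subseteq> \<Omega>"
  show "integrable lebesgue (\<lambda>x. indicator K x *\<^sub>R norm (f x))"
    using integrable_norm[OF Lp_loc_1D[OF assms K]] by simp
qed

lemma test_integrable:
  assumes "has_weak_grad \<Omega> u g" "\<phi> \<in> Cc_inf \<Omega>"
  shows "integrable lebesgue (\<lambda>x. u x *\<^sub>R grad \<phi> x)" "integrable lebesgue (\<lambda>x. \<phi> x *\<^sub>R g x)"
proof -
  obtain K where K: "compact K" "K \<subseteq> \<Omega>" and \<phi>0: "\<And>x. x \<notin> K \<Longrightarrow> \<phi> x = 0" "\<And>x. x \<notin> K \<Longrightarrow> grad \<phi> x = 0"
    and sm: "smooth_on \<phi> UNIV" using Cc_infE[OF assms(2)] by metis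
  show "integrable lebesgue (\<lambda>x. u x *\<^sub>R grad \<phi> x)"
    by (rule integrable_times_test[OF has_weak_grad_Lp_loc(1)[OF assms(1)] K smooth_onD(2)[OF sm] \<phi>0(2)])
  show "integrable lebesgue (\<lambda>x. \<phi> x *\<^sub>R g x)"
    by (rule integrable_test_times[OF has_weak_grad_Lp_loc(2)[OF assms(1)] K smooth_onD(3)[OF sm] \<phi>0(1)])
qed

lemma has_weak_grad_add:
  assumes \<Omega>: "open \<Omega>" and u: "has_weak_grad \<Omega> u g" and w: "has_weak_grad \<Omega> w h"
  shows "has_weak_grad \<Omega> (\<lambda>x. u x + w x) (\<lambda>x. g x + h x)"
  unfolding has_weak_grad_iff[OF \<Omega>]
proof (intro conjI ballI)
  fix \<phi> assume \<phi>: "\<phi> \<in> Cc_inf \<Omega>"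
  note i = test_integrable[OF u \<phi>] test_integrable[OF w \<phi>]
  have "(\<integral>x. u x *\<^sub>R grad \<phi> x \<partial>lebesgue) = - (\<integral>x. \<phi> x *\<^sub>R g x \<partial>lebesgue)"
    "(\<integral>x. w x *\<^sub>R grad \<phi> x \<partial>lebesgue) = - (\<integral>x. \<phi> x *\<^sub>R h x \<partial>lebesgue)"
    using u w \<phi> by (auto simp: has_weak_grad_iff[OF \<Omega>])
  then show "(\<integral>x. (u x + w x) *\<^sub>R grad \<phi> x \<partial>lebesgue) = - (\<integral>x. \<phi> x *\<^sub>R (g x + h x) \<partial>lebesgue)"
    unfolding scaleR_add_left scaleR_add_right using i by simp
qed (use Lp_loc_1_add has_weak_grad_Lp_loc[OF u] has_weak_grad_Lp_loc[OF w] in blast)+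

lemma has_weak_grad_scale:
  assumes \<Omega>: "open \<Omega>" and u: "has_weak_grad \<Omega> u g"
  shows "has_weak_grad \<Omega> (\<lambda>x. c * u x) (\<lambda>x. c *\<^sub>R g x)"
  unfolding has_weak_grad_iff[OF \<Omega>]
proof (intro conjI ballI)
  fix \<phi> assume \<phi>: "\<phi> \<in> Cc_inf \<Omega>"
  have "(\<integral>x. u x *\<^sub>R grad \<phi> x \<partial>lebesgue) = - (\<integral>x. \<phi> x *\<^sub>R g x \<partial>lebesgue)"
    using u \<phi> by (auto simp: has_weak_grad_iff[OF \<Omega>])
  moreover have "(c * u x) *\<^sub>R grad \<phi> x = c *\<^sub>R (u x *\<^sub>R grad \<phi> x)" "\<phi> x *\<^sub>R (c *\<^sub>R g x) = c *\<^sub>R (\<phi> x *\<^sub>R g x)" for x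
    by (auto simp: mult.commute)
  ultimately show "(\<integral>x. (c * u x) *\<^sub>R grad \<phi> x \<partial>lebesgue) = - (\<integral>x. \<phi> x *\<^sub>R (c *\<^sub>R g x) \<partial>lebesgue)"
    by (simp only: integral_scaleR_right scaleR_minus_right)
next
  show "(\<lambda>x. c * u x) \<in> Lp_loc \<Omega> 1" using Lp_loc_1_scaleR[OF has_weak_grad_Lp_loc(1)[OF u], of c] by simp
  show "(\<lambda>x. c *\<^sub>R g x) \<in> Lp_loc \<Omega> 1" by (rule Lp_loc_1_scaleR[OF has_weak_grad_Lp_loc(2)[OF u]])
qed

lemma has_weak_grad_diff:
  assumes \<Omega>: "open \<Omega>" and u: "has_weak_grad \<Omega> u g" and w: "has_weak_grad \<Omega> w h"
  shows "has_weak_grad \<Omega> (\<lambda>x. u x - w x) (\<lambda>x. g x - h x)"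
  using has_weak_grad_add[OF \<Omega> u has_weak_grad_scale[OF \<Omega> w, of "-1"]] by simp

lemma has_weak_grad_cong_AE:
  assumes \<Omega>: "open \<Omega>" and u: "has_weak_grad \<Omega> u g"
    and m: "u' \<in> borel_measurable (lebesgue_on \<Omega>)" "g' \<in> borel_measurable (lebesgue_on \<Omega>)"
    and ae: "AE x in lebesgue. x \<in> \<Omega> \<longrightarrow> u' x = u x \<and> g' x = g x"
  shows "has_weak_grad \<Omega> u' g'"
proof -
  have l: "u' \<in> Lp_loc \<Omega> 1" "g' \<in> Lp_loc \<Omega> 1"
    by (rule Lp_loc_1_bound[OF \<Omega> m(1) Lp_loc_1_norm[OF has_weak_grad_Lp_loc(1)[OF u]]], use ae in eventually_elim, simp)
      (rule Lp_loc_1_bound[OF \<Omega> m(2) Lp_loc_1_norm[OF has_weak_grad_Lp_loc(2)[OF u]]], use ae in eventually_elim, simp)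
  have "(\<integral>x. u' x *\<^sub>R grad \<phi> x \<partial>lebesgue) = - (\<integral>x. \<phi> x *\<^sub>R g' x \<partial>lebesgue)" if \<phi>: "\<phi> \<in> Cc_inf \<Omega>" for \<phi>
  proof -
    obtain K where K: "compact K" "K \<subseteq> \<Omega>" and \<phi>0: "\<And>x. x \<notin> K \<Longrightarrow> \<phi> x = 0" "\<And>x. x \<notin> K \<Longrightarrow> grad \<phi> x = 0"
      and sm: "smooth_on \<phi> UNIV" using Cc_infE[OF \<phi>] by metis
    have i: "integrable lebesgue (\<lambda>x. u' x *\<^sub>R grad \<phi> x)" "integrable lebesgue (\<lambda>x. \<phi> x *\<^sub>R g' x)"
      by (rule integrable_times_test[OF l(1) K smooth_onD(2)[OF sm] \<phi>0(2)] integrable_test_times[OF l(2) K smooth_onD(3)[OF sm] \<phi>0(1)]; assumption)+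
    note t = test_integrable[OF u \<phi>]
    have "(\<integral>x. u' x *\<^sub>R grad \<phi> x \<partial>lebesgue) = (\<integral>x. u x *\<^sub>R grad \<phi> x \<partial>lebesgue)"
    proof (rule integral_cong_AE)
      show "AE x in lebesgue. u' x *\<^sub>R grad \<phi> x = u x *\<^sub>R grad \<phi> x"
        using ae by eventually_elim (use K \<phi>0 in fastforce)
    qed (use i t in auto)
    moreover have "(\<integral>x. \<phi> x *\<^sub>R g' x \<partial>lebesgue) = (\<integral>x. \<phi> x *\<^sub>R g x \<partial>lebesgue)"
    proof (rule integral_cong_AE)
      show "AE x in lebesgue. \<phi> x *\<^sub>R g' x = \<phi> x *\<^sub>R g x"
        using ae by eventually_elim (use K \<phi>0 in fastforce)
    qed (use i t in auto)
    ultimately show ?thesis using u \<phi> by (simp add: has_weak_grad_iff[OF \<Omega>])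
  qed
  then show ?thesis using l by (simp add: has_weak_grad_iff[OF \<Omega>])
qed

text \<open>Dominated convergence on both sides of the defining identity.\<close>

lemma has_weak_grad_limit:
  assumes \<Omega>: "open \<Omega>" and u: "\<And>n. has_weak_grad \<Omega> (u n) (g n)"
    and m: "u' \<in> borel_measurable (lebesgue_on \<Omega>)" "g' \<in> borel_measurable (lebesgue_on \<Omega>)"
    and dom: "U \<in> Lp_loc \<Omega> 1" "H \<in> Lp_loc \<Omega> 1"
      "\<And>n x. x \<in> \<Omega> \<Longrightarrow> norm (u n x) \<le> (U x :: real)" "\<And>n x. x \<in> \<Omega> \<Longrightarrow> norm (g n x) \<le> (H x :: real)"
    and lim: "\<And>x. x \<in> \<Omega> \<Longrightarrow> (\<lambda>n. u n x) \<longlonglongrightarrow> u' x" "\<And>x. x \<in> \<Omega> \<Longrightarrow> (\<lambda>n. g n x) \<longlonglongrightarrow> g' x"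
  shows "has_weak_grad \<Omega> u' g'"
proof -
  have b: "norm (u' x) \<le> U x" "norm (g' x) \<le> H x" if "x \<in> \<Omega>" for x
    using LIMSEQ_le_const2[OF tendsto_norm[OF lim(1)[OF that]]] LIMSEQ_le_const2[OF tendsto_norm[OF lim(2)[OF that]]]
      dom(3,4)[OF that] by blast+
  have l: "u' \<in> Lp_loc \<Omega> 1" "g' \<in> Lp_loc \<Omega> 1"
    using Lp_loc_1_bound[OF \<Omega> m(1) dom(1)] Lp_loc_1_bound[OF \<Omega> m(2) dom(2)] b by auto
  have "(\<integral>x. u' x *\<^sub>R grad \<phi> x \<partial>lebesgue) = - (\<integral>x. \<phi> x *\<^sub>R g' x \<partial>lebesgue)" if \<phi>: "\<phi> \<in> Cc_inf \<Omega>" for \<phi>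
  proof -
    obtain K where K: "compact K" "K \<subseteq> \<Omega>" and \<phi>0: "\<And>x. x \<notin> K \<Longrightarrow> \<phi> x = 0" "\<And>x. x \<notin> K \<Longrightarrow> grad \<phi> x = 0"
      and sm: "smooth_on \<phi> UNIV" using Cc_infE[OF \<phi>] by metis
    note i = integrable_times_test[OF l(1) K smooth_onD(2)[OF sm] \<phi>0(2)] integrable_test_times[OF l(2) K smooth_onD(3)[OF sm] \<phi>0(1)]
    note iU = integrable_norm[OF integrable_times_test[OF dom(1) K smooth_onD(2)[OF sm] \<phi>0(2)]]
      integrable_norm[OF integrable_test_times[OF dom(2) K smooth_onD(3)[OF sm] \<phi>0(1)]]
    have d1: "norm (u n x *\<^sub>R grad \<phi> x) \<le> norm (U x *\<^sub>R grad \<phi> x)" for n x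
    proof (cases "x \<in> K")
      case True
      then have "norm (u n x) \<le> \<bar>U x\<bar>" using dom(3)[of x n] K by auto
      then show ?thesis by (simp add: mult_right_mono)
    qed (simp add: \<phi>0)
    have d2: "norm (\<phi> x *\<^sub>R g n x) \<le> norm (\<phi> x *\<^sub>R H x)" for n x
    proof (cases "x \<in> K")
      case True
      then have "norm (g n x) \<le> \<bar>H x\<bar>" using dom(4)[of x n] K by auto
      then show ?thesis by (simp add: abs_mult mult_left_mono)
    qed (simp add: \<phi>0)
    have "(\<lambda>n. \<integral>x. u n x *\<^sub>R grad \<phi> x \<partial>lebesgue) \<longlonglongrightarrow> (\<integral>x. u' x *\<^sub>R grad \<phi> x \<partial>lebesgue)"
    proof (rule integral_dominated_convergence[OF _ _ iU(1)])
      show "AE x in lebesgue. (\<lambda>n. u n x *\<^sub>R grad \<phi> x) \<longlonglongrightarrow> u' x *\<^sub>R grad \<phi> x"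
      proof (rule AE_I2)
        fix x show "(\<lambda>n. u n x *\<^sub>R grad \<phi> x) \<longlonglongrightarrow> u' x *\<^sub>R grad \<phi> x"
          using K \<phi>0(2) lim(1) by (cases "x \<in> K") (auto intro!: tendsto_intros)
      qed
    qed (use d1 i test_integrable[OF u \<phi>] in auto)
    moreover have "(\<lambda>n. \<integral>x. \<phi> x *\<^sub>R g n x \<partial>lebesgue) \<longlonglongrightarrow> (\<integral>x. \<phi> x *\<^sub>R g' x \<partial>lebesgue)"
    proof (rule integral_dominated_convergence[OF _ _ iU(2)])
      show "AE x in lebesgue. (\<lambda>n. \<phi> x *\<^sub>R g n x) \<longlonglongrightarrow> \<phi> x *\<^sub>R g' x"
      proof (rule AE_I2)
        fix x show "(\<lambda>n. \<phi> x *\<^sub>R g n x) \<longlonglongrightarrow> \<phi> x *\<^sub>R g' x"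
          using K \<phi>0(1) lim(2) by (cases "x \<in> K") (auto intro!: tendsto_intros)
      qed
    qed (use d2 i test_integrable[OF u \<phi>] in auto)
    moreover have "(\<integral>x. u n x *\<^sub>R grad \<phi> x \<partial>lebesgue) = - (\<integral>x. \<phi> x *\<^sub>R g n x \<partial>lebesgue)" for n
      using u \<phi> by (auto simp: has_weak_grad_iff[OF \<Omega>])
    ultimately have "(\<lambda>n. - (\<integral>x. \<phi> x *\<^sub>R g n x \<partial>lebesgue)) \<longlonglongrightarrow> (\<integral>x. u' x *\<^sub>R grad \<phi> x \<partial>lebesgue)"
      "(\<lambda>n. - (\<integral>x. \<phi> x *\<^sub>R g n x \<partial>lebesgue)) \<longlonglongrightarrow> - (\<integral>x. \<phi> x *\<^sub>R g' x \<partial>lebesgue)"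
      by (simp_all only: tendsto_minus)
    then show ?thesis by (rule LIMSEQ_unique)
  qed
  then show ?thesis using l by (simp add: has_weak_grad_iff[OF \<Omega>])
qed

lemma continuous_Lp_loc:
  fixes f :: "'a::euclidean_space \<Rightarrow> 'b::euclidean_space"
  assumes "continuous_on UNIV f"
  shows "f \<in> Lp_loc \<Omega> 1"
  unfolding Lp_loc_1_iff
proof (intro allI impI)
  fix K :: "'a set" assume K: "compact K"
  have i: "integrable lborel (\<lambda>x. indicator K x *\<^sub>R f x)"
    by (rule borel_integrable_compact[OF K continuous_on_subset[OF assms]]) simp
  show "integrable lebesgue (\<lambda>x. indicator K x *\<^sub>R f x)"
    using i by (simp only: integrable_completion[OF borel_measurable_integrable[OF i]])
qed

lemma has_weak_grad_smooth:
  fixes f :: "'a::euclidean_space \<Rightarrow> real"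
  assumes \<Omega>: "open \<Omega>" and f: "smooth_on f UNIV"
  shows "has_weak_grad \<Omega> f (grad f)"
  unfolding has_weak_grad_iff[OF \<Omega>]
proof (intro conjI ballI)
  note sf = smooth_onD[OF f]
  show l: "f \<in> Lp_loc \<Omega> 1" "grad f \<in> Lp_loc \<Omega> 1" by (rule continuous_Lp_loc, rule sf)+
  fix \<phi> assume \<phi>: "\<phi> \<in> Cc_inf \<Omega>"
  obtain K where K: "compact K" "K \<subseteq> \<Omega>" and \<phi>0: "\<And>x. x \<notin> K \<Longrightarrow> \<phi> x = 0" "\<And>x. x \<notin> K \<Longrightarrow> grad \<phi> x = 0"
    and sm: "smooth_on \<phi> UNIV" using Cc_infE[OF \<phi>] by metis
  note s = smooth_onD[OF sm]
  note i = integrable_times_test[OF l(1) K s(2) \<phi>0(2)] integrable_test_times[OF l(2) K s(3) \<phi>0(1)]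
  have d: "((\<lambda>x. f x * \<phi> x) has_derivative (\<lambda>h. (f x *\<^sub>R grad \<phi> x + \<phi> x *\<^sub>R grad f x) \<bullet> h)) (at x)" for x
    by (rule has_derivative_eq_rhs[OF has_derivative_mult[OF has_derivative_grad[OF sf(1)] has_derivative_grad[OF s(1)]]])
      (auto simp: inner_add_left)
  note g = gradI[OF d]
  have c: "continuous_on UNIV (\<lambda>x. f x *\<^sub>R grad \<phi> x + \<phi> x *\<^sub>R grad f x)" by (intro continuous_intros s sf)
  have out: "f x *\<^sub>R grad \<phi> x + \<phi> x *\<^sub>R grad f x = 0" if "x \<notin> K" for x using \<phi>0 that by simp
  obtain B where B: "\<And>x. norm (f x *\<^sub>R grad \<phi> x + \<phi> x *\<^sub>R grad f x) \<le> B"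
    by (rule bounded_compact_support[OF c K(1) out]) blast+
  have "integrable lborel (grad (\<lambda>x. f x * \<phi> x))" "(\<integral>x. grad (\<lambda>x. f x * \<phi> x) x \<partial>lborel) = 0"
    by (rule integral_grad_eq_0[of _ B K], use d differentiable_def in blast, use B g in simp, rule K, use \<phi>0 in simp)+
  then have "(\<integral>x. f x *\<^sub>R grad \<phi> x + \<phi> x *\<^sub>R grad f x \<partial>lebesgue) = 0"
    unfolding g by (subst integral_completion) (auto dest: borel_measurable_integrable simp: g[abs_def])
  then show "(\<integral>x. f x *\<^sub>R grad \<phi> x \<partial>lebesgue) = - (\<integral>x. \<phi> x *\<^sub>R grad f x \<partial>lebesgue)"
    using i by (simp add: eq_neg_iff_add_eq_0)
qed

lemma has_weak_grad_const:
  assumes "open \<Omega>"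
  shows "has_weak_grad \<Omega> (\<lambda>x. c) (\<lambda>x. 0)"
proof -
  have "smooth_on (\<lambda>x. c) UNIV" by (simp add: smooth_on_def Ck_on_const)
  moreover have "grad (\<lambda>x. c) = (\<lambda>x::'a. 0)" by (rule ext, rule gradI) simp
  ultimately show ?thesis using has_weak_grad_smooth[OF assms] by metis
qed

lemma has_real_derivative_max_power2: "((\<lambda>s::real. (max s 0)\<^sup>2) has_real_derivative 2 * max s 0) (at s)"
proof -
  consider "s > 0" | "s < 0" | "s = 0" by linarith
  then show ?thesis
  proof cases
    case 1
    have "((\<lambda>s::real. s\<^sup>2) has_real_derivative 2 * max s 0) (at s)" using 1 by (auto intro!: derivative_eq_intros)
    then show ?thesis by (rule has_field_derivative_transform_within_open[of _ _ _ "{0<..}"]) (use 1 in auto)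
  next
    case 2
    have "((\<lambda>s::real. 0) has_real_derivative 2 * max s 0) (at s)" using 2 by (auto intro!: derivative_eq_intros)
    then show ?thesis by (rule has_field_derivative_transform_within_open[of _ _ _ "{..<0}"]) (use 2 in auto)
  next
    case 3
    have "((\<lambda>h. ((max (0 + h) 0)\<^sup>2 - (max 0 0)\<^sup>2) / h) \<longlongrightarrow> 0) (at (0::real))"
    proof (rule Lim_null_comparison)
      show "\<forall>\<^sub>F h in at (0::real). norm (((max (0 + h) 0)\<^sup>2 - (max 0 0)\<^sup>2) / h) \<le> \<bar>h\<bar>"
        by (intro always_eventually) (auto simp: max_def power2_eq_square)
      show "((\<lambda>h::real. \<bar>h\<bar>) \<longlongrightarrow> 0) (at 0)" by (auto intro!: tendsto_eq_intros)
    qed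
    then show ?thesis using 3 by (simp add: DERIV_def)
  qed
qed

text \<open>Apply the chain rule to the continuously differentiable functions \<open>sqrt ((s^+)^2 + \<tau>^2) - \<tau>\<close>, whose derivatives lie
between 0 and 1 and converge to the indicator of \<open>s > 0\<close>, and let \<open>\<tau>\<close> tend to zero.\<close>

lemma has_weak_grad_pos_part:
  fixes \<Omega> :: "'a::euclidean_space set"
  assumes \<Omega>: "open \<Omega>" and u: "has_weak_grad \<Omega> u g"
  shows "has_weak_grad \<Omega> (\<lambda>x. max (u x) 0) (\<lambda>x. if u x > 0 then g x else 0)"
proof -
  note [measurable] = has_weak_grad_measurable[OF \<Omega> u]
  define \<tau> where "\<tau> n = inverse (real (Suc n))" for n
  have \<tau>: "\<tau> n > 0" for n by (simp add: \<tau>_def)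
  define F where "F n s = sqrt ((max s 0)\<^sup>2 + (\<tau> n)\<^sup>2) - \<tau> n" for n and s :: real
  define F1 where "F1 n s = max s 0 / sqrt ((max s 0)\<^sup>2 + (\<tau> n)\<^sup>2)" for n and s :: real
  have pos: "(max s 0)\<^sup>2 + (\<tau> n)\<^sup>2 > 0" for n s using \<tau>[of n] by (simp add: add_nonneg_pos)
  have der: "(F n has_real_derivative F1 n s) (at s)" for n s
  proof -
    have "((\<lambda>s. (max s 0)\<^sup>2 + (\<tau> n)\<^sup>2) has_real_derivative (2 * max s 0 + 0)) (at s)"
      by (rule DERIV_add[OF has_real_derivative_max_power2 DERIV_const])
    from DERIV_chain2[OF DERIV_real_sqrt[OF pos] this]
    have "((\<lambda>s. sqrt ((max s 0)\<^sup>2 + (\<tau> n)\<^sup>2) - \<tau> n) has_real_derivative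
        inverse (sqrt ((max s 0)\<^sup>2 + (\<tau> n)\<^sup>2)) / 2 * (2 * max s 0 + 0) - 0) (at s)"
      by (rule DERIV_diff[OF _ DERIV_const])
    moreover have "F n = (\<lambda>s. sqrt ((max s 0)\<^sup>2 + (\<tau> n)\<^sup>2) - \<tau> n)" by (simp add: F_def fun_eq_iff)
    moreover have "inverse (sqrt ((max s 0)\<^sup>2 + (\<tau> n)\<^sup>2)) / 2 * (2 * max s 0 + 0) - 0 = F1 n s"
    proof -
      have "inverse q / 2 * (2 * m + 0) - 0 = m / q" for q m :: real by (simp add: field_simps)
      then show ?thesis unfolding F1_def .
    qed
    ultimately show ?thesis by simp
  qed
  have F1b: "\<bar>F1 n s\<bar> \<le> 1" for n s
  proof -
    have "max s 0 \<le> sqrt ((max s 0)\<^sup>2 + (\<tau> n)\<^sup>2)" by (rule real_le_rsqrt) simp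
    then show ?thesis using pos[of s n] by (simp add: F1_def divide_le_eq)
  qed
  have Fb: "\<bar>F n s\<bar> \<le> \<bar>s\<bar>" for n s
  proof -
    have "sqrt ((max s 0)\<^sup>2 + (\<tau> n)\<^sup>2) \<le> max s 0 + \<tau> n" 
      using sqrt_sum_squares_le_sum[of "max s 0" "\<tau> n"] \<tau>[of n] by simp
    moreover have "\<tau> n \<le> sqrt ((max s 0)\<^sup>2 + (\<tau> n)\<^sup>2)" by (rule real_le_rsqrt) simp
    ultimately show ?thesis by (simp add: F_def)
  qed
  have wg: "has_weak_grad \<Omega> (\<lambda>x. F n (u x)) (\<lambda>x. F1 n (u x) *\<^sub>R g x)" for n
  proof -
    have "has_weak_grad \<Omega> (\<lambda>x. F n (u x)) (\<lambda>x. F1 n (u x) *\<^sub>R g x + 0 *\<^sub>R g x)"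
    proof (rule has_weak_grad_chain_rule[OF \<Omega> u u, where S = UNIV and F = "\<lambda>s t. F n s" and Fs = "\<lambda>s t. F1 n s" and Ft = "\<lambda>s t. 0"])
      fix s t :: real
      have "((\<lambda>z. F n (fst z)) has_derivative (\<lambda>z. F1 n s * fst z)) (at (s, t))"
      proof -
        have f: "(fst has_derivative fst) (at (s, t :: real))" by (rule bounded_linear_imp_has_derivative[OF bounded_linear_fst])
        have "(F n has_derivative (*) (F1 n s)) (at (fst (s, t)))" using der[of n s] by (simp add: has_field_derivative_def)
        from has_derivative_compose[OF f this] show ?thesis .
      qed
      then show "((\<lambda>z. F n (fst z)) has_derivative (\<lambda>z. F1 n s * fst z + 0 * snd z)) (at (s, t))" by simp
    next
      have nz: "sqrt ((max (fst z) 0)\<^sup>2 + (\<tau> n)\<^sup>2) \<noteq> 0" for z :: "real \<times> real" by (rule not_sym[OF less_imp_neq[OF real_sqrt_gt_zero[OF pos]]])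
      show "continuous_on UNIV (\<lambda>z::real\<times>real. F1 n (fst z))"
        unfolding F1_def by (intro continuous_intros ballI nz)
      show "continuous_on UNIV (\<lambda>z::real\<times>real. 0)" by (rule continuous_on_const)
      show "\<exists>C L. closed C \<and> convex C \<and> C \<noteq> {} \<and> C \<subseteq> UNIV \<and> (\<forall>s t::real. (s, t) \<in> C \<longrightarrow> \<bar>F1 n s\<bar> \<le> L \<and> \<bar>0::real\<bar> \<le> L) \<and>
         (AE x in lebesgue. x \<in> K \<longrightarrow> (u x, u x) \<in> C)" for K :: "'a set"
        by (rule exI[of _ UNIV], rule exI[of _ 1]) (auto simp: F1b)
    qed (auto simp: F_def F1_def)
    then show ?thesis by simp
  qed
  have \<tau>0: "\<tau> \<longlonglongrightarrow> 0" unfolding \<tau>_def by (rule LIMSEQ_inverse_real_of_nat)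
  show ?thesis
  proof (rule has_weak_grad_limit[OF \<Omega> wg _ _ Lp_loc_1_norm[OF has_weak_grad_Lp_loc(1)[OF u]] Lp_loc_1_norm[OF has_weak_grad_Lp_loc(2)[OF u]]])
    fix n x
    show "norm (F n (u x)) \<le> norm (u x)" using Fb by simp
    show "norm (F1 n (u x) *\<^sub>R g x) \<le> norm (g x)" using F1b[of n "u x"] by (simp add: mult_left_le_one_le)
  next
    fix x
    have "(\<lambda>n. F n (u x)) \<longlonglongrightarrow> sqrt ((max (u x) 0)\<^sup>2 + 0\<^sup>2) - 0"
      unfolding F_def by (intro tendsto_intros \<tau>0)
    then show "(\<lambda>n. F n (u x)) \<longlonglongrightarrow> max (u x) 0" by simp
    show "(\<lambda>n. F1 n (u x) *\<^sub>R g x) \<longlonglongrightarrow> (if u x > 0 then g x else 0)"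
    proof (cases "u x > 0")
      case True
      have "(\<lambda>n. F1 n (u x) *\<^sub>R g x) \<longlonglongrightarrow> (max (u x) 0 / sqrt ((max (u x) 0)\<^sup>2 + 0\<^sup>2)) *\<^sub>R g x"
        unfolding F1_def using True by (intro tendsto_intros \<tau>0) auto
      then show ?thesis using True by simp
    qed (simp add: F1_def max_def)
  qed auto
qed

lemma has_weak_grad_max:
  assumes \<Omega>: "open \<Omega>" and u: "has_weak_grad \<Omega> u g" and w: "has_weak_grad \<Omega> w h"
  shows "has_weak_grad \<Omega> (\<lambda>x. max (u x) (w x)) (\<lambda>x. if u x > w x then g x else h x)"
proof -
  have "has_weak_grad \<Omega> (\<lambda>x. w x + max (u x - w x) 0) (\<lambda>x. h x + (if u x - w x > 0 then g x - h x else 0))"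
    by (intro has_weak_grad_add has_weak_grad_pos_part has_weak_grad_diff assms)
  moreover have "(\<lambda>x. w x + max (u x - w x) 0) = (\<lambda>x. max (u x) (w x))" by auto
  moreover have "(\<lambda>x. h x + (if u x - w x > 0 then g x - h x else 0)) = (\<lambda>x. if u x > w x then g x else h x)" by auto
  ultimately show ?thesis by simp
qed

lemma has_weak_grad_min:
  assumes \<Omega>: "open \<Omega>" and u: "has_weak_grad \<Omega> u g" and w: "has_weak_grad \<Omega> w h"
  shows "has_weak_grad \<Omega> (\<lambda>x. min (u x) (w x)) (\<lambda>x. if u x > w x then h x else g x)"
proof -
  have "has_weak_grad \<Omega> (\<lambda>x. u x - max (u x - w x) 0) (\<lambda>x. g x - (if u x - w x > 0 then g x - h x else 0))"
    by (intro has_weak_grad_diff has_weak_grad_pos_part assms)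
  moreover have "(\<lambda>x. u x - max (u x - w x) 0) = (\<lambda>x. min (u x) (w x))" by auto
  moreover have "(\<lambda>x. g x - (if u x - w x > 0 then g x - h x else 0)) = (\<lambda>x. if u x > w x then h x else g x)" by auto
  ultimately show ?thesis by simp
qed

section \<open>Test functions that are only weakly differentiable\<close>

lemma weak_grad_has_weak_grad:
  assumes "has_weak_grad \<Omega> u g"
  shows "has_weak_grad \<Omega> u (weak_grad \<Omega> u)"
  unfolding weak_grad_def by (rule someI[of "has_weak_grad \<Omega> u", OF assms])

lemma weak_grad_AE_eq:
  assumes "open \<Omega>" "has_weak_grad \<Omega> u g"
  shows "AE x in lebesgue. x \<in> \<Omega> \<longrightarrow> weak_grad \<Omega> u x = g x"
  using weak_grad_unique[OF assms(1) weak_grad_has_weak_grad[OF assms(2)] assms(2)] .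

text \<open>The vector field of the \<open>p\<close>-Laplace operator.\<close>

definition flux :: "real \<Rightarrow> 'a::euclidean_space \<Rightarrow> 'a" where
  "flux p g = norm g powr (p - 2) *\<^sub>R g"

lemma flux_inner_self: "p > 0 \<Longrightarrow> flux p g \<bullet> g = norm g powr p"
proof (cases "g = 0")
  case False
  then show ?thesis using powr_add[of "norm g" "p - 2" 2]
    by (simp add: flux_def dot_square_norm powr_numeral)
qed (simp add: flux_def)

lemma norm_flux: "p > 1 \<Longrightarrow> norm (flux p g) = norm g powr (p - 1)"
proof (cases "g = 0")
  case False
  then show ?thesis using powr_add[of "norm g" "p - 2" 1] by (simp add: flux_def)
qed (simp add: flux_def)

lemma flux_inner_le:
  assumes "p > 1"
  shows "\<bar>flux p g \<bullet> h\<bar> \<le> norm g powr (p - 1) * norm h"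
  using Cauchy_Schwarz_ineq2[of "flux p g" h] norm_flux[OF assms, of g] by simp

lemma powr_mult_le_add:
  fixes s t :: real
  assumes "s \<ge> 0" "t \<ge> 0" "p > 1"
  shows "s powr (p - 1) * t \<le> s powr p + t powr p"
proof (cases "t \<le> s")
  case True
  have "s powr (p - 1) * t \<le> s powr (p - 1) * s" using True by (intro mult_left_mono) auto
  also have "\<dots> = s powr p" using assms by (cases "s = 0") (auto simp: powr_diff)
  finally show ?thesis by (simp add: add_increasing2)
next
  case False
  have "s powr (p - 1) * t \<le> t powr (p - 1) * t" using False assms by (intro mult_right_mono powr_mono2) auto
  also have "\<dots> = t powr p" using assms by (cases "t = 0") (auto simp: powr_diff)
  finally show ?thesis by (simp add: add_increasing)
qed

lemma flux_measurable:
  assumes "g \<in> borel_measurable M"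
  shows "(\<lambda>x. flux p (g x)) \<in> borel_measurable M"
  unfolding flux_def using assms by measurable

lemma Lp_loc_integrable_powr:
  fixes f :: "'a::euclidean_space \<Rightarrow> 'b::euclidean_space"
  assumes "f \<in> Lp_loc \<Omega> p" "compact K" "K \<subseteq> \<Omega>"
  shows "integrable lebesgue (\<lambda>x. indicator K x * norm (f x) powr p)"
proof -
  have "integrable (lebesgue_on K) (\<lambda>x. norm (f x) powr p)" using assms by (simp add: Lp_loc_def Lp_def)
  then show ?thesis using assms(2) by (simp add: integrable_lebesgue_on)
qed

text \<open>Smooth test functions that approximate a weakly differentiable function \<open>\<phi>\<close> with weak gradient \<open>G\<close>: their values are
bounded by \<open>M\<close>, their supports lie in one compact set, and \<open>S\<close> dominates the \<open>p\<close>-th powers of the errors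
of the gradients.\<close>

definition approximating_tests ::
    "'a::euclidean_space set \<Rightarrow> real \<Rightarrow> real \<Rightarrow> ('a \<Rightarrow> real) \<Rightarrow> ('a \<Rightarrow> 'a) \<Rightarrow> 'a set \<Rightarrow> (nat \<Rightarrow> 'a \<Rightarrow> real) \<Rightarrow>
      ('a \<Rightarrow> real) \<Rightarrow> bool" where
  "approximating_tests \<Omega> p M \<phi> G K \<Phi> S \<longleftrightarrow>
    compact K \<and> K \<subseteq> \<Omega> \<and> (\<forall>n. \<Phi> n \<in> Cc_inf \<Omega>) \<and> (\<forall>n x. 0 \<le> \<Phi> n x \<and> \<Phi> n x \<le> M) \<and>
    (\<forall>n x. x \<notin> K \<longrightarrow> \<Phi> n x = 0 \<and> grad (\<Phi> n) x = 0) \<and>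
    integrable lebesgue S \<and> (AE x in lebesgue. \<forall>n. norm (grad (\<Phi> n) x - G x) powr p \<le> S x) \<and>
    (AE x in lebesgue. (\<lambda>n. \<Phi> n x) \<longlonglongrightarrow> \<phi> x) \<and> (AE x in lebesgue. (\<lambda>n. grad (\<Phi> n) x) \<longlonglongrightarrow> G x)"

text \<open>Mollify with radii smaller than the distance from the support to the boundary.\<close>

lemma approximating_tests_exist:
  fixes \<Omega> :: "'a::euclidean_space set"
  assumes \<Omega>: "open \<Omega>" and wg: "has_weak_grad \<Omega> \<phi> G" and Gp: "G \<in> Lp_loc \<Omega> p" and p: "p \<ge> 1"
    and K: "compact K" "K \<subseteq> \<Omega>" and out: "\<And>x. x \<notin> K \<Longrightarrow> \<phi> x = 0" "\<And>x. x \<notin> K \<Longrightarrow> G x = 0"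
    and bd: "AE x in lebesgue. x \<in> \<Omega> \<longrightarrow> 0 \<le> \<phi> x \<and> \<phi> x \<le> M" and M: "M \<ge> 0"
  shows "\<exists>K' \<Phi> S. approximating_tests \<Omega> p M \<phi> G K' \<Phi> S"
proof -
  obtain d K1 where d: "d > 0" "compact K1" "K1 \<subseteq> \<Omega>" "\<And>x. x \<in> K \<Longrightarrow> cball x d \<subseteq> K1"
    using compact_neighbourhood[OF \<Omega> K] by metis
  obtain d2 K2 where d2: "d2 > 0" "compact K2" "K2 \<subseteq> \<Omega>" "\<And>x. x \<in> K1 \<Longrightarrow> cball x d2 \<subseteq> K2"
    using compact_neighbourhood[OF \<Omega> d(2,3)] by metis
  have KK: "K \<subseteq> K2"
  proof
    fix x assume "x \<in> K"
    then have "x \<in> K1" using d(4)[of x] d(1) by auto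
    then show "x \<in> K2" using d2(4)[of x] d2(1) by auto
  qed
  obtain U where U: "borel_restriction K2 \<phi> U" using borel_restriction_exists[OF has_weak_grad_Lp_loc(1)[OF wg] d2(2,3)] .
  obtain H where H: "borel_restriction K2 G H" using borel_restriction_exists[OF has_weak_grad_Lp_loc(2)[OF wg] d2(2,3)] .
  have iU: "integrable lborel U" "integrable lborel H" using U H by (auto simp: borel_restriction_def)
  have aU: "AE x in lebesgue. U x = \<phi> x"
  proof -
    have "AE x in lebesgue. U x = indicator K2 x *\<^sub>R \<phi> x" using U by (simp add: borel_restriction_def)
    then show ?thesis by (rule eventually_mono) (use KK out(1) in \<open>force simp: indicator_def\<close>)
  qed
  have aH: "AE x in lebesgue. H x = G x"
  proof -
    have "AE x in lebesgue. H x = indicator K2 x *\<^sub>R G x" using H by (simp add: borel_restriction_def)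
    then show ?thesis by (rule eventually_mono) (use KK out(2) in \<open>force simp: indicator_def\<close>)
  qed
  have iUp: "integrable lborel (\<lambda>x. norm (U x) powr 1)" using iU by simp
  have iHp: "integrable lborel (\<lambda>x. norm (H x) powr p)"
    using borel_restriction_powr[OF Gp d2(2,3) H] p by simp
  obtain TU :: "nat \<Rightarrow> real" where TU: "\<forall>n. TU n > 0" "\<forall>r. (\<forall>n. 0 < r n \<and> r n < TU n) \<longrightarrow> converges_along 1 U r"
    using converges_along_small_radii[OF iU(1) iUp order_refl] by blast
  obtain TH :: "nat \<Rightarrow> real" where TH: "\<forall>n. TH n > 0" "\<forall>r. (\<forall>n. 0 < r n \<and> r n < TH n) \<longrightarrow> converges_along p H r"
    using converges_along_small_radii[OF iU(2) iHp p] by blast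
  define r where "r n = min (min d d2) (min (TU n) (TH n)) / 2" for n
  have r: "0 < r n" "r n < d" "r n < d2" "0 < r n \<and> r n < TU n" "0 < r n \<and> r n < TH n" for n
    using d(1) d2(1) TU(1)[rule_format, of n] TH(1)[rule_format, of n] by (auto simp: r_def)
  have cU: "converges_along 1 U r" and cH: "converges_along p H r" using TU(2) TH(2) r by blast+
  note mo = mollifier[OF r(1), where 'a = 'a]
  define \<Phi> where "\<Phi> n = conv (mollifier (r n)) U" for n
  define \<Gamma> where "\<Gamma> n = conv (mollifier (r n)) H" for n
  have aU0: "AE y in lborel. y \<notin> K \<longrightarrow> U y = 0" using aU out(1) unfolding AE_lborel_lebesgue by (rule_tac eventually_mono) auto
  have aH0: "AE y in lborel. y \<notin> K \<longrightarrow> H y = 0" using aH out(2) unfolding AE_lborel_lebesgue by (rule_tac eventually_mono) auto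
  have far: "mollifier (r n) (x - y) = 0" if "x \<notin> K1" "y \<in> K" for n x y
  proof -
    have "\<not> dist y x \<le> d" using d(4)[OF that(2)] that(1) by auto
    then have "r n \<le> norm (x - y)" using r(2)[of n] by (simp add: dist_norm norm_minus_commute)
    then show ?thesis by (rule mo(3))
  qed
  have \<Phi>out: "\<Phi> n x = 0" if "x \<notin> K1" for n x
  proof -
    have "AE y in lborel. mollifier (r n) (x - y) *\<^sub>R U y = 0"
      using aU0 by (rule eventually_mono) (use far[OF that] in force)
    then show ?thesis unfolding \<Phi>_def conv_def by (rule integral_eq_zero_AE)
  qed
  have \<Gamma>out: "\<Gamma> n x = 0" if "x \<notin> K1" for n x
  proof -
    have "AE y in lborel. mollifier (r n) (x - y) *\<^sub>R H y = 0"
      using aH0 by (rule eventually_mono) (use far[OF that] in force)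
    then show ?thesis unfolding \<Gamma>_def conv_def by (rule integral_eq_zero_AE)
  qed
  have sm: "smooth_on (\<Phi> n) UNIV" for n
    unfolding smooth_on_def \<Phi>_def using Ck_on_conv[where R = "r n", OF mo(1)[of n] mo(3)[of n] iU(1)] by blast
  have test: "\<Phi> n \<in> Cc_inf \<Omega>" for n by (rule Cc_infI[OF sm d(2,3) \<Phi>out])
  have g: "grad (\<Phi> n) x = \<Gamma> n x" for n x
  proof (cases "x \<in> K1")
    case True
    have c: "cball x (r n) \<subseteq> K2" using d2(4)[OF True] r(3)[of n] by auto
    show ?thesis unfolding \<Phi>_def \<Gamma>_def
      by (rule gradI[OF mollified_has_derivative[OF \<Omega> wg d2(2,3) r(1) c U H]])
  next
    case False
    then show ?thesis using grad_eq_0_outside[OF compact_imp_closed[OF d(2)] \<Phi>out[of _ n] False] \<Gamma>out by simp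
  qed
  have UM: "AE y in lborel. U y \<in> {0..M}"
  proof -
    have "AE y in lebesgue. U y \<in> {0..M}"
      using aU bd
    proof eventually_elim
      case (elim y)
      then show ?case using out(1)[of y] K(2) M by (cases "y \<in> K") auto
    qed
    then show ?thesis by (simp add: AE_lborel_lebesgue)
  qed
  have range: "\<Phi> n x \<in> {0..M}" for n x
    unfolding \<Phi>_def conv_def
  proof (rule integral_mem_closed_convex)
    show "integrable lborel (\<lambda>y. mollifier (r n) (x - y))" using lborel_integrable_reflect[OF mo(4)[of n], of x] .
    show "(\<integral>y. mollifier (r n) (x - y) \<partial>lborel) = 1"
      using lborel_integral_reflect[of "mollifier (r n)" x] mo(4,5)[of n] by auto
    show "integrable lborel (\<lambda>y. mollifier (r n) (x - y) *\<^sub>R U y)"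
      by (rule conv_integrable[where k = "mollifier (r n)" and R = "r n", OF mo(6)[of n] mo(3)[of n] iU(1)])
    show "AE y in lborel. mollifier (r n) (x - y) \<noteq> 0 \<longrightarrow> U y \<in> {0..M}" using UM by (rule eventually_mono) simp
  qed (auto simp: mo(2))
  obtain S where S: "integrable lborel S" "AE x in lebesgue. \<forall>n. norm (conv (mollifier (r n)) H x - H x) powr p \<le> S x"
       "AE x in lebesgue. (\<lambda>n. conv (mollifier (r n)) H x) \<longlonglongrightarrow> H x" using cH unfolding converges_along_def by blast
  have l: "AE x in lebesgue. (\<lambda>n. conv (mollifier (r n)) U x) \<longlonglongrightarrow> U x" using cU unfolding converges_along_def by blast
  have c1: "integrable lebesgue S" using S(1) by (simp only: integrable_completion[OF borel_measurable_integrable[OF S(1)]])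
  have c2: "AE x in lebesgue. \<forall>n. norm (grad (\<Phi> n) x - G x) powr p \<le> S x"
    using S(2) aH by eventually_elim (simp add: g \<Gamma>_def)
  have c3: "AE x in lebesgue. (\<lambda>n. \<Phi> n x) \<longlonglongrightarrow> \<phi> x"
    using l aU by eventually_elim (simp add: \<Phi>_def)
  have c4: "AE x in lebesgue. (\<lambda>n. grad (\<Phi> n) x) \<longlonglongrightarrow> G x"
    using S(3) aH by eventually_elim (simp add: g \<Gamma>_def)
  have c5: "\<forall>n x. x \<notin> K1 \<longrightarrow> \<Phi> n x = 0 \<and> grad (\<Phi> n) x = 0" using \<Phi>out \<Gamma>out g by simp
  have c6: "\<forall>n x. 0 \<le> \<Phi> n x \<and> \<Phi> n x \<le> M" using range by auto
  have t: "\<forall>n. \<Phi> n \<in> Cc_inf \<Omega>" using test by blast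
  have "approximating_tests \<Omega> p M \<phi> G K1 \<Phi> S"
    unfolding approximating_tests_def by (intro conjI d(2,3) c1 c2 c3 c4 c5 c6 t)
  then show ?thesis by blast
qed

lemma p_laplace_form_test:
  assumes \<Omega>: "open \<Omega>" and u: "has_weak_grad \<Omega> u V" and \<phi>: "\<phi> \<in> Cc_inf \<Omega>"
  shows "p_laplace_form \<Omega> p u \<phi> = (\<integral>x. flux p (weak_grad \<Omega> u x) \<bullet> grad \<phi> x \<partial>lebesgue)"
proof -
  obtain K where K: "compact K" "K \<subseteq> \<Omega>" and \<phi>0: "\<And>x. x \<notin> K \<Longrightarrow> grad \<phi> x = 0"
    and sm: "smooth_on \<phi> UNIV" using Cc_infE[OF \<phi>] by metis
  note gs = has_weak_grad_smooth[OF \<Omega> sm]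
  note wu = weak_grad_has_weak_grad[OF u]
  have ae: "AE x in lebesgue_on \<Omega>. weak_grad \<Omega> \<phi> x = grad \<phi> x"
    using weak_grad_AE_eq[OF \<Omega> gs] \<Omega> by (simp add: AE_lebesgue_on)
  note m = has_weak_grad_measurable[OF \<Omega> wu] has_weak_grad_measurable[OF \<Omega> gs]
    has_weak_grad_measurable[OF \<Omega> weak_grad_has_weak_grad[OF gs]]
  have "p_laplace_form \<Omega> p u \<phi> = (\<integral>x. flux p (weak_grad \<Omega> u x) \<bullet> weak_grad \<Omega> \<phi> x \<partial>lebesgue_on \<Omega>)"
    by (simp add: p_laplace_form_def flux_def)
  also have "\<dots> = (\<integral>x. flux p (weak_grad \<Omega> u x) \<bullet> grad \<phi> x \<partial>lebesgue_on \<Omega>)"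
    using ae by (intro integral_cong_AE borel_measurable_inner flux_measurable m) (auto elim: eventually_mono)
  also have "\<dots> = (\<integral>x. flux p (weak_grad \<Omega> u x) \<bullet> grad \<phi> x \<partial>lebesgue)"
  proof (rule integral_lebesgue_on[OF open_sets_lebesgue[OF \<Omega>]])
    fix x assume "x \<notin> \<Omega>"
    then have "grad \<phi> x = 0" using K(2) by (intro \<phi>0) blast
    then show "flux p (weak_grad \<Omega> u x) \<bullet> grad \<phi> x = 0" by simp
  qed
  finally show ?thesis .
qed

text \<open>The integrands are dominated by \<open>|W|^p\<close> plus a multiple of \<open>S + |G|^p\<close>, all on a fixed compact set.\<close>

lemma p_laplace_form_limit:
  assumes \<Omega>: "open \<Omega>" and p: "p > 1" and W: "W \<in> borel_measurable (lebesgue_on \<Omega>)" "W \<in> Lp_loc \<Omega> p"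
    and G: "G \<in> borel_measurable (lebesgue_on \<Omega>)" "G \<in> Lp_loc \<Omega> p"
    and K: "compact K" "K \<subseteq> \<Omega>" and out: "\<And>x. x \<notin> K \<Longrightarrow> G x = 0" "\<And>n x. x \<notin> K \<Longrightarrow> g n x = 0"
    and g: "\<And>n. g n \<in> borel_measurable lebesgue"
    and S: "integrable lebesgue S" "AE x in lebesgue. \<forall>n. norm (g n x - G x) powr p \<le> S x"
    and lim: "AE x in lebesgue. (\<lambda>n. g n x) \<longlonglongrightarrow> G x"
  shows "integrable lebesgue (\<lambda>x. flux p (W x) \<bullet> G x)"
    "(\<lambda>n. \<integral>x. flux p (W x) \<bullet> g n x \<partial>lebesgue) \<longlonglongrightarrow> (\<integral>x. flux p (W x) \<bullet> G x \<partial>lebesgue)"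
proof -
  define dom where "dom x = indicator K x * norm (W x) powr p + 2 powr p * (S x + indicator K x * norm (G x) powr p)" for x
  have idom: "integrable lebesgue dom"
    unfolding dom_def
    by (intro Bochner_Integration.integrable_add integrable_mult_right S Lp_loc_integrable_powr[OF W(2) K] Lp_loc_integrable_powr[OF G(2) K])
  have mW: "(\<lambda>x. indicator K x *\<^sub>R flux p (W x)) \<in> borel_measurable lebesgue"
    by (rule measurable_indicator_compact[OF \<Omega> flux_measurable[OF W(1)] K])
  have mG: "G \<in> borel_measurable lebesgue"
    by (rule measurable_outside_compact[OF \<Omega> G(1) K(2) out(1)])
  have eq: "flux p (W x) \<bullet> h = (indicator K x *\<^sub>R flux p (W x)) \<bullet> h" if "x \<notin> K \<Longrightarrow> h = 0" for x h
    using that by (cases "x \<in> K") auto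
  have m1: "(\<lambda>x. flux p (W x) \<bullet> G x) \<in> borel_measurable lebesgue"
  proof -
    have "(\<lambda>x. flux p (W x) \<bullet> G x) = (\<lambda>x. (indicator K x *\<^sub>R flux p (W x)) \<bullet> G x)"
      by (rule ext, rule eq, rule out(1))
    then show ?thesis by (simp only: borel_measurable_inner[OF mW mG])
  qed
  have m2: "(\<lambda>x. flux p (W x) \<bullet> g n x) \<in> borel_measurable lebesgue" for n
  proof -
    have "(\<lambda>x. flux p (W x) \<bullet> g n x) = (\<lambda>x. (indicator K x *\<^sub>R flux p (W x)) \<bullet> g n x)"
      by (rule ext, rule eq, rule out(2))
    then show ?thesis by (simp only: borel_measurable_inner[OF mW g])
  qed
  have bd: "AE x in lebesgue. norm (flux p (W x) \<bullet> g n x) \<le> dom x" for n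
    using S(2)
  proof eventually_elim
    case (elim x)
    have S0: "S x \<ge> 0" using elim powr_ge_zero order_trans by blast
    show ?case
    proof (cases "x \<in> K")
      case True
      have "norm (flux p (W x) \<bullet> g n x) \<le> norm (W x) powr (p - 1) * norm (g n x)"
        using flux_inner_le[OF p] by simp
      also have "\<dots> \<le> norm (W x) powr p + norm (g n x) powr p"
        using p by (intro powr_mult_le_add) auto
      also have "norm (g n x) powr p = norm ((g n x - G x) - (- G x)) powr p" by simp
      also have "\<dots> \<le> 2 powr p * (norm (g n x - G x) powr p + norm (- G x) powr p)"
        using p by (intro norm_diff_powr_le) auto
      also have "\<dots> \<le> 2 powr p * (S x + norm (G x) powr p)"
        using elim by (intro mult_left_mono) auto
      finally show ?thesis using True by (simp add: dom_def)
    next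
      case False
      then show ?thesis using S0 out(2)[OF False] by (simp add: dom_def)
    qed
  qed
  have l: "AE x in lebesgue. (\<lambda>n. flux p (W x) \<bullet> g n x) \<longlonglongrightarrow> flux p (W x) \<bullet> G x"
    using lim by eventually_elim (intro tendsto_intros)
  show "integrable lebesgue (\<lambda>x. flux p (W x) \<bullet> G x)"
    by (rule integrable_dominated_convergence[OF m1 m2 idom l bd])
  show "(\<lambda>n. \<integral>x. flux p (W x) \<bullet> g n x \<partial>lebesgue) \<longlonglongrightarrow> (\<integral>x. flux p (W x) \<bullet> G x \<partial>lebesgue)"
    by (rule integral_dominated_convergence[OF m1 m2 idom l bd])
qed

definition source :: "('a \<Rightarrow> real) \<Rightarrow> ('a \<Rightarrow> real) \<Rightarrow> real \<Rightarrow> real \<Rightarrow> ('a \<Rightarrow> real) \<Rightarrow> 'a \<Rightarrow> real" where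
  "source a b \<delta> \<beta> v x = a x / v x powr \<delta> + b x * v x powr \<beta>"

lemma source_measurable:
  assumes "a \<in> borel_measurable M" "b \<in> borel_measurable M" "v \<in> borel_measurable M"
  shows "source a b \<delta> \<beta> v \<in> borel_measurable M"
  unfolding source_def[abs_def] using assms by measurable

lemma source_nonneg:
  assumes "0 \<le> a x" "0 \<le> b x"
  shows "0 \<le> source a b \<delta> \<beta> v x"
  using assms by (simp add: source_def)

lemma enn2ereal_le_imp:
  assumes "enn2ereal x \<le> ereal y"
  shows "x \<le> ennreal y" "0 \<le> y"
proof -
  have "0 \<le> ereal y" using assms enn2ereal_nonneg order_trans by blast
  then show "0 \<le> y" by simp
  then show "x \<le> ennreal y" using assms by (simp add: less_eq_ennreal.rep_eq enn2ereal_ennreal)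
qed

lemma le_enn2ereal_imp:
  assumes "ereal y \<le> enn2ereal x"
  shows "ennreal y \<le> x"
proof (cases "0 \<le> y")
  case True
  then show ?thesis using assms by (simp add: less_eq_ennreal.rep_eq enn2ereal_ennreal)
qed (simp add: ennreal_neg)

lemma source_form_eq: "source_form \<Omega> a b \<delta> \<beta> v \<phi> = (\<integral>\<^sup>+x. ennreal (source a b \<delta> \<beta> v x * \<phi> x) \<partial>lebesgue_on \<Omega>)"
  by (simp add: source_form_def source_def)

lemma test_measurable:
  assumes "open \<Omega>" "\<phi> \<in> Cc_inf \<Omega>"
  shows "\<phi> \<in> borel_measurable (lebesgue_on \<Omega>)" "grad \<phi> \<in> borel_measurable lebesgue"
proof -
  have sm: "smooth_on \<phi> UNIV" using assms(2) by (simp add: Cc_inf_def)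
  show "\<phi> \<in> borel_measurable (lebesgue_on \<Omega>)"
    by (rule measurable_restrict_space1[OF continuous_measurable_lebesgue[OF smooth_onD(3)[OF sm]]])
  show "grad \<phi> \<in> borel_measurable lebesgue"
    by (rule continuous_measurable_lebesgue[OF smooth_onD(2)[OF sm]])
qed

lemma approximating_tests_p_laplace_form:
  fixes \<Omega> :: "'a::euclidean_space set"
  assumes \<Omega>: "open \<Omega>" and p: "p > 1"
    and u: "has_weak_grad \<Omega> u V" "weak_grad \<Omega> u \<in> Lp_loc \<Omega> p"
    and \<phi>: "has_weak_grad \<Omega> \<phi> G" "G \<in> Lp_loc \<Omega> p" "compact K" "K \<subseteq> \<Omega>" "\<And>x. x \<notin> K \<Longrightarrow> G x = 0"
    and A: "approximating_tests \<Omega> p M \<phi> G K' \<Phi> S"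
  shows "integrable lebesgue (\<lambda>x. flux p (weak_grad \<Omega> u x) \<bullet> G x)"
    "(\<lambda>n. p_laplace_form \<Omega> p u (\<Phi> n)) \<longlonglongrightarrow> (\<integral>x. flux p (weak_grad \<Omega> u x) \<bullet> G x \<partial>lebesgue)"
proof -
  have K': "compact K'" "K' \<subseteq> \<Omega>" and test: "\<And>n. \<Phi> n \<in> Cc_inf \<Omega>"
    and out: "\<And>n x. x \<notin> K' \<Longrightarrow> grad (\<Phi> n) x = 0"
    and S: "integrable lebesgue S" "AE x in lebesgue. \<forall>n. norm (grad (\<Phi> n) x - G x) powr p \<le> S x"
    and l: "AE x in lebesgue. (\<lambda>n. grad (\<Phi> n) x) \<longlonglongrightarrow> G x"
    using A unfolding approximating_tests_def by blast+
  note wu = weak_grad_has_weak_grad[OF u(1)]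
  have KK: "compact (K \<union> K')" "K \<union> K' \<subseteq> \<Omega>" using \<phi> K' by auto
  have o1: "G x = 0" if "x \<notin> K \<union> K'" for x using \<phi>(5) that by simp
  have o2: "grad (\<Phi> n) x = 0" if "x \<notin> K \<union> K'" for n x using out that by simp
  note lim = p_laplace_form_limit[where g = "\<lambda>n. grad (\<Phi> n)", OF \<Omega> p has_weak_grad_measurable(2)[OF \<Omega> wu] u(2)
    has_weak_grad_measurable(2)[OF \<Omega> \<phi>(1)] \<phi>(2) KK o1 o2 test_measurable(2)[OF \<Omega> test] S l]
  show "integrable lebesgue (\<lambda>x. flux p (weak_grad \<Omega> u x) \<bullet> G x)" by (rule lim(1))
  show "(\<lambda>n. p_laplace_form \<Omega> p u (\<Phi> n)) \<longlonglongrightarrow> (\<integral>x. flux p (weak_grad \<Omega> u x) \<bullet> G x \<partial>lebesgue)"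
    unfolding p_laplace_form_test[OF \<Omega> u(1) test] by (rule lim(2))
qed

text \<open>The source term is the lower semicontinuous side of the inequality, so Fatou's lemma suffices for it.\<close>

lemma super_inequality_Sobolev_test:
  fixes \<Omega> :: "'a::euclidean_space set"
  assumes \<Omega>: "open \<Omega>" and p: "p > 1"
    and ab: "a \<in> borel_measurable (lebesgue_on \<Omega>)" "b \<in> borel_measurable (lebesgue_on \<Omega>)"
    and u: "has_weak_grad \<Omega> w W" "weak_grad \<Omega> w \<in> Lp_loc \<Omega> p"
    and super: "super_inequality \<Omega> p a b \<delta> \<beta> (Cc_inf \<Omega>) w"
    and \<phi>: "has_weak_grad \<Omega> \<phi> G" "G \<in> Lp_loc \<Omega> p" "compact K" "K \<subseteq> \<Omega>" "\<And>x. x \<notin> K \<Longrightarrow> \<phi> x = 0" "\<And>x. x \<notin> K \<Longrightarrow> G x = 0"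
    and bd: "AE x in lebesgue. x \<in> \<Omega> \<longrightarrow> 0 \<le> \<phi> x \<and> \<phi> x \<le> M" and M: "M \<ge> 0"
  shows "integrable lebesgue (\<lambda>x. flux p (weak_grad \<Omega> w x) \<bullet> G x)"
    "(\<integral>\<^sup>+x. ennreal (source a b \<delta> \<beta> w x * \<phi> x) \<partial>lebesgue_on \<Omega>) \<le> ennreal (\<integral>x. flux p (weak_grad \<Omega> w x) \<bullet> G x \<partial>lebesgue)"
    "0 \<le> (\<integral>x. flux p (weak_grad \<Omega> w x) \<bullet> G x \<partial>lebesgue)"
proof -
  have p1: "p \<ge> 1" using p by simp
  obtain K' \<Phi> S where A: "approximating_tests \<Omega> p M \<phi> G K' \<Phi> S"
    using approximating_tests_exist[OF \<Omega> \<phi>(1,2) p1 \<phi>(3-6) bd M] by blast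
  note lim = approximating_tests_p_laplace_form[OF \<Omega> p u \<phi>(1-4,6) A]
  have test: "\<Phi> n \<in> Cc_inf \<Omega>" "0 \<le> \<Phi> n x" for n x using A unfolding approximating_tests_def by blast+
  have l: "AE x in lebesgue. (\<lambda>n. \<Phi> n x) \<longlonglongrightarrow> \<phi> x" using A unfolding approximating_tests_def by blast
  show "integrable lebesgue (\<lambda>x. flux p (weak_grad \<Omega> w x) \<bullet> G x)" by (rule lim(1))
  let ?f = "source a b \<delta> \<beta> w"
  have ineq: "enn2ereal (\<integral>\<^sup>+x. ennreal (?f x * \<Phi> n x) \<partial>lebesgue_on \<Omega>) \<le> ereal (p_laplace_form \<Omega> p w (\<Phi> n))" for n
    using super test unfolding super_inequality_def source_form_eq by simp
  note ineq = enn2ereal_le_imp[OF ineq]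
  show "0 \<le> (\<integral>x. flux p (weak_grad \<Omega> w x) \<bullet> G x \<partial>lebesgue)"
    by (rule LIMSEQ_le_const[OF lim(2)]) (use ineq(2) in auto)
  have [measurable]: "?f \<in> borel_measurable (lebesgue_on \<Omega>)"
    by (rule source_measurable[OF ab has_weak_grad_measurable(1)[OF \<Omega> u(1)]])
  note [measurable] = test_measurable(1)[OF \<Omega> test(1)]
  have ae: "AE x in lebesgue_on \<Omega>. ennreal (?f x * \<phi> x) = liminf (\<lambda>n. ennreal (?f x * \<Phi> n x))"
  proof -
    have "AE x in lebesgue. x \<in> \<Omega> \<longrightarrow> ennreal (?f x * \<phi> x) = liminf (\<lambda>n. ennreal (?f x * \<Phi> n x))"
      using l
    proof eventually_elim
      case (elim x)
      have "(\<lambda>n. ennreal (?f x * \<Phi> n x)) \<longlonglongrightarrow> ennreal (?f x * \<phi> x)"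
        by (intro tendsto_ennrealI tendsto_intros elim)
      from lim_imp_Liminf[OF trivial_limit_sequentially this] show ?case by simp
    qed
    then show ?thesis using \<Omega> by (simp add: AE_lebesgue_on)
  qed
  have "(\<integral>\<^sup>+x. ennreal (?f x * \<phi> x) \<partial>lebesgue_on \<Omega>) = (\<integral>\<^sup>+x. liminf (\<lambda>n. ennreal (?f x * \<Phi> n x)) \<partial>lebesgue_on \<Omega>)"
    by (rule nn_integral_cong_AE[OF ae])
  also have "\<dots> \<le> liminf (\<lambda>n. \<integral>\<^sup>+x. ennreal (?f x * \<Phi> n x) \<partial>lebesgue_on \<Omega>)"
    by (rule nn_integral_liminf) measurable
  also have "\<dots> \<le> liminf (\<lambda>n. ennreal (p_laplace_form \<Omega> p w (\<Phi> n)))"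
    by (intro Liminf_mono always_eventually allI ineq(1))
  also have "\<dots> = ennreal (\<integral>x. flux p (weak_grad \<Omega> w x) \<bullet> G x \<partial>lebesgue)"
    by (intro lim_imp_Liminf trivial_limit_sequentially tendsto_ennrealI lim(2))
  finally show "(\<integral>\<^sup>+x. ennreal (?f x * \<phi> x) \<partial>lebesgue_on \<Omega>) \<le> ennreal (\<integral>x. flux p (weak_grad \<Omega> w x) \<bullet> G x \<partial>lebesgue)" .
qed

text \<open>In the inequality of a subsolution the source term bounds from above, so its integrals must converge.
For this the source has to be locally integrable.\<close>

lemma sub_inequality_Sobolev_test:
  fixes \<Omega> :: "'a::euclidean_space set"
  assumes \<Omega>: "open \<Omega>" and p: "p > 1"
    and ab: "a \<in> borel_measurable (lebesgue_on \<Omega>)" "b \<in> borel_measurable (lebesgue_on \<Omega>)"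
      "\<And>x. x \<in> \<Omega> \<Longrightarrow> 0 \<le> a x" "\<And>x. x \<in> \<Omega> \<Longrightarrow> 0 \<le> b x"
    and u: "has_weak_grad \<Omega> v V" "weak_grad \<Omega> v \<in> Lp_loc \<Omega> p"
    and sub: "sub_inequality \<Omega> p a b \<delta> \<beta> (Cc_inf \<Omega>) v"
    and loc: "\<And>K. compact K \<Longrightarrow> K \<subseteq> \<Omega> \<Longrightarrow> (\<integral>\<^sup>+x. indicator K x * ennreal (source a b \<delta> \<beta> v x) \<partial>lebesgue_on \<Omega>) < \<infinity>"
    and \<phi>: "has_weak_grad \<Omega> \<phi> G" "G \<in> Lp_loc \<Omega> p" "compact K" "K \<subseteq> \<Omega>" "\<And>x. x \<notin> K \<Longrightarrow> \<phi> x = 0" "\<And>x. x \<notin> K \<Longrightarrow> G x = 0"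
    and bd: "AE x in lebesgue. x \<in> \<Omega> \<longrightarrow> 0 \<le> \<phi> x \<and> \<phi> x \<le> M" and M: "M \<ge> 0"
  shows "integrable lebesgue (\<lambda>x. flux p (weak_grad \<Omega> v x) \<bullet> G x)"
    "ennreal (\<integral>x. flux p (weak_grad \<Omega> v x) \<bullet> G x \<partial>lebesgue) \<le> (\<integral>\<^sup>+x. ennreal (source a b \<delta> \<beta> v x * \<phi> x) \<partial>lebesgue_on \<Omega>)"
proof -
  have p1: "p \<ge> 1" using p by simp
  obtain K' \<Phi> S where A: "approximating_tests \<Omega> p M \<phi> G K' \<Phi> S"
    using approximating_tests_exist[OF \<Omega> \<phi>(1,2) p1 \<phi>(3-6) bd M] by blast
  note lim = approximating_tests_p_laplace_form[OF \<Omega> p u \<phi>(1-4,6) A]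
  have test: "\<Phi> n \<in> Cc_inf \<Omega>" "0 \<le> \<Phi> n x" "\<Phi> n x \<le> M" for n x using A unfolding approximating_tests_def by blast+
  have K': "compact K'" "K' \<subseteq> \<Omega>" "\<And>n x. x \<notin> K' \<Longrightarrow> \<Phi> n x = 0" using A unfolding approximating_tests_def by blast+
  have l: "AE x in lebesgue. (\<lambda>n. \<Phi> n x) \<longlonglongrightarrow> \<phi> x" using A unfolding approximating_tests_def by blast
  show "integrable lebesgue (\<lambda>x. flux p (weak_grad \<Omega> v x) \<bullet> G x)" by (rule lim(1))
  let ?f = "source a b \<delta> \<beta> v"
  have ineq: "ereal (p_laplace_form \<Omega> p v (\<Phi> n)) \<le> enn2ereal (\<integral>\<^sup>+x. ennreal (?f x * \<Phi> n x) \<partial>lebesgue_on \<Omega>)" for n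
    using sub test unfolding sub_inequality_def source_form_eq by simp
  note ineq = le_enn2ereal_imp[OF ineq]
  have [measurable]: "?f \<in> borel_measurable (lebesgue_on \<Omega>)"
    by (rule source_measurable[OF ab(1,2) has_weak_grad_measurable(1)[OF \<Omega> u(1)]])
  note [measurable] = test_measurable(1)[OF \<Omega> test(1)] has_weak_grad_measurable(1)[OF \<Omega> \<phi>(1)]
  have [measurable]: "(\<lambda>x. indicator K' x :: ennreal) \<in> borel_measurable (lebesgue_on \<Omega>)"
    by (rule measurable_restrict_space1, rule borel_measurable_indicator) (use K' in simp)
  have lim2: "(\<lambda>n. \<integral>\<^sup>+x. ennreal (?f x * \<Phi> n x) \<partial>lebesgue_on \<Omega>) \<longlonglongrightarrow> (\<integral>\<^sup>+x. ennreal (?f x * \<phi> x) \<partial>lebesgue_on \<Omega>)"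
  proof (rule nn_integral_dominated_convergence[where w = "\<lambda>x. ennreal M * (indicator K' x * ennreal (?f x))"])
    show "(\<integral>\<^sup>+x. ennreal M * (indicator K' x * ennreal (?f x)) \<partial>lebesgue_on \<Omega>) < \<infinity>"
      using loc[OF K'(1,2)] by (subst nn_integral_cmult) (auto simp: ennreal_mult_less_top)
    show "AE x in lebesgue_on \<Omega>. ennreal (?f x * \<Phi> n x) \<le> ennreal M * (indicator K' x * ennreal (?f x))" for n
    proof (rule AE_I2)
      fix x assume "x \<in> space (lebesgue_on \<Omega>)"
      then have x: "x \<in> \<Omega>" by (simp add: space_restrict_space)
      have f0: "0 \<le> ?f x" using ab(3,4)[OF x] by (rule source_nonneg)
      show "ennreal (?f x * \<Phi> n x) \<le> ennreal M * (indicator K' x * ennreal (?f x))"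
      proof (cases "x \<in> K'")
        case True
        have "?f x * \<Phi> n x \<le> M * ?f x" using mult_right_mono[OF test(3)[of n x] f0] by (simp add: mult.commute)
        then show ?thesis using True M f0 by (simp add: ennreal_mult[symmetric] ennreal_leI)
      qed (simp add: K'(3))
    qed
    show "AE x in lebesgue_on \<Omega>. (\<lambda>n. ennreal (?f x * \<Phi> n x)) \<longlonglongrightarrow> ennreal (?f x * \<phi> x)"
    proof -
      have "AE x in lebesgue. x \<in> \<Omega> \<longrightarrow> (\<lambda>n. ennreal (?f x * \<Phi> n x)) \<longlonglongrightarrow> ennreal (?f x * \<phi> x)"
        using l by eventually_elim (intro impI tendsto_ennrealI tendsto_intros)
      then show ?thesis using \<Omega> by (simp add: AE_lebesgue_on)
    qed
  qed measurable
  show "ennreal (\<integral>x. flux p (weak_grad \<Omega> v x) \<bullet> G x \<partial>lebesgue) \<le> (\<integral>\<^sup>+x. ennreal (?f x * \<phi> x) \<partial>lebesgue_on \<Omega>)"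
    by (rule LIMSEQ_le[OF tendsto_ennrealI[OF lim(2)] lim2]) (use ineq in auto)
qed

section \<open>Truncating functions of zero boundary values\<close>

text \<open>The bound may hold almost everywhere and with a constant that depends on the compact set.\<close>

lemma Lp_loc_combination:
  fixes f :: "'a::euclidean_space \<Rightarrow> 'b::euclidean_space" and g :: "'a \<Rightarrow> 'c::euclidean_space" and h :: "'a \<Rightarrow> 'd::euclidean_space"
  assumes \<Omega>: "open \<Omega>" and p: "p > 0" and f: "f \<in> Lp_loc \<Omega> p" and g: "g \<in> Lp_loc \<Omega> p"
    and h: "h \<in> borel_measurable (lebesgue_on \<Omega>)"
    and b: "\<And>K. compact K \<Longrightarrow> K \<subseteq> \<Omega> \<Longrightarrow> \<exists>A\<ge>0. AE x in lebesgue. x \<in> K \<longrightarrow> norm (h x) \<le> A * norm (f x) + A * norm (g x)"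
  shows "h \<in> Lp_loc \<Omega> p"
  unfolding Lp_loc_def
proof (intro CollectI allI impI, elim conjE)
  fix K assume K: "compact K" "K \<subseteq> \<Omega>"
  obtain A where A: "A \<ge> 0" "AE x in lebesgue. x \<in> K \<longrightarrow> norm (h x) \<le> A * norm (f x) + A * norm (g x)"
    using b[OF K] by blast
  have mh: "(\<lambda>x. indicator K x *\<^sub>R h x) \<in> borel_measurable lebesgue"
    by (rule measurable_indicator_compact[OF \<Omega> h K])
  then have mK: "h \<in> borel_measurable (lebesgue_on K)" using K(1) by (simp add: measurable_lebesgue_on)
  then have m2: "(\<lambda>x. norm (h x) powr p) \<in> borel_measurable (lebesgue_on K)" by measurable
  have i: "integrable (lebesgue_on K) (\<lambda>x. norm (f x) powr p)" "integrable (lebesgue_on K) (\<lambda>x. norm (g x) powr p)"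
    using f g K by (auto simp: Lp_loc_def Lp_def)
  have "integrable (lebesgue_on K) (\<lambda>x. norm (h x) powr p)"
  proof (rule Bochner_Integration.integrable_bound[OF _ m2])
    show "integrable (lebesgue_on K) (\<lambda>x. 2 powr p * (A powr p * norm (f x) powr p + A powr p * norm (g x) powr p))"
      using i by (intro integrable_mult_right Bochner_Integration.integrable_add)
    have "AE x in lebesgue_on K. norm (h x) \<le> A * norm (f x) + A * norm (g x)"
      using A(2) K(1) by (simp add: AE_lebesgue_on)
    then show "AE x in lebesgue_on K. norm (norm (h x) powr p) \<le> norm (2 powr p * (A powr p * norm (f x) powr p + A powr p * norm (g x) powr p))"
    proof eventually_elim
      case (elim x)
      have "norm (h x) powr p \<le> (A * norm (f x) + A * norm (g x)) powr p"
        using elim p by (intro powr_mono2) auto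
      also have "\<dots> \<le> 2 powr p * ((A * norm (f x)) powr p + (A * norm (g x)) powr p)"
        using A p by (intro powr_add_le) auto
      also have "\<dots> = 2 powr p * (A powr p * norm (f x) powr p + A powr p * norm (g x) powr p)"
        using A by (simp add: powr_mult)
      finally have "norm (h x) powr p \<le> 2 powr p * (A powr p * norm (f x) powr p + A powr p * norm (g x) powr p)" .
      then show ?case by simp
    qed
  qed
  then show "h \<in> Lp K p" using mK by (simp add: Lp_def)
qed

lemma Lp_loc_cong_AE:
  fixes f :: "'a::euclidean_space \<Rightarrow> 'b::euclidean_space"
  assumes "open \<Omega>" "p > 0" "f \<in> Lp_loc \<Omega> p" "g \<in> borel_measurable (lebesgue_on \<Omega>)"
    "AE x in lebesgue. x \<in> \<Omega> \<longrightarrow> g x = f x"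
  shows "g \<in> Lp_loc \<Omega> p"
proof (rule Lp_loc_combination[OF assms(1,2,3,3,4)])
  fix K assume "compact K" "K \<subseteq> \<Omega>"
  then have "AE x in lebesgue. x \<in> K \<longrightarrow> norm (g x) \<le> 1 * norm (f x) + 1 * norm (f x)"
    using assms(5) by (elim eventually_mono) auto
  then show "\<exists>A\<ge>0. AE x in lebesgue. x \<in> K \<longrightarrow> norm (g x) \<le> A * norm (f x) + A * norm (f x)"
    by (intro exI[of _ 1]) simp
qed

lemma Lp_imp_Lp_loc:
  fixes f :: "'a::euclidean_space \<Rightarrow> 'b::euclidean_space"
  assumes "open \<Omega>" "f \<in> Lp \<Omega> p"
  shows "f \<in> Lp_loc \<Omega> p"
  unfolding Lp_loc_def
proof (intro CollectI allI impI, elim conjE)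
  fix K assume K: "compact K" "K \<subseteq> \<Omega>"
  have f: "f \<in> borel_measurable (lebesgue_on \<Omega>)" "integrable (lebesgue_on \<Omega>) (\<lambda>x. norm (f x) powr p)"
    using assms(2) by (auto simp: Lp_def)
  have m: "f \<in> borel_measurable (lebesgue_on K)"
    using measurable_indicator_compact[OF assms(1) f(1) K] K(1) by (simp add: measurable_lebesgue_on)
  have "integrable lebesgue (\<lambda>x. indicator \<Omega> x *\<^sub>R (norm (f x) powr p))"
    using f(2) assms(1) by (simp add: integrable_lebesgue_on)
  then have "integrable lebesgue (\<lambda>x. indicator K x *\<^sub>R (indicator \<Omega> x *\<^sub>R (norm (f x) powr p)))"
    by (rule integrable_mult_indicator[rotated]) (use K(1) in simp)
  also have "(\<lambda>x. indicator K x *\<^sub>R (indicator \<Omega> x *\<^sub>R (norm (f x) powr p))) = (\<lambda>x. indicator K x *\<^sub>R (norm (f x) powr p))"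
    using K(2) by (intro ext) (auto simp: indicator_def)
  finally show "f \<in> Lp K p" using m K(1) by (simp add: Lp_def integrable_lebesgue_on)
qed

lemma W1p_loc_weak_grad:
  assumes "open \<Omega>" "p > 0" "v \<in> W1p_loc \<Omega> p"
  shows "has_weak_grad \<Omega> v (weak_grad \<Omega> v)" "weak_grad \<Omega> v \<in> Lp_loc \<Omega> p"
proof -
  obtain g where g: "has_weak_grad \<Omega> v g" "g \<in> Lp_loc \<Omega> p" using assms(3) by (auto simp: W1p_loc_def)
  show h: "has_weak_grad \<Omega> v (weak_grad \<Omega> v)" by (rule weak_grad_has_weak_grad[OF g(1)])
  show "weak_grad \<Omega> v \<in> Lp_loc \<Omega> p"
    by (rule Lp_loc_cong_AE[OF assms(1,2) g(2) has_weak_grad_measurable(2)[OF assms(1) h] weak_grad_AE_eq[OF assms(1) g(1)]])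
qed

lemma locally_positive_compact:
  assumes "locally_positive \<Omega> w" "compact K" "K \<subseteq> \<Omega>"
  obtains c where "c > 0" "AE x in lebesgue. x \<in> K \<longrightarrow> c \<le> w x"
proof -
  have "compactly_contained K \<Omega>"
    using assms(2,3) by (simp add: compactly_contained_def closure_closed compact_imp_closed)
  then show ?thesis using assms(1) that unfolding locally_positive_def by blast
qed

lemma locally_positive_AE:
  fixes \<Omega> :: "'a::euclidean_space set"
  assumes "open \<Omega>" "locally_positive \<Omega> w"
  shows "AE x in lebesgue. x \<in> \<Omega> \<longrightarrow> 0 < w x"
proof (rule AE_open_from_compact[OF assms(1)])
  fix K assume K: "compact K" "K \<subseteq> \<Omega>"
  obtain c where c: "c > 0" "AE x in lebesgue. x \<in> K \<longrightarrow> c \<le> w x"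
    by (rule locally_positive_compact[OF assms(2) K])
  show "AE x in lebesgue. x \<in> K \<longrightarrow> 0 < w x" using c(2) by (rule eventually_mono) (use c(1) in auto)
qed

text \<open>Compactly supported bounded functions \<open>zn n\<close> with \<open>0 \<le> zn n \<le> z\<close> that converge to \<open>z\<close> together with their weak gradients
\<open>Zn n\<close>, the \<open>p\<close>-th powers of which are dominated by \<open>S\<close>. The bound by \<open>z\<close> makes every set
\<open>{zn n > k w}\<close> a subset of \<open>{z > k w}\<close>.\<close>

definition truncations ::
    "'a::euclidean_space set \<Rightarrow> real \<Rightarrow> ('a \<Rightarrow> real) \<Rightarrow> ('a \<Rightarrow> 'a) \<Rightarrow> (nat \<Rightarrow> 'a \<Rightarrow> real) \<Rightarrow> (nat \<Rightarrow> 'a \<Rightarrow> 'a) \<Rightarrow>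
      (nat \<Rightarrow> 'a set) \<Rightarrow> (nat \<Rightarrow> real) \<Rightarrow> ('a \<Rightarrow> real) \<Rightarrow> bool" where
  "truncations \<Omega> p z Z zn Zn K M S \<longleftrightarrow>
    (\<forall>n. has_weak_grad \<Omega> (zn n) (Zn n) \<and> Zn n \<in> Lp_loc \<Omega> p \<and> compact (K n) \<and> K n \<subseteq> \<Omega> \<and> 0 < M n) \<and>
    (\<forall>n x. x \<notin> K n \<longrightarrow> zn n x = 0 \<and> Zn n x = 0) \<and> (\<forall>n x. 0 \<le> zn n x \<and> zn n x \<le> z x \<and> zn n x \<le> M n) \<and>
    integrable (lebesgue_on \<Omega>) S \<and>
    (AE x in lebesgue_on \<Omega>. (\<forall>n. norm (Zn n x) powr p \<le> S x) \<and> (\<lambda>n. zn n x) \<longlonglongrightarrow> z x \<and> (\<lambda>n. Zn n x) \<longlonglongrightarrow> Z x)"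

lemma integrable_on_open:
  fixes h :: "'a::euclidean_space \<Rightarrow> 'b::euclidean_space"
  assumes "open \<Omega>" "integrable lebesgue h"
  shows "integrable (lebesgue_on \<Omega>) h"
proof -
  have "integrable lebesgue (\<lambda>x. indicator \<Omega> x *\<^sub>R h x)" using assms by (intro integrable_mult_indicator) auto
  then show ?thesis using assms(1) by (simp add: integrable_lebesgue_on)
qed

lemma test_powr_integrable:
  fixes \<phi> :: "'a::euclidean_space \<Rightarrow> 'b::euclidean_space"
  assumes \<Omega>: "open \<Omega>" and c: "continuous_on UNIV \<phi>" and K: "compact K" "\<And>x. x \<notin> K \<Longrightarrow> \<phi> x = 0" and p: "p > 0"
  shows "integrable (lebesgue_on \<Omega>) (\<lambda>x. norm (\<phi> x) powr p)"
proof -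
  have "continuous_on UNIV (\<lambda>x. norm (\<phi> x) powr p)"
    using c p by (intro continuous_on_powr' continuous_intros) auto
  then have i: "integrable lborel (\<lambda>x. norm (\<phi> x) powr p)"
    by (rule integrable_compact_support[OF _ K(1)]) (use K(2) in simp)
  then have "integrable lebesgue (\<lambda>x. norm (\<phi> x) powr p)"
    by (simp only: integrable_completion[OF borel_measurable_integrable[OF i]])
  then show ?thesis by (rule integrable_on_open[OF \<Omega>])
qed

lemma integrable_powr_diff:
  fixes f g :: "'a \<Rightarrow> 'b::euclidean_space"
  assumes "f \<in> borel_measurable M" "g \<in> borel_measurable M" "p > 0"
    "integrable M (\<lambda>x. norm (f x) powr p)" "integrable M (\<lambda>x. norm (g x) powr p)"
  shows "integrable M (\<lambda>x. norm (f x - g x) powr p)"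
proof (rule Bochner_Integration.integrable_bound)
  show "integrable M (\<lambda>x. 2 powr p * (norm (f x) powr p + norm (g x) powr p))"
    using assms by (intro integrable_mult_right Bochner_Integration.integrable_add)
  show "AE x in M. norm (norm (f x - g x) powr p) \<le> norm (2 powr p * (norm (f x) powr p + norm (g x) powr p))"
    using norm_diff_powr_le[OF assms(3)] by (intro AE_I2) (auto intro: order_trans[OF _ abs_ge_self])
  show "(\<lambda>x. norm (f x - g x) powr p) \<in> borel_measurable M" using assms(1,2) by measurable
qed

lemma W1p_Lp:
  assumes \<Omega>: "open \<Omega>" and p: "p > 0" and z: "z \<in> W1p \<Omega> p" "has_weak_grad \<Omega> z Z"
  shows "Z \<in> Lp \<Omega> p"
proof -
  obtain g where g: "has_weak_grad \<Omega> z g" "g \<in> Lp \<Omega> p" using z by (auto simp: W1p_def)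
  have ae: "AE x in lebesgue_on \<Omega>. Z x = g x"
    using weak_grad_unique[OF \<Omega> z(2) g(1)] \<Omega> by (simp add: AE_lebesgue_on)
  have m: "Z \<in> borel_measurable (lebesgue_on \<Omega>)" "g \<in> borel_measurable (lebesgue_on \<Omega>)"
    using has_weak_grad_measurable(2)[OF \<Omega> z(2)] has_weak_grad_measurable(2)[OF \<Omega> g(1)] .
  have "integrable (lebesgue_on \<Omega>) (\<lambda>x. norm (g x) powr p)" using g(2) by (simp add: Lp_def)
  then have "integrable (lebesgue_on \<Omega>) (\<lambda>x. norm (Z x) powr p)"
    by (rule integrable_cong_AE_imp) (use m ae in \<open>auto elim: eventually_mono\<close>)
  then show ?thesis using m by (simp add: Lp_def)
qed

text \<open>Choose the \<open>n\<close>-th smooth function at distance less than \<open>2^(-n/p)\<close>, so that the \<open>p\<close>-th powers of the distances are summable.\<close>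

lemma W1p_0_fast_approximation:
  fixes \<Omega> :: "'a::euclidean_space set"
  assumes \<Omega>: "open \<Omega>" and p: "p \<ge> 1" and z: "z \<in> W1p_0 \<Omega> p" and Z: "has_weak_grad \<Omega> z Z"
  shows "\<exists>\<phi> S. (\<forall>n::nat. \<phi> n \<in> Cc_inf \<Omega>) \<and> integrable (lebesgue_on \<Omega>) S \<and>
    (AE x in lebesgue_on \<Omega>. (\<forall>n. norm (grad (\<phi> n) x - Z x) powr p \<le> S x) \<and> (\<lambda>n. \<phi> n x) \<longlonglongrightarrow> z x \<and> (\<lambda>n. grad (\<phi> n) x) \<longlonglongrightarrow> Z x)"
proof -
  have p0: "p > 0" using p by simp
  have zW: "z \<in> W1p \<Omega> p" using z by (simp add: W1p_0_def)
  note ZL = W1p_Lp[OF \<Omega> p0 zW Z]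
  have zL: "z \<in> Lp \<Omega> p" using zW by (simp add: W1p_def)
  have "\<exists>\<phi>\<in>Cc_inf \<Omega>. W1p_norm \<Omega> p (\<lambda>x. z x - \<phi> x) < ((1/2)^n) powr (1/p)" for n :: nat
    using z by (simp add: W1p_0_def)
  then obtain \<phi> where \<phi>: "\<And>n. \<phi> n \<in> Cc_inf \<Omega>" "\<And>n. W1p_norm \<Omega> p (\<lambda>x. z x - \<phi> n x) < ((1/2)^n) powr (1/p)"
    by metis
  have sm: "smooth_on (\<phi> n) UNIV" for n using \<phi>(1)[of n] by (simp add: Cc_inf_def)
  have m\<phi>: "\<phi> n \<in> borel_measurable (lebesgue_on \<Omega>)" "grad (\<phi> n) \<in> borel_measurable (lebesgue_on \<Omega>)" for n
    using test_measurable[OF \<Omega> \<phi>(1)] measurable_restrict_space1 by blast+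
  have mz: "z \<in> borel_measurable (lebesgue_on \<Omega>)" "Z \<in> borel_measurable (lebesgue_on \<Omega>)"
    using has_weak_grad_measurable[OF \<Omega> Z] .
  have ip: "integrable (lebesgue_on \<Omega>) (\<lambda>x. norm (\<phi> n x) powr p)" "integrable (lebesgue_on \<Omega>) (\<lambda>x. norm (grad (\<phi> n) x) powr p)" for n
  proof -
    obtain K where K: "compact K" "K \<subseteq> \<Omega>" and \<phi>0: "\<And>x. x \<notin> K \<Longrightarrow> \<phi> n x = 0" "\<And>x. x \<notin> K \<Longrightarrow> grad (\<phi> n) x = 0"
      using Cc_infE[OF \<phi>(1)[of n]] by metis
    show "integrable (lebesgue_on \<Omega>) (\<lambda>x. norm (\<phi> n x) powr p)"
      by (rule test_powr_integrable[OF \<Omega> smooth_onD(3)[OF sm] K(1) \<phi>0(1) p0])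
    show "integrable (lebesgue_on \<Omega>) (\<lambda>x. norm (grad (\<phi> n) x) powr p)"
      by (rule test_powr_integrable[OF \<Omega> smooth_onD(2)[OF sm] K(1) \<phi>0(2) p0])
  qed
  have id: "integrable (lebesgue_on \<Omega>) (\<lambda>x. norm (\<phi> n x - z x) powr p)" "integrable (lebesgue_on \<Omega>) (\<lambda>x. norm (grad (\<phi> n) x - Z x) powr p)" for n
  proof -
    have i: "integrable (lebesgue_on \<Omega>) (\<lambda>x. norm (z x) powr p)" "integrable (lebesgue_on \<Omega>) (\<lambda>x. norm (Z x) powr p)"
      using zL ZL by (auto simp: Lp_def)
    show "integrable (lebesgue_on \<Omega>) (\<lambda>x. norm (\<phi> n x - z x) powr p)"
      by (rule integrable_powr_diff[OF m\<phi>(1) mz(1) p0 ip(1) i(1)])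
    show "integrable (lebesgue_on \<Omega>) (\<lambda>x. norm (grad (\<phi> n) x - Z x) powr p)"
      by (rule integrable_powr_diff[OF m\<phi>(2) mz(2) p0 ip(2) i(2)])
  qed
  have small: "(\<integral>x. norm (\<phi> n x - z x) powr p \<partial>lebesgue_on \<Omega>) \<le> (1/2)^n"
     "(\<integral>x. norm (grad (\<phi> n) x - Z x) powr p \<partial>lebesgue_on \<Omega>) \<le> (1/2)^n" for n
  proof -
    note wd = has_weak_grad_diff[OF \<Omega> Z has_weak_grad_smooth[OF \<Omega> sm[of n]]]
    let ?A = "\<integral>x. norm (z x - \<phi> n x) powr p \<partial>lebesgue_on \<Omega>"
    let ?B = "\<integral>x. norm (weak_grad \<Omega> (\<lambda>x. z x - \<phi> n x) x) powr p \<partial>lebesgue_on \<Omega>"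
    have AB: "?A \<ge> 0" "?B \<ge> 0" by (auto intro!: integral_nonneg_AE)
    have "?A + ?B \<le> (1/2)^n"
    proof (rule ccontr)
      assume "\<not> ?A + ?B \<le> (1/2)^n"
      then have "((1/2)^n) powr (1/p) \<le> (?A + ?B) powr (1/p)" using p by (intro powr_mono2) auto
      then show False using \<phi>(2)[of n] by (simp add: W1p_norm_def)
    qed
    moreover have "(\<integral>x. norm (grad (\<phi> n) x - Z x) powr p \<partial>lebesgue_on \<Omega>) = ?B"
    proof (rule integral_cong_AE)
      have "AE x in lebesgue_on \<Omega>. weak_grad \<Omega> (\<lambda>x. z x - \<phi> n x) x = Z x - grad (\<phi> n) x"
        using weak_grad_AE_eq[OF \<Omega> wd] \<Omega> by (simp add: AE_lebesgue_on)
      then show "AE x in lebesgue_on \<Omega>. norm (grad (\<phi> n) x - Z x) powr p = norm (weak_grad \<Omega> (\<lambda>x. z x - \<phi> n x) x) powr p"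
        by eventually_elim (simp add: norm_minus_commute)
      have mw: "weak_grad \<Omega> (\<lambda>x. z x - \<phi> n x) \<in> borel_measurable (lebesgue_on \<Omega>)"
        by (rule has_weak_grad_measurable(2)[OF \<Omega> weak_grad_has_weak_grad[OF wd]])
      then show "(\<lambda>x. norm (weak_grad \<Omega> (\<lambda>x. z x - \<phi> n x) x) powr p) \<in> borel_measurable (lebesgue_on \<Omega>)" by measurable
    qed (use id(2) in auto)
    moreover have "(\<integral>x. norm (\<phi> n x - z x) powr p \<partial>lebesgue_on \<Omega>) = ?A"
      by (intro Bochner_Integration.integral_cong refl) (simp add: abs_minus_commute)
    ultimately show "(\<integral>x. norm (\<phi> n x - z x) powr p \<partial>lebesgue_on \<Omega>) \<le> (1/2)^n"
      "(\<integral>x. norm (grad (\<phi> n) x - Z x) powr p \<partial>lebesgue_on \<Omega>) \<le> (1/2)^n" using AB by linarith+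
  qed
  have fin: "(\<Sum>n. \<integral>\<^sup>+x. ennreal (F n x) \<partial>lebesgue_on \<Omega>) < \<infinity>"
    if "\<And>n. integrable (lebesgue_on \<Omega>) (F n)" "\<And>n x. 0 \<le> F n x" "\<And>n. (\<integral>x. F n x \<partial>lebesgue_on \<Omega>) \<le> (1/2)^n" for F :: "nat \<Rightarrow> 'a \<Rightarrow> real"
  proof -
    have "(\<Sum>n. \<integral>\<^sup>+x. ennreal (F n x) \<partial>lebesgue_on \<Omega>) \<le> (\<Sum>n. ennreal ((1/2)^n))"
      using that by (intro suminf_le) (auto simp: nn_integral_eq_integral intro!: ennreal_leI)
    also have "\<dots> = ennreal (\<Sum>n. (1/2)^n)" by (intro suminf_ennreal2) (auto intro: summable_geometric)
    also have "\<dots> < \<infinity>" by simp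
    finally show ?thesis .
  qed
  have md: "(\<lambda>x. \<phi> n x - z x) \<in> borel_measurable (lebesgue_on \<Omega>)" "(\<lambda>x. grad (\<phi> n) x - Z x) \<in> borel_measurable (lebesgue_on \<Omega>)" for n
    using m\<phi> mz by (auto intro: borel_measurable_diff)
  obtain S0 where S0: "AE x in lebesgue_on \<Omega>. (\<lambda>n. \<phi> n x - z x) \<longlonglongrightarrow> 0"
    by (rule summable_powr_imp_dominated[where f = "\<lambda>n x. \<phi> n x - z x", OF md(1) fin[OF id(1) _ small(1)] p0]) auto
  obtain S where S: "integrable (lebesgue_on \<Omega>) S" "AE x in lebesgue_on \<Omega>. \<forall>n. norm (grad (\<phi> n) x - Z x) powr p \<le> S x"
     "AE x in lebesgue_on \<Omega>. (\<lambda>n. grad (\<phi> n) x - Z x) \<longlonglongrightarrow> 0"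
    by (rule summable_powr_imp_dominated[where f = "\<lambda>n x. grad (\<phi> n) x - Z x", OF md(2) fin[OF id(2) _ small(2)] p0]) auto
  have "AE x in lebesgue_on \<Omega>. (\<forall>n. norm (grad (\<phi> n) x - Z x) powr p \<le> S x) \<and> (\<lambda>n. \<phi> n x) \<longlonglongrightarrow> z x \<and> (\<lambda>n. grad (\<phi> n) x) \<longlonglongrightarrow> Z x"
    using S(2,3) S0 by eventually_elim (simp add: LIM_zero_iff)
  then show ?thesis using \<phi>(1) S(1) by blast
qed

text \<open>Take \<open>zn = min z (\<phi>n^+)\<close> for a fast approximating sequence \<open>\<phi>n\<close>. Where \<open>z > 0\<close> the gradient of \<open>zn\<close> is
eventually one of \<open>\<nabla>\<phi>n\<close> and \<open>\<nabla>z\<close>; where \<open>z = 0\<close> both \<open>zn\<close> and its gradient vanish.\<close>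

lemma truncations_exist:
  fixes \<Omega> :: "'a::euclidean_space set"
  assumes \<Omega>: "open \<Omega>" and p: "p \<ge> 1" and z: "z \<in> W1p_0 \<Omega> p" and Z: "has_weak_grad \<Omega> z Z"
    and z0: "\<And>x. 0 \<le> z x" and Z0: "\<And>x. z x = 0 \<Longrightarrow> Z x = 0"
  shows "\<exists>zn Zn K M S. truncations \<Omega> p z Z zn Zn K M S"
proof -
  have p0: "p > 0" using p by simp
  have zW: "z \<in> W1p \<Omega> p" using z by (simp add: W1p_0_def)
  note ZL = W1p_Lp[OF \<Omega> p0 zW Z]
  obtain \<phi> S where \<phi>: "\<And>n::nat. \<phi> n \<in> Cc_inf \<Omega>" and S: "integrable (lebesgue_on \<Omega>) S"
    and ae: "AE x in lebesgue_on \<Omega>. (\<forall>n. norm (grad (\<phi> n) x - Z x) powr p \<le> S x) \<and> (\<lambda>n. \<phi> n x) \<longlonglongrightarrow> z x \<and> (\<lambda>n. grad (\<phi> n) x) \<longlonglongrightarrow> Z x"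
    using W1p_0_fast_approximation[OF \<Omega> p z Z] by blast
  have "\<exists>K M. compact K \<and> K \<subseteq> \<Omega> \<and> (\<forall>x. x \<notin> K \<longrightarrow> \<phi> n x = 0 \<and> grad (\<phi> n) x = 0) \<and> 0 < M \<and> (\<forall>x. \<phi> n x \<le> M)" for n
  proof -
    obtain K where K: "compact K" "K \<subseteq> \<Omega>" and \<phi>0: "\<And>x. x \<notin> K \<Longrightarrow> \<phi> n x = 0" "\<And>x. x \<notin> K \<Longrightarrow> grad (\<phi> n) x = 0"
      and sm: "smooth_on (\<phi> n) UNIV" using Cc_infE[OF \<phi>(1)[of n]] by metis
    obtain B where B: "B > 0" "\<And>x. norm (\<phi> n x) \<le> B"
      by (rule bounded_compact_support[OF smooth_onD(3)[OF sm] K(1) \<phi>0(1)]) auto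
    have "\<phi> n x \<le> B" for x using B(2)[of x] by simp
    then show ?thesis using K \<phi>0 B(1) by blast
  qed
  then obtain K M where K: "\<And>n. compact (K n)" "\<And>n. K n \<subseteq> \<Omega>" "\<And>n x. x \<notin> K n \<Longrightarrow> \<phi> n x = 0" "\<And>n x. x \<notin> K n \<Longrightarrow> grad (\<phi> n) x = 0"
    and M: "\<And>n. 0 < M n" "\<And>n x. \<phi> n x \<le> M n" by metis
  define zn where "zn n x = min (z x) (max (\<phi> n x) 0)" for n x
  define P where "P n x = (if \<phi> n x > 0 then grad (\<phi> n) x else 0)" for n x
  define Zn where "Zn n x = (if z x > max (\<phi> n x) 0 then P n x else Z x)" for n x
  have wg: "has_weak_grad \<Omega> (zn n) (Zn n)" for n
  proof -
    have "smooth_on (\<phi> n) UNIV" using \<phi>(1)[of n] by (simp add: Cc_inf_def)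
    from has_weak_grad_min[OF \<Omega> Z has_weak_grad_pos_part[OF \<Omega> has_weak_grad_smooth[OF \<Omega> this]]]
    show ?thesis unfolding zn_def[abs_def] Zn_def[abs_def] P_def .
  qed
  have bnd: "norm (Zn n x) \<le> norm (grad (\<phi> n) x) + norm (Z x)" for n x by (simp add: Zn_def P_def)
  have out: "zn n x = 0 \<and> Zn n x = 0" if "x \<notin> K n" for n x
    using K(3,4)[OF that] z0[of x] Z0[of x] by (auto simp: zn_def Zn_def P_def)
  have rng: "0 \<le> zn n x \<and> zn n x \<le> z x \<and> zn n x \<le> M n" for n x
    using z0[of x] M(1)[of n] M(2)[of n x] by (auto simp: zn_def)
  (* The gradient of zn is bounded by the sum of the norms of grad (phi n) and Z, and grad (phi n)
     differs from Z by at most S in p-th power. *)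
  define S' where "S' x = 2 powr p * (2 powr p * (S x + norm (Z x) powr p) + norm (Z x) powr p)" for x
  have iZ: "integrable (lebesgue_on \<Omega>) (\<lambda>x. norm (Z x) powr p)" using ZL by (simp add: Lp_def)
  have S': "integrable (lebesgue_on \<Omega>) S'" unfolding S'_def
    using S iZ by (intro integrable_mult_right Bochner_Integration.integrable_add)
  have ae': "AE x in lebesgue_on \<Omega>. (\<forall>n. norm (Zn n x) powr p \<le> S' x) \<and> (\<lambda>n. zn n x) \<longlonglongrightarrow> z x \<and> (\<lambda>n. Zn n x) \<longlonglongrightarrow> Z x"
    using ae
  proof eventually_elim
    case (elim x)
    have 1: "norm (Zn n x) powr p \<le> S' x" for n
    proof -
      have "norm (grad (\<phi> n) x) powr p = norm ((grad (\<phi> n) x - Z x) - (- Z x)) powr p" by simp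
      also have "\<dots> \<le> 2 powr p * (norm (grad (\<phi> n) x - Z x) powr p + norm (- Z x) powr p)"
        by (rule norm_diff_powr_le[OF p0])
      also have "\<dots> \<le> 2 powr p * (S x + norm (Z x) powr p)" using elim by (intro mult_left_mono) auto
      finally have g: "norm (grad (\<phi> n) x) powr p \<le> 2 powr p * (S x + norm (Z x) powr p)" .
      have "norm (Zn n x) powr p \<le> (norm (grad (\<phi> n) x) + norm (Z x)) powr p"
        using bnd p0 by (intro powr_mono2) auto
      also have "\<dots> \<le> 2 powr p * (norm (grad (\<phi> n) x) powr p + norm (Z x) powr p)"
        using p0 by (intro powr_add_le) auto
      also have "\<dots> \<le> S' x" unfolding S'_def using g by (intro mult_left_mono) auto
      finally show ?thesis .
    qed
    have "(\<lambda>n. zn n x) \<longlonglongrightarrow> min (z x) (max (z x) 0)"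
      unfolding zn_def using elim by (intro tendsto_min tendsto_max tendsto_const) auto
    then have 2: "(\<lambda>n. zn n x) \<longlonglongrightarrow> z x" using z0[of x] by (simp add: min_def max_def)
    have 3: "(\<lambda>n. Zn n x) \<longlonglongrightarrow> Z x"
    proof (cases "z x = 0")
      case True
      then show ?thesis by (simp add: Zn_def)
    next
      case False
      then have "z x > 0" using z0[of x] by simp
      then have ev: "\<forall>\<^sub>F n in sequentially. \<phi> n x > 0" using elim order_tendstoD(1) by blast
      have "(\<lambda>n. grad (\<phi> n) x - Z x) \<longlonglongrightarrow> 0" using elim LIM_zero by blast
      then have "(\<lambda>n. Zn n x - Z x) \<longlonglongrightarrow> 0"
      proof (rule Lim_transform_bound[rotated])
        show "\<forall>\<^sub>F n in sequentially. norm (Zn n x - Z x) \<le> norm (grad (\<phi> n) x - Z x)"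
          using ev by eventually_elim (simp add: Zn_def P_def)
      qed
      then show ?thesis by (simp add: LIM_zero_iff)
    qed
    show ?case using 1 2 3 by blast
  qed
  have ZnL: "Zn n \<in> Lp_loc \<Omega> p" for n
  proof (rule Lp_imp_Lp_loc[OF \<Omega>])
    have m: "Zn n \<in> borel_measurable (lebesgue_on \<Omega>)" by (rule has_weak_grad_measurable(2)[OF \<Omega> wg])
    have "integrable (lebesgue_on \<Omega>) (\<lambda>x. norm (Zn n x) powr p)"
    proof (rule Bochner_Integration.integrable_bound[OF S'])
      show "(\<lambda>x. norm (Zn n x) powr p) \<in> borel_measurable (lebesgue_on \<Omega>)" using m by measurable
      show "AE x in lebesgue_on \<Omega>. norm (norm (Zn n x) powr p) \<le> norm (S' x)"
        using ae' by eventually_elim (auto intro: order_trans[OF _ abs_ge_self])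
    qed
    then show "Zn n \<in> Lp \<Omega> p" using m by (simp add: Lp_def)
  qed
  have "truncations \<Omega> p z Z zn Zn K M S'"
    unfolding truncations_def by (intro conjI allI impI wg ZnL K(1,2) M(1) S' ae') (use out rng in auto)
  then show ?thesis by blast
qed

section \<open>Test functions built from a ratio, and Picone's inequality\<close>

lemma has_derivative_powr_mult:
  fixes s t :: real
  assumes "s > 0" "t > 0"
  shows "((\<lambda>z. fst z powr \<alpha> * snd z powr \<gamma>) has_derivative
    (\<lambda>z. \<alpha> * s powr (\<alpha> - 1) * t powr \<gamma> * fst z + \<gamma> * s powr \<alpha> * t powr (\<gamma> - 1) * snd z)) (at (s, t))"
proof -
  have f: "(fst has_derivative fst) (at (s, t))" "(snd has_derivative snd) (at (s, t))"
    by (rule bounded_linear_imp_has_derivative[OF bounded_linear_fst] bounded_linear_imp_has_derivative[OF bounded_linear_snd])+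
  have d: "((\<lambda>x. x powr \<alpha>) has_derivative (*) (\<alpha> * s powr (\<alpha> - 1))) (at (fst (s, t)))"
    "((\<lambda>x. x powr \<gamma>) has_derivative (*) (\<gamma> * t powr (\<gamma> - 1))) (at (snd (s, t)))"
    using has_real_derivative_powr[OF assms(1)] has_real_derivative_powr[OF assms(2)]
    by (simp_all add: has_field_derivative_def)
  show ?thesis
    by (rule has_derivative_eq_rhs[OF has_derivative_mult[OF has_derivative_compose[OF f(1) d(1)] has_derivative_compose[OF f(2) d(2)]]])
      (auto simp: algebra_simps)
qed

lemma cone_closed_convex:
  fixes c k L :: real
  defines "C \<equiv> {z :: real \<times> real. c \<le> snd z \<and> k * snd z \<le> fst z \<and> fst z \<le> L * snd z}"
  shows "closed C" "convex C"
proof -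
  show "closed C" unfolding C_def by (intro closed_Collect_conj closed_Collect_le continuous_intros)
  show "convex C"
  proof (rule convexI)
    fix x y :: "real \<times> real" and u v :: real
    assume x: "x \<in> C" and y: "y \<in> C" and uv: "0 \<le> u" "0 \<le> v" "u + v = 1"
    have "u * c + v * c \<le> u * snd x + v * snd y"
      using x y uv by (intro add_mono mult_left_mono) (auto simp: C_def)
    moreover have "u * c + v * c = c" using uv(3) by (metis distrib_right mult_1)
    moreover have "u * (k * snd x) + v * (k * snd y) \<le> u * fst x + v * fst y"
      using x y uv by (intro add_mono mult_left_mono) (auto simp: C_def)
    moreover have "u * fst x + v * fst y \<le> u * (L * snd x) + v * (L * snd y)"
      using x y uv by (intro add_mono mult_left_mono) (auto simp: C_def)
    ultimately show "u *\<^sub>R x + v *\<^sub>R y \<in> C" by (simp add: C_def algebra_simps)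
  qed
qed

text \<open>Let \<open>m = max z (k w)\<close>. The function in question is \<open>F(m, w)\<close>, since \<open>F\<close> vanishes on the ray \<open>s = k t\<close>; the
second vanishing condition says the same for the gradient. On a compact set \<open>w \<ge> c > 0\<close> and
\<open>z \<le> M \<le> (M/c) w\<close>, so \<open>(m, w)\<close> takes values in a closed convex cone on which the ratio \<open>m/w\<close> is bounded
above and below. The partial derivatives of \<open>F\<close>, being functions of the ratio, are bounded there.\<close>

lemma truncated_ratio_chain_rule:
  fixes \<Omega> :: "'a::euclidean_space set"
  assumes \<Omega>: "open \<Omega>" and w: "has_weak_grad \<Omega> w W" "locally_positive \<Omega> w"
    and z: "has_weak_grad \<Omega> z Z" "\<And>x. z x \<le> M" and k: "k > 0"
    and der: "\<And>s t. 0 < s \<Longrightarrow> 0 < t \<Longrightarrow>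
      ((\<lambda>z. F (fst z) (snd z)) has_derivative (\<lambda>z. Fs (s / t) * fst z + Ft (s / t) * snd z)) (at (s, t))"
    and cont: "continuous_on {0<..} Fs" "continuous_on {0<..} Ft"
    and meas: "(\<lambda>z. F (fst z) (snd z)) \<in> borel_measurable borel" "Fs \<in> borel_measurable borel" "Ft \<in> borel_measurable borel"
    and vanish: "\<And>t. 0 < t \<Longrightarrow> F (k * t) t = 0" "Fs k * k + Ft k = 0"
  defines "P \<equiv> \<lambda>x. 0 < w x \<and> k * w x < z x"
  shows "has_weak_grad \<Omega> (\<lambda>x. if P x then F (z x) (w x) else 0)
     (\<lambda>x. if P x then Fs (z x / w x) *\<^sub>R Z x + Ft (z x / w x) *\<^sub>R W x else 0)"
    "\<And>p. p > 0 \<Longrightarrow> Z \<in> Lp_loc \<Omega> p \<Longrightarrow> W \<in> Lp_loc \<Omega> p \<Longrightarrow>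
      (\<lambda>x. if P x then Fs (z x / w x) *\<^sub>R Z x + Ft (z x / w x) *\<^sub>R W x else 0) \<in> Lp_loc \<Omega> p"
proof -
  define m where "m x = max (z x) (k * w x)" for x
  define Mg where "Mg x = (if z x > k * w x then Z x else k *\<^sub>R W x)" for x
  have m: "has_weak_grad \<Omega> m Mg"
    using has_weak_grad_max[OF \<Omega> z(1) has_weak_grad_scale[OF \<Omega> w(1)]] unfolding m_def[abs_def] Mg_def[abs_def] .
  note [measurable] = has_weak_grad_measurable[OF \<Omega> w(1)] has_weak_grad_measurable[OF \<Omega> z(1)] has_weak_grad_measurable[OF \<Omega> m]
  have Fm: "(\<lambda>x. F (f x) (g x)) \<in> borel_measurable M" if "f \<in> borel_measurable M" "g \<in> borel_measurable M" for f g :: "'a \<Rightarrow> real" and M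
  proof -
    have "(\<lambda>x. (f x, g x)) \<in> M \<rightarrow>\<^sub>M borel" using that by (rule borel_measurable_Pair)
    from measurable_compose[OF this meas(1)] show ?thesis by simp
  qed
  note [measurable] = meas(2,3) Fm
  have pos: "AE x in lebesgue. x \<in> \<Omega> \<longrightarrow> 0 < w x" by (rule locally_positive_AE[OF \<Omega> w(2)])
  have bounded_on: "\<exists>L. \<forall>q. k \<le> q \<and> q \<le> L0 \<longrightarrow> \<bar>Fs q\<bar> \<le> L \<and> \<bar>Ft q\<bar> \<le> L" for L0
  proof -
    have sub: "{k..L0} \<subseteq> {0<..}" using k by auto
    have b: "bounded (Fs ` {k..L0})" "bounded (Ft ` {k..L0})"
      by (intro compact_imp_bounded compact_continuous_image continuous_on_subset[OF cont(1) sub] continuous_on_subset[OF cont(2) sub] compact_Icc)+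
    obtain b1 where b1: "\<forall>y\<in>Fs ` {k..L0}. norm y \<le> b1" using b(1) unfolding bounded_iff by blast
    obtain b2 where b2: "\<forall>y\<in>Ft ` {k..L0}. norm y \<le> b2" using b(2) unfolding bounded_iff by blast
    show ?thesis
    proof (intro exI[of _ "max b1 b2"] allI impI)
      fix q assume "k \<le> q \<and> q \<le> L0"
      then have "norm (Fs q) \<le> b1" "norm (Ft q) \<le> b2" using b1 b2 by auto
      then show "\<bar>Fs q\<bar> \<le> max b1 b2 \<and> \<bar>Ft q\<bar> \<le> max b1 b2" by auto
    qed
  qed
  have local: "\<exists>c L0. c > 0 \<and> k \<le> L0 \<and> (AE x in lebesgue. x \<in> K \<longrightarrow> c \<le> w x \<and> z x \<le> L0 * w x)" if K: "compact K" "K \<subseteq> \<Omega>" for K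
  proof -
    obtain c where c: "c > 0" "AE x in lebesgue. x \<in> K \<longrightarrow> c \<le> w x" by (rule locally_positive_compact[OF w(2) K])
    (* The maximum with k keeps the ratio k of the points where z is at most k w inside the cone. *)
    define L0 where "L0 = max k (M / c)"
    have "AE x in lebesgue. x \<in> K \<longrightarrow> c \<le> w x \<and> z x \<le> L0 * w x"
      using c(2)
    proof eventually_elim
      case (elim x)
      have "z x \<le> L0 * w x" if cw: "c \<le> w x"
      proof -
        have "z x \<le> M" by (rule z(2))
        also have "\<dots> = (M / c) * c" using c(1) by simp
        also have "\<dots> \<le> L0 * c" using c(1) by (intro mult_right_mono) (auto simp: L0_def)
        also have "\<dots> \<le> L0 * w x" using cw k by (intro mult_left_mono) (auto simp: L0_def)
        finally show ?thesis .
      qed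
      then show ?case using elim by blast
    qed
    then show ?thesis using c(1) by (intro exI[of _ c] exI[of _ L0]) (auto simp: L0_def)
  qed
  let ?S = "{z :: real \<times> real. 0 < fst z \<and> 0 < snd z}"
  have chain: "has_weak_grad \<Omega> (\<lambda>x. F (m x) (w x)) (\<lambda>x. Fs (m x / w x) *\<^sub>R Mg x + Ft (m x / w x) *\<^sub>R W x)"
  proof (rule has_weak_grad_chain_rule[OF \<Omega> m w(1), where S = ?S and F = F and Fs = "\<lambda>s t. Fs (s / t)" and Ft = "\<lambda>s t. Ft (s / t)"])
    fix s t :: real assume "(s, t) \<in> ?S"
    then show "((\<lambda>z. F (fst z) (snd z)) has_derivative (\<lambda>z. Fs (s / t) * fst z + Ft (s / t) * snd z)) (at (s, t))"
      using der by simp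
  next
    have q: "continuous_on ?S (\<lambda>z. fst z / snd z)" by (intro continuous_intros) auto
    show "continuous_on ?S (\<lambda>z. Fs (fst z / snd z))" "continuous_on ?S (\<lambda>z. Ft (fst z / snd z))"
      by (rule continuous_on_compose2[OF cont(1) q] continuous_on_compose2[OF cont(2) q]; auto)+
  next
    fix K assume K: "compact K" "K \<subseteq> \<Omega>"
    obtain c L0 where cL: "c > 0" "k \<le> L0" "AE x in lebesgue. x \<in> K \<longrightarrow> c \<le> w x \<and> z x \<le> L0 * w x" using local[OF K] by blast
    obtain L where L: "\<forall>q. k \<le> q \<and> q \<le> L0 \<longrightarrow> \<bar>Fs q\<bar> \<le> L \<and> \<bar>Ft q\<bar> \<le> L" using bounded_on by blast
    let ?C = "{z :: real \<times> real. c \<le> snd z \<and> k * snd z \<le> fst z \<and> fst z \<le> L0 * snd z}"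
    have ne: "(k * c, c) \<in> ?C" using cL by (simp add: mult_right_mono)
    have sub: "?C \<subseteq> ?S"
    proof
      fix y assume y: "y \<in> ?C"
      then have "0 < k * snd y" using k cL(1) by simp
      then show "y \<in> ?S" using y cL(1) by auto
    qed
    have bd: "\<bar>Fs (s / t)\<bar> \<le> L \<and> \<bar>Ft (s / t)\<bar> \<le> L" if "(s, t) \<in> ?C" for s t
    proof -
      have "t > 0" using that cL(1) by auto
      then have "k \<le> s / t" "s / t \<le> L0" using that by (auto simp: divide_simps)
      then show ?thesis using L by blast
    qed
    have ae: "AE x in lebesgue. x \<in> K \<longrightarrow> (m x, w x) \<in> ?C"
      using cL(3)
    proof eventually_elim
      case (elim x)
      show ?case
      proof
        assume "x \<in> K"
        then have x: "c \<le> w x" "z x \<le> L0 * w x" using elim by auto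
        then have "k * w x \<le> L0 * w x" using cL by (intro mult_right_mono) auto
        then show "(m x, w x) \<in> ?C" using x by (simp add: m_def)
      qed
    qed
    show "\<exists>C L. closed C \<and> convex C \<and> C \<noteq> {} \<and> C \<subseteq> ?S \<and>
       (\<forall>s t. (s, t) \<in> C \<longrightarrow> \<bar>Fs (s / t)\<bar> \<le> L \<and> \<bar>Ft (s / t)\<bar> \<le> L) \<and> (AE x in lebesgue. x \<in> K \<longrightarrow> (m x, w x) \<in> C)"
      by (rule exI[of _ ?C], rule exI[of _ L]) (use cone_closed_convex[of c k L0] ne sub bd ae in blast)
  qed measurable
  let ?G = "\<lambda>x. if P x then Fs (z x / w x) *\<^sub>R Z x + Ft (z x / w x) *\<^sub>R W x else 0"
  have mG: "?G \<in> borel_measurable (lebesgue_on \<Omega>)" unfolding P_def by measurable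
  have mF: "(\<lambda>x. if P x then F (z x) (w x) else 0) \<in> borel_measurable (lebesgue_on \<Omega>)" unfolding P_def by measurable
  show "has_weak_grad \<Omega> (\<lambda>x. if P x then F (z x) (w x) else 0) ?G"
  proof (rule has_weak_grad_cong_AE[OF \<Omega> chain mF mG])
    show "AE x in lebesgue. x \<in> \<Omega> \<longrightarrow> (if P x then F (z x) (w x) else 0) = F (m x) (w x) \<and>
        ?G x = Fs (m x / w x) *\<^sub>R Mg x + Ft (m x / w x) *\<^sub>R W x"
      using pos
    proof eventually_elim
      case (elim x)
      show ?case
      proof
        assume "x \<in> \<Omega>"
        then have wx: "0 < w x" using elim by blast
        show "(if P x then F (z x) (w x) else 0) = F (m x) (w x) \<and> ?G x = Fs (m x / w x) *\<^sub>R Mg x + Ft (m x / w x) *\<^sub>R W x"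
        proof (cases "k * w x < z x")
          case True
          then have "m x = z x" "Mg x = Z x" "P x" using wx by (auto simp: m_def Mg_def P_def)
          then show ?thesis by simp
        next
          case False
          then have mm: "m x = k * w x" "Mg x = k *\<^sub>R W x" "\<not> P x" using wx by (auto simp: m_def Mg_def P_def)
          have "Fs k *\<^sub>R (k *\<^sub>R W x) + Ft k *\<^sub>R W x = (Fs k * k + Ft k) *\<^sub>R W x" by (simp add: scaleR_add_left)
          then show ?thesis using mm vanish wx by simp
        qed
      qed
    qed
  qed
  show "?G \<in> Lp_loc \<Omega> p" if p: "p > 0" and ZW: "Z \<in> Lp_loc \<Omega> p" "W \<in> Lp_loc \<Omega> p" for p
  proof (rule Lp_loc_combination[OF \<Omega> p ZW mG])
    fix K assume K: "compact K" "K \<subseteq> \<Omega>"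
    obtain c L0 where cL: "c > 0" "k \<le> L0" "AE x in lebesgue. x \<in> K \<longrightarrow> c \<le> w x \<and> z x \<le> L0 * w x" using local[OF K] by blast
    obtain L where L: "\<forall>q. k \<le> q \<and> q \<le> L0 \<longrightarrow> \<bar>Fs q\<bar> \<le> L \<and> \<bar>Ft q\<bar> \<le> L" using bounded_on by blast
    have L0: "L \<ge> 0" using L cL(2) by force
    have "AE x in lebesgue. x \<in> K \<longrightarrow> norm (?G x) \<le> L * norm (Z x) + L * norm (W x)"
      using cL(3)
    proof eventually_elim
      case (elim x)
      show ?case
      proof
        assume x: "x \<in> K"
        show "norm (?G x) \<le> L * norm (Z x) + L * norm (W x)"
        proof (cases "P x")
          case True
          then have "k \<le> z x / w x" "z x / w x \<le> L0" using elim x by (auto simp: P_def divide_simps)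
          then have b: "\<bar>Fs (z x / w x)\<bar> \<le> L" "\<bar>Ft (z x / w x)\<bar> \<le> L" using L by auto
          have "norm (?G x) \<le> \<bar>Fs (z x / w x)\<bar> * norm (Z x) + \<bar>Ft (z x / w x)\<bar> * norm (W x)"
            using True norm_triangle_ineq[of "Fs (z x / w x) *\<^sub>R Z x" "Ft (z x / w x) *\<^sub>R W x"] by simp
          also have "\<dots> \<le> L * norm (Z x) + L * norm (W x)" using b by (intro add_mono mult_right_mono) auto
          finally show ?thesis .
        next
          case False then show ?thesis using L0 by simp
        qed
      qed
    qed
    then show "\<exists>A\<ge>0. AE x in lebesgue. x \<in> K \<longrightarrow> norm (?G x) \<le> A * norm (Z x) + A * norm (W x)" using L0 by blast
  qed
qed

text \<open>Picone's inequality with \<open>s = z/w\<close>: the vector paired with the flux is the gradient of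
\<open>z^p / w^(p-1) - k^p w\<close>. Young's inequality is applied to \<open>s |W|\<close> and \<open>|Z|\<close>.\<close>

lemma picone_super:
  fixes W Z :: "'a::euclidean_space"
  assumes p: "p > 1" and s: "s \<ge> 0"
  shows "flux p W \<bullet> ((p * s powr (p - 1)) *\<^sub>R Z - ((p - 1) * s powr p + k powr p) *\<^sub>R W) \<le> norm Z powr p - k powr p * norm W powr p"
proof -
  have "flux p W \<bullet> Z \<le> norm W powr (p - 1) * norm Z" using flux_inner_le[OF p, of W Z] by linarith
  then have "(p * s powr (p - 1)) * (flux p W \<bullet> Z) \<le> (p * s powr (p - 1)) * (norm W powr (p - 1) * norm Z)"
    using p by (intro mult_left_mono) auto
  also have "\<dots> = p * (s * norm W) powr (p - 1) * norm Z" using s by (simp add: powr_mult)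
  also have "\<dots> \<le> (p - 1) * (s * norm W) powr p + norm Z powr p" using s p by (intro young_powr) auto
  also have "\<dots> = (p - 1) * s powr p * norm W powr p + norm Z powr p" using s by (simp add: powr_mult)
  finally show ?thesis using p by (simp add: inner_diff_right flux_inner_self algebra_simps)
qed

text \<open>Picone's inequality with \<open>s = w/z\<close>, for the gradient of \<open>z - w^p / z^(p-1)\<close>. The flux is that of \<open>V\<close> whereas
the test function has the gradient \<open>Z\<close> of a truncation; the last term on the left accounts for the difference.\<close>

lemma picone_sub:
  fixes V W Z :: "'a::euclidean_space"
  assumes p: "p > 1" and s: "s \<ge> 0" "s \<le> 1"
  shows "norm V powr p - norm W powr p - p * norm V powr (p - 1) * norm (Z - V)
    \<le> flux p V \<bullet> ((1 + (p - 1) * s powr p) *\<^sub>R Z - (p * s powr (p - 1)) *\<^sub>R W)"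
proof -
  have "flux p V \<bullet> W \<le> norm V powr (p - 1) * norm W" using flux_inner_le[OF p, of V W] by linarith
  then have "(p * s powr (p - 1)) * (flux p V \<bullet> W) \<le> (p * s powr (p - 1)) * (norm V powr (p - 1) * norm W)"
    using p by (intro mult_left_mono) auto
  also have "\<dots> = p * (s * norm V) powr (p - 1) * norm W" using s by (simp add: powr_mult)
  also have "\<dots> \<le> (p - 1) * (s * norm V) powr p + norm W powr p" using s p by (intro young_powr) auto
  also have "\<dots> = (p - 1) * s powr p * norm V powr p + norm W powr p" using s by (simp add: powr_mult)
  finally have 1: "(p * s powr (p - 1)) * (flux p V \<bullet> W) \<le> (p - 1) * s powr p * norm V powr p + norm W powr p" .
  have c: "0 \<le> 1 + (p - 1) * s powr p" "1 + (p - 1) * s powr p \<le> p"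
  proof -
    have "s powr p \<le> 1" using s p by (simp add: powr_le1)
    then have "(p - 1) * s powr p \<le> p - 1" using p by (simp add: mult_left_le)
    then show "1 + (p - 1) * s powr p \<le> p" by simp
    show "0 \<le> 1 + (p - 1) * s powr p" using p by (simp add: add_nonneg_nonneg)
  qed
  have "- (flux p V \<bullet> (Z - V)) \<le> norm V powr (p - 1) * norm (Z - V)" using flux_inner_le[OF p, of V "Z - V"] by linarith
  then have "(1 + (p - 1) * s powr p) * - (flux p V \<bullet> (Z - V)) \<le> p * (norm V powr (p - 1) * norm (Z - V))"
    using c p by (intro order_trans[OF mult_left_mono mult_right_mono]) auto
  then have 2: "- ((1 + (p - 1) * s powr p) * (flux p V \<bullet> (Z - V))) \<le> p * norm V powr (p - 1) * norm (Z - V)"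
    by (simp only: mult_minus_right mult.assoc)
  have "flux p V \<bullet> Z = norm V powr p + flux p V \<bullet> (Z - V)"
    using p by (simp add: inner_diff_right flux_inner_self)
  then have "(1 + (p - 1) * s powr p) * (flux p V \<bullet> Z)
      = (1 + (p - 1) * s powr p) * norm V powr p + (1 + (p - 1) * s powr p) * (flux p V \<bullet> (Z - V))"
    using distrib_left by metis
  moreover have "(1 + (p - 1) * s powr p) * norm V powr p = norm V powr p + (p - 1) * s powr p * norm V powr p"
    by (simp only: distrib_right mult_1)
  moreover have "flux p V \<bullet> ((1 + (p - 1) * s powr p) *\<^sub>R Z - (p * s powr (p - 1)) *\<^sub>R W)
     = (1 + (p - 1) * s powr p) * (flux p V \<bullet> Z) - (p * s powr (p - 1)) * (flux p V \<bullet> W)"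
    by (simp only: inner_diff_right inner_scaleR_right)
  ultimately show ?thesis using 1 2 by linarith
qed

lemma powr_ratio_super:
  fixes s t p :: real
  assumes "s > 0" "t > 0"
  shows "p * s powr (p - 1) * t powr (1 - p) = p * (s / t) powr (p - 1)"
    "(1 - p) * s powr p * t powr ((1 - p) - 1) = - ((p - 1) * (s / t) powr p)"
proof -
  have q: "(s / t) powr a = s powr a / t powr a" for a using assms by (simp add: powr_divide)
  have "t powr (1 - p) = inverse (t powr (p - 1))" using powr_minus[of t "p - 1"] by simp
  then show "p * s powr (p - 1) * t powr (1 - p) = p * (s / t) powr (p - 1)"
    unfolding q by (simp add: divide_inverse)
  have "t powr ((1 - p) - 1) = inverse (t powr p)" using powr_minus[of t p] by simp
  then show "(1 - p) * s powr p * t powr ((1 - p) - 1) = - ((p - 1) * (s / t) powr p)"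
    unfolding q by (simp add: divide_inverse algebra_simps)
qed

lemma powr_ratio_sub:
  fixes s t p :: real
  assumes "s > 0" "t > 0"
  shows "(1 - p) * s powr ((1 - p) - 1) * t powr p = - ((p - 1) * (s / t) powr (- p))"
    "p * s powr (1 - p) * t powr (p - 1) = p * (s / t) powr (1 - p)"
proof -
  have q: "(s / t) powr a = s powr a / t powr a" for a using assms by (simp add: powr_divide)
  have "t powr p = inverse (t powr (- p))" using powr_minus[of t "- p"] by simp
  then show "(1 - p) * s powr ((1 - p) - 1) * t powr p = - ((p - 1) * (s / t) powr (- p))"
    unfolding q by (simp add: divide_inverse algebra_simps)
  have "t powr (p - 1) = inverse (t powr (1 - p))" using powr_minus[of t "1 - p"] by simp
  then show "p * s powr (1 - p) * t powr (p - 1) = p * (s / t) powr (1 - p)"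
    unfolding q by (simp add: divide_inverse)
qed

text \<open>The ratio lemma for \<open>F(s,t) = s^p t^(1-p) - k^p t\<close>, which vanishes on \<open>s = k t\<close>; it gives \<open>(z^p - k^p w^p)^+ / w^(p-1)\<close>.\<close>

lemma super_test_function:
  fixes \<Omega> :: "'a::euclidean_space set"
  assumes \<Omega>: "open \<Omega>" and p: "p > 1" and w: "has_weak_grad \<Omega> w W" "locally_positive \<Omega> w"
    and z: "has_weak_grad \<Omega> z Z" "\<And>x. z x \<le> M" and k: "k > 0"
    and L: "Z \<in> Lp_loc \<Omega> p" "W \<in> Lp_loc \<Omega> p"
  defines "G \<equiv> \<lambda>x. if 0 < w x \<and> k * w x < z x
       then (p * (z x / w x) powr (p - 1)) *\<^sub>R Z x - ((p - 1) * (z x / w x) powr p + k powr p) *\<^sub>R W x else 0"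
  shows "has_weak_grad \<Omega> (\<lambda>x. if 0 < w x \<and> k * w x < z x then z x powr p * w x powr (1 - p) - k powr p * w x else 0) G"
    "G \<in> Lp_loc \<Omega> p"
proof -
  have der: "((\<lambda>y. fst y powr p * snd y powr (1 - p) - k powr p * snd y) has_derivative
      (\<lambda>y. p * (s / t) powr (p - 1) * fst y + - ((p - 1) * (s / t) powr p + k powr p) * snd y)) (at (s, t))"
    if "0 < s" "0 < t" for s t :: real
  proof -
    have snd: "((\<lambda>y. k powr p * snd y) has_derivative (\<lambda>y. k powr p * snd y)) (at (s, t))"
      by (intro bounded_linear_imp_has_derivative bounded_linear_mult_right[THEN bounded_linear_compose] bounded_linear_snd)
    show ?thesis
      by (rule has_derivative_eq_rhs[OF has_derivative_diff[OF has_derivative_powr_mult[OF that, of p "1 - p"] snd]])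
        (simp only: powr_ratio_super[OF that] fun_eq_iff, simp add: algebra_simps)
  qed
  have c: "continuous_on {0<..} (\<lambda>q::real. p * q powr (p - 1))" "continuous_on {0<..} (\<lambda>q::real. - ((p - 1) * q powr p + k powr p))"
    by (intro continuous_intros; auto)+
  have v: "(k * t) powr p * t powr (1 - p) - k powr p * t = 0" if "0 < t" for t
  proof -
    have "t powr p * t powr (1 - p) = t" using powr_add[of t p "1 - p"] that by simp
    then show ?thesis using k that by (simp add: powr_mult)
  qed
  have "k powr (p - 1) * k = k powr p" using powr_add[of k "p - 1" 1] k by simp
  then have v2: "p * k powr (p - 1) * k + - ((p - 1) * k powr p + k powr p) = 0"
    by (simp add: mult.assoc) (simp add: algebra_simps)
  have fs: "fst \<in> borel_measurable (borel :: (real \<times> real) measure)" "snd \<in> borel_measurable (borel :: (real \<times> real) measure)"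
    by (intro borel_measurable_continuous_onI continuous_intros)+
  have m: "(\<lambda>y :: real \<times> real. fst y powr p * snd y powr (1 - p) - k powr p * snd y) \<in> borel_measurable borel"
    "(\<lambda>q :: real. p * q powr (p - 1)) \<in> borel_measurable borel"
    "(\<lambda>q :: real. - ((p - 1) * q powr p + k powr p)) \<in> borel_measurable borel"
    by (intro borel_measurable_diff borel_measurable_times powr_real_measurable borel_measurable_const fs) measurable
  note T = truncated_ratio_chain_rule[OF \<Omega> w z k, where F = "\<lambda>s t. s powr p * t powr (1 - p) - k powr p * t"
    and Fs = "\<lambda>q. p * q powr (p - 1)" and Ft = "\<lambda>q. - ((p - 1) * q powr p + k powr p)", OF der c m v v2]
  have G: "G = (\<lambda>x. if 0 < w x \<and> k * w x < z x then (p * (z x / w x) powr (p - 1)) *\<^sub>R Z x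
     + (- ((p - 1) * (z x / w x) powr p + k powr p)) *\<^sub>R W x else 0)"
    unfolding G_def by (rule ext) (simp only: scaleR_minus_left diff_conv_add_uminus)
  show "has_weak_grad \<Omega> (\<lambda>x. if 0 < w x \<and> k * w x < z x then z x powr p * w x powr (1 - p) - k powr p * w x else 0) G"
    unfolding G by (rule T(1))
  show "G \<in> Lp_loc \<Omega> p" unfolding G by (rule T(2)) (use p L in simp_all)
qed

text \<open>The ratio lemma for \<open>F(s,t) = s - t^p s^(1-p)\<close>, which vanishes on \<open>s = t\<close>; it gives \<open>(z^p - w^p)^+ / z^(p-1)\<close>.\<close>

lemma sub_test_function:
  fixes \<Omega> :: "'a::euclidean_space set"
  assumes \<Omega>: "open \<Omega>" and p: "p > 1" and w: "has_weak_grad \<Omega> w W" "locally_positive \<Omega> w"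
    and z: "has_weak_grad \<Omega> z Z" "\<And>x. z x \<le> M"
    and L: "Z \<in> Lp_loc \<Omega> p" "W \<in> Lp_loc \<Omega> p"
  defines "G \<equiv> \<lambda>x. if 0 < w x \<and> w x < z x
       then (1 + (p - 1) * (w x / z x) powr p) *\<^sub>R Z x - (p * (w x / z x) powr (p - 1)) *\<^sub>R W x else 0"
  shows "has_weak_grad \<Omega> (\<lambda>x. if 0 < w x \<and> w x < z x then z x - w x powr p * z x powr (1 - p) else 0) G"
    "G \<in> Lp_loc \<Omega> p"
proof -
  have der: "((\<lambda>y. fst y - snd y powr p * fst y powr (1 - p)) has_derivative
      (\<lambda>y. (1 + (p - 1) * (s / t) powr (- p)) * fst y + - (p * (s / t) powr (1 - p)) * snd y)) (at (s, t))"
    if "0 < s" "0 < t" for s t :: real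
  proof -
    have fst: "((\<lambda>y. fst y) has_derivative (\<lambda>y. fst y)) (at (s, t))"
      by (rule bounded_linear_imp_has_derivative[OF bounded_linear_fst])
    have "((\<lambda>y. fst y - fst y powr (1 - p) * snd y powr p) has_derivative
      (\<lambda>y. (1 + (p - 1) * (s / t) powr (- p)) * fst y + - (p * (s / t) powr (1 - p)) * snd y)) (at (s, t))"
      by (rule has_derivative_eq_rhs[OF has_derivative_diff[OF fst has_derivative_powr_mult[OF that, of "1 - p" p]]])
        (simp only: powr_ratio_sub[OF that] fun_eq_iff, simp add: algebra_simps)
    then show ?thesis by (simp only: mult.commute)
  qed
  have c: "continuous_on {0<..} (\<lambda>q::real. 1 + (p - 1) * q powr (- p))" "continuous_on {0<..} (\<lambda>q::real. - (p * q powr (1 - p)))"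
    by (intro continuous_intros; auto)+
  have v: "(1 * t) - t powr p * (1 * t) powr (1 - p) = 0" if "0 < t" for t :: real
    using powr_add[of t p "1 - p"] that by simp
  have v2: "(1 + (p - 1) * 1 powr (- p)) * 1 + - (p * 1 powr (1 - p)) = 0" by simp
  have one: "(1::real) > 0" by simp
  have fs: "fst \<in> borel_measurable (borel :: (real \<times> real) measure)" "snd \<in> borel_measurable (borel :: (real \<times> real) measure)"
    by (intro borel_measurable_continuous_onI continuous_intros)+
  have m: "(\<lambda>y :: real \<times> real. fst y - snd y powr p * fst y powr (1 - p)) \<in> borel_measurable borel"
    "(\<lambda>q :: real. 1 + (p - 1) * q powr (- p)) \<in> borel_measurable borel"
    "(\<lambda>q :: real. - (p * q powr (1 - p))) \<in> borel_measurable borel"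
    by (intro borel_measurable_diff borel_measurable_times powr_real_measurable borel_measurable_const fs) measurable
  note T = truncated_ratio_chain_rule[OF \<Omega> w z one, where F = "\<lambda>s t. s - t powr p * s powr (1 - p)"
    and Fs = "\<lambda>q. 1 + (p - 1) * q powr (- p)" and Ft = "\<lambda>q. - (p * q powr (1 - p))", OF der c m v v2]
  have inv: "(w x / z x) powr p = (z x / w x) powr (- p)" "(w x / z x) powr (p - 1) = (z x / w x) powr (1 - p)"
    if "0 < w x \<and> 1 * w x < z x" for x
  proof -
    have q: "(w x / z x) powr a = w x powr a / z x powr a" "(z x / w x) powr a = z x powr a / w x powr a" for a
      using that by (simp_all add: powr_divide)
    have m: "(z x / w x) powr (- p) = inverse ((z x / w x) powr p)" "(z x / w x) powr (1 - p) = inverse ((z x / w x) powr (p - 1))"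
      using powr_minus[of "z x / w x" p] powr_minus[of "z x / w x" "p - 1"] by simp_all
    show "(w x / z x) powr p = (z x / w x) powr (- p)" "(w x / z x) powr (p - 1) = (z x / w x) powr (1 - p)"
      unfolding m unfolding q by simp_all
  qed
  have G: "G = (\<lambda>x. if 0 < w x \<and> 1 * w x < z x then (1 + (p - 1) * (z x / w x) powr (- p)) *\<^sub>R Z x
     + (- (p * (z x / w x) powr (1 - p))) *\<^sub>R W x else 0)"
    unfolding G_def by (rule ext) (simp add: inv)
  have f: "(\<lambda>x. if 0 < w x \<and> w x < z x then z x - w x powr p * z x powr (1 - p) else 0)
     = (\<lambda>x. if 0 < w x \<and> 1 * w x < z x then z x - w x powr p * z x powr (1 - p) else 0)" by simp
  show "has_weak_grad \<Omega> (\<lambda>x. if 0 < w x \<and> w x < z x then z x - w x powr p * z x powr (1 - p) else 0) G"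
    unfolding G f by (rule T(1))
  show "G \<in> Lp_loc \<Omega> p" unfolding G by (rule T(2)) (use p L in simp_all)
qed

text \<open>Mollify the indicator of a compact neighbourhood of \<open>K\<close>.\<close>

lemma cutoff_exists:
  fixes \<Omega> :: "'a::euclidean_space set"
  assumes \<Omega>: "open \<Omega>" and K: "compact K" "K \<subseteq> \<Omega>"
  shows "\<exists>\<eta>\<in>Cc_inf \<Omega>. (\<forall>x. 0 \<le> \<eta> x) \<and> (\<forall>x\<in>K. \<eta> x = 1)"
proof -
  obtain d K1 where d: "d > 0" "compact K1" "K1 \<subseteq> \<Omega>" "\<And>x. x \<in> K \<Longrightarrow> cball x d \<subseteq> K1"
    using compact_neighbourhood[OF \<Omega> K] by metis
  obtain d2 K2 where d2: "d2 > 0" "compact K2" "K2 \<subseteq> \<Omega>" "\<And>x. x \<in> K1 \<Longrightarrow> cball x d2 \<subseteq> K2"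
    using compact_neighbourhood[OF \<Omega> d(2,3)] by metis
  define r where "r = min d d2"
  have r: "0 < r" "r \<le> d" "r \<le> d2" using d(1) d2(1) by (auto simp: r_def)
  note mo = mollifier[OF r(1), where 'a = 'a]
  define f where "f = (indicator K1 :: 'a \<Rightarrow> real)"
  have fi: "integrable lborel f" unfolding f_def
    using emeasure_compact_finite[OF d(2)] d(2) by (intro integrable_real_indicator) (auto simp: borel_compact)
  define \<eta> where "\<eta> = conv (mollifier r) f"
  have sm: "smooth_on \<eta> UNIV" unfolding smooth_on_def \<eta>_def
    using Ck_on_conv[where R = r, OF mo(1) mo(3) fi] by blast
  have out: "\<eta> x = 0" if x: "x \<notin> K2" for x
  proof -
    have "(\<lambda>y. mollifier r (x - y) *\<^sub>R f y) = (\<lambda>y. 0)"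
    proof
      fix y show "mollifier r (x - y) *\<^sub>R f y = 0"
    proof (cases "y \<in> K1")
      case True
      have "\<not> dist y x \<le> d2" using d2(4)[OF True] x by auto
      then have "r \<le> norm (x - y)" using r by (simp add: dist_norm norm_minus_commute)
      then show ?thesis using mo(3) by simp
      qed (simp add: f_def)
    qed
    then show ?thesis unfolding \<eta>_def conv_def by (simp only: Bochner_Integration.integral_zero)
  qed
  have nn: "0 \<le> \<eta> x" for x
    unfolding \<eta>_def conv_def by (intro integral_nonneg_AE AE_I2) (simp add: mo(2) f_def)
  have one: "\<eta> x = 1" if x: "x \<in> K" for x
  proof -
    have "(\<lambda>y. mollifier r (x - y) *\<^sub>R f y) = (\<lambda>y. mollifier r (x - y))"
    proof
      fix y show "mollifier r (x - y) *\<^sub>R f y = mollifier r (x - y)"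
    proof (cases "y \<in> K1")
      case False
      then have "\<not> dist x y \<le> d" using d(4)[OF x] by auto
      then have "r \<le> norm (x - y)" using r by (simp add: dist_norm)
      then show ?thesis using mo(3) by simp
      qed (simp add: f_def)
    qed
    then have "\<eta> x = (\<integral>y. mollifier r (x - y) \<partial>lborel)" unfolding \<eta>_def conv_def by (simp only:)
    also have "\<dots> = 1" using lborel_integral_reflect[of "mollifier r" x] mo(4,5) by auto
    finally show ?thesis .
  qed
  have "\<eta> \<in> Cc_inf \<Omega>" by (rule Cc_infI[OF sm d2(2,3) out])
  then show ?thesis using nn one by blast
qed

section \<open>Integral estimates for a subsolution and a supersolution\<close>

text \<open>The data of the comparison principle on an arbitrary open set, with \<open>a\<close> and \<open>b\<close> integrable.\<close>

locale comparison_pair =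
  fixes \<Omega> :: "'a::euclidean_space set" and a b v w :: "'a \<Rightarrow> real" and p \<delta> \<beta> :: real
  assumes \<Omega>: "open \<Omega>" and p: "1 < p" and \<delta>: "0 < \<delta>" and \<beta>: "0 < \<beta>" "\<beta> < p - 1"
    and a_nonneg: "\<And>x. x \<in> \<Omega> \<Longrightarrow> 0 \<le> a x" and b_nonneg: "\<And>x. x \<in> \<Omega> \<Longrightarrow> 0 \<le> b x"
    and ab_pos: "\<And>x. x \<in> \<Omega> \<Longrightarrow> 0 < a x + b x"
    and a_int: "integrable (lebesgue_on \<Omega>) a" and b_int: "integrable (lebesgue_on \<Omega>) b"
    and sub: "subsolution \<Omega> p a b \<delta> \<beta> v" and super: "supersolution \<Omega> p a b \<delta> \<beta> w"
    and bdry: "nonpos_on_boundary \<Omega> p v"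
begin

abbreviation "V \<equiv> weak_grad \<Omega> v"
abbreviation "W \<equiv> weak_grad \<Omega> w"
abbreviation "L\<Omega> \<equiv> lebesgue_on \<Omega>"
abbreviation "fv \<equiv> source a b \<delta> \<beta> v"
abbreviation "fw \<equiv> source a b \<delta> \<beta> w"

lemma p_pos: "0 < p" using p by simp

lemma v_Sobolev: "has_weak_grad \<Omega> v V" "V \<in> Lp_loc \<Omega> p"
  using W1p_loc_weak_grad[OF \<Omega> p_pos] sub by (auto simp: subsolution_def)

lemma w_Sobolev: "has_weak_grad \<Omega> w W" "W \<in> Lp_loc \<Omega> p"
  using W1p_loc_weak_grad[OF \<Omega> p_pos] super by (auto simp: supersolution_def)

lemma locally_positive_pair: "locally_positive \<Omega> v" "locally_positive \<Omega> w"
  using sub super by (auto simp: subsolution_def supersolution_def)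

lemma sub_super_inequalities: "sub_inequality \<Omega> p a b \<delta> \<beta> (Cc_inf \<Omega>) v" "super_inequality \<Omega> p a b \<delta> \<beta> (Cc_inf \<Omega>) w"
  using sub super by (auto simp: subsolution_def supersolution_def)

lemma data_measurable [measurable]: "a \<in> borel_measurable L\<Omega>" "b \<in> borel_measurable L\<Omega>" "v \<in> borel_measurable L\<Omega>"
  "w \<in> borel_measurable L\<Omega>" "V \<in> borel_measurable L\<Omega>" "W \<in> borel_measurable L\<Omega>"
  using a_int b_int has_weak_grad_measurable[OF \<Omega> v_Sobolev(1)] has_weak_grad_measurable[OF \<Omega> w_Sobolev(1)] by auto

lemma sources_measurable [measurable]: "fv \<in> borel_measurable L\<Omega>" "fw \<in> borel_measurable L\<Omega>"
  by (intro source_measurable data_measurable)+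

lemma sources_nonneg: "x \<in> \<Omega> \<Longrightarrow> 0 \<le> fv x" "x \<in> \<Omega> \<Longrightarrow> 0 \<le> fw x"
  using a_nonneg b_nonneg by (auto intro: source_nonneg)

lemma in_domain: "x \<in> space L\<Omega> \<Longrightarrow> x \<in> \<Omega>"
  by (simp add: space_restrict_space)

lemma AE_domain_iff: "(AE x in L\<Omega>. P x) \<longleftrightarrow> (AE x in lebesgue. x \<in> \<Omega> \<longrightarrow> P x)"
  by (rule AE_lebesgue_on[OF open_sets_lebesgue[OF \<Omega>]])

lemma w_pos: "AE x in L\<Omega>. 0 < w x" and v_pos: "AE x in L\<Omega>. 0 < v x"
  unfolding AE_domain_iff using locally_positive_AE[OF \<Omega>] locally_positive_pair by blast+

lemma AE_in_domain: "AE x in L\<Omega>. x \<in> \<Omega>"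
  by (rule AE_I2) (rule in_domain)

lemma local_integrable_powr_on:
  assumes "compact K" "K \<subseteq> \<Omega>" "g \<in> Lp_loc \<Omega> p" "h \<in> borel_measurable L\<Omega>"
    "\<And>x. x \<in> K \<Longrightarrow> \<bar>h x\<bar> \<le> norm (g x) powr p" "\<And>x. x \<notin> K \<Longrightarrow> h x = (0::real)"
  shows "integrable L\<Omega> h"
proof (rule Bochner_Integration.integrable_bound[OF _ assms(4)])
  show "integrable L\<Omega> (\<lambda>x. indicator K x * norm (g x) powr p)"
    by (rule integrable_on_open[OF \<Omega> Lp_loc_integrable_powr[OF assms(3,1,2)]])
  show "AE x in L\<Omega>. norm (h x) \<le> norm (indicator K x * norm (g x) powr p)"
  proof (rule AE_I2)
    fix x show "norm (h x) \<le> norm (indicator K x * norm (g x) powr p)"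
      using assms(5,6)[of x] by (cases "x \<in> K") auto
  qed
qed

text \<open>Insert the test function into the inequality of \<open>w\<close>, bound the gradient term by Picone's inequality and
move the integral of \<open>k^p |\<nabla>w|^p\<close> to the left; it is finite because the support is compact.\<close>

lemma super_test:
  assumes z: "has_weak_grad \<Omega> z Z" "Z \<in> Lp_loc \<Omega> p" and K: "compact K" "K \<subseteq> \<Omega>"
    and out: "\<And>x. x \<notin> K \<Longrightarrow> z x = 0 \<and> Z x = 0" and z0: "\<And>x. 0 \<le> z x" and zM: "\<And>x. z x \<le> M" and M: "0 < M" and k: "0 < k"
  shows "(\<integral>\<^sup>+x. ennreal (if 0 < w x \<and> k * w x < z x
            then fw x * (z x powr p * w x powr (1 - p) - k powr p * w x) + k powr p * norm (W x) powr p else 0) \<partial>L\<Omega>)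
     \<le> (\<integral>\<^sup>+x. ennreal (if 0 < w x \<and> k * w x < z x then norm (Z x) powr p else 0) \<partial>L\<Omega>)"
proof -
  let ?P = "\<lambda>x. 0 < w x \<and> k * w x < z x"
  define \<phi> where "\<phi> x = (if ?P x then z x powr p * w x powr (1 - p) - k powr p * w x else 0)" for x
  define G where "G x = (if ?P x then (p * (z x / w x) powr (p - 1)) *\<^sub>R Z x - ((p - 1) * (z x / w x) powr p + k powr p) *\<^sub>R W x else 0)" for x
  have \<phi>G: "has_weak_grad \<Omega> \<phi> G" "G \<in> Lp_loc \<Omega> p"
    using super_test_function[OF \<Omega> p w_Sobolev(1) locally_positive_pair(2) z(1) zM k z(2) w_Sobolev(2)] unfolding \<phi>_def[abs_def] G_def[abs_def] .
  have nP: "\<not> ?P x" if "x \<notin> K" for x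
  proof -
    have "z x = 0" using out[OF that] by simp
    moreover have "0 < k * w x" if "0 < w x" using k that by simp
    ultimately show ?thesis by force
  qed
  have out': "\<phi> x = 0" "G x = 0" if "x \<notin> K" for x using nP[OF that] by (auto simp only: \<phi>_def G_def if_False)
  have \<phi>0: "0 \<le> \<phi> x" for x
  proof (cases "?P x")
    case True
    have "k powr p * w x = (k * w x) powr p * w x powr (1 - p)"
      using k True powr_add[of "w x" p "1 - p"] by (simp add: powr_mult)
    also have "\<dots> \<le> z x powr p * w x powr (1 - p)" using True k p by (intro mult_right_mono powr_mono2) auto
    finally show ?thesis using True by (simp add: \<phi>_def)
  qed (simp only: \<phi>_def if_False order_refl)
  obtain c where c: "c > 0" "AE x in lebesgue. x \<in> K \<longrightarrow> c \<le> w x" by (rule locally_positive_compact[OF locally_positive_pair(2) K])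
  (* The test function is at most z^p / w^(p-1), where z is at most M and w at least c on K. *)
  define M' where "M' = M powr p * c powr (1 - p)"
  have M': "0 \<le> M'" by (simp add: M'_def)
  have bd: "AE x in lebesgue. x \<in> \<Omega> \<longrightarrow> 0 \<le> \<phi> x \<and> \<phi> x \<le> M'"
    using c(2)
  proof eventually_elim
    case (elim x)
    have "\<phi> x \<le> M'"
    proof (cases "?P x")
      case True
      then have cw: "c \<le> w x" using elim nP by blast
      have "\<phi> x \<le> z x powr p * w x powr (1 - p)" using True k by (simp add: \<phi>_def)
      also have "\<dots> \<le> M powr p * c powr (1 - p)"
        using z0 zM c(1) cw p by (intro mult_mono powr_mono2 powr_mono2') auto
      finally show ?thesis by (simp add: M'_def)
    next
      case False then show ?thesis using M' by (simp only: \<phi>_def if_False)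
    qed
    then show ?case using \<phi>0 by blast
  qed
  note T = super_inequality_Sobolev_test[OF \<Omega> p data_measurable(1,2) w_Sobolev sub_super_inequalities(2) \<phi>G K out' bd M']
  note [measurable] = has_weak_grad_measurable[OF \<Omega> z(1)] has_weak_grad_measurable[OF \<Omega> \<phi>G(1)]
  define X where "X x = (if ?P x then norm (Z x) powr p else 0)" for x
  define Y where "Y x = (if ?P x then k powr p * norm (W x) powr p else 0)" for x
  have mX [measurable]: "X \<in> borel_measurable L\<Omega>" "Y \<in> borel_measurable L\<Omega>" unfolding X_def Y_def by measurable
  have iX: "integrable L\<Omega> X"
    by (rule local_integrable_powr_on[OF K z(2)]) (use nP in \<open>auto simp: X_def\<close>)
  have iY': "integrable L\<Omega> (\<lambda>x. if ?P x then norm (W x) powr p else 0)"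
    by (rule local_integrable_powr_on[OF K w_Sobolev(2)]) (use nP in auto)
  have Yeq: "Y = (\<lambda>x. k powr p * (if ?P x then norm (W x) powr p else 0))" by (auto simp: Y_def)
  have iY: "integrable L\<Omega> Y" unfolding Yeq using iY' by (rule integrable_mult_right)
  have X0: "0 \<le> X x" and Y0: "0 \<le> Y x" for x by (auto simp: X_def Y_def)
  have iG: "integrable L\<Omega> (\<lambda>x. flux p (W x) \<bullet> G x)" by (rule integrable_on_open[OF \<Omega> T(1)])
  have "(\<integral>x. flux p (W x) \<bullet> G x \<partial>lebesgue) = (\<integral>x. flux p (W x) \<bullet> G x \<partial>L\<Omega>)"
  proof (rule integral_lebesgue_on[symmetric, OF open_sets_lebesgue[OF \<Omega>]])
    fix x assume "x \<notin> \<Omega>"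
    then have "G x = 0" using K(2) by (intro out'(2)) blast
    then show "flux p (W x) \<bullet> G x = 0" by simp
  qed
  also have "\<dots> \<le> (\<integral>x. X x - Y x \<partial>L\<Omega>)"
  proof (rule integral_mono[OF iG])
    show "integrable L\<Omega> (\<lambda>x. X x - Y x)" using iX iY by simp
    fix x
    show "flux p (W x) \<bullet> G x \<le> X x - Y x"
    proof (cases "?P x")
      case True
      have "0 \<le> z x / w x" using True z0 by simp
      from picone_super[OF p this, of "W x" "Z x" k] show ?thesis using True by (simp add: G_def X_def Y_def)
    next
      case False then show ?thesis by (simp only: G_def X_def Y_def if_False)simp
    qed
  qed
  also have "\<dots> = (\<integral>x. X x \<partial>L\<Omega>) - (\<integral>x. Y x \<partial>L\<Omega>)" using iX iY by simp
  finally have le: "(\<integral>x. flux p (W x) \<bullet> G x \<partial>lebesgue) \<le> (\<integral>x. X x \<partial>L\<Omega>) - (\<integral>x. Y x \<partial>L\<Omega>)" .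
  have IY0: "0 \<le> (\<integral>x. Y x \<partial>L\<Omega>)" using Y0 by (intro integral_nonneg_AE) auto
  have "(\<integral>\<^sup>+x. ennreal (fw x * \<phi> x) \<partial>L\<Omega>) \<le> ennreal ((\<integral>x. X x \<partial>L\<Omega>) - (\<integral>x. Y x \<partial>L\<Omega>))"
    using T(2) ennreal_leI[OF le] by (rule order_trans)
  then have "(\<integral>\<^sup>+x. ennreal (fw x * \<phi> x) \<partial>L\<Omega>) + ennreal (\<integral>x. Y x \<partial>L\<Omega>) \<le> ennreal ((\<integral>x. X x \<partial>L\<Omega>) - (\<integral>x. Y x \<partial>L\<Omega>)) + ennreal (\<integral>x. Y x \<partial>L\<Omega>)"
    by (rule add_right_mono)
  also have "\<dots> = ennreal (\<integral>x. X x \<partial>L\<Omega>)"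
    using le T(3) IY0 by (subst ennreal_plus[symmetric]) auto
  also have "\<dots> = (\<integral>\<^sup>+x. ennreal (X x) \<partial>L\<Omega>)" using iX X0 by (simp add: nn_integral_eq_integral)
  also have "ennreal (\<integral>x. Y x \<partial>L\<Omega>) = (\<integral>\<^sup>+x. ennreal (Y x) \<partial>L\<Omega>)" using iY Y0 by (simp add: nn_integral_eq_integral)
  also have "(\<integral>\<^sup>+x. ennreal (fw x * \<phi> x) \<partial>L\<Omega>) + (\<integral>\<^sup>+x. ennreal (Y x) \<partial>L\<Omega>) = (\<integral>\<^sup>+x. ennreal (fw x * \<phi> x) + ennreal (Y x) \<partial>L\<Omega>)"
    by (rule nn_integral_add[symmetric]) measurable
  also have "\<dots> = (\<integral>\<^sup>+x. ennreal (if ?P x then fw x * (z x powr p * w x powr (1 - p) - k powr p * w x) + k powr p * norm (W x) powr p else 0) \<partial>L\<Omega>)"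
  proof (rule nn_integral_cong)
    fix x assume "x \<in> space L\<Omega>"
    then have "0 \<le> fw x * \<phi> x" using in_domain sources_nonneg(2) \<phi>0 by simp
    then have "ennreal (fw x * \<phi> x) + ennreal (Y x) = ennreal (fw x * \<phi> x + Y x)" using Y0 by simp
    also have "fw x * \<phi> x + Y x = (if ?P x then fw x * (z x powr p * w x powr (1 - p) - k powr p * w x) + k powr p * norm (W x) powr p else 0)"
      by (cases "?P x") (simp_all only: \<phi>_def Y_def if_True if_False mult_zero_right add_0_left simp_thms)
    finally show "ennreal (fw x * \<phi> x) + ennreal (Y x) = ennreal (if ?P x then fw x * (z x powr p * w x powr (1 - p) - k powr p * w x) + k powr p * norm (W x) powr p else 0)" .
  qed
  finally show ?thesis unfolding X_def .
qed

text \<open>Fatou's lemma on the left and dominated convergence on the right. Where \<open>z \<le> k w\<close> all integrands vanish,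
as \<open>zn \<le> z\<close>. The right-hand side is finite since \<open>z\<close> has a \<open>p\<close>-integrable gradient on the whole domain; so the
estimate controls \<open>\<nabla>w\<close> up to the boundary on \<open>{z > k w}\<close>.\<close>

lemma super_estimate:
  assumes T: "truncations \<Omega> p z Z zn Zn K M S" and zZ: "has_weak_grad \<Omega> z Z" and k: "0 < k"
  shows "(\<integral>\<^sup>+x. ennreal (if 0 < w x \<and> k * w x < z x
            then fw x * (z x powr p * w x powr (1 - p) - k powr p * w x) + k powr p * norm (W x) powr p else 0) \<partial>L\<Omega>)
     \<le> (\<integral>\<^sup>+x. ennreal (if 0 < w x \<and> k * w x < z x then norm (Z x) powr p else 0) \<partial>L\<Omega>)" (is "?A \<le> ?B")
    and "(\<integral>\<^sup>+x. ennreal (if 0 < w x \<and> k * w x < z x then norm (Z x) powr p else 0) \<partial>L\<Omega>) < \<infinity>"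
proof -
  have wg: "has_weak_grad \<Omega> (zn n) (Zn n)" "Zn n \<in> Lp_loc \<Omega> p" "compact (K n)" "K n \<subseteq> \<Omega>" "0 < M n" for n
    using T unfolding truncations_def by blast+
  have out: "zn n x = 0 \<and> Zn n x = 0" if "x \<notin> K n" for n x using T that unfolding truncations_def by blast
  have rng: "0 \<le> zn n x" "zn n x \<le> z x" "zn n x \<le> M n" for n x using T unfolding truncations_def by blast+
  have S: "integrable L\<Omega> S" and ae: "AE x in L\<Omega>. (\<forall>n. norm (Zn n x) powr p \<le> S x) \<and> (\<lambda>n. zn n x) \<longlonglongrightarrow> z x \<and> (\<lambda>n. Zn n x) \<longlonglongrightarrow> Z x"
    using T unfolding truncations_def by blast+
  let ?P = "\<lambda>x. 0 < w x \<and> k * w x < z x"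
  let ?Pn = "\<lambda>n x. 0 < w x \<and> k * w x < zn n x"
  define A where "A z x = (if 0 < w x \<and> k * w x < z
            then fw x * (z powr p * w x powr (1 - p) - k powr p * w x) + k powr p * norm (W x) powr p else 0)" for z x
  have PnP: "?P x" if "?Pn n x" for n x using that rng(2)[of n x] by auto
  note [measurable] = has_weak_grad_measurable[OF \<Omega> wg(1)] has_weak_grad_measurable[OF \<Omega> zZ]
  have [measurable]: "S \<in> borel_measurable L\<Omega>" using S by auto
  have Z0: "AE x in L\<Omega>. norm (Z x) powr p \<le> S x"
    using ae
  proof eventually_elim
    case (elim x)
    then have "(\<lambda>n. norm (Zn n x) powr p) \<longlonglongrightarrow> norm (Z x) powr p"
      using p_pos by (intro tendsto_powr' tendsto_norm tendsto_const) auto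
    then show ?case by (rule LIMSEQ_le_const2) (use elim in auto)
  qed
  have Sfin: "(\<integral>\<^sup>+x. ennreal (S x) \<partial>L\<Omega>) < \<infinity>"
  proof -
    have "(\<integral>\<^sup>+x. ennreal (norm (S x)) \<partial>L\<Omega>) < \<infinity>" using S by (simp add: integrable_iff_bounded)
    moreover have "(\<integral>\<^sup>+x. ennreal (S x) \<partial>L\<Omega>) \<le> (\<integral>\<^sup>+x. ennreal (norm (S x)) \<partial>L\<Omega>)"
      by (intro nn_integral_mono ennreal_leI) simp
    ultimately show ?thesis by (rule le_less_trans[rotated])
  qed
  show fin: "?B < \<infinity>"
  proof (rule le_less_trans[OF nn_integral_mono_AE Sfin])
    show "AE x in L\<Omega>. ennreal (if ?P x then norm (Z x) powr p else 0) \<le> ennreal (S x)"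
      using Z0 by eventually_elim (auto intro: ennreal_leI)
  qed
  have mA: "(\<lambda>x. A (zn n x) x) \<in> borel_measurable L\<Omega>" for n unfolding A_def by measurable
  have "?A \<le> (\<integral>\<^sup>+x. liminf (\<lambda>n. ennreal (A (zn n x) x)) \<partial>L\<Omega>)"
  proof (rule nn_integral_mono_AE)
    show "AE x in L\<Omega>. ennreal (if ?P x then fw x * (z x powr p * w x powr (1 - p) - k powr p * w x) + k powr p * norm (W x) powr p else 0)
        \<le> liminf (\<lambda>n. ennreal (A (zn n x) x))"
      using ae
    proof eventually_elim
      case (elim x)
      show ?case
      proof (cases "?P x")
        case True
        have l: "(\<lambda>n. zn n x) \<longlonglongrightarrow> z x" using elim by blast
        have ev: "\<forall>\<^sub>F n in sequentially. k * w x < zn n x" using order_tendstoD(1)[OF l] True by blast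
        have zpos: "z x \<noteq> 0" using True k mult_pos_pos[of k "w x"] by linarith
        have "(\<lambda>n. fw x * (zn n x powr p * w x powr (1 - p) - k powr p * w x) + k powr p * norm (W x) powr p)
           \<longlonglongrightarrow> fw x * (z x powr p * w x powr (1 - p) - k powr p * w x) + k powr p * norm (W x) powr p"
          by (intro tendsto_intros l) (use zpos in simp)
        then have "(\<lambda>n. A (zn n x) x) \<longlonglongrightarrow> fw x * (z x powr p * w x powr (1 - p) - k powr p * w x) + k powr p * norm (W x) powr p"
          by (rule Lim_transform_eventually) (rule eventually_mono[OF ev], use True in \<open>simp add: A_def\<close>)
        then have "(\<lambda>n. ennreal (A (zn n x) x)) \<longlonglongrightarrow> ennreal (fw x * (z x powr p * w x powr (1 - p) - k powr p * w x) + k powr p * norm (W x) powr p)"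
          by (rule tendsto_ennrealI)
        from lim_imp_Liminf[OF trivial_limit_sequentially this] show ?thesis using True by simp
      next
        case False then show ?thesis by (simp only: if_False) simp
      qed
    qed
  qed
  also have "\<dots> \<le> liminf (\<lambda>n. \<integral>\<^sup>+x. ennreal (A (zn n x) x) \<partial>L\<Omega>)"
    by (rule nn_integral_liminf) (use mA in measurable)
  also have "\<dots> \<le> liminf (\<lambda>n. \<integral>\<^sup>+x. ennreal (if ?P x then norm (Zn n x) powr p else 0) \<partial>L\<Omega>)"
  proof (intro Liminf_mono always_eventually allI)
    fix n
    have "(\<integral>\<^sup>+x. ennreal (A (zn n x) x) \<partial>L\<Omega>) \<le> (\<integral>\<^sup>+x. ennreal (if ?Pn n x then norm (Zn n x) powr p else 0) \<partial>L\<Omega>)"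
      unfolding A_def by (rule super_test[OF wg(1-4) out rng(1,3) wg(5) k])
    also have "\<dots> \<le> (\<integral>\<^sup>+x. ennreal (if ?P x then norm (Zn n x) powr p else 0) \<partial>L\<Omega>)"
      using PnP by (intro nn_integral_mono ennreal_leI) auto
    finally show "(\<integral>\<^sup>+x. ennreal (A (zn n x) x) \<partial>L\<Omega>) \<le> (\<integral>\<^sup>+x. ennreal (if ?P x then norm (Zn n x) powr p else 0) \<partial>L\<Omega>)" .
  qed
  also have "\<dots> = ?B"
  proof (rule lim_imp_Liminf[OF trivial_limit_sequentially])
    have conv: "AE x in L\<Omega>. (\<lambda>n. ennreal (if ?P x then norm (Zn n x) powr p else 0)) \<longlonglongrightarrow> ennreal (if ?P x then norm (Z x) powr p else 0)"
      using ae
    proof eventually_elim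
      case (elim x)
      then have "(\<lambda>n. norm (Zn n x) powr p) \<longlonglongrightarrow> norm (Z x) powr p"
        using p_pos by (intro tendsto_powr' tendsto_norm tendsto_const) auto
      then show ?case by (intro tendsto_ennrealI) (cases "?P x"; simp only: if_True if_False simp_thms tendsto_const)
    qed
    show "(\<lambda>n. \<integral>\<^sup>+x. ennreal (if ?P x then norm (Zn n x) powr p else 0) \<partial>L\<Omega>) \<longlonglongrightarrow> ?B"
    proof (rule nn_integral_dominated_convergence[OF _ _ _ _ Sfin conv])
      show "AE x in L\<Omega>. ennreal (if ?P x then norm (Zn n x) powr p else 0) \<le> ennreal (S x)" for n
        using ae by eventually_elim (auto intro: ennreal_leI)
    qed measurable
  qed
  finally show "?A \<le> ?B" .
qed

text \<open>Here the source term is monotone in \<open>zn\<close>, hence bounded by its value for \<open>z\<close>. By Picone's inequality the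
gradient term is at least the integral over \<open>{zn > w}\<close> of \<open>|\<nabla>v|^p - |\<nabla>w|^p\<close>, up to an error that contains
\<open>|\<nabla>zn - \<nabla>z|\<close>; the assumed integrability of \<open>|\<nabla>w|^p\<close> on \<open>{z > w}\<close> allows the limit to be taken.\<close>

lemma sub_estimate:
  assumes T: "truncations \<Omega> p z Z zn Zn K M S" and zZ: "has_weak_grad \<Omega> z Z" and ZV: "\<And>x. 0 < z x \<Longrightarrow> Z x = V x"
    and loc: "\<And>K. compact K \<Longrightarrow> K \<subseteq> \<Omega> \<Longrightarrow> (\<integral>\<^sup>+x. indicator K x * ennreal (fv x) \<partial>L\<Omega>) < \<infinity>"
    and iW: "integrable L\<Omega> (\<lambda>x. if 0 < w x \<and> w x < z x then norm (W x) powr p else 0)"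
  shows "ennreal (\<integral>x. (if 0 < w x \<and> w x < z x then norm (Z x) powr p - norm (W x) powr p else 0) \<partial>L\<Omega>)
     \<le> (\<integral>\<^sup>+x. ennreal (if 0 < w x \<and> w x < z x then fv x * (z x - w x powr p * z x powr (1 - p)) else 0) \<partial>L\<Omega>)"
proof -
  have wg: "has_weak_grad \<Omega> (zn n) (Zn n)" "Zn n \<in> Lp_loc \<Omega> p" "compact (K n)" "K n \<subseteq> \<Omega>" "0 < M n" for n
    using T unfolding truncations_def by blast+
  have out: "zn n x = 0 \<and> Zn n x = 0" if "x \<notin> K n" for n x using T that unfolding truncations_def by blast
  have rng: "0 \<le> zn n x" "zn n x \<le> z x" "zn n x \<le> M n" for n x using T unfolding truncations_def by blast+
  have S: "integrable L\<Omega> S" and ae: "AE x in L\<Omega>. (\<forall>n. norm (Zn n x) powr p \<le> S x) \<and> (\<lambda>n. zn n x) \<longlonglongrightarrow> z x \<and> (\<lambda>n. Zn n x) \<longlonglongrightarrow> Z x"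
    using T unfolding truncations_def by blast+
  let ?P = "\<lambda>x. 0 < w x \<and> w x < z x"
  let ?Pn = "\<lambda>n x. 0 < w x \<and> w x < zn n x"
  have PnP: "?P x" if "?Pn n x" for n x using that rng(2)[of n x] by auto
  have PnK: "x \<in> K n" if "?Pn n x" for n x using that out[of x n] by force
  note [measurable] = has_weak_grad_measurable[OF \<Omega> wg(1)] has_weak_grad_measurable[OF \<Omega> zZ]
  define \<phi> where "\<phi> n x = (if ?Pn n x then zn n x - w x powr p * zn n x powr (1 - p) else 0)" for n x
  define G where "G n x = (if ?Pn n x then (1 + (p - 1) * (w x / zn n x) powr p) *\<^sub>R Zn n x - (p * (w x / zn n x) powr (p - 1)) *\<^sub>R W x else 0)" for n x
  define \<Phi> where "\<Phi> x = (if ?P x then z x - w x powr p * z x powr (1 - p) else 0)" for x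
  have \<phi>G: "has_weak_grad \<Omega> (\<phi> n) (G n)" "G n \<in> Lp_loc \<Omega> p" for n
    using sub_test_function[OF \<Omega> p w_Sobolev(1) locally_positive_pair(2) wg(1) rng(3) wg(2) w_Sobolev(2), of n] unfolding \<phi>_def[abs_def] G_def[abs_def] .
  have out': "\<phi> n x = 0" "G n x = 0" if "x \<notin> K n" for n x using PnK that by (auto simp: \<phi>_def G_def)
  have up: "w x powr p * y powr (1 - p) \<le> y" if "0 < w x" "w x < y" for x y
  proof -
    have "w x powr p * y powr (1 - p) \<le> y powr p * y powr (1 - p)"
      using that p by (intro mult_right_mono powr_mono2) auto
    also have "\<dots> = y" using powr_add[of y p "1 - p"] that by simp
    finally show ?thesis .
  qed
  have \<phi>b: "0 \<le> \<phi> n x" "\<phi> n x \<le> M n" "\<phi> n x \<le> \<Phi> x" for n x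
  proof -
    show "0 \<le> \<phi> n x" using up[of x "zn n x"] by (simp add: \<phi>_def)
    show "\<phi> n x \<le> M n"
    proof (cases "?Pn n x")
      case True
      have "\<phi> n x = zn n x - w x powr p * zn n x powr (1 - p)" using True by (simp add: \<phi>_def)
      moreover have "0 \<le> w x powr p * zn n x powr (1 - p)" by simp
      ultimately show ?thesis using rng(3)[of n x] by linarith
    qed (use wg(5)[of n] in \<open>simp only: \<phi>_def if_False less_imp_le\<close>)
    show "\<phi> n x \<le> \<Phi> x"
    proof (cases "?Pn n x")
      case True
      have "z x powr (1 - p) \<le> zn n x powr (1 - p)" using True rng(2) p by (intro powr_mono2') auto
      then have "w x powr p * z x powr (1 - p) \<le> w x powr p * zn n x powr (1 - p)" by (intro mult_left_mono) auto
      moreover have "\<phi> n x = zn n x - w x powr p * zn n x powr (1 - p)" using True by (simp add: \<phi>_def)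
      moreover have "\<Phi> x = z x - w x powr p * z x powr (1 - p)" using PnP[OF True] by (simp add: \<Phi>_def)
      ultimately show ?thesis using rng(2)[of n x] by linarith
    next
      case False
      then have "\<phi> n x = 0" by (simp only: \<phi>_def if_False)
      then show ?thesis using up[of x "z x"] by (simp add: \<Phi>_def)
    qed
  qed
  have bd: "AE x in lebesgue. x \<in> \<Omega> \<longrightarrow> 0 \<le> \<phi> n x \<and> \<phi> n x \<le> M n" for n using \<phi>b by (intro AE_I2) blast
  note T = sub_inequality_Sobolev_test[OF \<Omega> p data_measurable(1,2) a_nonneg b_nonneg v_Sobolev sub_super_inequalities(1) loc \<phi>G wg(3,4) out' bd less_imp_le[OF wg(5)]]
  define D where "D n x = (if ?Pn n x then norm (V x) powr p - norm (W x) powr p - p * norm (V x) powr (p - 1) * norm (Zn n x - V x) else 0)" for n x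
  define D' where "D' x = (if ?P x then norm (Z x) powr p - norm (W x) powr p else 0)" for x
  define dom where "dom x = S x + (if ?P x then norm (W x) powr p else 0) + p * (S x + 2 powr p * (S x + S x))" for x
  have mD: "D n \<in> borel_measurable L\<Omega>" "D' \<in> borel_measurable L\<Omega>" for n unfolding D_def D'_def by measurable
  have idom: "integrable L\<Omega> dom" unfolding dom_def using S iW
    by (intro Bochner_Integration.integrable_add integrable_mult_right)
  have Z0: "AE x in L\<Omega>. norm (Z x) powr p \<le> S x"
    using ae
  proof eventually_elim
    case (elim x)
    then have "(\<lambda>n. norm (Zn n x) powr p) \<longlonglongrightarrow> norm (Z x) powr p"
      using p_pos by (intro tendsto_powr' tendsto_norm tendsto_const) auto
    then show ?case by (rule LIMSEQ_le_const2) (use elim in auto)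
  qed
  have bD: "AE x in L\<Omega>. norm (D n x) \<le> dom x" for n
    using ae Z0
  proof eventually_elim
    case (elim x)
    have S0: "0 \<le> S x" using elim(2) powr_ge_zero order_trans by blast
    show ?case
    proof (cases "?Pn n x")
      case True
      then have PP: "?P x" by (rule PnP)
      then have VZ: "V x = Z x" using ZV[of x] by simp
      have "norm (Z x) powr (p - 1) * norm (Zn n x - Z x) \<le> norm (Z x) powr p + norm (Zn n x - Z x) powr p"
        using p by (intro powr_mult_le_add) auto
      also have "\<dots> \<le> S x + 2 powr p * (norm (Zn n x) powr p + norm (Z x) powr p)"
        using elim(2) norm_diff_powr_le[OF p_pos] by (intro add_mono) auto
      also have "\<dots> \<le> S x + 2 powr p * (S x + S x)"
        using elim by (intro add_left_mono mult_left_mono add_mono) auto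
      finally have 1: "p * (norm (Z x) powr (p - 1) * norm (Zn n x - Z x)) \<le> p * (S x + 2 powr p * (S x + S x))"
        using p by (intro mult_left_mono) auto
      have 2: "0 \<le> p * (norm (Z x) powr (p - 1) * norm (Zn n x - Z x))" using p by simp
      have "D n x = norm (Z x) powr p - norm (W x) powr p - p * (norm (Z x) powr (p - 1) * norm (Zn n x - Z x))"
        using True VZ by (simp add: D_def mult.assoc)
      moreover have "0 \<le> norm (Z x) powr p" "0 \<le> norm (W x) powr p" by simp_all
      moreover have "dom x = S x + norm (W x) powr p + p * (S x + 2 powr p * (S x + S x))" using PP by (simp add: dom_def)
      ultimately show ?thesis using 1 2 elim(2) by (simp only: real_norm_def abs_le_iff) linarith
    next
      case False
      then have "D n x = 0" by (simp only: D_def if_False)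
      moreover have "0 \<le> p * (S x + 2 powr p * (S x + S x))" using S0 p by simp
      ultimately show ?thesis using S0 by (simp add: dom_def)
    qed
  qed
  have iD: "integrable L\<Omega> (D n)" for n
  proof (rule Bochner_Integration.integrable_bound[OF idom mD(1)])
    show "AE x in L\<Omega>. norm (D n x) \<le> norm (dom x)" using bD[of n] by eventually_elim (simp add: order_trans[OF _ abs_ge_self])
  qed
  have lim: "(\<lambda>n. \<integral>x. D n x \<partial>L\<Omega>) \<longlonglongrightarrow> (\<integral>x. D' x \<partial>L\<Omega>)"
  proof (rule integral_dominated_convergence[OF mD(2) mD(1) idom _ bD])
    show "AE x in L\<Omega>. (\<lambda>n. D n x) \<longlonglongrightarrow> D' x"
      using ae
    proof eventually_elim
      case (elim x)
      show ?case
      proof (cases "?P x")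
        case True
        then have VZ: "V x = Z x" using ZV[of x] by simp
        have l: "(\<lambda>n. zn n x) \<longlonglongrightarrow> z x" "(\<lambda>n. Zn n x) \<longlonglongrightarrow> Z x" using elim by blast+
        have ev: "\<forall>\<^sub>F n in sequentially. w x < zn n x" using order_tendstoD(1)[OF l(1)] True by blast
        have "(\<lambda>n. norm (Z x) powr p - norm (W x) powr p - p * norm (Z x) powr (p - 1) * norm (Zn n x - Z x))
          \<longlonglongrightarrow> norm (Z x) powr p - norm (W x) powr p - p * norm (Z x) powr (p - 1) * norm (Z x - Z x)"
          by (intro tendsto_diff tendsto_mult tendsto_norm tendsto_const l)
        then have "(\<lambda>n. norm (Z x) powr p - norm (W x) powr p - p * norm (Z x) powr (p - 1) * norm (Zn n x - Z x)) \<longlonglongrightarrow> D' x"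
          using True by (simp add: D'_def)
        then show ?thesis
          by (rule Lim_transform_eventually) (rule eventually_mono[OF ev], use True VZ in \<open>simp add: D_def\<close>)
      next
        case False
        then have "\<not> ?Pn n x" for n using PnP by blast
        then have "D n x = 0" for n unfolding D_def by (rule if_not_P)
        moreover have "D' x = 0" using False by (simp only: D'_def if_False)
        ultimately show ?thesis by simp
      qed
    qed
  qed
  have le: "ennreal (\<integral>x. D n x \<partial>L\<Omega>) \<le> (\<integral>\<^sup>+x. ennreal (fv x * \<Phi> x) \<partial>L\<Omega>)" for n
  proof -
    have "(\<integral>x. D n x \<partial>L\<Omega>) \<le> (\<integral>x. flux p (V x) \<bullet> G n x \<partial>L\<Omega>)"
    proof (rule integral_mono[OF iD integrable_on_open[OF \<Omega> T(1)]])
      fix x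
      show "D n x \<le> flux p (V x) \<bullet> G n x"
      proof (cases "?Pn n x")
        case True
        then have "0 \<le> w x / zn n x" "w x / zn n x \<le> 1" by auto
        from picone_sub[OF p this, of "V x" "W x" "Zn n x"] show ?thesis using True by (simp add: D_def G_def)
      next
        case False then show ?thesis by (simp only: D_def G_def if_False) simp
      qed
    qed
    also have "\<dots> = (\<integral>x. flux p (V x) \<bullet> G n x \<partial>lebesgue)"
    proof (rule integral_lebesgue_on[OF open_sets_lebesgue[OF \<Omega>]])
      fix x assume "x \<notin> \<Omega>"
      then have "G n x = 0" using wg(4)[of n] by (intro out'(2)) blast
      then show "flux p (V x) \<bullet> G n x = 0" by simp
    qed
    finally have "ennreal (\<integral>x. D n x \<partial>L\<Omega>) \<le> (\<integral>\<^sup>+x. ennreal (fv x * \<phi> n x) \<partial>L\<Omega>)"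
      using T(2)[of n] ennreal_leI order_trans by blast
    also have "\<dots> \<le> (\<integral>\<^sup>+x. ennreal (fv x * \<Phi> x) \<partial>L\<Omega>)"
    proof (rule nn_integral_mono)
      fix x assume "x \<in> space L\<Omega>"
      then have "0 \<le> fv x" using in_domain sources_nonneg(1) by blast
      then show "ennreal (fv x * \<phi> n x) \<le> ennreal (fv x * \<Phi> x)"
        using \<phi>b(3) by (intro ennreal_leI mult_left_mono) auto
    qed
    finally show ?thesis .
  qed
  have "ennreal (\<integral>x. D' x \<partial>L\<Omega>) \<le> (\<integral>\<^sup>+x. ennreal (fv x * \<Phi> x) \<partial>L\<Omega>)"
    by (rule LIMSEQ_le_const2[OF tendsto_ennrealI[OF lim]]) (use le in auto)
  also have "(\<integral>\<^sup>+x. ennreal (fv x * \<Phi> x) \<partial>L\<Omega>) = (\<integral>\<^sup>+x. ennreal (if ?P x then fv x * (z x - w x powr p * z x powr (1 - p)) else 0) \<partial>L\<Omega>)"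
    by (intro nn_integral_cong) (simp add: \<Phi>_def)
  finally show ?thesis unfolding D'_def .
qed

end

section \<open>The subsolution above a positive level\<close>

context comparison_pair begin

text \<open>These are the functions that the boundary condition on \<open>v\<close> places in \<open>W_0^(1,p)\<close>.\<close>

definition excess :: "real \<Rightarrow> 'a \<Rightarrow> real" where
  "excess \<epsilon> x = max (v x - \<epsilon>) 0"

definition excess_grad :: "real \<Rightarrow> 'a \<Rightarrow> 'a" where
  "excess_grad \<epsilon> x = (if v x - \<epsilon> > 0 then V x else 0)"

lemma excess_has_weak_grad: "has_weak_grad \<Omega> (excess \<epsilon>) (excess_grad \<epsilon>)"
  using has_weak_grad_pos_part[OF \<Omega> has_weak_grad_diff[OF \<Omega> v_Sobolev(1) has_weak_grad_const[OF \<Omega>, of \<epsilon>]]]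
  unfolding excess_def[abs_def] excess_grad_def[abs_def] diff_zero .

lemma excess_meas [measurable]: "excess \<epsilon> \<in> borel_measurable L\<Omega>" "excess_grad \<epsilon> \<in> borel_measurable L\<Omega>"
  by (rule has_weak_grad_measurable[OF \<Omega> excess_has_weak_grad])+

lemma excess_truncations:
  assumes "0 < \<epsilon>"
  shows "\<exists>zn Zn K M S. truncations \<Omega> p (excess \<epsilon>) (excess_grad \<epsilon>) zn Zn K M S"
proof (rule truncations_exist[OF \<Omega> less_imp_le[OF p] _ excess_has_weak_grad])
  show "excess \<epsilon> \<in> W1p_0 \<Omega> p" using bdry assms by (simp add: nonpos_on_boundary_def excess_def[abs_def])
  show "0 \<le> excess \<epsilon> x" for x by (simp add: excess_def)
  show "excess_grad \<epsilon> x = 0" if "excess \<epsilon> x = 0" for x using that by (auto simp: excess_def excess_grad_def)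
qed

text \<open>Where \<open>v \<le> 2\<close> the integrand is bounded by a multiple of \<open>b\<close>. Where \<open>v > 2\<close> and \<open>v > w\<close>, the function \<open>z = (v - 1)^+\<close> satisfies
\<open>z \<ge> v/2 > w/2\<close>, hence \<open>(z^p - 4^(-p) w^p) / w^(p-1)\<close> is at least a multiple of \<open>v^p / w^(p-1)\<close>; multiplied by \<open>b w^\<beta>\<close> this
dominates \<open>b v^(\<beta>+1)\<close>, because the exponent \<open>\<beta> + 1 - p\<close> is negative.\<close>

lemma large_b_term: "(\<integral>\<^sup>+x. ennreal (if 0 < w x \<and> w x < v x then b x * v x powr (\<beta> + 1) else 0) \<partial>L\<Omega>) < \<infinity>"
proof -
  obtain zn Zn K M S where T: "truncations \<Omega> p (excess 1) (excess_grad 1) zn Zn K M S"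
    using excess_truncations[of 1] by auto
  define A where "A x = (if 0 < w x \<and> (1/4) * w x < excess 1 x
            then fw x * (excess 1 x powr p * w x powr (1 - p) - (1/4) powr p * w x) + (1/4) powr p * norm (W x) powr p else 0)" for x
  have [measurable]: "A \<in> borel_measurable L\<Omega>" unfolding A_def by measurable
  have fin: "(\<integral>\<^sup>+x. ennreal (A x) \<partial>L\<Omega>) < \<infinity>"
    unfolding A_def by (rule le_less_trans[OF super_estimate(1)[OF T excess_has_weak_grad] super_estimate(2)[OF T excess_has_weak_grad]]) simp_all
  (* From z >= v/2 and w < v: z^p - 4^(-p) w^p >= c v^p. *)
  define c where "c = (1/2) powr p - (1/4::real) powr p"
  have c: "0 < c" unfolding c_def using p powr_less_mono2[of p "1/4" "1/2::real"] by simp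
  define B where "B x = (if 0 < w x \<and> w x < v x then b x * v x powr (\<beta> + 1) else 0)" for x
  have bound: "ennreal (B x) \<le> ennreal (2 powr (\<beta> + 1)) * ennreal (norm (b x)) + ennreal (1 / c) * ennreal (A x)" if "x \<in> \<Omega>" for x
  proof -
    have bx: "0 \<le> b x" using b_nonneg that by simp
    have A0: "0 \<le> A x"
    proof (cases "0 < w x \<and> (1/4) * w x < excess 1 x")
      case True
      have "(1/4) powr p * w x = ((1/4) * w x) powr p * w x powr (1 - p)"
        using True powr_add[of "w x" p "1 - p"] powr_mult[of "1/4" "w x" p] by simp
      also have "\<dots> \<le> excess 1 x powr p * w x powr (1 - p)" using True p by (intro mult_right_mono powr_mono2) auto
      finally have "0 \<le> excess 1 x powr p * w x powr (1 - p) - (1/4) powr p * w x" by simp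
      then have "0 \<le> fw x * (excess 1 x powr p * w x powr (1 - p) - (1/4) powr p * w x)"
        using sources_nonneg(2)[OF that] by (rule mult_nonneg_nonneg[rotated])
      then have "0 \<le> fw x * (excess 1 x powr p * w x powr (1 - p) - (1/4) powr p * w x) + (1/4) powr p * norm (W x) powr p"
        by (rule add_nonneg_nonneg) simp
      then show ?thesis using True by (simp only: A_def if_True simp_thms)
    next
      case False then show ?thesis by (simp only: A_def if_False order_refl)
    qed
    have "B x \<le> 2 powr (\<beta> + 1) * b x + (1 / c) * A x"
    proof (cases "0 < w x \<and> w x < v x")
      case True
      show ?thesis
      proof (cases "v x \<le> 2")
        case le: True
        have "v x powr (\<beta> + 1) \<le> 2 powr (\<beta> + 1)" using True le \<beta> by (intro powr_mono2) auto
        then have "b x * v x powr (\<beta> + 1) \<le> 2 powr (\<beta> + 1) * b x" using bx by (simp add: mult.commute mult_left_mono)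
        moreover have "0 \<le> (1 / c) * A x" using c A0 by simp
        ultimately show ?thesis using True by (simp add: B_def)
      next
        case False
        have lv: "excess 1 x = v x - 1" "v x / 2 \<le> excess 1 x" "(1/4) * w x < excess 1 x" using False True by (auto simp: excess_def)
        have vp: "v x powr (p + (\<beta> + 1 - p)) = v x powr p * v x powr (\<beta> + 1 - p)" by (rule powr_add)
        have e1: "w x powr \<beta> * w x powr (1 - p) = w x powr (\<beta> + 1 - p)"
          using powr_add[of "w x" \<beta> "1 - p"] by (simp add: add.commute add_diff_eq)
        have w1: "w x powr (1 - p) * w x powr p = w x" using powr_add[of "w x" "1 - p" p] True by simp
        have "c * (b x * v x powr (\<beta> + 1)) = b x * (c * v x powr p * v x powr (\<beta> + 1 - p))"
          using vp by (simp add: mult_ac)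
        also have "\<dots> \<le> b x * (c * v x powr p * w x powr (\<beta> + 1 - p))"
          using bx c True \<beta> by (intro mult_left_mono powr_mono2') auto
        also have "\<dots> = (b x * w x powr \<beta>) * (c * v x powr p * w x powr (1 - p))"
          unfolding e1[symmetric] by (simp add: mult_ac)
        also have "\<dots> \<le> fw x * (c * v x powr p * w x powr (1 - p))"
          using a_nonneg[OF that] c by (intro mult_right_mono) (auto simp: source_def)
        also have "\<dots> \<le> fw x * (excess 1 x powr p * w x powr (1 - p) - (1/4) powr p * w x)"
        proof (rule mult_left_mono[OF _ sources_nonneg(2)[OF that]])
          have "(1/2) powr p * v x powr p = (v x / 2) powr p" using True powr_mult[of "1/2" "v x" p] by simp
          also have "\<dots> \<le> excess 1 x powr p" using lv(2) True p by (intro powr_mono2) auto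
          finally have 1: "(1/2) powr p * v x powr p \<le> excess 1 x powr p" .
          have 2: "(1/4) powr p * w x powr p \<le> (1/4) powr p * v x powr p"
            using True p by (intro mult_left_mono powr_mono2) auto
          have "c * v x powr p \<le> excess 1 x powr p - (1/4) powr p * w x powr p"
            unfolding c_def left_diff_distrib using 1 2 by linarith
          then have "c * v x powr p * w x powr (1 - p) \<le> (excess 1 x powr p - (1/4) powr p * w x powr p) * w x powr (1 - p)"
            by (intro mult_right_mono) auto
          also have "\<dots> = excess 1 x powr p * w x powr (1 - p) - (1/4) powr p * (w x powr (1 - p) * w x powr p)"
            by (simp add: algebra_simps)
          finally show "c * v x powr p * w x powr (1 - p) \<le> excess 1 x powr p * w x powr (1 - p) - (1/4) powr p * w x"
            unfolding w1 .
        qed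
        also have "\<dots> \<le> A x" using True lv(3) by (simp add: A_def)
        finally have "b x * v x powr (\<beta> + 1) \<le> (1 / c) * A x" using c by (simp add: pos_le_divide_eq mult.commute)
        moreover have "0 \<le> 2 powr (\<beta> + 1) * b x" using bx by simp
        ultimately have "b x * v x powr (\<beta> + 1) \<le> 2 powr (\<beta> + 1) * b x + (1 / c) * A x" by linarith
        then show ?thesis using True by (simp add: B_def)
      qed
    next
      case False
      have "0 \<le> 2 powr (\<beta> + 1) * b x + (1 / c) * A x" using bx A0 c by simp
      then show ?thesis using False by (simp only: B_def if_False)
    qed
    then have "ennreal (B x) \<le> ennreal (2 powr (\<beta> + 1) * b x + (1 / c) * A x)" by (rule ennreal_leI)
    also have "\<dots> = ennreal (2 powr (\<beta> + 1)) * ennreal (norm (b x)) + ennreal (1 / c) * ennreal (A x)"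
      using bx A0 c by (simp add: ennreal_mult[symmetric] ennreal_plus[symmetric] del: ennreal_plus)
    finally show ?thesis .
  qed
  have bfin: "(\<integral>\<^sup>+x. ennreal (norm (b x)) \<partial>L\<Omega>) < \<infinity>" using b_int by (simp add: integrable_iff_bounded)
  have "(\<integral>\<^sup>+x. ennreal (B x) \<partial>L\<Omega>) \<le> (\<integral>\<^sup>+x. ennreal (2 powr (\<beta> + 1)) * ennreal (norm (b x)) + ennreal (1 / c) * ennreal (A x) \<partial>L\<Omega>)"
    by (rule nn_integral_mono) (rule bound, rule in_domain)
  also have "\<dots> = ennreal (2 powr (\<beta> + 1)) * (\<integral>\<^sup>+x. ennreal (norm (b x)) \<partial>L\<Omega>) + ennreal (1 / c) * (\<integral>\<^sup>+x. ennreal (A x) \<partial>L\<Omega>)"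
    by (simp add: nn_integral_add nn_integral_cmult)
  also have "\<dots> < \<infinity>" using bfin fin by (simp add: ennreal_mult_less_top)
  finally show ?thesis unfolding B_def .
qed

text \<open>The inequality of \<open>w\<close>, tested with a cutoff function, bounds the integral by a real number.\<close>

lemma source_w_local:
  assumes K: "compact K" "K \<subseteq> \<Omega>"
  shows "(\<integral>\<^sup>+x. indicator K x * ennreal (fw x) \<partial>L\<Omega>) < \<infinity>"
proof -
  obtain \<eta> where \<eta>: "\<eta> \<in> Cc_inf \<Omega>" "\<And>x. 0 \<le> \<eta> x" "\<And>x. x \<in> K \<Longrightarrow> \<eta> x = 1"
    using cutoff_exists[OF \<Omega> K] by blast
  have "enn2ereal (source_form \<Omega> a b \<delta> \<beta> w \<eta>) \<le> ereal (p_laplace_form \<Omega> p w \<eta>)"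
    using sub_super_inequalities(2) \<eta>(1,2) unfolding super_inequality_def by simp
  then have "source_form \<Omega> a b \<delta> \<beta> w \<eta> \<le> ennreal (p_laplace_form \<Omega> p w \<eta>)" by (rule enn2ereal_le_imp(1))
  then have fin: "(\<integral>\<^sup>+x. ennreal (fw x * \<eta> x) \<partial>L\<Omega>) < \<infinity>"
    unfolding source_form_eq by (rule le_less_trans) simp
  have "(\<integral>\<^sup>+x. indicator K x * ennreal (fw x) \<partial>L\<Omega>) \<le> (\<integral>\<^sup>+x. ennreal (fw x * \<eta> x) \<partial>L\<Omega>)"
  proof (rule nn_integral_mono)
    fix x show "indicator K x * ennreal (fw x) \<le> ennreal (fw x * \<eta> x)"
      using \<eta>(3)[of x] by (cases "x \<in> K") auto
  qed
  then show ?thesis using fin by (rule le_less_trans)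
qed

text \<open>The singular term is controlled by the local lower bound of \<open>v\<close>. The other one is bounded by the source of \<open>w\<close> where
\<open>v \<le> w\<close>, and elsewhere by \<open>b + b v^(\<beta>+1)\<close>, which \<open>large_b_term\<close> shows to be integrable.\<close>

lemma source_v_local:
  assumes K: "compact K" "K \<subseteq> \<Omega>"
  shows "(\<integral>\<^sup>+x. indicator K x * ennreal (fv x) \<partial>L\<Omega>) < \<infinity>"
proof -
  obtain c where c: "c > 0" "AE x in lebesgue. x \<in> K \<longrightarrow> c \<le> v x" by (rule locally_positive_compact[OF locally_positive_pair(1) K])
  define B where "B x = (if 0 < w x \<and> w x < v x then b x * v x powr (\<beta> + 1) else 0)" for x
  have [measurable]: "B \<in> borel_measurable L\<Omega>" unfolding B_def by measurable
  have [measurable]: "(\<lambda>x. indicator K x :: ennreal) \<in> borel_measurable L\<Omega>"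
    by (rule measurable_restrict_space1, rule borel_measurable_indicator) (use K in simp)
  let ?R = "\<lambda>x. ennreal (1 / c powr \<delta>) * ennreal (norm (a x)) + (indicator K x * ennreal (fw x) + (ennreal (norm (b x)) + ennreal (B x)))"
  have cK: "AE x in L\<Omega>. x \<in> K \<longrightarrow> c \<le> v x" unfolding AE_domain_iff using c(2) by (rule eventually_mono) simp
  have "AE x in L\<Omega>. indicator K x * ennreal (fv x) \<le> ?R x"
    using cK w_pos AE_in_domain
  proof eventually_elim
    case (elim x)
    show ?case
    proof (cases "x \<in> K")
      case True
      have x: "c \<le> v x" "0 < w x" "0 \<le> a x" "0 \<le> b x" using elim True a_nonneg b_nonneg by auto
      have vx: "0 < v x" using x(1) c(1) by simp
      have B0: "0 \<le> B x" using x by (simp add: B_def)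
      have "c powr \<delta> \<le> v x powr \<delta>" using x c(1) \<delta> by (intro powr_mono2) auto
      then have "a x / v x powr \<delta> \<le> a x / c powr \<delta>" using x c(1) by (intro divide_left_mono) auto
      moreover have "b x * v x powr \<beta> \<le> fw x + (b x + B x)"
      proof (cases "v x \<le> w x")
        case True
        have "b x * v x powr \<beta> \<le> b x * w x powr \<beta>" using True vx x \<beta> by (intro mult_left_mono powr_mono2) auto
        also have "\<dots> \<le> fw x" using x by (simp add: source_def)
        finally show ?thesis using x B0 by simp
      next
        case False
        have "v x powr \<beta> \<le> 1 + v x powr (\<beta> + 1)"
        proof (cases "v x \<le> 1")
          case True
          then have "v x powr \<beta> \<le> 1" using vx \<beta> by (simp add: powr_le1)
          then show ?thesis using powr_ge_zero[of "v x" "\<beta> + 1"] by linarith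
        next
          case False
          then have "v x powr \<beta> \<le> v x powr (\<beta> + 1)" by (intro powr_mono) auto
          then show ?thesis by simp
        qed
        then have "b x * v x powr \<beta> \<le> b x * (1 + v x powr (\<beta> + 1))" using x by (intro mult_left_mono) auto
        also have "\<dots> = b x + B x" using False x by (simp add: B_def distrib_left)
        finally show ?thesis using sources_nonneg(2) elim by (metis add_increasing)
      qed
      ultimately have "fv x \<le> (1 / c powr \<delta>) * norm (a x) + (fw x + (norm (b x) + B x))"
        using x by (simp add: source_def)
      then have "ennreal (fv x) \<le> ennreal ((1 / c powr \<delta>) * norm (a x) + (fw x + (norm (b x) + B x)))" by (rule ennreal_leI)
      also have "\<dots> = ?R x"
        using True B0 sources_nonneg(2) elim by (simp add: ennreal_mult[symmetric] ennreal_plus[symmetric] del: ennreal_plus)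
      finally show ?thesis using True by simp
    qed simp
  qed
  then have "(\<integral>\<^sup>+x. indicator K x * ennreal (fv x) \<partial>L\<Omega>) \<le> (\<integral>\<^sup>+x. ?R x \<partial>L\<Omega>)" by (rule nn_integral_mono_AE)
  also have "\<dots> = ennreal (1 / c powr \<delta>) * (\<integral>\<^sup>+x. ennreal (norm (a x)) \<partial>L\<Omega>) + ((\<integral>\<^sup>+x. indicator K x * ennreal (fw x) \<partial>L\<Omega>)
      + ((\<integral>\<^sup>+x. ennreal (norm (b x)) \<partial>L\<Omega>) + (\<integral>\<^sup>+x. ennreal (B x) \<partial>L\<Omega>)))"
    by (simp add: nn_integral_add nn_integral_cmult)
  also have "\<dots> < \<infinity>"
    using a_int b_int source_w_local[OF K] large_b_term by (simp add: integrable_iff_bounded ennreal_mult_less_top B_def)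
  finally show ?thesis .
qed

text \<open>Subtract \<open>super_estimate\<close> with \<open>k = 1\<close> from \<open>sub_estimate\<close>: both contain the same difference of gradient integrals.\<close>

lemma excess_comparison:
  assumes \<epsilon>: "0 < \<epsilon>"
  defines "P \<equiv> \<lambda>x. 0 < w x \<and> w x < excess \<epsilon> x"
  shows "(\<integral>\<^sup>+x. ennreal (if P x then fw x * (excess \<epsilon> x powr p * w x powr (1 - p) - w x) else 0) \<partial>L\<Omega>)
     \<le> (\<integral>\<^sup>+x. ennreal (if P x then fv x * (excess \<epsilon> x - w x powr p * excess \<epsilon> x powr (1 - p)) else 0) \<partial>L\<Omega>)" (is "?A \<le> ?B")
    and "(\<integral>\<^sup>+x. ennreal (if P x then fw x * (excess \<epsilon> x powr p * w x powr (1 - p) - w x) else 0) \<partial>L\<Omega>) < \<infinity>"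
proof -
  obtain zn Zn K M S where T: "truncations \<Omega> p (excess \<epsilon>) (excess_grad \<epsilon>) zn Zn K M S"
    using excess_truncations[OF \<epsilon>] by auto
  let ?Y = "\<integral>\<^sup>+x. ennreal (if P x then norm (W x) powr p else 0) \<partial>L\<Omega>"
  let ?X = "\<integral>\<^sup>+x. ennreal (if P x then norm (excess_grad \<epsilon> x) powr p else 0) \<partial>L\<Omega>"
  have m [measurable]: "Measurable.pred L\<Omega> P" unfolding P_def by measurable
  have nn: "0 \<le> fw x * (excess \<epsilon> x powr p * w x powr (1 - p) - w x)" if "P x" "x \<in> \<Omega>" for x
  proof -
    have "w x = w x powr p * w x powr (1 - p)" using that powr_add[of "w x" p "1 - p"] by (simp add: P_def)
    also have "\<dots> \<le> excess \<epsilon> x powr p * w x powr (1 - p)" using that p by (intro mult_right_mono powr_mono2) (auto simp: P_def)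
    finally show ?thesis using sources_nonneg(2)[OF that(2)] by simp
  qed
  have "?A + ?Y = (\<integral>\<^sup>+x. ennreal (if P x then fw x * (excess \<epsilon> x powr p * w x powr (1 - p) - w x) else 0)
      + ennreal (if P x then norm (W x) powr p else 0) \<partial>L\<Omega>)"
    by (rule nn_integral_add[symmetric]) measurable
  also have "\<dots> = (\<integral>\<^sup>+x. ennreal (if 0 < w x \<and> 1 * w x < excess \<epsilon> x
       then fw x * (excess \<epsilon> x powr p * w x powr (1 - p) - 1 powr p * w x) + 1 powr p * norm (W x) powr p else 0) \<partial>L\<Omega>)"
  proof (rule nn_integral_cong)
    fix x assume "x \<in> space L\<Omega>"
    then have x: "x \<in> \<Omega>" by (rule in_domain)
    show "ennreal (if P x then fw x * (excess \<epsilon> x powr p * w x powr (1 - p) - w x) else 0) + ennreal (if P x then norm (W x) powr p else 0)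
       = ennreal (if 0 < w x \<and> 1 * w x < excess \<epsilon> x
       then fw x * (excess \<epsilon> x powr p * w x powr (1 - p) - 1 powr p * w x) + 1 powr p * norm (W x) powr p else 0)"
    proof (cases "P x")
      case True
      then show ?thesis using nn[OF True x] by (simp add: P_def)
    next
      case False
      then have "\<not> (0 < w x \<and> 1 * w x < excess \<epsilon> x)" by (simp add: P_def)
      then show ?thesis using False by (simp only: if_False) simp
    qed
  qed
  also have "\<dots> \<le> (\<integral>\<^sup>+x. ennreal (if 0 < w x \<and> 1 * w x < excess \<epsilon> x then norm (excess_grad \<epsilon> x) powr p else 0) \<partial>L\<Omega>)"
    by (rule super_estimate(1)[OF T excess_has_weak_grad]) simp
  also have "\<dots> = ?X" by (simp add: P_def)
  finally have AY: "?A + ?Y \<le> ?X" .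
  have Xfin: "?X < \<infinity>" using super_estimate(2)[OF T excess_has_weak_grad, of 1] by (simp add: P_def)
  have AYfin: "?A + ?Y < \<infinity>" using AY Xfin by (rule le_less_trans)
  have Afin: "?A < \<infinity>" by (rule le_less_trans[OF _ AYfin]) simp
  have Yfin: "?Y < \<infinity>" by (rule le_less_trans[OF _ AYfin]) simp
  show "?A < \<infinity>" by (rule Afin)
  have iW: "integrable L\<Omega> (\<lambda>x. if P x then norm (W x) powr p else 0)"
    by (rule integrableI_nonneg) (use Yfin in \<open>auto\<close>)
  have iZ: "integrable L\<Omega> (\<lambda>x. if P x then norm (excess_grad \<epsilon> x) powr p else 0)"
    by (rule integrableI_nonneg) (use Xfin in \<open>auto\<close>)
  let ?y = "\<integral>x. (if P x then norm (W x) powr p else 0) \<partial>L\<Omega>"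
  let ?x = "\<integral>x. (if P x then norm (excess_grad \<epsilon> x) powr p else 0) \<partial>L\<Omega>"
  have Y: "?Y = ennreal ?y" using iW by (intro nn_integral_eq_integral) auto
  have X: "?X = ennreal ?x" using iZ by (intro nn_integral_eq_integral) auto
  have y0: "0 \<le> ?y" by (intro integral_nonneg_AE) auto
  have grad: "excess_grad \<epsilon> x = V x" if "0 < excess \<epsilon> x" for x using that by (auto simp: excess_def excess_grad_def)
  have "ennreal (\<integral>x. (if P x then norm (excess_grad \<epsilon> x) powr p - norm (W x) powr p else 0) \<partial>L\<Omega>) \<le> ?B"
    using sub_estimate[OF T excess_has_weak_grad grad source_v_local] iW unfolding P_def by blast
  also have "(\<integral>x. (if P x then norm (excess_grad \<epsilon> x) powr p - norm (W x) powr p else 0) \<partial>L\<Omega>)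
     = (\<integral>x. (if P x then norm (excess_grad \<epsilon> x) powr p else 0) - (if P x then norm (W x) powr p else 0) \<partial>L\<Omega>)"
    by (intro Bochner_Integration.integral_cong refl) simp
  also have "\<dots> = ?x - ?y" using iW iZ by (rule Bochner_Integration.integral_diff[rotated])
  finally have xB: "ennreal (?x - ?y) \<le> ?B" .
  have "?A \<le> ennreal (?x - ?y)"
  proof -
    obtain r where r: "0 \<le> r" "?A = ennreal r" using Afin by (cases ?A) (auto simp: top_unique)
    have "ennreal (r + ?y) \<le> ennreal ?x" using AY unfolding X Y r(2) using r(1) y0 by simp
    moreover have "0 \<le> ?x" by (intro integral_nonneg_AE) auto
    ultimately have "r + ?y \<le> ?x" by simp
    then show ?thesis unfolding r(2) by (intro ennreal_leI) simp
  qed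
  then show "?A \<le> ?B" using xB by (rule order_trans)
qed

end

section \<open>The comparison principle\<close>

text \<open>Both sides are the quotient \<open>f(x,y) / y^(p-1)\<close>, at \<open>y = t\<close> and at \<open>y = s\<close>, times \<open>t^p - s^p\<close>; the quotient is strictly decreasing in \<open>y\<close>.\<close>

lemma source_ratio_less:
  fixes \<alpha> \<gamma> \<delta> \<beta> p s t :: real
  assumes "0 < s" "s < t" "0 \<le> \<alpha>" "0 \<le> \<gamma>" "0 < \<alpha> + \<gamma>" "0 < \<delta>" "\<beta> < p - 1" "1 < p"
  shows "(\<alpha> / t powr \<delta> + \<gamma> * t powr \<beta>) * (t - s powr p * t powr (1 - p))
    < (\<alpha> / s powr \<delta> + \<gamma> * s powr \<beta>) * (t powr p * s powr (1 - p) - s)"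
proof -
  have t0: "0 < t" using assms by simp
  define D where "D = t powr p - s powr p"
  have D: "0 < D" unfolding D_def using assms powr_less_mono2[of p s t] by simp
  have e: "y powr p * y powr (1 - p) = y" if "0 < y" for y using powr_add[of y p "1 - p"] that by simp
  have f: "(\<alpha> / y powr \<delta> + \<gamma> * y powr \<beta>) * y powr (1 - p) = \<alpha> * y powr (1 - p - \<delta>) + \<gamma> * y powr (\<beta> + 1 - p)" if "0 < y" for y
  proof -
    have "y powr (1 - p - \<delta>) = y powr (1 - p) / y powr \<delta>" by (rule powr_diff)
    moreover have "y powr (\<beta> + 1 - p) = y powr \<beta> * y powr (1 - p)" using powr_add[of y \<beta> "1 - p"] by (simp add: add_diff_eq)
    ultimately show ?thesis by (simp add: distrib_right)
  qed
  have m: "t powr (1 - p - \<delta>) < s powr (1 - p - \<delta>)" "t powr (\<beta> + 1 - p) < s powr (\<beta> + 1 - p)"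
    using assms by (intro powr_less_mono2_neg; simp)+
  have "\<alpha> * t powr (1 - p - \<delta>) + \<gamma> * t powr (\<beta> + 1 - p) < \<alpha> * s powr (1 - p - \<delta>) + \<gamma> * s powr (\<beta> + 1 - p)"
  proof (cases "0 < \<alpha>")
    case True
    then show ?thesis using m assms by (intro add_less_le_mono mult_strict_left_mono mult_left_mono) auto
  next
    case False
    then have "0 < \<gamma>" "\<alpha> = 0" using assms by auto
    then show ?thesis using m by simp
  qed
  then have "(\<alpha> / t powr \<delta> + \<gamma> * t powr \<beta>) * t powr (1 - p) * D < (\<alpha> / s powr \<delta> + \<gamma> * s powr \<beta>) * s powr (1 - p) * D"
    unfolding f[OF t0] f[OF assms(1)] using D by (rule mult_strict_right_mono)
  moreover have "t powr (1 - p) * D = t - s powr p * t powr (1 - p)"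
    unfolding D_def right_diff_distrib using e[OF t0] by (simp add: mult.commute)
  moreover have "s powr (1 - p) * D = t powr p * s powr (1 - p) - s"
    unfolding D_def right_diff_distrib using e[OF assms(1)] by (simp add: mult.commute)
  ultimately show ?thesis by (simp only: mult.assoc)
qed

context comparison_pair begin

text \<open>For \<open>z = (v - \<epsilon>)^+\<close> split the source of \<open>v\<close> into the source at \<open>z\<close> and an error. Then \<open>excess_comparison\<close> bounds the integral of the
nonnegative difference of the source terms at \<open>w\<close> and at \<open>z\<close> by the integral of the error, which tends to zero with \<open>\<epsilon>\<close>.
By Fatou's lemma the limit of the difference vanishes almost everywhere, but it is positive where \<open>v > w\<close>.\<close>

theorem comparison: "AE x in L\<Omega>. v x \<le> w x"
proof -
  define e where "e n = inverse (real (Suc n))" for n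
  have e: "0 < e n" for n by (simp add: e_def)
  have e0: "e \<longlonglongrightarrow> 0" unfolding e_def by (rule LIMSEQ_inverse_real_of_nat)
  let ?z = "\<lambda>n. excess (e n)"
  let ?P = "\<lambda>n x. 0 < w x \<and> w x < ?z n x"
  let ?s = "\<lambda>n x. a x / ?z n x powr \<delta> + b x * ?z n x powr \<beta>"
  (* A and Y are the source terms at w and at z, each with its own test function; R bounds the
     error caused by the shift, and B dominates R uniformly in n. *)
  define A where "A n x = (if ?P n x then fw x * (?z n x powr p * w x powr (1 - p) - w x) else 0)" for n x
  define Y where "Y n x = (if ?P n x then ?s n x * (?z n x - w x powr p * ?z n x powr (1 - p)) else 0)" for n x
  define R where "R n x = (if ?P n x then b x * (v x powr \<beta> - ?z n x powr \<beta>) * ?z n x else 0)" for n x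
  define B where "B x = (if 0 < w x \<and> w x < v x then b x * v x powr (\<beta> + 1) else 0)" for x
  have [measurable]: "A n \<in> borel_measurable L\<Omega>" "Y n \<in> borel_measurable L\<Omega>" "R n \<in> borel_measurable L\<Omega>" "B \<in> borel_measurable L\<Omega>" for n
    unfolding A_def Y_def R_def B_def by measurable
  have zv: "?z n x \<le> v x" if "?P n x" for n x using that e[of n] by (auto simp: excess_def)
  have pos: "0 \<le> ?z n x - w x powr p * ?z n x powr (1 - p)" "?z n x - w x powr p * ?z n x powr (1 - p) \<le> ?z n x" if "?P n x" for n x
  proof -
    have "w x powr p * ?z n x powr (1 - p) \<le> ?z n x powr p * ?z n x powr (1 - p)"
      using that p by (intro mult_right_mono powr_mono2) auto
    also have "\<dots> = ?z n x" using that powr_add[of "?z n x" p "1 - p"] by simp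
    finally show "0 \<le> ?z n x - w x powr p * ?z n x powr (1 - p)" by simp
    show "?z n x - w x powr p * ?z n x powr (1 - p) \<le> ?z n x" by simp
  qed
  have Y0: "0 \<le> Y n x" if "x \<in> \<Omega>" for n x
    unfolding Y_def using pos(1)[of x n] a_nonneg[OF that] b_nonneg[OF that] by simp
  have YA: "Y n x \<le> A n x" if "x \<in> \<Omega>" for n x
  proof (cases "?P n x")
    case True
    then have "0 < w x" "w x < ?z n x" by auto
    from source_ratio_less[OF this a_nonneg[OF that] b_nonneg[OF that] ab_pos[OF that] \<delta> \<beta>(2) p]
    show ?thesis using True by (simp add: A_def Y_def source_def)
  next
    case False then show ?thesis by (simp only: A_def Y_def if_False order_refl)
  qed
  have R0: "0 \<le> R n x" if "x \<in> \<Omega>" for n x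
  proof (cases "?P n x")
    case True
    have "?z n x powr \<beta> \<le> v x powr \<beta>" using True zv[OF True] \<beta> by (intro powr_mono2) auto
    then show ?thesis using True b_nonneg[OF that] by (simp add: R_def)
  qed (simp only: R_def if_False order_refl)
  have RB: "R n x \<le> B x" if "x \<in> \<Omega>" for n x
  proof (cases "?P n x")
    case True
    have zx: "0 < ?z n x" "?z n x \<le> v x" using True zv[OF True] by auto
    have "(v x powr \<beta> - ?z n x powr \<beta>) * ?z n x \<le> v x powr \<beta> * v x"
      using zx by (intro mult_mono) auto
    also have "\<dots> = v x powr (\<beta> + 1)" using powr_add[of "v x" \<beta> 1] zx by simp
    finally have "b x * ((v x powr \<beta> - ?z n x powr \<beta>) * ?z n x) \<le> b x * v x powr (\<beta> + 1)"
      using b_nonneg[OF that] by (rule mult_left_mono)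
    moreover have "0 < w x \<and> w x < v x" using True zx by auto
    ultimately show ?thesis using True by (simp add: R_def B_def mult.assoc)
  next
    case False
    then have "R n x = 0" by (simp only: R_def if_False)
    then show ?thesis using b_nonneg[OF that] by (simp add: B_def)
  qed
  have key: "(\<integral>\<^sup>+x. ennreal (A n x - Y n x) \<partial>L\<Omega>) \<le> (\<integral>\<^sup>+x. ennreal (R n x) \<partial>L\<Omega>)" for n
  proof -
    have "(\<integral>\<^sup>+x. ennreal (Y n x) \<partial>L\<Omega>) + (\<integral>\<^sup>+x. ennreal (A n x - Y n x) \<partial>L\<Omega>) = (\<integral>\<^sup>+x. ennreal (Y n x) + ennreal (A n x - Y n x) \<partial>L\<Omega>)"
      by (rule nn_integral_add[symmetric]) measurable
    also have "\<dots> = (\<integral>\<^sup>+x. ennreal (A n x) \<partial>L\<Omega>)"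
    proof (rule nn_integral_cong)
      fix x assume "x \<in> space L\<Omega>"
      then have x: "x \<in> \<Omega>" by (rule in_domain)
      show "ennreal (Y n x) + ennreal (A n x - Y n x) = ennreal (A n x)"
        using Y0[OF x, of n] YA[OF x, of n] by (subst ennreal_plus[symmetric]) auto
    qed
    also have "\<dots> \<le> (\<integral>\<^sup>+x. ennreal (if ?P n x then fv x * (?z n x - w x powr p * ?z n x powr (1 - p)) else 0) \<partial>L\<Omega>)"
      unfolding A_def by (rule excess_comparison(1)[OF e])
    also have "\<dots> \<le> (\<integral>\<^sup>+x. ennreal (Y n x) + ennreal (R n x) \<partial>L\<Omega>)"
    proof (rule nn_integral_mono)
      fix x assume "x \<in> space L\<Omega>"
      then have x: "x \<in> \<Omega>" by (rule in_domain)
      have "(if ?P n x then fv x * (?z n x - w x powr p * ?z n x powr (1 - p)) else 0) \<le> Y n x + R n x"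
      proof (cases "?P n x")
        case True
        have zx: "0 < ?z n x" "?z n x \<le> v x" using True zv[OF True] by auto
        have pw: "?z n x powr \<delta> \<le> v x powr \<delta>" using zx \<delta> by (intro powr_mono2) auto
        have pb: "?z n x powr \<beta> \<le> v x powr \<beta>" using zx \<beta> by (intro powr_mono2) auto
        have "a x / v x powr \<delta> \<le> a x / ?z n x powr \<delta>" using pw zx a_nonneg[OF x] by (intro divide_left_mono) auto
        then have "fv x \<le> ?s n x + b x * (v x powr \<beta> - ?z n x powr \<beta>)" by (simp add: source_def right_diff_distrib)
        then have "fv x * (?z n x - w x powr p * ?z n x powr (1 - p)) \<le> (?s n x + b x * (v x powr \<beta> - ?z n x powr \<beta>)) * (?z n x - w x powr p * ?z n x powr (1 - p))"
          using pos(1)[OF True] by (rule mult_right_mono)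
        also have "\<dots> = ?s n x * (?z n x - w x powr p * ?z n x powr (1 - p)) + b x * (v x powr \<beta> - ?z n x powr \<beta>) * (?z n x - w x powr p * ?z n x powr (1 - p))"
          by (rule distrib_right)
        also have "\<dots> \<le> ?s n x * (?z n x - w x powr p * ?z n x powr (1 - p)) + b x * (v x powr \<beta> - ?z n x powr \<beta>) * ?z n x"
          using pos(2)[OF True] pb b_nonneg[OF x] by (intro add_left_mono mult_left_mono) auto
        finally show ?thesis using True by (simp add: Y_def R_def)
      next
        case False
        then show ?thesis by (simp only: Y_def R_def if_False order_refl add_0_left)
      qed
      then show "ennreal (if ?P n x then fv x * (?z n x - w x powr p * ?z n x powr (1 - p)) else 0) \<le> ennreal (Y n x) + ennreal (R n x)"
        using Y0[OF x] R0[OF x] by (simp add: ennreal_leI ennreal_plus[symmetric] del: ennreal_plus)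
    qed
    also have "\<dots> = (\<integral>\<^sup>+x. ennreal (Y n x) \<partial>L\<Omega>) + (\<integral>\<^sup>+x. ennreal (R n x) \<partial>L\<Omega>)" by (rule nn_integral_add) measurable
    finally have le: "(\<integral>\<^sup>+x. ennreal (Y n x) \<partial>L\<Omega>) + (\<integral>\<^sup>+x. ennreal (A n x - Y n x) \<partial>L\<Omega>)
       \<le> (\<integral>\<^sup>+x. ennreal (Y n x) \<partial>L\<Omega>) + (\<integral>\<^sup>+x. ennreal (R n x) \<partial>L\<Omega>)" .
    have "(\<integral>\<^sup>+x. ennreal (Y n x) \<partial>L\<Omega>) \<le> (\<integral>\<^sup>+x. ennreal (A n x) \<partial>L\<Omega>)"
      using YA in_domain by (intro nn_integral_mono ennreal_leI) blast
    also have "\<dots> < \<infinity>" unfolding A_def by (rule excess_comparison(2)[OF e])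
    finally show ?thesis using le by (auto simp: ennreal_add_left_cancel_le)
  qed
  have zlim: "(\<lambda>n. ?z n x) \<longlonglongrightarrow> v x" if "0 < v x" for x
  proof -
    have "(\<lambda>n. max (v x - e n) 0) \<longlonglongrightarrow> max (v x - 0) 0" by (intro tendsto_max tendsto_diff tendsto_const e0)
    then show ?thesis using that by (simp add: excess_def)
  qed
  have "(\<lambda>n. \<integral>\<^sup>+x. ennreal (R n x) \<partial>L\<Omega>) \<longlonglongrightarrow> (\<integral>\<^sup>+x. 0 \<partial>L\<Omega>)"
  proof (rule nn_integral_dominated_convergence[where w = "\<lambda>x. ennreal (B x)"])
    show "(\<integral>\<^sup>+x. ennreal (B x) \<partial>L\<Omega>) < \<infinity>" unfolding B_def by (rule large_b_term)
    show "AE x in L\<Omega>. ennreal (R n x) \<le> ennreal (B x)" for n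
      using AE_in_domain by eventually_elim (intro ennreal_leI RB)
    show "AE x in L\<Omega>. (\<lambda>n. ennreal (R n x)) \<longlonglongrightarrow> 0"
      using v_pos
    proof eventually_elim
      case (elim x)
      have "(\<lambda>n. b x * (v x powr \<beta> - ?z n x powr \<beta>) * ?z n x) \<longlonglongrightarrow> b x * (v x powr \<beta> - v x powr \<beta>) * v x"
        using elim by (intro tendsto_mult tendsto_diff tendsto_const tendsto_powr zlim) auto
      then have g: "(\<lambda>n. b x * (v x powr \<beta> - ?z n x powr \<beta>) * ?z n x) \<longlonglongrightarrow> 0" by simp
      have "(\<lambda>n. R n x) \<longlonglongrightarrow> 0"
        by (rule Lim_transform_bound[OF always_eventually g]) (simp add: R_def)
      then have "(\<lambda>n. ennreal (R n x)) \<longlonglongrightarrow> ennreal 0" by (rule tendsto_ennrealI)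
      then show ?case by simp
    qed
  qed measurable
  then have R_lim: "(\<lambda>n. \<integral>\<^sup>+x. ennreal (R n x) \<partial>L\<Omega>) \<longlonglongrightarrow> 0" by simp
  have "(\<integral>\<^sup>+x. liminf (\<lambda>n. ennreal (A n x - Y n x)) \<partial>L\<Omega>) \<le> liminf (\<lambda>n. \<integral>\<^sup>+x. ennreal (A n x - Y n x) \<partial>L\<Omega>)"
    by (rule nn_integral_liminf) measurable
  also have "\<dots> \<le> liminf (\<lambda>n. \<integral>\<^sup>+x. ennreal (R n x) \<partial>L\<Omega>)"
    by (intro Liminf_mono always_eventually allI key)
  also have "\<dots> = 0" by (rule lim_imp_Liminf[OF trivial_limit_sequentially R_lim])
  finally have "(\<integral>\<^sup>+x. liminf (\<lambda>n. ennreal (A n x - Y n x)) \<partial>L\<Omega>) = 0" by simp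
  then have "AE x in L\<Omega>. liminf (\<lambda>n. ennreal (A n x - Y n x)) = 0"
    by (subst (asm) nn_integral_0_iff_AE) measurable
  then show ?thesis
    using v_pos w_pos AE_in_domain
  proof eventually_elim
    case (elim x)
    show ?case
    proof (rule ccontr)
      assume "\<not> v x \<le> w x"
      then have wv: "w x < v x" by simp
      note l = zlim[OF elim(2)]
      have vn: "v x \<noteq> 0" using elim(2) by simp
      have ev: "\<forall>\<^sub>F n in sequentially. w x < ?z n x" using order_tendstoD(1)[OF l] wv by blast
      let ?l = "fw x * (v x powr p * w x powr (1 - p) - w x) - (a x / v x powr \<delta> + b x * v x powr \<beta>) * (v x - w x powr p * v x powr (1 - p))"
      have "0 < ?l"
        using source_ratio_less[OF elim(3) wv a_nonneg[OF elim(4)] b_nonneg[OF elim(4)] ab_pos[OF elim(4)] \<delta> \<beta>(2) p]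
        by (simp add: source_def)
      moreover have "(\<lambda>n. fw x * (?z n x powr p * w x powr (1 - p) - w x) - ?s n x * (?z n x - w x powr p * ?z n x powr (1 - p))) \<longlonglongrightarrow> ?l"
        by (intro tendsto_diff tendsto_mult tendsto_add tendsto_divide tendsto_const tendsto_powr l vn) (use vn in simp)
      then have "(\<lambda>n. A n x - Y n x) \<longlonglongrightarrow> ?l"
        by (rule Lim_transform_eventually) (rule eventually_mono[OF ev], use elim(3) in \<open>simp add: A_def Y_def\<close>)
      then have "(\<lambda>n. ennreal (A n x - Y n x)) \<longlonglongrightarrow> ennreal ?l" by (rule tendsto_ennrealI)
      from lim_imp_Liminf[OF trivial_limit_sequentially this] have "ennreal ?l = 0" using elim(1) by simp
      ultimately show False by (simp only: ennreal_eq_0_iff)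
    qed
  qed
qed

end

text \<open>On a bounded set \<open>|f| \<le> 1 + |f|^q\<close> is an integrable bound.\<close>

lemma Lp_integrable_bounded:
  fixes f :: "'a::euclidean_space \<Rightarrow> real"
  assumes \<Omega>: "open \<Omega>" "bounded \<Omega>" and f: "f \<in> Lp \<Omega> q" and q: "1 \<le> q"
  shows "integrable (lebesgue_on \<Omega>) f"
proof (rule Bochner_Integration.integrable_bound)
  have "emeasure lebesgue \<Omega> < \<infinity>" using emeasure_bounded_finite[OF \<Omega>(2)] \<Omega>(1) by (simp add: emeasure_completion)
  then have "finite_measure (lebesgue_on \<Omega>)"
    using \<Omega>(1) by (intro finite_measureI) (auto simp: emeasure_restrict_space space_restrict_space)
  then have "integrable (lebesgue_on \<Omega>) (\<lambda>x. 1::real)" by (rule finite_measure.integrable_const)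
  then show "integrable (lebesgue_on \<Omega>) (\<lambda>x. 1 + norm (f x) powr q)"
    using f by (intro Bochner_Integration.integrable_add) (auto simp: Lp_def)
  show "f \<in> borel_measurable (lebesgue_on \<Omega>)" using f by (simp add: Lp_def)
  show "AE x in lebesgue_on \<Omega>. norm (f x) \<le> norm (1 + norm (f x) powr q)"
  proof (rule AE_I2)
    fix x
    have "norm (f x) \<le> 1 + norm (f x) powr q"
    proof (cases "norm (f x) \<le> 1")
      case True then show ?thesis using powr_ge_zero[of "norm (f x)" q] by linarith
    next
      case False
      then have "norm (f x) powr 1 \<le> norm (f x) powr q" using q by (intro powr_mono) auto
      then show ?thesis by simp
    qed
    then show "norm (f x) \<le> norm (1 + norm (f x) powr q)" using abs_ge_self order_trans by (metis real_norm_def)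
  qed
qed

lemma conj_exp_ge_1: "1 < s \<Longrightarrow> 1 \<le> conj_exp s"
  by (simp add: conj_exp_def divide_simps)

text \<open>In each of the cases \<open>a\<close> and \<open>b\<close> lie in some \<open>L^q\<close> with \<open>q \<ge> 1\<close>, since the conjugate of an exponent above 1
is above 1 and the Sobolev exponent exceeds \<open>p > \<beta> + 1\<close>. The domain being bounded, they are integrable.\<close>

theorem theorem2p1:
  fixes \<Omega> :: "(real ^ 'n) set"
    and a b v w :: "real ^ 'n \<Rightarrow> real"
    and p \<delta> \<beta> :: real
  assumes "CARD('n) \<ge> 2"
    and "smooth_bounded_domain \<Omega>"
    and "1 < p" and "p < real CARD('n)"
    and "\<delta> > 0"
    and "0 < \<beta>" and "\<beta> < p - 1"
    and "a \<in> borel_measurable (lebesgue_on \<Omega>)" and "\<forall>x\<in>\<Omega>. 0 \<le> a x"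
    and "b \<in> borel_measurable (lebesgue_on \<Omega>)" and "\<forall>x\<in>\<Omega>. 0 \<le> b x"
    and "b \<in> Lp \<Omega> (conj_exp (sobolev_exp CARD('n) p / (\<beta> + 1)))"
    and "\<forall>x\<in>\<Omega>. a x + b x > 0"
    and "subsolution \<Omega> p a b \<delta> \<beta> v"
    and "supersolution \<Omega> p a b \<delta> \<beta> w"
    and "nonpos_on_boundary \<Omega> p v"
  shows
    "(\<delta> < 1 \<and> a \<in> Lp \<Omega> (conj_exp (sobolev_exp CARD('n) p / (1 - \<delta>))) \<or>
      \<delta> > 1 \<and> a \<in> Lp \<Omega> 1 \<or>
      \<delta> = 1 \<and> (\<exists>s>1. a \<in> Lp \<Omega> s)
        \<longrightarrow> (AE x in lebesgue_on \<Omega>. v x \<le> w x))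
     \<and>
     (v \<in> W1p_0 \<Omega> p \<and> w \<in> W1p_0 \<Omega> p \<and>
      sub_inequality \<Omega> p a b \<delta> \<beta> (W1p_0 \<Omega> p) v \<and>
      super_inequality \<Omega> p a b \<delta> \<beta> (W1p_0 \<Omega> p) w \<and>
      (\<delta> < 1 \<and> a \<in> Lp \<Omega> (conj_exp (sobolev_exp CARD('n) p / (1 - \<delta>))) \<or>
       \<delta> > 1 \<and> a \<in> Lp \<Omega> 1 \<or>
       \<delta> = 1 \<and> a \<in> Lp \<Omega> 1)
        \<longrightarrow> (AE x in lebesgue_on \<Omega>. v x \<le> w x))"
proof -
  have \<Omega>: "open \<Omega>" "bounded \<Omega>" using assms(2) by (auto simp: smooth_bounded_domain_def)
  have star: "p < sobolev_exp CARD('n) p"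
    using assms(3,4) by (simp add: sobolev_exp_def pos_less_divide_eq algebra_simps)
  have b_int: "integrable (lebesgue_on \<Omega>) b"
  proof (rule Lp_integrable_bounded[OF \<Omega> assms(12)])
    have "1 < sobolev_exp CARD('n) p / (\<beta> + 1)" using star assms(6,7) by (simp add: pos_less_divide_eq)
    then show "1 \<le> conj_exp (sobolev_exp CARD('n) p / (\<beta> + 1))" by (rule conj_exp_ge_1)
  qed
  have main: "AE x in lebesgue_on \<Omega>. v x \<le> w x" if "a \<in> Lp \<Omega> q" "1 \<le> q" for q
  proof -
    interpret comparison_pair \<Omega> a b v w p \<delta> \<beta>
      using assms \<Omega> b_int Lp_integrable_bounded[OF \<Omega> that] by unfold_locales auto
    show ?thesis by (rule comparison)
  qed
  have weak: "1 \<le> conj_exp (sobolev_exp CARD('n) p / (1 - \<delta>))" if "\<delta> < 1"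
  proof -
    have "1 < sobolev_exp CARD('n) p / (1 - \<delta>)" using star assms(3,5) that by (simp add: pos_less_divide_eq)
    then show ?thesis by (rule conj_exp_ge_1)
  qed
  show ?thesis using main weak by (meson less_imp_le order_refl)
qed

end
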